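(* Let $u$ be $\alpha$-harmonic on $\mathbb D$. (1) If $u(x)=\mathcal P_{\mathbb D}[\mu](x)+c(1-\Phi(x))$, $x\in\mathbb D$, for some $(\mu,c)\in\mathcal M(\mathbf S)\times\mathbb R$, then $u\in h^1_\alpha(\mathbb D)$ and $\|u\|_{h^1}=\|\mu\|\vee|c|$. (2) Let $p\in(1,\infty]$. If $u(x)=\mathcal P_{\mathbb D}[f](x)+c(1-\Phi(x))$, $x\in\mathbb D$, for some $(f,c)\in L^p(\mathbf S,\sigma)\times\mathbb R$, then $u\in h^p_\alpha(\mathbb D)$ and $\|u\|_{h^p}=\|f\|_p\vee|c|$.
   Context: Let $d\ge 2$, $\alpha\in(1,2)$, and let $(X_t,\mathbb P^x)$ be the symmetric $\alpha$-stable Lévy process on $\mathbb R^d$ with $\mathbb E^xe^{i\xi\cdot(X_t-x)}=e^{-t|\xi|^\alpha}$. For $B\subset\mathbb R^d$, $\tau_B=\inf\{t>0:X_t\notin B\}$, $T_B=\tau_{B^c}$. For open $D$, a Borel $u:\mathbb R^d\to\mathbb R$ is $\alpha$-harmonic on $D$ if $u(x)=\mathbb E^xu(X_{\tau_U})$ (absolutely convergent) for every bounded open $U$ with $\overline U\subset D$ and every $x\in U$. $\mathbf S$ is the unit sphere, $\mathbb D=\mathbb R^d\setminus\mathbf S$, $\sigma$ the normalized surface measure on $\mathbf S$, $\mathcal M(\mathbf S)$ the finite signed Borel measures on $\mathbf S$ with total variation norm $\|\mu\|$, $\|f\|_p$ the $L^p(\mathbf S,\sigma)$ norm. $\Phi(x)=\mathbb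 P^x(T_{\mathbf S}<\infty)$. With $\mathcal C_2=\pi^{1/2}2^{2-\alpha}\Gamma((\alpha+d)/2-1)/\Gamma((\alpha-1)/2)$, $\mathcal P_{\mathbb D}(x,y)=\frac{\mathcal C_2}{\Gamma(d/2)}\frac{||x|^2-1|^{\alpha-1}}{|x-y|^{d+\alpha-2}}$ ($x\in\mathbb D,y\in\mathbf S$), $\mathcal P_{\mathbb D}[\mu](x)=\int_{\mathbf S}\mathcal P_{\mathbb D}(x,y)\mu(dy)$, $\mathcal P_{\mathbb D}[f](x)=\int_{\mathbf S}\mathcal P_{\mathbb D}(x,y)f(y)\sigma(dy)$. For $r>0$, $r\ne1$, $u_r(x)=u(rx)$, $x\in\mathbf S$. For $p\in[1,\infty]$, $h^p_\alpha(\mathbb D)$ is the set of $u$ $\alpha$-harmonic on $\mathbb D$ with $\|u\|_{h^p}:=\sup_{r>0,r\ne1}\|u_r\|_p<\infty$. *)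

theory Defs
  imports "HOL-Probability.Probability"
begin

text \<open>X is a process on the probability space M, X t w in R^d, started at 0,
  with cadlag paths, independent increments, and the increment X t - X s (s \<le> t)
  having characteristic function exp(-(t-s)|xi|^alpha).  The process under P^x is
  x + X.\<close>

definition sym_stable_process ::
  "real \<Rightarrow> 'w measure \<Rightarrow> (real \<Rightarrow> 'w \<Rightarrow> 'a::euclidean_space) \<Rightarrow> bool" where
  "sym_stable_process \<alpha> M X \<longleftrightarrow>
     prob_space M
   \<and> (\<forall>t\<ge>0. X t \<in> borel_measurable M)
   \<and> (\<forall>w\<in>space M. X 0 w = 0)
   \<and> (\<forall>w\<in>space M. \<forall>t\<ge>0. continuous (at_right t) (\<lambda>s. X s w))
   \<and> (\<forall>w\<in>space M. \<forall>t>0. \<exists>l. ((\<lambda>s. X s w) \<longlongrightarrow> l) (at_left t))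
   \<and> (\<forall>t::nat \<Rightarrow> real. mono t \<longrightarrow> 0 \<le> t 0 \<longrightarrow>
        prob_space.indep_vars M (\<lambda>_. borel) (\<lambda>i w. X (t (Suc i)) w - X (t i) w) UNIV)
   \<and> (\<forall>s t \<xi>. 0 \<le> s \<longrightarrow> s \<le> t \<longrightarrow>
        (\<integral>w. cis (\<xi> \<bullet> (X t w - X s w)) \<partial>M) = complex_of_real (exp (- (t - s) * norm \<xi> powr \<alpha>)))"

definition exit_time :: "'a set \<Rightarrow> (real \<Rightarrow> 'a) \<Rightarrow> ereal" where
  "exit_time B \<omega> = Inf {ereal t | t. 0 < t \<and> \<omega> t \<notin> B}"

definition hit_time :: "'a set \<Rightarrow> (real \<Rightarrow> 'a) \<Rightarrow> ereal" where
  "hit_time B \<omega> = exit_time (- B) \<omega>"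

definition path_from :: "(real \<Rightarrow> 'w \<Rightarrow> 'a::real_vector) \<Rightarrow> 'a \<Rightarrow> 'w \<Rightarrow> real \<Rightarrow> 'a" where
  "path_from X x w = (\<lambda>t. x + X t w)"

text \<open>Position at the exit time from U (only evaluated when the exit time is finite a.s.).\<close>
definition exit_pos :: "(real \<Rightarrow> 'w \<Rightarrow> 'a::real_vector) \<Rightarrow> 'a set \<Rightarrow> 'a \<Rightarrow> 'w \<Rightarrow> 'a" where
  "exit_pos X U x w = path_from X x w (real_of_ereal (exit_time U (path_from X x w)))"

text \<open>alpha-harmonic functions on an open set D.  Expectations are taken w.r.t. the
  completion of M (exit times of cadlag processes are measurable w.r.t. the completion).\<close>
definition alpha_harmonic ::
  "'w measure \<Rightarrow> (real \<Rightarrow> 'w \<Rightarrow> 'a::euclidean_space) \<Rightarrow> 'a set \<Rightarrow> ('a \<Rightarrow> real) \<Rightarrow> bool" where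
  "alpha_harmonic M X D u \<longleftrightarrow>
     u \<in> borel_measurable borel
   \<and> (\<forall>U x. open U \<longrightarrow> bounded U \<longrightarrow> closure U \<subseteq> D \<longrightarrow> x \<in> U \<longrightarrow>
        integrable (completion M) (\<lambda>w. u (exit_pos X U x w))
      \<and> u x = (\<integral>w. u (exit_pos X U x w) \<partial>completion M))"

definition Phi :: "'w measure \<Rightarrow> (real \<Rightarrow> 'w \<Rightarrow> 'a::euclidean_space) \<Rightarrow> 'a \<Rightarrow> real" where
  "Phi M X x = measure (completion M)
      {w \<in> space M. hit_time (sphere 0 1) (path_from X x w) < \<infinity>}"

text \<open>sigma = normalized surface measure on S, realised as the radial projection of the
  normalized Lebesgue measure of the unit ball (cone measure = normalized surface measure).\<close>
definition sphere_sigma :: "'a::euclidean_space measure" where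
  "sphere_sigma = distr (uniform_measure lborel (ball 0 1)) borel (\<lambda>x. x /\<^sub>R norm x)"

definition C2 :: "nat \<Rightarrow> real \<Rightarrow> real" where
  "C2 d \<alpha> = sqrt pi * 2 powr (2 - \<alpha>) * Gamma ((\<alpha> + real d) / 2 - 1) / Gamma ((\<alpha> - 1) / 2)"

definition PD_kernel :: "real \<Rightarrow> 'a::euclidean_space \<Rightarrow> 'a \<Rightarrow> real" where
  "PD_kernel \<alpha> x y = C2 DIM('a) \<alpha> / Gamma (real DIM('a) / 2)
     * \<bar>(norm x)\<^sup>2 - 1\<bar> powr (\<alpha> - 1) / norm (x - y) powr (real DIM('a) + \<alpha> - 2)"

text \<open>A finite signed Borel measure mu on S is represented as N1 - N2 with N1, N2
  finite (nonnegative) Borel measures concentrated on S; every element of M(S) is of this form.\<close>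
definition sphere_fin_meas :: "'a::euclidean_space measure \<Rightarrow> bool" where
  "sphere_fin_meas N \<longleftrightarrow> sets N = sets borel \<and> finite_measure N
     \<and> emeasure N (- sphere 0 1) = 0"

definition PD_meas :: "real \<Rightarrow> 'a::euclidean_space measure \<Rightarrow> 'a measure \<Rightarrow> 'a \<Rightarrow> real" where
  "PD_meas \<alpha> N1 N2 x = (\<integral>y. PD_kernel \<alpha> x y \<partial>N1) - (\<integral>y. PD_kernel \<alpha> x y \<partial>N2)"

definition tv_norm :: "'a::euclidean_space measure \<Rightarrow> 'a measure \<Rightarrow> real" where
  "tv_norm N1 N2 = Sup ((\<lambda>(n, A). \<Sum>i<n. \<bar>measure N1 (A i) - measure N2 (A i)\<bar>) `
      {(n::nat, A). (\<forall>i<n. A i \<in> sets N1 \<inter> sets N2) \<and> disjoint_family_on A {..<n}})"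

definition PD_fun :: "real \<Rightarrow> ('a::euclidean_space \<Rightarrow> real) \<Rightarrow> 'a \<Rightarrow> real" where
  "PD_fun \<alpha> f x = (\<integral>y. PD_kernel \<alpha> x y * f y \<partial>sphere_sigma)"

definition Lp_norm :: "'a measure \<Rightarrow> ereal \<Rightarrow> ('a \<Rightarrow> real) \<Rightarrow> ereal" where
  "Lp_norm N p f =
    (if p = \<infinity> then esssup N (\<lambda>x. ereal \<bar>f x\<bar>)
     else (let I = (\<integral>\<^sup>+x. ennreal (\<bar>f x\<bar> powr real_of_ereal p) \<partial>N) in
           if I = \<top> then \<infinity> else ereal (enn2real I powr (1 / real_of_ereal p))))"

definition hp_norm :: "ereal \<Rightarrow> ('a::euclidean_space \<Rightarrow> real) \<Rightarrow> ereal" where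
  "hp_norm p u = (SUP r \<in> {r::real. 0 < r \<and> r \<noteq> 1}. Lp_norm sphere_sigma p (\<lambda>x. u (r *\<^sub>R x)))"

definition hp_space ::
  "'w measure \<Rightarrow> (real \<Rightarrow> 'w \<Rightarrow> 'a::euclidean_space) \<Rightarrow> ereal \<Rightarrow> ('a \<Rightarrow> real) set" where
  "hp_space M X p = {u. alpha_harmonic M X (- sphere 0 1) u \<and> hp_norm p u < \<infinity>}"

end

theory Submission
  imports Defs "HOL-Real_Asymp.Real_Asymp"
begin

text \<open>The function \<open>\<theta>(|x|) = \<integral> P(x, y) \<sigma>(dy)\<close> is at most 1, tends to 1 at the sphere, and an inversion
  identifies it with a multiple of the Riesz potential \<open>\<integral> |x - y| powr (\<alpha> - d) \<sigma>(dy)\<close>. Since this potential is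
  excessive for the process and bounded by its value on the sphere, stopping at the hitting times of thin shells
  shows \<open>\<theta> \<le> \<Phi>\<close>; the passage from shells to the sphere needs that the process does not jump away from the sphere
  at the time at which it approaches it. Moreover \<open>\<Phi>\<close> vanishes at infinity.

  Hence \<open>|u(r x)| \<le> \<integral> P(r x, y) |\<mu>|(dy) + (1 - \<theta>(r)) |c|\<close>, a subconvex combination. As
  \<open>P(r x, y) = P(r y, x)\<close> on the sphere, Jensen's inequality and Tonelli bound all norms \<open>\<parallel>u\<^sub>r\<parallel>\<close> by the maximum.
  Conversely \<open>u\<^sub>r\<close> tends to \<open>c\<close> as \<open>r \<rightarrow> \<infinity>\<close>, and to the boundary value as \<open>r \<rightarrow> 1\<close> (weakly for measures, along a
  subsequence almost everywhere for functions), so that Fatou's lemma and duality give the two lower bounds.\<close>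

section \<open>Integration in polar coordinates and the surface measure\<close>

text \<open>The obstacle in comparing \<theta> with paths is that the Riesz kernel has no absolutely
  convergent Fourier integral, since \<alpha> < d. It is therefore first convolved with a Gaussian
  of variance s. On the Fourier side an increment over time \<tau> multiplies by exp(- \<tau>
  |\<xi>| powr \<alpha>), and a first-order expansion replaces generator theory, with an explicit
  error O(\<tau>^2): the negative generator of the smoothed potential is the smoothed surface
  measure, negligible away from the sphere and large near it. Stopping is carried out on dyadic time
  grids, where independence of increments suffices and the errors sum to a quantity that vanishes
  with the mesh; right continuity of the paths then leads to continuous time. The constant
  \<open>C2\<close> is such that \<theta> equals 1 on the sphere, so a quotient of potential values
  is a value of \<theta>. The two bounds on \<alpha> enter separately: \<alpha> > 1 makes the
  potential finite on the sphere, \<alpha> < 2 makes it strictly subharmonic inside, which places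
  its maximum on the sphere.\<close>

lemma nn_integral_eq_has_integral_pos:
  fixes f :: "real \<Rightarrow> real"
  assumes [measurable]: "f \<in> borel_measurable borel" "S \<in> sets borel"
    and "\<And>x. x \<in> S \<Longrightarrow> 0 \<le> f x" and "(f has_integral I) S"
  shows "(\<integral>\<^sup>+x. ennreal (f x) * indicator S x \<partial>lborel) = ennreal I"
proof -
  have "(\<integral>\<^sup>+x. ennreal (indicator S x * f x) \<partial>lborel) = ennreal I"
    using nn_integral_has_integral_lebesgue[OF assms(3,4)] by simp
  then show ?thesis
    by (subst nn_integral_cong[where v="\<lambda>x. ennreal (indicator S x * f x)"]) (auto split: split_indicator)
qed

lemma nn_integral_change_of_variables:
  fixes f g g' :: "real \<Rightarrow> real"
  assumes f[measurable]: "f \<in> borel_measurable borel" and fnn: "\<And>x. x \<in> T \<Longrightarrow> 0 \<le> f x"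
    and S[measurable]: "S \<in> sets borel" and T[measurable]: "T \<in> sets borel"
    and m[measurable]: "(\<lambda>x. \<bar>g' x\<bar> * f (g x)) \<in> borel_measurable borel"
    and der: "\<And>x. x \<in> S \<Longrightarrow> (g has_real_derivative g' x) (at x within S)"
    and inj: "inj_on g S" and im: "g ` S = T"
    and fin: "(f has_integral I) T"
  shows "(\<integral>\<^sup>+x. ennreal (\<bar>g' x\<bar> * f (g x)) * indicator S x \<partial>lborel) = ennreal I"
proof -
  have "f absolutely_integrable_on T"
    using fin fnn by (intro nonnegative_absolutely_integrable_1) (auto simp: integrable_on_def)
  then have "f absolutely_integrable_on (g ` S) \<and> integral (g ` S) f = I"
    using fin im by (auto intro: integral_unique)
  then have *: "(\<lambda>x. \<bar>g' x\<bar> *\<^sub>R f (g x)) absolutely_integrable_on S \<and> integral S (\<lambda>x. \<bar>g' x\<bar> *\<^sub>R f (g x)) = I"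
    using has_absolute_integral_change_of_variables_real[OF _ der inj, of f I] S by simp
  then have "((\<lambda>x. \<bar>g' x\<bar> * f (g x)) has_integral I) S"
    using set_lebesgue_integral_eq_integral(1)[of S "\<lambda>x. \<bar>g' x\<bar> *\<^sub>R f (g x)"]
    by (simp add: has_integral_iff)
  then show ?thesis
    by (intro nn_integral_eq_has_integral_pos) (use im fnn in auto)
qed

text \<open>The substitution \<open>t = b * r powr q\<close> leads to the Gamma integral. Both signs
  of \<open>q\<close> occur, whence the absolute value: \<open>q = 2\<close> for Gaussians,
  \<open>q = 1\<close> and \<open>q = -1\<close> for the two subordination formulas,
  \<open>q = \<alpha>\<close> for the decay in time.\<close>

lemma nn_integral_powr_exp_powr:
  fixes p q b :: real
  assumes "q \<noteq> 0" "p / q > 0" "b > 0"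
  shows "(\<integral>\<^sup>+r. ennreal (r powr (p - 1) * exp (- b * r powr q)) * indicator {0<..} r \<partial>lborel)
    = ennreal (Gamma (p / q) / (\<bar>q\<bar> * b powr (p / q)))"
proof -
  define f where "f t = t powr (p / q - 1) / exp t" for t :: real
  define g where "g r = b * r powr q" for r :: real
  define g' where "g' r = b * (q * r powr (q - 1))" for r :: real
  have [measurable]: "f \<in> borel_measurable borel" "g \<in> borel_measurable borel" "g' \<in> borel_measurable borel"
    unfolding f_def g_def g'_def by measurable
  have G: "(f has_integral Gamma (p / q)) {0<..}"
  proof -
    have "(f has_integral Gamma (p / q)) {0..}"
      unfolding f_def by (rule Gamma_integral_real[OF assms(2)])
    then have "((\<lambda>t. if t \<in> {0<..} then f t else 0) has_integral Gamma (p/q)) {0..}"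
      by (rule has_integral_spike [of "{0}", rotated 2]) auto
    then show ?thesis
      by (subst (asm) has_integral_restrict) auto
  qed
  have der: "(g has_real_derivative g' r) (at r within {0<..})" if "r > 0" for r
    unfolding g_def[abs_def] g'_def using that by (auto intro!: derivative_eq_intros)
  have inj: "inj_on g {0<..}"
  proof (rule inj_onI)
    fix x y assume xy: "x \<in> {0<..}" "y \<in> {0<..}" "g x = g y"
    then have "x powr q = y powr q" using \<open>b > 0\<close> by (simp add: g_def)
    then have "(x powr q) powr (1/q) = (y powr q) powr (1/q)" by simp
    then show "x = y" using xy \<open>q \<noteq> 0\<close> by (simp add: powr_powr)
  qed
  have im: "g ` {0<..} = {0<..}"
  proof safe
    fix t :: real assume "t > 0"
    then have "t = g ((t / b) powr (1/q))"
      using \<open>b > 0\<close> \<open>q \<noteq> 0\<close> by (simp add: g_def powr_powr)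
    then show "t \<in> g ` {0<..}" using \<open>t > 0\<close> \<open>b > 0\<close> by (intro image_eqI[of _ _ "(t / b) powr (1/q)"]) auto
  qed (use \<open>b > 0\<close> in \<open>simp add: g_def\<close>)
  have "(\<integral>\<^sup>+r. ennreal (\<bar>g' r\<bar> * f (g r)) * indicator {0<..} r \<partial>lborel) = ennreal (Gamma (p / q))"
    by (rule nn_integral_change_of_variables[OF _ _ _ _ _ _ inj im G])
      (use im in \<open>auto simp: f_def intro!: der\<close>)
  moreover have "\<bar>g' r\<bar> * f (g r) = (\<bar>q\<bar> * b powr (p / q)) * (r powr (p - 1) * exp (- b * r powr q))" if "r > 0" for r
  proof -
    have e: "r powr (q - 1) * (r powr q) powr (p/q - 1) = r powr (p - 1)"
      using \<open>q \<noteq> 0\<close> by (simp add: powr_powr powr_add[symmetric] field_simps)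
    have "\<bar>g' r\<bar> * f (g r) = \<bar>q\<bar> * (b * b powr (p/q - 1)) * (r powr (q - 1) * (r powr q) powr (p/q - 1)) * exp (- b * r powr q)"
      using \<open>b > 0\<close> that by (simp add: g'_def f_def g_def abs_mult powr_mult exp_minus field_simps)
    also have "b * b powr (p/q - 1) = b powr (p/q)"
      using \<open>b > 0\<close> by (simp add: powr_mult_base)
    finally show ?thesis unfolding e by (simp add: mult_ac)
  qed
  ultimately have "(\<integral>\<^sup>+r. ennreal (\<bar>q\<bar> * b powr (p / q)) * (ennreal (r powr (p - 1) * exp (- b * r powr q)) * indicator {0<..} r) \<partial>lborel) = ennreal (Gamma (p / q))"
    by (subst (asm) nn_integral_cong[where v="\<lambda>r. ennreal (\<bar>q\<bar> * b powr (p / q)) * (ennreal (r powr (p - 1) * exp (- b * r powr q)) * indicator {0<..} r)"])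
      (auto split: split_indicator simp: ennreal_mult'[symmetric])
  then have *: "ennreal (\<bar>q\<bar> * b powr (p / q)) * (\<integral>\<^sup>+r. (ennreal (r powr (p - 1) * exp (- b * r powr q)) * indicator {0<..} r) \<partial>lborel) = ennreal (Gamma (p / q))"
    by (subst (asm) nn_integral_cmult) auto
  have pos: "\<bar>q\<bar> * b powr (p / q) > 0" using assms by simp
  have "(\<integral>\<^sup>+r. (ennreal (r powr (p - 1) * exp (- b * r powr q)) * indicator {0<..} r) \<partial>lborel)
    = ennreal (1 / (\<bar>q\<bar> * b powr (p / q))) * (ennreal (\<bar>q\<bar> * b powr (p / q)) * (\<integral>\<^sup>+r. (ennreal (r powr (p - 1) * exp (- b * r powr q)) * indicator {0<..} r) \<partial>lborel))"
    using pos by (subst mult.assoc[symmetric], subst ennreal_mult'[symmetric]) auto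
  also have "\<dots> = ennreal (Gamma (p / q) / (\<bar>q\<bar> * b powr (p / q)))"
    unfolding * using pos Gamma_real_pos[OF assms(2)] by (simp add: ennreal_mult'[symmetric])
  finally show ?thesis .
qed

section \<open>Scaling, the cone measure and polar coordinates\<close>

lemma nn_integral_lborel_scaleR:
  fixes f :: "'a::euclidean_space \<Rightarrow> ennreal"
  assumes [measurable]: "f \<in> borel_measurable borel" and "c \<noteq> 0"
  shows "(\<integral>\<^sup>+x. f x \<partial>lborel) = ennreal (\<bar>c\<bar> ^ DIM('a)) * (\<integral>\<^sup>+x. f (t + c *\<^sub>R x) \<partial>lborel)"
proof -
  have "(\<integral>\<^sup>+x. f x \<partial>lborel) = (\<integral>\<^sup>+x. f x \<partial>density (distr lborel borel (\<lambda>x. t + c *\<^sub>R x)) (\<lambda>_. \<bar>c\<bar>^DIM('a)))"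
    using lborel_affine[OF assms(2), of t] by simp
  also have "\<dots> = ennreal (\<bar>c\<bar> ^ DIM('a)) * (\<integral>\<^sup>+x. f (t + c *\<^sub>R x) \<partial>lborel)"
    by (simp add: nn_integral_density nn_integral_distr nn_integral_cmult)
  finally show ?thesis .
qed

lemma emeasure_lborel_unit_ball:
  "emeasure lborel (ball 0 1 :: 'a::euclidean_space set) = ennreal (measure lborel (ball 0 1 :: 'a set))"
  "measure lborel (ball 0 1 :: 'a set) > 0"
proof -
  show "emeasure lborel (ball 0 1 :: 'a::euclidean_space set) = ennreal (measure lborel (ball 0 1 :: 'a set))"
    using emeasure_lborel_ball_finite[of "0::'a" 1] by (intro emeasure_eq_ennreal_measure) auto
  show "measure lborel (ball 0 1 :: 'a set) > 0"
    using content_ball_pos[of 1 "0::'a"] by simp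
qed

lemma sets_sphere_sigma [simp, measurable_cong]: "sets sphere_sigma = sets borel"
  by (simp add: sphere_sigma_def)

lemma space_sphere_sigma [simp]: "space sphere_sigma = UNIV"
  by (simp add: sphere_sigma_def)

lemma nn_integral_sphere_sigma:
  fixes f :: "'a::euclidean_space \<Rightarrow> ennreal"
  assumes [measurable]: "f \<in> borel_measurable borel"
  shows "ennreal (measure lborel (ball 0 1 :: 'a set)) * (\<integral>\<^sup>+y. f y \<partial>sphere_sigma)
    = (\<integral>\<^sup>+x. f (x /\<^sub>R norm x) * indicator (ball 0 1) x \<partial>lborel)"
proof -
  have "(\<integral>\<^sup>+y. f y \<partial>sphere_sigma) = (\<integral>\<^sup>+x. f (x /\<^sub>R norm x) * indicator (ball 0 1) x \<partial>lborel) / emeasure lborel (ball 0 1 :: 'a set)"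
    unfolding sphere_sigma_def
    by (subst nn_integral_distr) (simp_all add: nn_integral_uniform_measure)
  then show ?thesis
    using emeasure_lborel_unit_ball[where 'a='a]
    by (simp add: emeasure_lborel_unit_ball(1) ennreal_times_divide ennreal_mult_divide_eq mult.commute[of "ennreal _"])
qed

lemma prob_space_sphere_sigma: "prob_space (sphere_sigma :: 'a::euclidean_space measure)"
  unfolding sphere_sigma_def
proof (rule prob_space.prob_space_distr)
  show "prob_space (uniform_measure lborel (ball (0::'a) 1))"
    using emeasure_lborel_unit_ball[where 'a='a] by (intro prob_space_uniform_measure) auto
qed measurable

lemma AE_sphere_sigma: "AE y in (sphere_sigma :: 'a::euclidean_space measure). norm y = 1"
proof -
  have "AE x in lborel. x \<in> ball (0::'a) 1 \<longrightarrow> norm (x /\<^sub>R norm x) = 1"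
    using AE_lborel_singleton[of "0::'a"] by eventually_elim auto
  then show ?thesis
    unfolding sphere_sigma_def
    by (subst AE_distr_iff) (auto simp: AE_uniform_measure emeasure_lborel_unit_ball)
qed

lemma nn_integral_ball_scale:
  fixes f :: "'a::euclidean_space \<Rightarrow> ennreal"
  assumes [measurable]: "f \<in> borel_measurable borel" and "R > 0"
  shows "(\<integral>\<^sup>+x. f (x /\<^sub>R norm x) * indicator {..<R} (norm x) \<partial>lborel)
    = ennreal (R ^ DIM('a)) * (ennreal (measure lborel (ball 0 1 :: 'a set)) * (\<integral>\<^sup>+y. f y \<partial>sphere_sigma))"
proof -
  have "(\<integral>\<^sup>+x. f (x /\<^sub>R norm x) * indicator {..<R} (norm x) \<partial>lborel)
    = ennreal (\<bar>R\<bar> ^ DIM('a)) * (\<integral>\<^sup>+x. f ((0 + R *\<^sub>R x) /\<^sub>R norm (0 + R *\<^sub>R x)) * indicator {..<R} (norm (0 + R *\<^sub>R x)) \<partial>lborel)"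
    using \<open>R > 0\<close> by (intro nn_integral_lborel_scaleR) auto
  also have "(\<lambda>x::'a. f ((0 + R *\<^sub>R x) /\<^sub>R norm (0 + R *\<^sub>R x)) * indicator {..<R} (norm (0 + R *\<^sub>R x)))
    = (\<lambda>x. f (x /\<^sub>R norm x) * indicator (ball 0 1) x)"
    using \<open>R > 0\<close> by (auto simp: fun_eq_iff indicator_def field_simps)
  finally show ?thesis
    using \<open>R > 0\<close> by (simp add: nn_integral_sphere_sigma)
qed

text \<open>For a product of a radial and an angular function it suffices to know the image under
  \<open>norm\<close> of the measure with density \<open>f (x /\<^sub>R norm x)\<close>. On the
  half-lines \<open>{..<R}\<close> it is a constant times \<open>R ^ DIM('a)\<close> by scaling, and
  these sets determine it. Finiteness of the angular integral gives the half-lines finite measure,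
  as the uniqueness theorem demands.\<close>

lemma nn_integral_polar:
  fixes f :: "'a::euclidean_space \<Rightarrow> ennreal" and h :: "real \<Rightarrow> ennreal"
  assumes f[measurable]: "f \<in> borel_measurable borel" and h[measurable]: "h \<in> borel_measurable borel"
    and fin: "(\<integral>\<^sup>+y. f y \<partial>sphere_sigma) \<noteq> \<infinity>"
  shows "(\<integral>\<^sup>+x. h (norm x) * f (x /\<^sub>R norm x) \<partial>lborel)
    = (\<integral>\<^sup>+y. f y \<partial>sphere_sigma) * (ennreal (DIM('a) * measure lborel (ball 0 1 :: 'a set)) *
        (\<integral>\<^sup>+r. h r * (ennreal (r powr (DIM('a) - 1)) * indicator {0<..} r) \<partial>lborel))"
proof -
  define K where "K = (\<integral>\<^sup>+y. f y \<partial>sphere_sigma)"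
  define b where "b = measure lborel (ball 0 1 :: 'a set)"
  have b: "b > 0" unfolding b_def by (rule emeasure_lborel_unit_ball)
  define \<mu> where "\<mu> = distr (density lborel (\<lambda>x::'a. f (x /\<^sub>R norm x))) borel norm"
  define \<nu> where "\<nu> = density lborel (\<lambda>r. K * ennreal (DIM('a) * b) * (ennreal (r powr (DIM('a) - 1)) * indicator {0<..} r))"
  have \<mu>: "emeasure \<mu> {..<R} = (if R > 0 then ennreal (R ^ DIM('a)) * (ennreal b * K) else 0)" for R
  proof -
    have "emeasure \<mu> {..<R} = (\<integral>\<^sup>+x. f (x /\<^sub>R norm x) * indicator {..<R} (norm x) \<partial>lborel)"
      unfolding \<mu>_def by (subst emeasure_distr)
        (auto simp: emeasure_density measurable_sets_borel[OF borel_measurable_norm] intro!: nn_integral_cong split: split_indicator)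
    also have "\<dots> = (if R > 0 then ennreal (R ^ DIM('a)) * (ennreal b * K) else 0)"
      using nn_integral_ball_scale[OF f, of R] unfolding b_def K_def
      by (auto intro!: nn_integral_zero' AE_I2 split: split_indicator dest: order.strict_trans1[OF norm_ge_zero])
    finally show ?thesis .
  qed
  have \<nu>: "emeasure \<nu> {..<R} = (if R > 0 then ennreal (R ^ DIM('a)) * (ennreal b * K) else 0)" for R
  proof -
    have 1: "(\<integral>\<^sup>+r. ennreal (DIM('a) * r ^ (DIM('a) - 1)) * indicator {0..R} r \<partial>lborel) = ennreal (R ^ DIM('a) - 0 ^ DIM('a))"
      if "R > 0" using that by (intro nn_integral_FTC_Icc) (auto intro!: derivative_eq_intros)
    have 2: "(\<integral>\<^sup>+r. ennreal (DIM('a) * r ^ (DIM('a) - 1)) * indicator {0<..<R} r \<partial>lborel) = ennreal (R ^ DIM('a))"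
      if "R > 0"
    proof -
      have "(\<integral>\<^sup>+r. ennreal (DIM('a) * r ^ (DIM('a) - 1)) * indicator {0<..<R} r \<partial>lborel)
          = (\<integral>\<^sup>+r. ennreal (DIM('a) * r ^ (DIM('a) - 1)) * indicator {0..R} r \<partial>lborel)"
        using AE_lborel_singleton[of "0::real"] AE_lborel_singleton[of R]
        by (intro nn_integral_cong_AE, eventually_elim) (auto split: split_indicator)
      then show ?thesis using 1[OF that] by (simp add: zero_power)
    qed
    have "emeasure \<nu> {..<R} = (\<integral>\<^sup>+r. (K * ennreal b) * (ennreal (DIM('a) * r ^ (DIM('a) - 1)) * indicator {0<..<R} r) \<partial>lborel)"
      unfolding \<nu>_def using b
      by (subst emeasure_density)
        (auto intro!: nn_integral_cong split: split_indicator simp: ennreal_mult' powr_realpow mult_ac of_nat_diff[symmetric]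
           simp del: of_nat_diff)
    also have "\<dots> = (K * ennreal b) * (\<integral>\<^sup>+r. ennreal (DIM('a) * r ^ (DIM('a) - 1)) * indicator {0<..<R} r \<partial>lborel)"
      by (subst nn_integral_cmult) auto
    also have "\<dots> = (if R > 0 then ennreal (R ^ DIM('a)) * (ennreal b * K) else 0)"
      using 2 by (auto simp: mult_ac)
    finally show ?thesis .
  qed
  have "\<mu> = \<nu>"
  proof (rule measure_eqI_generator_eq[where E="range lessThan" and \<Omega>=UNIV and A="\<lambda>n. {..<real n}"])
    show "Int_stable (range lessThan :: real set set)"
    proof -
      have "{..<a} \<inter> {..<b} = {..<min a b}" for a b :: real by auto
      then show ?thesis by (auto simp: Int_stable_def)
    qed
    show "sets \<mu> = sigma_sets UNIV (range lessThan)" "sets \<nu> = sigma_sets UNIV (range lessThan)"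
      by (simp_all add: \<mu>_def \<nu>_def borel_Iio)
    show "(\<Union>i. {..<real i}) = UNIV" by (auto intro: reals_Archimedean2)
    show "emeasure \<mu> {..<real i} \<noteq> \<infinity>" for i
      using fin by (auto simp: \<mu> K_def ennreal_mult_eq_top_iff)
  qed (auto simp: \<mu> \<nu>)
  have "(\<integral>\<^sup>+x. h (norm x) * f (x /\<^sub>R norm x) \<partial>lborel) = (\<integral>\<^sup>+r. h r \<partial>\<mu>)"
    by (simp add: \<mu>_def nn_integral_distr nn_integral_density mult.commute)
  also have "\<dots> = (\<integral>\<^sup>+r. (K * ennreal (DIM('a) * b)) * (h r * (ennreal (r powr (DIM('a) - 1)) * indicator {0<..} r)) \<partial>lborel)"
    unfolding \<open>\<mu> = \<nu>\<close> \<nu>_def by (subst nn_integral_density) (auto simp: mult_ac intro!: nn_integral_cong)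
  also have "\<dots> = (K * ennreal (DIM('a) * b)) * (\<integral>\<^sup>+r. (h r * (ennreal (r powr (DIM('a) - 1)) * indicator {0<..} r)) \<partial>lborel)"
    by (subst nn_integral_cmult) auto
  finally show ?thesis by (simp add: K_def b_def mult_ac)
qed

section \<open>Fourier transforms of Gaussians and the standard Gaussian law\<close>

lemma borel_measurable_cis [measurable]: "cis \<in> borel_measurable borel"
  by (intro borel_measurable_continuous_onI continuous_intros)

lemma gaussian_fourier_real:
  fixes s a :: real
  assumes "s > 0"
  shows "integrable lborel (\<lambda>x. complex_of_real (exp (- s * x\<^sup>2 / 2)) * cis (x * a))"
    and "(\<integral>x. complex_of_real (exp (- s * x\<^sup>2 / 2)) * cis (x * a) \<partial>lborel) = complex_of_real (sqrt (2 * pi / s) * exp (- a\<^sup>2 / (2 * s)))"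
proof -
  define F where "F x = complex_of_real (std_normal_density x) * cis (a / sqrt s * x)" for x
  interpret std: real_distribution std_normal_distribution by (rule real_dist_normal_dist)
  have int: "integrable lborel F"
    unfolding F_def
    by (rule Bochner_Integration.integrable_bound[of _ "std_normal_density"])
      (auto simp: norm_mult integrable_normal_density)
  have val: "(\<integral>x. F x \<partial>lborel) = complex_of_real (exp (- (a / sqrt s)\<^sup>2 / 2))"
  proof -
    have "char std_normal_distribution (a / sqrt s) = (\<integral>x. F x \<partial>lborel)"
      unfolding char_def F_def
      by (subst integral_density) (auto simp: normal_density_nonneg scaleR_conv_of_real cis_conv_exp)
    then show ?thesis by (simp add: char_std_normal_distribution)
  qed
  have eq: "complex_of_real (exp (- s * x\<^sup>2 / 2)) * cis (x * a) = complex_of_real (sqrt (2 * pi)) * F (0 + sqrt s * x)" for x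
    using assms by (simp add: F_def std_normal_density_def power_mult_distrib mult_ac)
  have int': "integrable lborel (\<lambda>x. F (0 + sqrt s * x))"
    using assms int by (intro lborel_integrable_real_affine) auto
  show "integrable lborel (\<lambda>x. complex_of_real (exp (- s * x\<^sup>2 / 2)) * cis (x * a))"
    unfolding eq using int' by (rule integrable_mult_right)
  have "(\<integral>x. complex_of_real (exp (- s * x\<^sup>2 / 2)) * cis (x * a) \<partial>lborel) = complex_of_real (sqrt (2 * pi)) * (\<integral>x. F (0 + sqrt s * x) \<partial>lborel)"
    unfolding eq by (rule integral_mult_right_zero)
  moreover have "(\<integral>x. F x \<partial>lborel) = sqrt s *\<^sub>R (\<integral>x. F (0 + sqrt s * x) \<partial>lborel)"
    using lborel_integral_real_affine[of "sqrt s" F 0] assms by simp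
  then have "(\<integral>x. F (0 + sqrt s * x) \<partial>lborel) = complex_of_real (exp (- (a / sqrt s)\<^sup>2 / 2) / sqrt s)"
    using assms val by (simp add: scaleR_conv_of_real field_simps)
  ultimately show "(\<integral>x. complex_of_real (exp (- s * x\<^sup>2 / 2)) * cis (x * a) \<partial>lborel) = complex_of_real (sqrt (2 * pi / s) * exp (- a\<^sup>2 / (2 * s)))"
    using assms by (simp add: real_sqrt_divide power_divide field_simps)
qed

lemma gaussian_fourier_cis:
  fixes a :: "'a::euclidean_space"
  assumes s: "s > (0::real)"
  shows "integrable lborel (\<lambda>x::'a. complex_of_real (exp (- s * (norm x)\<^sup>2 / 2)) * cis (x \<bullet> a))" (is "integrable _ ?F")
    and "(\<integral>x. complex_of_real (exp (- s * (norm x)\<^sup>2 / 2)) * cis (x \<bullet> a) \<partial>(lborel :: 'a measure))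
      = complex_of_real ((2 * pi / s) powr (DIM('a) / 2) * exp (- (norm a)\<^sup>2 / (2 * s)))"
proof -
  interpret P: product_sigma_finite "\<lambda>_. lborel :: real measure" ..
  define f where "f b x = complex_of_real (exp (- s * x\<^sup>2 / 2)) * cis (x * (a \<bullet> b))" for b and x :: real
  have eq: "?F (\<Sum>b\<in>Basis. x b *\<^sub>R b) = (\<Prod>b\<in>Basis. f b (x b))" for x :: "'a \<Rightarrow> real"
  proof -
    define v where "v = (\<Sum>b\<in>Basis. x b *\<^sub>R b)"
    have v: "v \<bullet> b = x b" if "b \<in> Basis" for b
      unfolding v_def using that by (simp add: inner_sum_left inner_Basis if_distrib if_distribR cong: if_cong)
    have n: "(norm v)\<^sup>2 = (\<Sum>b\<in>Basis. (x b)\<^sup>2)"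
      unfolding power2_norm_eq_inner euclidean_inner[of v v] using v by (simp add: power2_eq_square)
    have i: "v \<bullet> a = (\<Sum>b\<in>Basis. x b * (a \<bullet> b))"
      using v by (simp add: euclidean_inner[of v a])
    have "cis (\<Sum>b\<in>Basis. x b * (a \<bullet> b)) = (\<Prod>b\<in>Basis. cis (x b * (a \<bullet> b)))"
      by (simp add: cis_conv_exp exp_sum[symmetric] sum_distrib_left)
    moreover have "exp (- s * (\<Sum>b\<in>Basis. (x b)\<^sup>2) / 2) = (\<Prod>b\<in>Basis. exp (- s * (x b)\<^sup>2 / 2))"
      by (simp add: exp_sum[symmetric] sum_distrib_left sum_divide_distrib sum_negf)
    ultimately show ?thesis
      unfolding v_def[symmetric] n i f_def by (simp add: prod.distrib)
  qed
  have intf: "integrable lborel (f b)" for b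
    unfolding f_def using gaussian_fourier_real(1)[OF s] .
  have intP: "integrable (\<Pi>\<^sub>M b\<in>Basis. lborel) (\<lambda>x. \<Prod>b\<in>(Basis::'a set). f b (x b))"
    by (intro P.product_integrable_prod) (auto intro: intf)
  have m: "?F \<in> borel_measurable borel" by (intro borel_measurable_times borel_measurable_of_real borel_measurable_continuous_onI) (auto intro!: continuous_intros)
  show "integrable lborel ?F"
    unfolding lborel_eq[where 'a='a]
    by (subst integrable_distr_eq[OF _ m]) (simp, simp only: eq, rule intP)
  have "(\<integral>x. ?F x \<partial>lborel) = (\<integral>x. (\<Prod>b\<in>Basis. f b (x b)) \<partial>(\<Pi>\<^sub>M b\<in>(Basis::'a set). lborel))"
    unfolding lborel_eq[where 'a='a] by (subst integral_distr[OF _ m]) (simp, simp only: eq)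
  also have "\<dots> = (\<Prod>b\<in>Basis. \<integral>x. f b x \<partial>lborel)"
    by (intro P.product_integral_prod) (auto intro: intf)
  also have "\<dots> = (\<Prod>b\<in>(Basis::'a set). complex_of_real (sqrt (2 * pi / s) * exp (- (a \<bullet> b)\<^sup>2 / (2 * s))))"
    unfolding f_def by (simp only: gaussian_fourier_real(2)[OF s])
  also have "\<dots> = complex_of_real (sqrt (2 * pi / s) ^ DIM('a) * (\<Prod>b\<in>(Basis::'a set). exp (- (a \<bullet> b)\<^sup>2 / (2 * s))))"
    by (simp add: prod.distrib)
  also have "(\<Prod>b\<in>(Basis::'a set). exp (- (a \<bullet> b)\<^sup>2 / (2 * s))) = exp (- (norm a)\<^sup>2 / (2 * s))"
    unfolding power2_norm_eq_inner euclidean_inner[of a a]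
    by (simp add: exp_sum[symmetric] power2_eq_square sum_negf sum_divide_distrib)
  also have "sqrt (2 * pi / s) ^ DIM('a) = (2 * pi / s) powr (DIM('a) / 2)"
    using s by (simp add: powr_half_sqrt[symmetric] powr_realpow[symmetric] powr_powr)
  finally show "(\<integral>x. ?F x \<partial>lborel) = complex_of_real ((2 * pi / s) powr (DIM('a) / 2) * exp (- (norm a)\<^sup>2 / (2 * s)))" .
qed

lemma integrable_gaussian:
  assumes "s > (0::real)"
  shows "integrable lborel (\<lambda>x::'a::euclidean_space. exp (- s * (norm x)\<^sup>2 / 2))"
proof -
  have "integrable lborel (\<lambda>x::'a. norm (complex_of_real (exp (- s * (norm x)\<^sup>2 / 2)) * cis (x \<bullet> 0)))"
    by (intro integrable_norm gaussian_fourier_cis assms)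
  then show ?thesis by (simp add: norm_mult)
qed

lemma gaussian_fourier:
  fixes a :: "'a::euclidean_space"
  assumes s: "s > (0::real)"
  shows "(\<integral>x. cos (x \<bullet> a) * exp (- s * (norm x)\<^sup>2 / 2) \<partial>lborel) = (2 * pi / s) powr (DIM('a) / 2) * exp (- (norm a)\<^sup>2 / (2 * s))"
proof -
  have "(\<integral>x. cos (x \<bullet> a) * exp (- s * (norm x)\<^sup>2 / 2) \<partial>lborel) = (\<integral>x. Re (complex_of_real (exp (- s * (norm x)\<^sup>2 / 2)) * cis (x \<bullet> a)) \<partial>lborel)"
    by (simp add: mult.commute)
  also have "\<dots> = Re (\<integral>x. complex_of_real (exp (- s * (norm x)\<^sup>2 / 2)) * cis (x \<bullet> a) \<partial>lborel)"
    by (rule integral_Re) (rule gaussian_fourier_cis[OF s])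
  finally show ?thesis unfolding gaussian_fourier_cis(2)[OF s] by simp
qed

text \<open>Used in two ways: its marginals yield the moments of the surface measure, and a shift by
  \<open>sqrt s *\<^sub>R z\<close> with \<open>z\<close> of this law realises convolution with
  \<open>heat_kernel s\<close>.\<close>

definition std_gaussian :: "'a::euclidean_space measure" where
  "std_gaussian = density lborel (\<lambda>x. ennreal ((2 * pi) powr (- real DIM('a) / 2) * exp (- (norm x)\<^sup>2 / 2)))"

lemma sets_std_gaussian [simp, measurable_cong]: "sets std_gaussian = sets borel"
  and space_std_gaussian [simp]: "space std_gaussian = UNIV"
  by (simp_all add: std_gaussian_def)

lemma std_gaussian_cis:
  fixes a :: "'a::euclidean_space"
  shows "(\<integral>x. cis (x \<bullet> a) \<partial>std_gaussian) = complex_of_real (exp (- (norm a)\<^sup>2 / 2))"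
proof -
  have "(\<integral>x. cis (x \<bullet> a) \<partial>std_gaussian) = (\<integral>x. complex_of_real ((2 * pi) powr (- real DIM('a) / 2)) * (complex_of_real (exp (- 1 * (norm x)\<^sup>2 / 2)) * cis (x \<bullet> a)) \<partial>lborel)"
    unfolding std_gaussian_def
    by (subst integral_density)
      (auto simp: scaleR_conv_of_real mult_ac intro!: borel_measurable_continuous_onI continuous_intros)
  also have "\<dots> = complex_of_real ((2 * pi) powr (- real DIM('a) / 2)) * complex_of_real ((2 * pi / 1) powr (DIM('a) / 2) * exp (- (norm a)\<^sup>2 / (2 * 1)))"
    by (subst integral_mult_right_zero, subst gaussian_fourier_cis(2)) auto
  also have "\<dots> = complex_of_real (((2 * pi) powr (- real DIM('a) / 2) * (2 * pi) powr (DIM('a) / 2)) * exp (- (norm a)\<^sup>2 / 2))"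
    by simp
  also have "(2 * pi) powr (- real DIM('a) / 2) * (2 * pi) powr (DIM('a) / 2) = 1"
    by (simp add: powr_add[symmetric])
  finally show ?thesis by simp
qed

lemma prob_space_std_gaussian: "prob_space (std_gaussian :: 'a::euclidean_space measure)"
proof
  have "integrable lborel (\<lambda>x::'a. (2 * pi) powr (- real DIM('a) / 2) * exp (- (norm x)\<^sup>2 / 2))"
    using integrable_gaussian[of 1, where 'a='a] by (intro integrable_mult_right) simp
  moreover have "(\<integral>x. (2 * pi) powr (- real DIM('a) / 2) * exp (- (norm x)\<^sup>2 / 2) \<partial>(lborel :: 'a measure)) = 1"
  proof -
    have "(\<integral>x. (2 * pi) powr (- real DIM('a) / 2) * exp (- (norm x)\<^sup>2 / 2) \<partial>(lborel :: 'a measure)) = (2 * pi) powr (- real DIM('a) / 2) * (2 * pi) powr (DIM('a) / 2)"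
      using gaussian_fourier[of 1 "0::'a"] by simp
    also have "\<dots> = 1" by (simp add: powr_add[symmetric])
    finally show ?thesis .
  qed
  ultimately have "(\<integral>\<^sup>+x. ennreal ((2 * pi) powr (- real DIM('a) / 2) * exp (- (norm x)\<^sup>2 / 2)) \<partial>(lborel :: 'a measure)) = 1"
    by (subst nn_integral_eq_integral) auto
  then show "emeasure std_gaussian (space (std_gaussian :: 'a measure)) = 1"
    by (simp add: std_gaussian_def emeasure_density)
qed

text \<open>Rotation invariance is read off the characteristic function, which depends only on the
  norm of its argument.\<close>

lemma std_gaussian_inner:
  fixes e :: "'a::euclidean_space"
  assumes "norm e = 1"
  shows "distr std_gaussian borel (\<lambda>x. x \<bullet> e) = std_normal_distribution"
proof (rule Levy_uniqueness)
  interpret prob_space "std_gaussian :: 'a measure" by (rule prob_space_std_gaussian)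
  show "real_distribution (distr std_gaussian borel (\<lambda>x. x \<bullet> e))"
    by (intro real_distribution.intro prob_space_distr real_distribution_axioms.intro) auto
  show "real_distribution std_normal_distribution" by (rule real_dist_normal_dist)
  show "char (distr std_gaussian borel (\<lambda>x. x \<bullet> e)) = char std_normal_distribution"
  proof
    fix t
    have "char (distr std_gaussian borel (\<lambda>x. x \<bullet> e)) t = (\<integral>x. cis (x \<bullet> (t *\<^sub>R e)) \<partial>std_gaussian)"
      by (simp add: char_def integral_distr cis_conv_exp)
    also have "\<dots> = char std_normal_distribution t"
      by (subst std_gaussian_cis) (simp add: assms char_std_normal_distribution)
    finally show "char (distr std_gaussian borel (\<lambda>x. x \<bullet> e)) t = char std_normal_distribution t" .
  qed
qed

section \<open>Zonal functions\<close>

lemma nn_integral_beta_even_moment: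
  fixes b :: real and k :: nat
  assumes "b > 0"
  shows "(\<integral>\<^sup>+t. ennreal (t ^ (2 * k) * (1 - t\<^sup>2) powr (b - 1)) * indicator {-1<..<1} t \<partial>lborel) = ennreal (Beta (real k + 1/2) b)"
proof -
  define f where "f x = x powr (real k + 1/2 - 1) * (1 - x) powr (b - 1)" for x :: real
  define F where "F t = t ^ (2 * k) * (1 - t\<^sup>2) powr (b - 1)" for t :: real
  have [measurable]: "f \<in> borel_measurable borel" "F \<in> borel_measurable borel"
    unfolding f_def F_def by measurable
  have I: "(f has_integral Beta (real k + 1/2) b) {0<..<1}"
    unfolding f_def has_integral_Icc_iff_Ioo[symmetric]
    by (rule has_integral_Beta_real) (use assms in auto)
  have im: "(\<lambda>t::real. t\<^sup>2) ` {0<..<1} = {0<..<1}"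
  proof safe
    fix x :: real assume "x \<in> {0<..<1}"
    then show "x \<in> (\<lambda>t::real. t\<^sup>2) ` {0<..<1}"
      by (intro image_eqI[of _ _ "sqrt x"]) auto
  qed (auto simp: power_less_one_iff abs_square_less_1)
  have half: "(\<integral>\<^sup>+t. ennreal (\<bar>2 * t\<bar> * f (t\<^sup>2)) * indicator {0<..<1} t \<partial>lborel) = ennreal (Beta (real k + 1/2) b)"
    by (rule nn_integral_change_of_variables[OF _ _ _ _ _ _ _ im I])
       (auto simp: f_def inj_on_def power2_eq_iff_nonneg intro!: derivative_eq_intros)
  have e: "\<bar>2 * t\<bar> * f (t\<^sup>2) = 2 * F t" if "t \<in> {0<..<1}" for t
  proof -
    have "t * (t\<^sup>2) powr (real k + 1/2 - 1) = t powr 1 * (t powr 2) powr (real k + 1/2 - 1)"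
      using that by simp
    also have "\<dots> = t powr real (2 * k)"
      using that unfolding powr_powr powr_add[symmetric] by (simp add: algebra_simps)
    also have "\<dots> = t ^ (2 * k)"
      using that powr_realpow[of t "2 * k"] by simp
    finally show ?thesis using that by (simp add: f_def F_def)
  qed
  have "(\<integral>\<^sup>+t. ennreal (F t) * indicator {-1<..<1} t \<partial>lborel)
    = (\<integral>\<^sup>+t. ennreal (F t) * indicator {0<..<1} t + ennreal (F t) * indicator {-1<..<0} t \<partial>lborel)"
    using AE_lborel_singleton[of "0::real"]
    by (intro nn_integral_cong_AE, eventually_elim) (auto split: split_indicator)
  also have "\<dots> = (\<integral>\<^sup>+t. ennreal (F t) * indicator {0<..<1} t \<partial>lborel) + (\<integral>\<^sup>+t. ennreal (F t) * indicator {-1<..<0} t \<partial>lborel)"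
    by (rule nn_integral_add) auto
  also have "(\<integral>\<^sup>+t. ennreal (F t) * indicator {-1<..<0} t \<partial>lborel) = (\<integral>\<^sup>+t. ennreal (F t) * indicator {0<..<1} t \<partial>lborel)"
    by (subst nn_integral_real_affine[where c="-1" and t=0])
      (auto intro!: nn_integral_cong simp: F_def split: split_indicator)
  also have "(\<integral>\<^sup>+t. ennreal (F t) * indicator {0<..<1} t \<partial>lborel) + (\<integral>\<^sup>+t. ennreal (F t) * indicator {0<..<1} t \<partial>lborel)
     = (\<integral>\<^sup>+t. ennreal (F t) * indicator {0<..<1} t + ennreal (F t) * indicator {0<..<1} t \<partial>lborel)"
    by (rule nn_integral_add[symmetric]) auto
  also have "\<dots> = (\<integral>\<^sup>+t. ennreal (\<bar>2 * t\<bar> * f (t\<^sup>2)) * indicator {0<..<1} t \<partial>lborel)"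
  proof (intro nn_integral_cong)
    fix t show "ennreal (F t) * indicator {0<..<1} t + ennreal (F t) * indicator {0<..<1} t = ennreal (\<bar>2 * t\<bar> * f (t\<^sup>2)) * indicator {0<..<1} t"
    proof (cases "t \<in> {0<..<1}")
      case True
      then have "F t \<ge> 0" by (simp add: F_def)
      then show ?thesis using True unfolding e[OF True] by (simp add: ennreal_plus[symmetric] del: ennreal_plus)
    qed simp
  qed
  finally show ?thesis unfolding half F_def .
qed

text \<open>The Gaussian moment of \<open>x \<bullet> e\<close> is computed twice: from the
  one-dimensional marginal, where it is the known normal moment, and in polar coordinates, where it
  is the moment on the sphere times a radial Gamma integral. No parametrisation of the sphere
  enters.\<close>

lemma sphere_sigma_even_moment:
  fixes e :: "'a::euclidean_space"
  assumes e: "norm e = 1"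
  shows "(\<integral>\<^sup>+y. ennreal ((y \<bullet> e) ^ (2 * k)) \<partial>sphere_sigma)
     = ennreal (Gamma (real k + 1/2) * Gamma (DIM('a) / 2) / (sqrt pi * Gamma (real k + DIM('a) / 2)))"
proof -
  interpret \<sigma>: prob_space "sphere_sigma :: 'a measure" by (rule prob_space_sphere_sigma)
  define c where "c = (2 * pi) powr (- real DIM('a) / 2)"
  \<comment> \<open>The normalising factor of the polar formula. It is eliminated by comparison with
    the case \<open>k = 0\<close>, so the volume of the unit ball is never evaluated.\<close>
  define D where "D = c * (DIM('a) * measure lborel (ball 0 1 :: 'a set))"
  define m where "m k = (\<integral>\<^sup>+y. ennreal ((y \<bullet> e) ^ (2 * k)) \<partial>sphere_sigma)" for k
  have c: "c > 0" unfolding c_def by simp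
  have D: "D > 0" using c emeasure_lborel_unit_ball(2)[where 'a='a] by (simp add: D_def)
  have m_fin: "m k \<le> 1" for k
  proof -
    have "m k \<le> (\<integral>\<^sup>+y. 1 \<partial>(sphere_sigma :: 'a measure))" unfolding m_def
      using AE_sphere_sigma
    proof (intro nn_integral_mono_AE, eventually_elim)
      fix y :: 'a assume "norm y = 1"
      then have "\<bar>y \<bullet> e\<bar> \<le> 1" using Cauchy_Schwarz_ineq2[of y e] e by simp
      then show "ennreal ((y \<bullet> e) ^ (2 * k)) \<le> 1"
        by (simp add: power_mult abs_square_le_1 power_le_one)
    qed
    then show ?thesis by (simp add: \<sigma>.emeasure_space_1[simplified])
  qed
  have *: "ennreal (fact (2 * k) / (2 ^ k * fact k)) = m k * ennreal (D * (Gamma (real k + DIM('a) / 2) * 2 powr (real k + DIM('a) / 2 - 1)))" for k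
  proof -
    have "ennreal (fact (2 * k) / (2 ^ k * fact k)) = (\<integral>\<^sup>+x. ennreal (x ^ (2 * k)) \<partial>std_normal_distribution)"
      using std_normal_distribution_even_moments[of k] by (subst nn_integral_eq_integral) auto
    also have "\<dots> = (\<integral>\<^sup>+x. ennreal ((x \<bullet> e) ^ (2 * k)) \<partial>std_gaussian)"
      unfolding std_gaussian_inner[OF e, symmetric] by (simp add: nn_integral_distr)
    also have "\<dots> = (\<integral>\<^sup>+x. ennreal (c * (norm x ^ (2 * k) * exp (- (norm x)\<^sup>2 / 2))) * ennreal (((x /\<^sub>R norm x) \<bullet> e) ^ (2 * k)) \<partial>lborel)"
    proof -
      have "ennreal (c * exp (- (norm x)\<^sup>2 / 2)) * ennreal ((x \<bullet> e) ^ (2 * k))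
        = ennreal (c * (norm x ^ (2 * k) * exp (- (norm x)\<^sup>2 / 2))) * ennreal (((x /\<^sub>R norm x) \<bullet> e) ^ (2 * k))" if "x \<noteq> 0" for x :: 'a
      proof -
        have "(x \<bullet> e) ^ (2 * k) = norm x ^ (2 * k) * ((x /\<^sub>R norm x) \<bullet> e) ^ (2 * k)"
          using that by (simp add: power_mult_distrib power_inverse)
        moreover define P Q where "P = norm x ^ (2 * k)" and "Q = ((x /\<^sub>R norm x) \<bullet> e) ^ (2 * k)"
        moreover have "P \<ge> 0" "Q \<ge> 0" by (auto simp: P_def Q_def)
        ultimately show ?thesis using c unfolding P_def[symmetric] Q_def[symmetric]
          by (simp add: ennreal_mult'[symmetric] mult_ac)
      qed
      then show ?thesis
        unfolding std_gaussian_def c_def[symmetric] using AE_lborel_singleton[of "0::'a"]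
        by (subst nn_integral_density) (auto intro!: nn_integral_cong_AE elim!: eventually_mono)
    qed
    also have "\<dots> = m k * (ennreal (DIM('a) * measure lborel (ball 0 1 :: 'a set)) *
        (\<integral>\<^sup>+r. ennreal (c * (r ^ (2 * k) * exp (- r\<^sup>2 / 2))) * (ennreal (r powr (DIM('a) - 1)) * indicator {0<..} r) \<partial>lborel))"
      unfolding m_def using m_fin[of k] unfolding m_def
      by (subst nn_integral_polar[where h="\<lambda>r. ennreal (c * (r ^ (2 * k) * exp (- r\<^sup>2 / 2)))"])
         (auto simp: top_unique)
    also have "(\<integral>\<^sup>+r. ennreal (c * (r ^ (2 * k) * exp (- r\<^sup>2 / 2))) * (ennreal (r powr (DIM('a) - 1)) * indicator {0<..} r) \<partial>lborel)
       = (\<integral>\<^sup>+r. ennreal c * (ennreal (r powr (2 * real k + DIM('a) - 1) * exp (- (1/2) * r powr 2)) * indicator {0<..} r) \<partial>lborel)"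
    proof (intro nn_integral_cong)
      fix r :: real
      have "r ^ (2 * k) * r powr (DIM('a) - 1) = r powr (2 * real k + DIM('a) - 1)" if "r > 0"
      proof -
        have "r ^ (2 * k) = r powr (2 * real k)" using that powr_realpow[of r "2 * k"] by simp
        then show ?thesis by (simp add: powr_add[symmetric] add_diff_eq)
      qed
      then show "ennreal (c * (r ^ (2 * k) * exp (- r\<^sup>2 / 2))) * (ennreal (r powr (DIM('a) - 1)) * indicator {0<..} r)
        = ennreal c * (ennreal (r powr (2 * real k + DIM('a) - 1) * exp (- (1/2) * r powr 2)) * indicator {0<..} r)"
        using c by (simp split: split_indicator) (simp add: ennreal_mult''[symmetric] mult.assoc mult.left_commute)
    qed
    also have "\<dots> = ennreal c * ennreal (Gamma ((2 * real k + DIM('a)) / 2) / (\<bar>2\<bar> * (1/2) powr ((2 * real k + DIM('a)) / 2)))"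
      by (subst nn_integral_cmult, measurable, subst nn_integral_powr_exp_powr) (auto simp: add_nonneg_pos)
    also have "(2 * real k + DIM('a)) / 2 = real k + DIM('a) / 2" by (simp add: add_divide_distrib)
    also have "Gamma (real k + DIM('a) / 2) / (\<bar>2\<bar> * (1/2) powr (real k + DIM('a) / 2)) = Gamma (real k + DIM('a) / 2) * 2 powr (real k + DIM('a) / 2 - 1)"
      using powr_diff[of 2 "real k + DIM('a) / 2" 1] by (simp add: powr_divide)
    finally show ?thesis
      using c by (simp add: D_def ennreal_mult'[symmetric] ennreal_mult''[symmetric] mult_ac)
  qed
  have G: "Gamma (real k + DIM('a) / 2) > 0" for k by (intro Gamma_real_pos) (simp add: add_nonneg_pos)
  have "m 0 = 1" by (simp add: m_def \<sigma>.emeasure_space_1[simplified])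
  then have D1: "D * (Gamma (DIM('a) / 2) * 2 powr (DIM('a) / 2 - 1)) = 1"
    using *[of 0] by (simp add: ennreal_eq_1)
  obtain q where q: "m k = ennreal q" "q \<ge> 0"
    using m_fin[of k] by (cases "m k") (auto simp: top_unique)
  have "fact (2 * k) / (2 ^ k * fact k) = q * (D * (Gamma (real k + DIM('a) / 2) * 2 powr (real k + DIM('a) / 2 - 1)))"
    using *[of k] q G[of k] D by (simp add: ennreal_mult'[symmetric])
  also have "2 powr (real k + DIM('a) / 2 - 1) = 2 ^ k * 2 powr (DIM('a) / 2 - 1)"
    using powr_add[of 2 "real k" "DIM('a) / 2 - 1"] powr_realpow[of 2 k] by (simp add: add_diff_eq)
  also have "D = 1 / (Gamma (DIM('a) / 2) * 2 powr (DIM('a) / 2 - 1))"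
    using D1 by (metis mult_zero_right nonzero_eq_divide_eq zero_neq_one)
  finally have qk: "fact (2 * k) / (2 ^ k * fact k) = q * (Gamma (real k + DIM('a) / 2) / Gamma (DIM('a) / 2)) * 2 ^ k"
    by simp
  then have "q = fact (2 * k) / (4 ^ k * fact k) * (Gamma (DIM('a) / 2) / Gamma (real k + DIM('a) / 2))"
  proof -
    have "q = F / (p * p * f) * (B / A)" if "F / (p * f) = q * (A / B) * p" "A > 0" "B > 0" "p > 0" "f > 0" for A B F f p :: real
      using that by (auto simp: field_simps)
    from this[of "fact (2 * k)" "2 ^ k" "fact k"] qk G[of k] G[of 0] show ?thesis
      by (simp add: power_mult_distrib[symmetric])
  qed
  \<comment> \<open>The duplication formula at half-integers, by induction from the value
    \<open>sqrt pi\<close> at \<open>1/2\<close>.\<close>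
  moreover have "Gamma (real k + 1/2) = sqrt pi * (fact (2 * k) / (4 ^ k * fact k))"
  proof (induction k)
    case (Suc k)
    have "Gamma (real (Suc k) + 1/2) = Gamma ((real k + 1/2) + 1)" by (simp add: add_ac)
    also have "\<dots> = (real k + 1/2) * Gamma (real k + 1/2)"
      by (rule Gamma_plus1) (auto elim!: nonpos_Ints_cases)
    also have "\<dots> = (real k + 1/2) * (sqrt pi * (fact (2 * k) / (4 ^ k * fact k)))" by (simp only: Suc)
    also have "\<dots> = sqrt pi * (fact (2 * Suc k) / (4 ^ Suc k * fact (Suc k)))"
      by (simp add: divide_simps) (simp add: algebra_simps)
    finally show ?case .
  qed (simp add: Gamma_one_half_real)
  ultimately show ?thesis using q unfolding m_def by simp
qed


lemma sphere_sigma_uminus: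
  "distr sphere_sigma borel uminus = (sphere_sigma :: 'a::euclidean_space measure)"
proof (rule measure_eqI)
  fix A :: "'a set" assume "A \<in> sets (distr sphere_sigma borel uminus)"
  then have [measurable]: "A \<in> sets borel" by simp
  define b where "b = measure lborel (ball 0 1 :: 'a set)"
  have b: "b > 0" unfolding b_def by (rule emeasure_lborel_unit_ball)
  have "ennreal b * (\<integral>\<^sup>+y. indicator A (- y) \<partial>sphere_sigma) = (\<integral>\<^sup>+x. indicator A (- (x /\<^sub>R norm x)) * indicator (ball 0 1) x \<partial>(lborel :: 'a measure))"
    unfolding b_def by (rule nn_integral_sphere_sigma) measurable
  also have "\<dots> = (\<integral>\<^sup>+x. indicator A (x /\<^sub>R norm x) * indicator (ball 0 1) x \<partial>(lborel :: 'a measure))"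
    by (subst nn_integral_lborel_scaleR[where c="-1" and t=0])
      (measurable, auto intro!: nn_integral_cong split: split_indicator)
  also have "\<dots> = ennreal b * (\<integral>\<^sup>+y. indicator A y \<partial>sphere_sigma)"
    unfolding b_def by (rule nn_integral_sphere_sigma[symmetric]) measurable
  finally have "(\<integral>\<^sup>+y. indicator A (- y) \<partial>sphere_sigma) = (\<integral>\<^sup>+y. indicator A y \<partial>sphere_sigma)"
    using b by (simp add: ennreal_mult_cancel_left)
  moreover have "(\<integral>\<^sup>+y. indicator A (- y) \<partial>(sphere_sigma :: 'a measure)) = (\<integral>\<^sup>+y. indicator A y \<partial>distr sphere_sigma borel uminus)"
    by (subst nn_integral_distr) auto
  ultimately show "emeasure (distr sphere_sigma borel uminus) A = emeasure sphere_sigma A"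
    by simp
qed simp

text \<open>The density of the law of \<open>y \<bullet> e\<close>, \<open>y\<close> uniform on the sphere of dimension \<open>n - 1\<close>, \<open>e\<close> a unit vector.\<close>
definition zonal_density :: "nat \<Rightarrow> real \<Rightarrow> real" where
  "zonal_density n t = indicator {-1<..<1} t * ((1 - t\<^sup>2) powr ((real n - 3) / 2) / Beta (1/2) ((real n - 1) / 2))"

lemma zonal_density_measurable [measurable]: "zonal_density n \<in> borel_measurable borel"
  unfolding zonal_density_def by measurable

lemma zonal_density_minus [simp]: "zonal_density n (- t) = zonal_density n t"
  by (auto simp: zonal_density_def split: split_indicator)

lemma Beta_pos: "a > 0 \<Longrightarrow> b > 0 \<Longrightarrow> Beta a b > (0::real)"
  by (simp add: Beta_def Gamma_real_pos)

lemma zonal_density_nonneg: "n \<ge> 2 \<Longrightarrow> zonal_density n t \<ge> 0"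
  using Beta_pos[of "1/2" "(real n - 1) / 2"] by (auto simp: zonal_density_def)

lemma zonal_even_moment:
  assumes "n \<ge> 2"
  shows "(\<integral>\<^sup>+t. ennreal (t ^ (2 * k)) * ennreal (zonal_density n t) \<partial>lborel)
    = ennreal (Gamma (real k + 1/2) * Gamma (n / 2) / (sqrt pi * Gamma (real k + n / 2)))"
proof -
  define B where "B = Beta (1/2) ((real n - 1) / 2)"
  have B: "B > 0" unfolding B_def using assms by (intro Beta_pos) auto
  have "(\<integral>\<^sup>+t. ennreal (t ^ (2 * k)) * ennreal (zonal_density n t) \<partial>lborel)
    = (\<integral>\<^sup>+t. ennreal (1 / B) * (ennreal (t ^ (2 * k) * (1 - t\<^sup>2) powr ((real n - 1) / 2 - 1)) * indicator {-1<..<1} t) \<partial>lborel)"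
  proof (intro nn_integral_cong)
    fix t :: real
    have e: "(real n - 3) / 2 = (real n - 1) / 2 - 1" by (simp add: field_simps)
    have "t ^ (2 * k) \<ge> 0" by simp
    then show "ennreal (t ^ (2 * k)) * ennreal (zonal_density n t) = ennreal (1 / B) * (ennreal (t ^ (2 * k) * (1 - t\<^sup>2) powr ((real n - 1) / 2 - 1)) * indicator {-1<..<1} t)"
      unfolding zonal_density_def B_def[symmetric] e using B
      by (auto simp: ennreal_mult'[symmetric] split: split_indicator)
  qed
  also have "\<dots> = ennreal (1 / B) * ennreal (Beta (real k + 1/2) ((real n - 1) / 2))"
    using assms by (subst nn_integral_cmult) (auto simp: nn_integral_beta_even_moment)
  also have "\<dots> = ennreal (Beta (real k + 1/2) ((real n - 1) / 2) / B)"
    using B by (simp add: ennreal_mult'[symmetric])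
  also have "Beta (real k + 1/2) ((real n - 1) / 2) / B = Gamma (real k + 1/2) * Gamma (n / 2) / (sqrt pi * Gamma (real k + n / 2))"
  proof -
    have e: "real k + 1/2 + (real n - 1) / 2 = real k + n / 2" "1/2 + (real n - 1) / 2 = n / 2" by (auto simp: field_simps)
    have "Gamma ((real n - 1) / 2) > 0" "Gamma (n / 2) > 0" "Gamma (real k + n / 2) > 0"
      using assms by (auto intro!: Gamma_real_pos simp: add_nonneg_pos)
    then show ?thesis unfolding B_def Beta_def e Gamma_one_half_real by (simp add: field_simps)
  qed
  finally show ?thesis .
qed


text \<open>Weierstrass approximation on \<open>{-1..1}\<close> passes from powers to all continuous
  functions; applied to sine and cosine it gives equal characteristic functions.\<close>

lemma real_distribution_eqI_moments:
  assumes M1: "real_distribution M1" and M2: "real_distribution M2"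
    and b1: "AE t in M1. \<bar>t\<bar> \<le> 1" and b2: "AE t in M2. \<bar>t\<bar> \<le> 1"
    and mom: "\<And>k::nat. (\<integral>t. t ^ k \<partial>M1) = (\<integral>t. t ^ k \<partial>M2)"
  shows "M1 = M2"
proof (rule Levy_uniqueness[OF M1 M2], rule ext)
  interpret M1: real_distribution M1 by fact
  interpret M2: real_distribution M2 by fact
  have intb: "integrable N f" if "real_distribution N" "AE t in N. \<bar>t\<bar> \<le> 1" "continuous_on UNIV f" for N and f :: "real \<Rightarrow> real"
  proof -
    interpret real_distribution N by fact
    have "compact (f ` {-1..1})"
      by (intro compact_continuous_image) (auto intro: continuous_on_subset[OF that(3)])
    then have "\<exists>B. \<forall>t\<in>{-1..1}. \<bar>f t\<bar> \<le> B"
      by (auto dest!: compact_imp_bounded simp: bounded_iff)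
    then obtain B where B: "\<And>t. \<bar>t\<bar> \<le> 1 \<Longrightarrow> \<bar>f t\<bar> \<le> B"
      by (metis abs_le_iff atLeastAtMost_iff minus_le_iff)
    have "f \<in> borel_measurable borel" using that(3) by (rule borel_measurable_continuous_onI)
    then show ?thesis
      using that(2) B by (intro integrable_const_bound[of _ B]) (auto elim!: eventually_mono)
  qed
  have poly: "(\<integral>t. p t \<partial>M1) = (\<integral>t. p t \<partial>M2)" if "real_polynomial_function p" for p :: "real \<Rightarrow> real"
  proof -
    obtain a n where p: "p = (\<lambda>x. \<Sum>i\<le>n. a i * x ^ i)"
      using \<open>real_polynomial_function p\<close> unfolding real_polynomial_function_iff_sum by blast
    have "integrable M1 (\<lambda>t. t ^ i)" "integrable M2 (\<lambda>t. t ^ i)" for i :: nat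
      by (intro intb[OF M1 b1] intb[OF M2 b2] continuous_intros)+
    then show ?thesis unfolding p by (simp add: mom)
  qed
  have cont: "(\<integral>t. f t \<partial>M1) = (\<integral>t. f t \<partial>M2)" if f: "continuous_on UNIV f" for f :: "real \<Rightarrow> real"
  proof (rule ccontr)
    assume ne: "(\<integral>t. f t \<partial>M1) \<noteq> (\<integral>t. f t \<partial>M2)"
    define \<epsilon> where "\<epsilon> = \<bar>(\<integral>t. f t \<partial>M1) - (\<integral>t. f t \<partial>M2)\<bar> / 3"
    have "\<epsilon> > 0" using ne by (simp add: \<epsilon>_def)
    then obtain p where p: "real_polynomial_function p" "\<And>t. t \<in> {-1..1} \<Longrightarrow> \<bar>f t - p t\<bar> < \<epsilon>"
      using Stone_Weierstrass_real_polynomial_function[of "{-1..1::real}" f \<epsilon>] f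
      by (metis compact_Icc continuous_on_subset subset_UNIV)
    have p': "\<bar>f t - p t\<bar> \<le> \<epsilon>" if "\<bar>t\<bar> \<le> 1" for t
      using that by (intro less_imp_le p(2)) auto
    have cp: "continuous_on UNIV p" using p(1)
      by (simp add: continuous_on_polymonial_function real_polynomial_function_eq)
    have close: "\<bar>(\<integral>t. f t \<partial>N) - (\<integral>t. p t \<partial>N)\<bar> \<le> \<epsilon>" if N: "real_distribution N" "AE t in N. \<bar>t\<bar> \<le> 1" for N
    proof -
      interpret real_distribution N by fact
      have i: "integrable N f" "integrable N p" "integrable N (\<lambda>t. \<bar>f t - p t\<bar>)"
        by (intro intb N f cp continuous_intros)+
      have "\<bar>(\<integral>t. f t \<partial>N) - (\<integral>t. p t \<partial>N)\<bar> = \<bar>\<integral>t. f t - p t \<partial>N\<bar>" using i by simp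
      also have "\<dots> \<le> (\<integral>t. \<bar>f t - p t\<bar> \<partial>N)" by (rule integral_abs_bound)
      also have "\<dots> \<le> (\<integral>t. \<epsilon> \<partial>N)"
        using N(2) by (intro integral_mono_AE i) (auto elim!: eventually_mono intro!: p')
      also have "\<dots> = \<epsilon>" using prob_space by simp
      finally show ?thesis .
    qed
    have "\<bar>(\<integral>t. f t \<partial>M1) - (\<integral>t. f t \<partial>M2)\<bar> \<le> 2 * \<epsilon>"
      using close[OF M1 b1] close[OF M2 b2] poly[OF p(1)] by linarith
    then show False using \<open>\<epsilon> > 0\<close> unfolding \<epsilon>_def by auto
  qed
  fix t
  have *: "char N t = Complex (\<integral>x. cos (t * x) \<partial>N) (\<integral>x. sin (t * x) \<partial>N)" if "real_distribution N" for N
  proof -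
    interpret real_distribution N by fact
    have i: "integrable N (\<lambda>x. iexp (t * x))"
      by (rule integrable_const_bound[of _ 1]) auto
    have "iexp (t * x) = cis (t * x)" for x by (simp add: cis_conv_exp)
    then show ?thesis unfolding char_def complex_eq_iff
      using integral_Re[OF i] integral_Im[OF i] by simp
  qed
  show "char M1 t = char M2 t"
    unfolding *[OF M1] *[OF M2] by (subst (1 2) cont) (auto intro!: continuous_intros)
qed

text \<open>Both laws are carried by \<open>{-1..1}\<close>, so their moments decide. The even ones
  are the same Gamma quotient, the odd ones vanish because both laws are symmetric.\<close>

theorem sphere_sigma_zonal:
  fixes e :: "'a::euclidean_space"
  assumes d: "DIM('a) \<ge> 2" and e: "norm e = 1"
  shows "distr sphere_sigma borel (\<lambda>y. y \<bullet> e) = density lborel (\<lambda>t. ennreal (zonal_density DIM('a) t))"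
    (is "?M1 = ?M2")
proof (rule real_distribution_eqI_moments)
  interpret \<sigma>: prob_space "sphere_sigma :: 'a measure" by (rule prob_space_sphere_sigma)
  let ?z = "zonal_density DIM('a)"
  have z: "?z t \<ge> 0" for t using zonal_density_nonneg[OF d] .
  interpret M1: prob_space ?M1 by (rule \<sigma>.prob_space_distr) simp
  show "real_distribution ?M1" by unfold_locales auto
  interpret M2: prob_space ?M2
  proof
    have "Gamma (real DIM('a) / 2) > 0" by (intro Gamma_real_pos) simp
    then have "ennreal (Gamma (real 0 + 1/2) * Gamma (DIM('a) / 2) / (sqrt pi * Gamma (real 0 + DIM('a) / 2))) = 1"
      using pi_gt_zero by (simp add: Gamma_one_half_real less_imp_neq[symmetric])
    then show "emeasure ?M2 (space ?M2) = 1"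
      using zonal_even_moment[OF d, of 0] by (simp add: emeasure_density)
  qed
  show "real_distribution ?M2" by unfold_locales auto
  show b1: "AE t in ?M1. \<bar>t\<bar> \<le> 1"
    unfolding AE_distr_iff[of "\<lambda>y. y \<bullet> e" sphere_sigma borel "\<lambda>t. \<bar>t\<bar> \<le> 1", simplified]
  proof -
    show "AE x in sphere_sigma. \<bar>x \<bullet> e\<bar> \<le> 1"
      using AE_sphere_sigma
    proof eventually_elim
      case (elim y)
      then show ?case using Cauchy_Schwarz_ineq2[of y e] e by simp
    qed
  qed
  show b2: "AE t in ?M2. \<bar>t\<bar> \<le> 1"
    by (auto simp: AE_density zonal_density_def split: split_indicator)
  fix k :: nat
  show "(\<integral>t. t ^ k \<partial>?M1) = (\<integral>t. t ^ k \<partial>?M2)"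
  proof (cases "even k")
    case True
    then obtain j where k: "k = 2 * j" by (auto elim: evenE)
    have "(\<integral>t. t ^ k \<partial>?M1) = enn2real (\<integral>\<^sup>+t. ennreal (t ^ k) \<partial>?M1)"
      "(\<integral>t. t ^ k \<partial>?M2) = enn2real (\<integral>\<^sup>+t. ennreal (t ^ k) \<partial>?M2)"
      by (intro integral_eq_nn_integral; simp add: k)+
    moreover have "(\<integral>\<^sup>+t. ennreal (t ^ k) \<partial>?M1) = (\<integral>\<^sup>+t. ennreal (t ^ k) \<partial>?M2)"
    proof -
      have "(\<integral>\<^sup>+t. ennreal (t ^ k) \<partial>?M1) = (\<integral>\<^sup>+y. ennreal ((y \<bullet> e) ^ (2 * j)) \<partial>sphere_sigma)"
        unfolding k by (simp add: nn_integral_distr)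
      also have "\<dots> = (\<integral>\<^sup>+t. ennreal (t ^ (2 * j)) * ennreal (?z t) \<partial>lborel)"
        by (simp only: sphere_sigma_even_moment[OF e] zonal_even_moment[OF d])
      also have "\<dots> = (\<integral>\<^sup>+t. ennreal (t ^ k) \<partial>?M2)"
        unfolding k by (subst nn_integral_density) (auto simp: mult.commute[of "ennreal (zonal_density _ _)"])
      finally show ?thesis .
    qed
    ultimately show ?thesis by simp
  next
    case False
    have "(\<integral>y. (y \<bullet> e) ^ k \<partial>sphere_sigma) = (\<integral>y. (y \<bullet> e) ^ k \<partial>distr sphere_sigma borel uminus)"
      by (simp add: sphere_sigma_uminus)
    also have "\<dots> = - (\<integral>y. (y \<bullet> e) ^ k \<partial>sphere_sigma)"
      using False by (subst integral_distr) auto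
    finally have 1: "(\<integral>y. (y \<bullet> e) ^ k \<partial>sphere_sigma) = 0" by simp
    have "(\<integral>t. ?z t * t ^ k \<partial>lborel) = - (\<integral>t. ?z t * t ^ k \<partial>lborel)"
      using lborel_integral_real_affine[of "-1" "\<lambda>t. ?z t * t ^ k" 0] False
      by (simp add: zonal_density_minus)
    then have 2: "(\<integral>t. ?z t * t ^ k \<partial>lborel) = 0" by simp
    show ?thesis
      using 1 2 z by (simp add: integral_distr integral_density)
  qed
qed

lemma nn_integral_zonal:
  fixes e :: "'a::euclidean_space"
  assumes "DIM('a) \<ge> 2" "norm e = 1" and [measurable]: "F \<in> borel_measurable borel"
  shows "(\<integral>\<^sup>+y. F (y \<bullet> e) \<partial>sphere_sigma) = (\<integral>\<^sup>+t. F t * ennreal (zonal_density DIM('a) t) \<partial>lborel)"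
proof -
  have "(\<integral>\<^sup>+y. F (y \<bullet> e) \<partial>sphere_sigma) = (\<integral>\<^sup>+t. F t \<partial>distr sphere_sigma borel (\<lambda>y. y \<bullet> e))"
    by (simp add: nn_integral_distr)
  also have "\<dots> = (\<integral>\<^sup>+t. F t * ennreal (zonal_density DIM('a) t) \<partial>lborel)"
    unfolding sphere_sigma_zonal[OF assms(1,2)] by (simp add: nn_integral_density mult.commute)
  finally show ?thesis .
qed

section \<open>The Riesz potential of the sphere\<close>

text \<open>By the law of cosines \<open>1 + r\<^sup>2 - 2 * r * t\<close> is the squared distance
  from \<open>r *\<^sub>R e\<close> to a unit vector \<open>y\<close> with
  \<open>y \<bullet> e = t\<close>, so this is the integral of the distance to the power
  \<open>- \<beta>\<close> over the sphere. It is extended real because for the exponent of the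
  Poisson kernel it diverges at \<open>r = 1\<close>.\<close>

definition zonal_riesz :: "nat \<Rightarrow> real \<Rightarrow> real \<Rightarrow> ennreal" where
  "zonal_riesz n \<beta> r = (\<integral>\<^sup>+t. ennreal ((1 + r\<^sup>2 - 2 * r * t) powr (- \<beta> / 2)) * ennreal (zonal_density n t) \<partial>lborel)"

lemma norm_diff_powr:
  fixes e y :: "'a::euclidean_space"
  assumes "norm e = 1" "norm y = 1"
  shows "norm (r *\<^sub>R e - y) powr (- \<beta>) = (1 + r\<^sup>2 - 2 * r * (y \<bullet> e)) powr (- \<beta> / 2)"
proof -
  have "(norm (r *\<^sub>R e - y))\<^sup>2 = r\<^sup>2 * (norm e)\<^sup>2 - 2 * r * (y \<bullet> e) + (norm y)\<^sup>2"
    unfolding power2_norm_eq_inner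
    by (simp add: inner_diff_left inner_diff_right inner_commute power2_eq_square algebra_simps)
  then have eq: "1 + r\<^sup>2 - 2 * r * (y \<bullet> e) = (norm (r *\<^sub>R e - y))\<^sup>2"
    using assms by simp
  show ?thesis
  proof (cases "norm (r *\<^sub>R e - y) = 0")
    case False
    then have "(norm (r *\<^sub>R e - y))\<^sup>2 = norm (r *\<^sub>R e - y) powr 2" by simp
    then show ?thesis unfolding eq by (simp only: powr_powr) simp
  qed (simp add: eq)
qed

lemma nn_integral_sphere_riesz:
  fixes e :: "'a::euclidean_space"
  assumes "DIM('a) \<ge> 2" "norm e = 1"
  shows "(\<integral>\<^sup>+y. ennreal (norm (r *\<^sub>R e - y) powr (- \<beta>)) \<partial>sphere_sigma) = zonal_riesz DIM('a) \<beta> r"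
proof -
  have "(\<integral>\<^sup>+y. ennreal (norm (r *\<^sub>R e - y) powr (- \<beta>)) \<partial>sphere_sigma)
    = (\<integral>\<^sup>+y. ennreal ((1 + r\<^sup>2 - 2 * r * (y \<bullet> e)) powr (- \<beta> / 2)) \<partial>sphere_sigma)"
    using AE_sphere_sigma[where 'a='a] assms(2)
    by (intro nn_integral_cong_AE) (auto elim!: eventually_mono simp: norm_diff_powr)
  also have "\<dots> = zonal_riesz DIM('a) \<beta> r"
    unfolding zonal_riesz_def
    by (rule nn_integral_zonal[OF assms, where F="\<lambda>t. ennreal ((1 + r\<^sup>2 - 2 * r * t) powr (- \<beta> / 2))"]) measurable
  finally show ?thesis .
qed

text \<open>A lower bound of the squared distance that is uniform in \<open>r\<close>. It supplies
  one majorant for all radii, in particular across the critical value \<open>r = 1\<close>.\<close>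

lemma zonal_quadratic_ge:
  assumes "r \<ge> 0" "\<bar>t\<bar> \<le> (1::real)"
  shows "(1 - t) / 2 \<le> 1 + r\<^sup>2 - 2 * r * t"
proof (cases "t \<ge> 0")
  case True
  have "(1 - t) * (1 / 2) \<le> (1 - t) * (1 + t)" using True assms by (intro mult_left_mono) auto
  then have "(1 - t) / 2 \<le> (1 - t) * (1 + t)" by simp
  also have "\<dots> \<le> (r - t)\<^sup>2 + (1 - t) * (1 + t)" by simp
  also have "\<dots> = 1 + r\<^sup>2 - 2 * r * t" by (simp add: power2_eq_square algebra_simps)
  finally show ?thesis .
next
  case False
  then have "r * t \<le> 0" using assms by (simp add: mult_nonneg_nonpos)
  then have "1 \<le> 1 + r\<^sup>2 - 2 * r * t" using zero_le_power2[of r] unfolding mult.assoc by linarith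
  then show ?thesis using assms by (auto simp: abs_le_iff)
qed

text \<open>The second intersection \<open>y'\<close> of the line through \<open>x\<close> and \<open>y\<close> with the sphere satisfies
  \<open>|x - y| |x - y'| = ||x|\<^sup>2 - 1|\<close>; the substitution \<open>y \<mapsto> y'\<close>, written in terms of \<open>t = y \<bullet> e\<close>,
  exchanges the two exponents.\<close>
lemma zonal_riesz_inversion:
  assumes n: "n \<ge> 2" and r: "r \<ge> 0" "r \<noteq> 1"
  shows "zonal_riesz n \<beta> r = ennreal (\<bar>1 - r\<^sup>2\<bar> powr (real n - 1 - \<beta>)) * zonal_riesz n (2 * (real n - 1) - \<beta>) r"
proof (cases "r = 0")
  case True
  then show ?thesis by (simp add: zonal_riesz_def)
next
  case False
  with r have r0: "r > 0" by simp
  define A where "A t = 1 + r\<^sup>2 - 2 * r * t" for t :: real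
  define D where "D = (1 - r\<^sup>2)\<^sup>2"
  have r2: "r\<^sup>2 \<noteq> 1" using r by (simp add: power2_eq_1_iff)
  then have D: "D > 0" by (simp add: D_def)
  have A: "A t > 0" if "\<bar>t\<bar> \<le> 1" for t
  proof -
    have "0 < (1 - r)\<^sup>2" using r by simp
    also have "\<dots> = 1 + r\<^sup>2 - 2 * r * 1" by (simp add: power2_eq_square algebra_simps)
    also have "\<dots> \<le> A t" unfolding A_def using that r0 by (intro diff_left_mono mult_left_mono) auto
    finally show ?thesis .
  qed
  \<comment> \<open>The second intersection point has the coordinate \<open>- g t\<close> along
    \<open>e\<close>, because its squared distance to \<open>r *\<^sub>R e\<close> is
    \<open>D / A t\<close>. With the sign changed \<open>g\<close> is increasing and fixes both end
    points, as the substitution rule requires.\<close>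
  define g where "g t = (D / A t - (1 + r\<^sup>2)) / (2 * r)" for t
  define g' where "g' t = D / (A t)\<^sup>2" for t
  have Ag: "A (- g t) = D / A t" for t
  proof -
    have "2 * r * g t = D / A t - (1 + r\<^sup>2)" unfolding g_def using r0 by simp
    then show ?thesis using A_def[of "- g t"] by simp
  qed
  \<comment> \<open>So the weight \<open>1 - t\<^sup>2\<close> changes by the derivative of
    \<open>g\<close>: the zonal density contributes the power \<open>(n - 3) / 2\<close> of
    \<open>g'\<close> and the Jacobian one more, together \<open>(n - 1) / 2\<close>.\<close>
  have gsq: "1 - (g t)\<^sup>2 = g' t * (1 - t\<^sup>2)" if "\<bar>t\<bar> \<le> 1" for t
  proof -
    have "(1 - (g t)\<^sup>2) * (4 * r\<^sup>2 * (A t)\<^sup>2) = 4 * r\<^sup>2 * (A t)\<^sup>2 - (D - (1 + r\<^sup>2) * A t)\<^sup>2"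
      unfolding g_def using r0 A[OF that] by (simp add: power2_eq_square field_simps)
    also have "\<dots> = 4 * r\<^sup>2 * (D * (1 - t\<^sup>2))"
      unfolding A_def D_def by algebra
    finally have *: "(1 - (g t)\<^sup>2) * (4 * r\<^sup>2 * (A t)\<^sup>2) = 4 * r\<^sup>2 * (D * (1 - t\<^sup>2))" .
    have "1 - (g t)\<^sup>2 = 4 * r\<^sup>2 * (D * (1 - t\<^sup>2)) / (4 * r\<^sup>2 * (A t)\<^sup>2)"
      unfolding *[symmetric] using r0 A[OF that] by simp
    then show ?thesis
      unfolding g'_def using r0 by simp
  qed
  have der: "(g has_real_derivative g' t) (at t)" if "\<bar>t\<bar> \<le> 1" for t
  proof -
    have dA: "(A has_real_derivative - 2 * r) (at t)"
      unfolding A_def by (auto intro!: derivative_eq_intros)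
    show ?thesis
      unfolding g_def[abs_def] g'_def using r0 A[OF that]
      by (auto intro!: derivative_eq_intros dA simp: power2_eq_square)
  qed
  have contA: "continuous_on {-1..1} A" unfolding A_def by (intro continuous_intros)
  have contg': "continuous_on {-1..1} g'"
  proof -
    have "A t \<noteq> 0" if "t \<in> {-1..1}" for t using A[of t] that by (simp add: abs_le_iff)
    then show ?thesis unfolding g'_def by (intro continuous_intros contA) auto
  qed
  have ends: "g (-1) = -1" "g 1 = 1"
  proof -
    have "A 1 = (1 - r)\<^sup>2" "A (-1) = (1 + r)\<^sup>2" by (auto simp: A_def power2_eq_square algebra_simps)
    moreover have "D = (1 - r)\<^sup>2 * (1 + r)\<^sup>2" unfolding D_def by algebra
    ultimately have "D / A 1 = (1 + r)\<^sup>2" "D / A (-1) = (1 - r)\<^sup>2" using r r0 by auto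
    then show "g (-1) = -1" "g 1 = 1" unfolding g_def using r0 by (auto simp: power2_eq_square field_simps)
  qed
  define B where "B = Beta (1/2) ((real n - 1) / 2)"
  define F where "F x = A (- x) powr (- \<beta> / 2) * zonal_density n x" for x
  have [measurable]: "F \<in> borel_measurable borel" unfolding F_def A_def by measurable
  have zr: "zonal_riesz n \<beta> r = (\<integral>\<^sup>+x. ennreal (F x) * indicator {g (-1)..g 1} x \<partial>lborel)"
  proof -
    have "zonal_riesz n \<beta> r = (\<integral>\<^sup>+x. ennreal ((A (- x)) powr (- \<beta> / 2)) * ennreal (zonal_density n (- x)) \<partial>lborel)"
      unfolding zonal_riesz_def A_def by (subst nn_integral_real_affine[where c="-1" and t=0]) auto
    also have "\<dots> = (\<integral>\<^sup>+x. ennreal (F x) * indicator {g (-1)..g 1} x \<partial>lborel)"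
      unfolding ends F_def
      by (intro nn_integral_cong)
        (auto simp: ennreal_mult'[symmetric] zonal_density_def split: split_indicator)
    finally show ?thesis .
  qed
  also have "\<dots> = (\<integral>\<^sup>+x. ennreal (F (g x) * g' x) * indicator {-1..1} x \<partial>lborel)"
  proof -
    have "(\<integral>\<^sup>+x. F x * indicator {g (-1)..g 1} x \<partial>lborel) = (\<integral>\<^sup>+x. F (g x) * g' x * indicator {-1..1} x \<partial>lborel)"
      by (rule nn_integral_substitution[OF _ der contg'])
        (auto simp: set_borel_measurable_def g'_def D[THEN less_imp_le] abs_le_iff)
    moreover have "ennreal (F x * indicator {g (-1)..g 1} x) = ennreal (F x) * indicator {g (-1)..g 1} x"
       "ennreal (F (g x) * g' x * indicator {-1..1} x) = ennreal (F (g x) * g' x) * indicator {-1..1} x" for x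
      by (auto split: split_indicator)
    ultimately show ?thesis by simp
  qed
  also have "\<dots> = (\<integral>\<^sup>+x. ennreal (\<bar>1 - r\<^sup>2\<bar> powr (real n - 1 - \<beta>)) * (ennreal ((1 + r\<^sup>2 - 2 * r * x) powr (- (2 * (real n - 1) - \<beta>) / 2)) * ennreal (zonal_density n x)) \<partial>lborel)"
  proof (rule nn_integral_cong_AE)
    have pt: "F (g x) * g' x = \<bar>1 - r\<^sup>2\<bar> powr (real n - 1 - \<beta>) * (A x powr (- (2 * (real n - 1) - \<beta>) / 2) * zonal_density n x)"
      if x: "x \<in> {-1<..<1}" for x
    proof -
      have xa: "\<bar>x\<bar> < 1" "\<bar>x\<bar> \<le> 1" using x by (auto simp: abs_less_iff)
      have Ax: "A x > 0" using A[OF xa(2)] .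
      have x1: "1 - x\<^sup>2 > 0" using xa by (simp add: abs_square_less_1)
      note gsqx = gsq[OF xa(2)]
      have g'x: "g' x > 0" unfolding g'_def using D Ax by simp
      have "1 - (g x)\<^sup>2 > 0" unfolding gsqx using x1 g'x by simp
      then have gx: "g x \<in> {-1<..<1}" by (simp add: abs_square_less_1 abs_less_iff)
      have zg: "zonal_density n (g x) = g' x powr ((real n - 3) / 2) * zonal_density n x"
        unfolding zonal_density_def gsqx using gx x x1 g'x by (simp add: powr_mult)
      have "F (g x) * g' x = (D / A x) powr (- \<beta> / 2) * (g' x powr ((real n - 3) / 2) * g' x powr 1) * zonal_density n x"
        unfolding F_def Ag zg using g'x by simp
      also have "g' x powr ((real n - 3) / 2) * g' x powr 1 = g' x powr ((real n - 1) / 2)"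
        unfolding powr_add[symmetric] by (simp add: field_simps)
      also have "(D / A x) powr (- \<beta> / 2) * g' x powr ((real n - 1) / 2) = D powr ((real n - 1 - \<beta>) / 2) * A x powr (- (2 * (real n - 1) - \<beta>) / 2)"
      proof -
        have lnD: "ln (D / A x) = ln D - ln (A x)" "ln (g' x) = ln D - 2 * ln (A x)"
          using D Ax by (auto simp: g'_def ln_div ln_realpow)
        show ?thesis
          using D Ax g'x unfolding powr_def
          by (simp add: lnD exp_add[symmetric] algebra_simps add_divide_distrib diff_divide_distrib)
      qed
      also have "D powr ((real n - 1 - \<beta>) / 2) = \<bar>1 - r\<^sup>2\<bar> powr (real n - 1 - \<beta>)"
      proof -
        have "D = \<bar>1 - r\<^sup>2\<bar> powr 2" using r2 by (simp add: D_def)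
        then show ?thesis by (simp only: powr_powr) (simp add: diff_divide_distrib)
      qed
      finally show ?thesis by (simp add: mult_ac)
    qed
    show "AE x in lborel. ennreal (F (g x) * g' x) * indicator {-1..1} x = ennreal (\<bar>1 - r\<^sup>2\<bar> powr (real n - 1 - \<beta>)) * (ennreal ((1 + r\<^sup>2 - 2 * r * x) powr (- (2 * (real n - 1) - \<beta>) / 2)) * ennreal (zonal_density n x))"
      using AE_lborel_singleton[of "1::real"] AE_lborel_singleton[of "-1::real"]
    proof eventually_elim
      case (elim x)
      show ?case
      proof (cases "x \<in> {-1<..<1}")
        case True
        then show ?thesis using pt[OF True] unfolding A_def
          by (simp add: ennreal_mult'[symmetric] zonal_density_nonneg[OF n])
      next
        case False
        then have "zonal_density n x = 0" "x \<notin> {-1..1}" using elim by (auto simp: zonal_density_def)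
        then show ?thesis by simp
      qed
    qed
  qed
  also have "\<dots> = ennreal (\<bar>1 - r\<^sup>2\<bar> powr (real n - 1 - \<beta>)) * zonal_riesz n (2 * (real n - 1) - \<beta>) r"
    unfolding zonal_riesz_def by (rule nn_integral_cmult) measurable
  finally show ?thesis .
qed

text \<open>On the sphere itself both factors become powers of \<open>x\<close> and
  \<open>1 - x\<close> after \<open>t = 1 - 2 * x\<close>. The power of \<open>x\<close> is
  integrable precisely for \<alpha> > 1, the condition for the potential to be finite on the
  sphere.\<close>

lemma zonal_riesz_one:
  assumes n: "n \<ge> 2" and a: "1 < \<alpha>"
  shows "zonal_riesz n (real n - \<alpha>) 1 = ennreal (2 powr (\<alpha> - 2) * Beta ((\<alpha> - 1) / 2) ((real n - 1) / 2) / Beta (1/2) ((real n - 1) / 2))"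
proof -
  define B where "B = Beta (1/2) ((real n - 1) / 2)"
  have B: "B > 0" unfolding B_def using n by (intro Beta_pos) auto
  define f where "f x = x powr ((\<alpha> - 1) / 2 - 1) * (1 - x) powr ((real n - 1) / 2 - 1)" for x :: real
  have [measurable]: "f \<in> borel_measurable borel" unfolding f_def by measurable
  have I: "(\<integral>\<^sup>+x. ennreal (f x) * indicator {0<..<1} x \<partial>lborel) = ennreal (Beta ((\<alpha> - 1) / 2) ((real n - 1) / 2))"
  proof (rule nn_integral_eq_has_integral_pos)
    show "(f has_integral Beta ((\<alpha> - 1) / 2) ((real n - 1) / 2)) {0<..<1}"
      unfolding f_def has_integral_Icc_iff_Ioo[symmetric]
      by (rule has_integral_Beta_real) (use n a in auto)
  qed (auto simp: f_def)
  have "zonal_riesz n (real n - \<alpha>) 1 = ennreal 2 * (\<integral>\<^sup>+x. ennreal ((1 + 1\<^sup>2 - 2 * 1 * (1 + (-2) * x)) powr (- (real n - \<alpha>) / 2)) * ennreal (zonal_density n (1 + (-2) * x)) \<partial>lborel)"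
    unfolding zonal_riesz_def by (subst nn_integral_real_affine[where c="-2" and t=1]) auto
  also have "\<dots> = ennreal 2 * (\<integral>\<^sup>+x. ennreal (2 powr (\<alpha> - 3) / B) * (ennreal (f x) * indicator {0<..<1} x) \<partial>lborel)"
  proof (rule arg_cong[where f="(*) (ennreal 2)"], rule nn_integral_cong)
    fix x :: real
    show "ennreal ((1 + 1\<^sup>2 - 2 * 1 * (1 + (-2) * x)) powr (- (real n - \<alpha>) / 2)) * ennreal (zonal_density n (1 + (-2) * x)) = ennreal (2 powr (\<alpha> - 3) / B) * (ennreal (f x) * indicator {0<..<1} x)"
    proof (cases "x \<in> {0<..<1}")
      case True
      then have x: "0 < x" "x < 1" by auto
      have "1 - (1 + (-2) * x)\<^sup>2 = 4 * x * (1 - x)" by (simp add: power2_eq_square algebra_simps)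
      then have z: "zonal_density n (1 + (-2) * x) = (4 * x * (1 - x)) powr ((real n - 3) / 2) / B"
        unfolding zonal_density_def B_def[symmetric] using x by simp
      have ln4: "ln (4::real) = 2 * ln 2" using ln_realpow[of 2 2] by simp
      have ln: "ln (4 * x) = 2 * ln 2 + ln x" "ln (4 * x * (1 - x)) = 2 * ln 2 + ln x + ln (1 - x)"
        using x by (simp_all add: ln_mult ln4)
      have "(4 * x) powr (- (real n - \<alpha>) / 2) * (4 * x * (1 - x)) powr ((real n - 3) / 2) = 2 powr (\<alpha> - 3) * f x"
        unfolding f_def powr_def using x
        by (simp add: ln exp_add[symmetric]) (simp add: algebra_simps add_divide_distrib diff_divide_distrib)
      then have "(1 + 1\<^sup>2 - 2 * 1 * (1 + (-2) * x)) powr (- (real n - \<alpha>) / 2) * zonal_density n (1 + (-2) * x) = 2 powr (\<alpha> - 3) / B * f x"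
        unfolding z by simp
      then show ?thesis using True B zonal_density_nonneg[OF n] by (simp add: ennreal_mult'[symmetric])
    next
      case False
      then have "1 + (-2) * x \<notin> {-1<..<1}" by auto
      then have "zonal_density n (1 + (-2) * x) = 0" by (simp add: zonal_density_def)
      then show ?thesis using False by simp
    qed
  qed
  also have "\<dots> = ennreal 2 * (ennreal (2 powr (\<alpha> - 3) / B) * ennreal (Beta ((\<alpha> - 1) / 2) ((real n - 1) / 2)))"
    by (subst nn_integral_cmult) (auto simp: I)
  also have "\<dots> = ennreal (2 * (2 powr (\<alpha> - 3) / B * Beta ((\<alpha> - 1) / 2) ((real n - 1) / 2)))"
    using B Beta_pos[of "(\<alpha> - 1) / 2" "(real n - 1) / 2"] n a by (simp add: ennreal_mult'[symmetric] del: ennreal_numeral)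
  also have "2 * (2 powr (\<alpha> - 3) / B * Beta ((\<alpha> - 1) / 2) ((real n - 1) / 2)) = 2 powr (\<alpha> - 2) * Beta ((\<alpha> - 1) / 2) ((real n - 1) / 2) / B"
    using powr_add[of 2 1 "\<alpha> - 3"] by simp
  finally show ?thesis unfolding B_def .
qed

text \<open>Second-order Taylor bound for twice the even part of \<open>(1 + x) powr (- p)\<close>.
  It holds on the whole interval and not only near 0, because two differentiations lead to the
  Bernoulli inequality \<open>bern\<close> for the exponent \<open>p + 2\<close>: from
  \<open>bern\<close> follows \<open>odd\<close>, and from \<open>odd\<close> the monotonicity of
  \<psi>.\<close>

lemma sum_powr_minus_ge:
  fixes p x :: real
  assumes p: "p > 0" and x: "\<bar>x\<bar> < 1"
  shows "(1 + x) powr (- p) + (1 - x) powr (- p) \<ge> 2 + p * (p + 1) * x\<^sup>2"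
proof -
  have bern: "(1 + y) powr (- m) \<ge> 1 - m * y" if "\<bar>y\<bar> < 1" "m > 0" for m y :: real
  proof -
    have "1 - m * y \<le> 1 - m * ln (1 + y)"
      using ln_add_one_self_le_self2[of y] that by (simp add: abs_less_iff)
    also have "\<dots> \<le> exp (- m * ln (1 + y))" using exp_ge_add_one_self[of "- m * ln (1 + y)"] by simp
    also have "\<dots> = (1 + y) powr (- m)" using that by (simp add: powr_def abs_less_iff)
    finally show ?thesis .
  qed
  have odd: "(1 - y) powr (- m) - (1 + y) powr (- m) \<ge> 2 * m * y" if y: "0 \<le> y" "y < 1" and m: "m > 0" for m y :: real
  proof -
    define \<omega> where "\<omega> y = (1 - y) powr (- m) - (1 + y) powr (- m) - 2 * m * y" for y
    have "\<omega> 0 \<le> \<omega> y"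
    proof (rule DERIV_nonneg_imp_nondecreasing[OF y(1)])
      fix z assume z: "0 \<le> z" "z \<le> y"
      have "(\<omega> has_real_derivative (m * (1 - z) powr (- (m + 1)) + m * (1 + z) powr (- (m + 1)) - 2 * m)) (at z)"
        unfolding \<omega>_def[abs_def] using z y
        by (auto intro!: derivative_eq_intros)
      moreover have "m * (1 - z) powr (- (m + 1)) + m * (1 + z) powr (- (m + 1)) - 2 * m \<ge> 0"
      proof -
        have "(1 - z) powr (- (m + 1)) + (1 + z) powr (- (m + 1)) \<ge> 2"
          using bern[of "- z" "m + 1"] bern[of z "m + 1"] z y m by simp
        then have "m * ((1 - z) powr (- (m + 1)) + (1 + z) powr (- (m + 1))) \<ge> m * 2"
          using m by (intro mult_left_mono) auto
        then show ?thesis by (simp add: algebra_simps)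
      qed
      ultimately show "\<exists>D. (\<omega> has_real_derivative D) (at z) \<and> 0 \<le> D" by blast
    qed
    then show ?thesis by (simp add: \<omega>_def)
  qed
  define \<psi> where "\<psi> y = (1 + y) powr (- p) + (1 - y) powr (- p) - p * (p + 1) * y\<^sup>2" for y
  have "\<psi> 0 \<le> \<psi> y" if y: "0 \<le> y" "y < 1" for y
  proof (rule DERIV_nonneg_imp_nondecreasing[OF y(1)])
    fix z assume z: "0 \<le> z" "z \<le> y"
    have "(\<psi> has_real_derivative (p * ((1 - z) powr (- (p + 1)) - (1 + z) powr (- (p + 1)) - 2 * (p + 1) * z))) (at z)"
      unfolding \<psi>_def[abs_def] using z y
      by (auto intro!: derivative_eq_intros simp: right_diff_distrib)
    moreover have "p * ((1 - z) powr (- (p + 1)) - (1 + z) powr (- (p + 1)) - 2 * (p + 1) * z) \<ge> 0"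
      using odd[of z "p + 1"] z y p by simp
    ultimately show "\<exists>D. (\<psi> has_real_derivative D) (at z) \<and> 0 \<le> D" by blast
  qed
  from this[of "\<bar>x\<bar>"] x have "\<psi> 0 \<le> \<psi> \<bar>x\<bar>" by simp
  also have "\<psi> \<bar>x\<bar> = \<psi> x" unfolding \<psi>_def by (cases "x \<ge> 0") auto
  finally show ?thesis by (simp add: \<psi>_def)
qed

text \<open>\<open>|v|\<close> to a power \<open>- 2 p\<close> with \<open>2 p + 2 > n\<close> is strictly subharmonic; this is its discrete form.\<close>
lemma norm_powr_strict_submean:
  assumes p: "p > 0" "2 * p + 2 > real DIM('a::euclidean_space)"
  obtains \<delta> where "\<delta> > 0" "\<delta> \<le> 1"
    "\<And>(v::'a) h. v \<noteq> 0 \<Longrightarrow> 0 < h \<Longrightarrow> h < \<delta> * norm v \<Longrightarrow>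
       real (2 * DIM('a)) * norm v powr (- 2 * p) < (\<Sum>b\<in>Basis. norm (v + h *\<^sub>R b) powr (- 2 * p) + norm (v - h *\<^sub>R b) powr (- 2 * p))"
proof -
  define d where "d = real DIM('a)"
  have d: "d > 0" by (simp add: d_def)
  \<comment> \<open>Summing the second-order terms over all coordinate directions gives the
    coefficient \<open>c\<close> of \<open>s = h\<^sup>2 / q\<close>, against which the centre value
    has slope \<open>p\<close>. Thus \<open>c > p\<close>, that is \<open>2 * p + 2 > d\<close>,
    expresses that the Laplacian of the power is positive.\<close>
  define c where "c = 2 * p * (p + 1) / d"
  have c: "c > p"
  proof -
    have "p * d < p * (2 * p + 2)" using p by (intro mult_strict_left_mono) (auto simp: d_def)
    then show ?thesis using d unfolding c_def by (simp add: field_simps)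
  qed
  define \<phi> where "\<phi> s = 1 + c * (s / (1 + s)\<^sup>2) - (1 + s) powr p" for s :: real
  have "(\<phi> has_real_derivative (c - p)) (at 0)"
    unfolding \<phi>_def[abs_def] by (auto intro!: derivative_eq_intros)
  then obtain \<delta>0 where \<delta>0: "\<delta>0 > 0" "\<And>h. 0 < h \<Longrightarrow> h < \<delta>0 \<Longrightarrow> \<phi> 0 < \<phi> (0 + h)"
    using DERIV_pos_inc_right[of \<phi> "c - p" 0] c by auto
  \<comment> \<open>The bound \<open>sqrt \<delta>0\<close> makes \<open>h\<^sup>2 / q\<close>
    smaller than \<delta>0, and the bound 1 keeps \<open>h\<close> below \<open>norm v\<close>, so
    that every \<epsilon> is below 1 in modulus.\<close>
  define \<delta> where "\<delta> = min 1 (sqrt \<delta>0)"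
  show thesis
  proof
    show "\<delta> > 0" "\<delta> \<le> 1" using \<delta>0 by (auto simp: \<delta>_def)
    fix v :: 'a and h :: real assume v: "v \<noteq> 0" and h: "0 < h" "h < \<delta> * norm v"
    define q where "q = (norm v)\<^sup>2"
    define Q where "Q = q + h\<^sup>2"
    define s where "s = h\<^sup>2 / q"
    have q: "q > 0" using v by (simp add: q_def)
    have Q: "Q > 0" using q by (simp add: Q_def add_pos_nonneg)
    have s0: "s > 0" using h q by (simp add: s_def)
    have hv: "h < norm v" using h \<open>\<delta> \<le> 1\<close> mult_right_mono[of \<delta> 1 "norm v"] by simp
    have "h < sqrt \<delta>0 * norm v" using h(2) mult_right_mono[of \<delta> "sqrt \<delta>0" "norm v"] by (simp add: \<delta>_def)
    then have "h\<^sup>2 < (sqrt \<delta>0 * norm v)\<^sup>2" using h(1) by (intro power_strict_mono) auto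
    then have "s < \<delta>0" using \<delta>0(1) q by (simp add: s_def q_def power_mult_distrib field_simps)
    then have \<phi>s: "(1 + s) powr p < 1 + c * (s / (1 + s)\<^sup>2)" using \<delta>0(2)[OF s0] by (simp add: \<phi>_def)
    define \<epsilon> where "\<epsilon> b = 2 * h * (v \<bullet> b) / Q" for b
    have \<epsilon>: "\<bar>\<epsilon> b\<bar> < 1" if "b \<in> Basis" for b
    proof -
      have "0 < (norm v - h)\<^sup>2" using hv by simp
      then have "2 * h * norm v < Q" by (simp add: Q_def q_def power2_eq_square algebra_simps)
      moreover have "2 * h * \<bar>v \<bullet> b\<bar> \<le> 2 * h * norm v"
        using Basis_le_norm[OF that, of v] h by (intro mult_left_mono) auto
      ultimately have "2 * h * \<bar>v \<bullet> b\<bar> < Q" by (rule le_less_trans[rotated])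
      then show ?thesis using Q h by (simp add: \<epsilon>_def abs_mult)
    qed
    have nb: "norm (v + h *\<^sub>R b) powr (- 2 * p) = Q powr (- p) * (1 + \<epsilon> b) powr (- p)"
      "norm (v - h *\<^sub>R b) powr (- 2 * p) = Q powr (- p) * (1 - \<epsilon> b) powr (- p)" if b: "b \<in> Basis" for b
    proof -
      have gen: "norm w powr (- 2 * p) = Q powr (- p) * (1 + e) powr (- p)" if "(norm w)\<^sup>2 = Q * (1 + e)" "\<bar>e\<bar> < 1" for w :: 'a and e
      proof -
        have "norm w \<noteq> 0" using that Q by (auto simp: abs_less_iff)
        then have "norm w powr (- 2 * p) = ((norm w)\<^sup>2) powr (- p)"
          using powr_powr[of "norm w" 2 "- p"] by simp
        also have "\<dots> = Q powr (- p) * (1 + e) powr (- p)"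
          unfolding that(1) using Q that(2) by (simp add: powr_mult abs_less_iff)
        finally show ?thesis .
      qed
      have "(norm (v + h *\<^sub>R b))\<^sup>2 = Q * (1 + \<epsilon> b)"
      proof -
        have "Q * (1 + \<epsilon> b) = Q + 2 * h * (v \<bullet> b)" using Q by (simp add: \<epsilon>_def distrib_left)
        also have "\<dots> = (norm (v + h *\<^sub>R b))\<^sup>2"
          unfolding Q_def q_def power2_norm_eq_inner using b
          by (simp add: inner_add_left inner_add_right inner_commute[of b v] power2_eq_square algebra_simps)
        finally show ?thesis ..
      qed
      from gen[OF this \<epsilon>[OF b]] show "norm (v + h *\<^sub>R b) powr (- 2 * p) = Q powr (- p) * (1 + \<epsilon> b) powr (- p)" .
      have "(norm (v - h *\<^sub>R b))\<^sup>2 = Q * (1 + (- \<epsilon> b))"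
      proof -
        have "Q * (1 + (- \<epsilon> b)) = Q - 2 * h * (v \<bullet> b)" using Q by (simp add: \<epsilon>_def right_diff_distrib)
        also have "\<dots> = (norm (v - h *\<^sub>R b))\<^sup>2"
          unfolding Q_def q_def power2_norm_eq_inner using b
          by (simp add: inner_diff_left inner_diff_right inner_commute[of b v] power2_eq_square algebra_simps)
        finally show ?thesis ..
      qed
      from gen[OF this] \<epsilon>[OF b] show "norm (v - h *\<^sub>R b) powr (- 2 * p) = Q powr (- p) * (1 - \<epsilon> b) powr (- p)" by simp
    qed
    have sum\<epsilon>: "(\<Sum>b\<in>(Basis::'a set). (\<epsilon> b)\<^sup>2) = 4 * h\<^sup>2 * q / Q\<^sup>2"
    proof -
      have "(\<Sum>b\<in>(Basis::'a set). (\<epsilon> b)\<^sup>2) = 4 * h\<^sup>2 / Q\<^sup>2 * (\<Sum>b\<in>(Basis::'a set). (v \<bullet> b)\<^sup>2)"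
        unfolding \<epsilon>_def sum_distrib_left by (intro sum.cong) (auto simp: power2_eq_square)
      also have "(\<Sum>b\<in>(Basis::'a set). (v \<bullet> b)\<^sup>2) = q"
        unfolding q_def power2_norm_eq_inner euclidean_inner[of v v] by (simp add: power2_eq_square)
      finally show ?thesis by simp
    qed
    have "real (2 * DIM('a)) * norm v powr (- 2 * p) = 2 * d * (Q powr (- p) * (1 + s) powr p)"
    proof -
      have "norm v powr (- 2 * p) = q powr (- p)"
        unfolding q_def using v powr_powr[of "norm v" 2 "- p"] by simp
      also have "q = Q / (1 + s)"
      proof -
        have "Q = q * (1 + s)" using q by (simp add: Q_def s_def distrib_left)
        then show ?thesis using s0 by simp
      qed
      also have "(Q / (1 + s)) powr (- p) = Q powr (- p) * (1 + s) powr p"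
        using Q s0 by (simp add: powr_divide powr_minus_divide)
      finally show ?thesis by (simp add: d_def)
    qed
    also have "\<dots> < 2 * d * (Q powr (- p) * (1 + c * (s / (1 + s)\<^sup>2)))"
      using \<phi>s d Q by simp
    also have "\<dots> = Q powr (- p) * (\<Sum>b\<in>(Basis::'a set). 2 + p * (p + 1) * (\<epsilon> b)\<^sup>2)"
    proof -
      have "(\<Sum>b\<in>(Basis::'a set). 2 + p * (p + 1) * (\<epsilon> b)\<^sup>2) = 2 * d + p * (p + 1) * (4 * h\<^sup>2 * q / Q\<^sup>2)"
        unfolding sum.distrib sum_distrib_left[symmetric] sum\<epsilon> by (simp add: d_def)
      also have "4 * h\<^sup>2 * q / Q\<^sup>2 = 4 * (s / (1 + s)\<^sup>2)"
      proof -
        have "Q = q * (1 + s)" "h\<^sup>2 = q * s" using q by (auto simp: Q_def s_def field_simps)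
        then show ?thesis using q by (simp add: power2_eq_square)
      qed
      finally have *: "(\<Sum>b\<in>(Basis::'a set). 2 + p * (p + 1) * (\<epsilon> b)\<^sup>2) = 2 * d * (1 + c * (s / (1 + s)\<^sup>2))"
        using d by (simp add: c_def distrib_left)
      show ?thesis unfolding * by simp
    qed
    also have "\<dots> \<le> Q powr (- p) * (\<Sum>b\<in>(Basis::'a set). (1 + \<epsilon> b) powr (- p) + (1 - \<epsilon> b) powr (- p))"
      by (intro mult_left_mono sum_mono sum_powr_minus_ge p \<epsilon>) auto
    also have "\<dots> = (\<Sum>b\<in>Basis. norm (v + h *\<^sub>R b) powr (- 2 * p) + norm (v - h *\<^sub>R b) powr (- 2 * p))"
      unfolding sum_distrib_left by (intro sum.cong refl) (simp only: nb distrib_left)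
    finally show "real (2 * DIM('a)) * norm v powr (- 2 * p) < (\<Sum>b\<in>Basis. norm (v + h *\<^sub>R b) powr (- 2 * p) + norm (v - h *\<^sub>R b) powr (- 2 * p))" .
  qed
qed

section \<open>The radial profile of the potential and the mass of the Poisson kernel\<close>

definition riesz_profile :: "nat \<Rightarrow> real \<Rightarrow> real \<Rightarrow> real" where
  "riesz_profile n \<alpha> r = (\<integral>t. (1 + r\<^sup>2 - 2 * r * t) powr (- (real n - \<alpha>) / 2) * zonal_density n t \<partial>lborel)"

context
  fixes \<alpha> :: real and n :: nat
  assumes n: "n \<ge> 2" and \<alpha>: "1 < \<alpha>" "\<alpha> < 2"
begin

text \<open>The majorant is a multiple of the integrand at \<open>r = 1\<close>, whose integral is
  the Beta value of \<open>zonal_riesz_one\<close>. Dominated convergence therefore works up to and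
  across the sphere.\<close>

lemma riesz_profile_dominated:
  "integrable lborel (\<lambda>t. ((1 - t) / 2) powr (- (real n - \<alpha>) / 2) * zonal_density n t)"
proof (rule integrableI_nonneg)
  have "(\<integral>\<^sup>+t. ennreal (((1 - t) / 2) powr (- (real n - \<alpha>) / 2) * zonal_density n t) \<partial>lborel)
    = (\<integral>\<^sup>+t. ennreal (4 powr ((real n - \<alpha>) / 2)) * (ennreal ((1 + 1\<^sup>2 - 2 * 1 * t) powr (- (real n - \<alpha>) / 2)) * ennreal (zonal_density n t)) \<partial>lborel)"
  proof (intro nn_integral_cong)
    fix t :: real
    have "((1 - t) / 2) powr (- (real n - \<alpha>) / 2) = 4 powr ((real n - \<alpha>) / 2) * (1 + 1\<^sup>2 - 2 * 1 * t) powr (- (real n - \<alpha>) / 2)" if "t < 1"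
    proof -
      have "(1 - t) / 2 = (1 + 1\<^sup>2 - 2 * 1 * t) / 4" by (simp add: field_simps)
      then have "((1 - t) / 2) powr (- (real n - \<alpha>) / 2) = (1 + 1\<^sup>2 - 2 * 1 * t) powr (- (real n - \<alpha>) / 2) / 4 powr (- (real n - \<alpha>) / 2)"
        using that by (simp only:) (subst powr_divide; simp)
      moreover have "(4::real) powr ((real n - \<alpha>) / 2) = 1 / 4 powr (- (real n - \<alpha>) / 2)"
        unfolding minus_divide_left[symmetric] by (simp only: powr_minus inverse_eq_divide) (simp only: div_by_1 divide_divide_eq_right mult_1)
      ultimately show ?thesis by (simp only: times_divide_eq_left mult_1)
    qed
    moreover have "zonal_density n t = 0" if "\<not> t < 1" using that by (simp add: zonal_density_def)
    ultimately show "ennreal (((1 - t) / 2) powr (- (real n - \<alpha>) / 2) * zonal_density n t) = ennreal (4 powr ((real n - \<alpha>) / 2)) * (ennreal ((1 + 1\<^sup>2 - 2 * 1 * t) powr (- (real n - \<alpha>) / 2)) * ennreal (zonal_density n t))"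
      using zonal_density_nonneg[OF n] by (cases "t < 1") (auto simp: ennreal_mult'[symmetric] mult_ac)
  qed
  also have "\<dots> = ennreal (4 powr ((real n - \<alpha>) / 2)) * zonal_riesz n (real n - \<alpha>) 1"
    unfolding zonal_riesz_def by (rule nn_integral_cmult) measurable
  also have "\<dots> < \<infinity>" unfolding zonal_riesz_one[OF n \<alpha>(1)] by (simp add: ennreal_mult_less_top)
  finally show "(\<integral>\<^sup>+t. ennreal (((1 - t) / 2) powr (- (real n - \<alpha>) / 2) * zonal_density n t) \<partial>lborel) < \<infinity>" .
qed (auto simp: zonal_density_nonneg[OF n])

lemma riesz_profile_bound:
  assumes "r \<ge> 0"
  shows "(1 + r\<^sup>2 - 2 * r * t) powr (- (real n - \<alpha>) / 2) * zonal_density n t \<le> ((1 - t) / 2) powr (- (real n - \<alpha>) / 2) * zonal_density n t"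
proof (cases "t \<in> {-1<..<1}")
  case True
  then have "(1 - t) / 2 \<le> 1 + r\<^sup>2 - 2 * r * t" by (intro zonal_quadratic_ge assms) (auto simp: abs_le_iff)
  then show ?thesis
    using True n \<alpha> zonal_density_nonneg[OF n] by (intro mult_right_mono powr_mono2') (auto simp: field_simps)
qed (auto simp: zonal_density_def)

lemma riesz_profile_norm_bound:
  assumes "r \<ge> 0"
  shows "norm ((1 + r\<^sup>2 - 2 * r * t) powr (- (real n - \<alpha>) / 2) * zonal_density n t) \<le> ((1 - t) / 2) powr (- (real n - \<alpha>) / 2) * zonal_density n t"
  unfolding real_norm_def
  by (subst abs_of_nonneg) (rule mult_nonneg_nonneg[OF powr_ge_zero zonal_density_nonneg[OF n]], rule riesz_profile_bound[OF assms])

lemma riesz_profile_integrable: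
  assumes "r \<ge> 0"
  shows "integrable lborel (\<lambda>t. (1 + r\<^sup>2 - 2 * r * t) powr (- (real n - \<alpha>) / 2) * zonal_density n t)"
  by (rule Bochner_Integration.integrable_bound[OF riesz_profile_dominated])
    (measurable, intro AE_I2 order.trans[OF riesz_profile_norm_bound[OF assms]], simp)

lemma riesz_profile_nonneg: "riesz_profile n \<alpha> r \<ge> 0"
  unfolding riesz_profile_def by (intro Bochner_Integration.integral_nonneg) (auto simp: zonal_density_nonneg[OF n])

lemma zonal_riesz_profile:
  assumes "r \<ge> 0"
  shows "zonal_riesz n (real n - \<alpha>) r = ennreal (riesz_profile n \<alpha> r)"
  unfolding riesz_profile_def zonal_riesz_def
  by (subst nn_integral_eq_integral[OF riesz_profile_integrable[OF assms], symmetric])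
    (auto simp: zonal_density_nonneg[OF n] ennreal_mult)

lemma riesz_profile_continuous: "continuous_on {0..} (riesz_profile n \<alpha>)"
  unfolding continuous_on_sequentially
proof (intro allI ballI impI, elim conjE)
  fix x :: "nat \<Rightarrow> real" and a assume a: "a \<in> {0..}" and x: "\<forall>k. x k \<in> {0..}" and lim: "x \<longlonglongrightarrow> a"
  show "(riesz_profile n \<alpha> \<circ> x) \<longlonglongrightarrow> riesz_profile n \<alpha> a"
    unfolding o_def riesz_profile_def
  proof (rule integral_dominated_convergence[where w="\<lambda>t. ((1 - t) / 2) powr (- (real n - \<alpha>) / 2) * zonal_density n t"])
    show "AE t in lborel. (\<lambda>i. (1 + (x i)\<^sup>2 - 2 * x i * t) powr (- (real n - \<alpha>) / 2) * zonal_density n t) \<longlonglongrightarrow> (1 + a\<^sup>2 - 2 * a * t) powr (- (real n - \<alpha>) / 2) * zonal_density n t"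
    proof (rule AE_I2)
      fix t :: real
      show "(\<lambda>i. (1 + (x i)\<^sup>2 - 2 * x i * t) powr (- (real n - \<alpha>) / 2) * zonal_density n t) \<longlonglongrightarrow> (1 + a\<^sup>2 - 2 * a * t) powr (- (real n - \<alpha>) / 2) * zonal_density n t"
      proof (cases "t \<in> {-1<..<1}")
        case True
        then have "(1 - t) / 2 \<le> 1 + a\<^sup>2 - 2 * a * t" using a by (intro zonal_quadratic_ge) (auto simp: abs_le_iff)
        then have "1 + a\<^sup>2 - 2 * a * t \<noteq> 0" using True by (auto simp: field_simps)
        then show ?thesis by (intro tendsto_intros lim) auto
      qed (simp add: zonal_density_def)
    qed
    show "integrable lborel (\<lambda>t. ((1 - t) / 2) powr (- (real n - \<alpha>) / 2) * zonal_density n t)"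
      by (rule riesz_profile_dominated)
    show "AE t in lborel. norm ((1 + (x i)\<^sup>2 - 2 * x i * t) powr (- (real n - \<alpha>) / 2) * zonal_density n t) \<le> ((1 - t) / 2) powr (- (real n - \<alpha>) / 2) * zonal_density n t" for i
      using x by (intro AE_I2 riesz_profile_norm_bound) auto
  qed measurable
qed

end

definition sphere_riesz :: "real \<Rightarrow> 'a::euclidean_space \<Rightarrow> real" where
  "sphere_riesz \<alpha> x = (\<integral>y. norm (x - y) powr (\<alpha> - real DIM('a)) \<partial>sphere_sigma)"

lemma sphere_riesz_measurable [measurable]: "sphere_riesz \<alpha> \<in> borel_measurable borel"
proof -
  interpret prob_space "sphere_sigma :: 'a measure" by (rule prob_space_sphere_sigma)
  show ?thesis unfolding sphere_riesz_def by measurable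
qed

lemma ex_unit_vector: "\<exists>e::'a::euclidean_space. norm e = 1 \<and> x = norm x *\<^sub>R e"
proof (cases "x = 0")
  case True
  obtain b :: 'a where "b \<in> Basis" using nonempty_Basis by blast
  then show ?thesis using True by (intro exI[of _ b]) auto
next
  case False
  then show ?thesis by (intro exI[of _ "x /\<^sub>R norm x"]) auto
qed

definition kappa :: "nat \<Rightarrow> real \<Rightarrow> real" where
  "kappa n \<alpha> = C2 n \<alpha> / Gamma (real n / 2)"

text \<open>For \<open>r \<noteq> 1\<close> this is the mass of the Poisson kernel, see
  \<open>PD_kernel_nn\<close>. The form through the profile also makes sense at
  \<open>r = 1\<close>, where the factor in front of the kernel vanishes and the integral of the
  distance power diverges, and it shows continuity there.\<close>

definition theta :: "nat \<Rightarrow> real \<Rightarrow> real \<Rightarrow> real" where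
  "theta n \<alpha> r = kappa n \<alpha> * riesz_profile n \<alpha> r"

locale stable_index =
  fixes \<alpha> :: real and dim :: "'a::euclidean_space itself"
  assumes dim: "DIM('a) \<ge> 2" and \<alpha>: "1 < \<alpha>" "\<alpha> < 2"
begin

lemma sphere_riesz_nn:
  "(\<integral>\<^sup>+y. ennreal (norm (x - y) powr (\<alpha> - real DIM('a))) \<partial>sphere_sigma) = ennreal (riesz_profile DIM('a) \<alpha> (norm (x::'a)))"
proof -
  obtain e :: 'a where e: "norm e = 1" "x = norm x *\<^sub>R e" using ex_unit_vector by blast
  have "(\<integral>\<^sup>+y. ennreal (norm (norm x *\<^sub>R e - y) powr (- (real DIM('a) - \<alpha>))) \<partial>sphere_sigma) = ennreal (riesz_profile DIM('a) \<alpha> (norm x))"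
    using nn_integral_sphere_riesz[OF dim e(1), of "norm x" "real DIM('a) - \<alpha>"] zonal_riesz_profile[OF dim \<alpha>, of "norm x"] by simp
  then show ?thesis using e(2)[symmetric] by simp
qed

lemma sphere_riesz_integrable: "integrable sphere_sigma (\<lambda>y::'a. norm (x - y) powr (\<alpha> - real DIM('a)))"
  by (rule integrableI_nonneg) (auto simp: sphere_riesz_nn)

lemma sphere_riesz_profile: "sphere_riesz \<alpha> (x::'a) = riesz_profile DIM('a) \<alpha> (norm x)"
  unfolding sphere_riesz_def
  using sphere_riesz_nn[of x] riesz_profile_nonneg[OF dim \<alpha>]
  by (subst integral_eq_nn_integral) auto

text \<open>Kelvin symmetry: for unit vectors the distance from \<open>r *\<^sub>R e\<close> to
  \<open>y\<close> is \<open>r\<close> times that from \<open>e /\<^sub>R r\<close> to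
  \<open>y\<close>. It carries bounds from the ball to its exterior and gives the decay at
  infinity.\<close>

lemma profile_inverse:
  assumes "r > 0"
  shows "riesz_profile DIM('a) \<alpha> r = r powr (\<alpha> - real DIM('a)) * riesz_profile DIM('a) \<alpha> (1 / r)"
proof -
  have "(1 + r\<^sup>2 - 2 * r * t) powr (- (real DIM('a) - \<alpha>) / 2) * zonal_density DIM('a) t
    = r powr (\<alpha> - real DIM('a)) * ((1 + (1 / r)\<^sup>2 - 2 * (1 / r) * t) powr (- (real DIM('a) - \<alpha>) / 2) * zonal_density DIM('a) t)" for t
  proof (cases "t \<in> {-1<..<1}")
    case True
    have pos: "1 + (1 / r)\<^sup>2 - 2 * (1 / r) * t > 0"
      using True assms by (intro less_le_trans[OF _ zonal_quadratic_ge]) (auto simp: abs_le_iff)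
    have "1 + r\<^sup>2 - 2 * r * t = r\<^sup>2 * (1 + (1 / r)\<^sup>2 - 2 * (1 / r) * t)"
      using assms by (simp add: field_simps power2_eq_square)
    then have "(1 + r\<^sup>2 - 2 * r * t) powr (- (real DIM('a) - \<alpha>) / 2) = (r\<^sup>2) powr (- (real DIM('a) - \<alpha>) / 2) * (1 + (1 / r)\<^sup>2 - 2 * (1 / r) * t) powr (- (real DIM('a) - \<alpha>) / 2)"
      using pos by (simp only:) (subst powr_mult; simp)
    also have "(r\<^sup>2) powr (- (real DIM('a) - \<alpha>) / 2) = r powr (\<alpha> - real DIM('a))"
      using powr_powr[of r 2 "- (real DIM('a) - \<alpha>) / 2"] assms by (simp add: diff_divide_distrib)
    finally show ?thesis by simp
  qed (simp add: zonal_density_def)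
  then show ?thesis
    unfolding riesz_profile_def by (simp only:) (rule integral_mult_right_zero)
qed

text \<open>Maximum principle: the potential of the sphere is strictly subharmonic in the open ball.\<close>
lemma profile_le_profile_one:
  assumes "r \<ge> 0"
  shows "riesz_profile DIM('a) \<alpha> r \<le> riesz_profile DIM('a) \<alpha> 1"
proof -
  have cont: "continuous_on {0..1} (riesz_profile DIM('a) \<alpha>)"
    by (rule continuous_on_subset[OF riesz_profile_continuous[OF dim \<alpha>]]) auto
  obtain r0 where r0: "r0 \<in> {0..1}" "\<And>s. s \<in> {0..1} \<Longrightarrow> riesz_profile DIM('a) \<alpha> s \<le> riesz_profile DIM('a) \<alpha> r0"
    using continuous_attains_sup[OF compact_Icc _ cont] by fastforce
  have "r0 = 1"
  proof (rule ccontr)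
    assume "r0 \<noteq> 1"
    then have r01: "0 \<le> r0" "r0 < 1" using r0 by auto
    \<comment> \<open>At an interior maximum the mean over the \<open>2 * DIM('a)\<close> neighbours
      cannot exceed the value. Here \<open>2 * p + 2 = DIM('a) - \<alpha> + 2\<close>, so \<alpha> <
      2 is what makes the power strictly subharmonic and gives the contradiction.\<close>
    define p where "p = (real DIM('a) - \<alpha>) / 2"
    have p: "p > 0" "2 * p + 2 > real DIM('a)" using dim \<alpha> by (auto simp: p_def field_simps)
    have pe: "- 2 * p = \<alpha> - real DIM('a)" by (simp add: p_def)
    obtain \<delta> where \<delta>: "\<delta> > 0" "\<delta> \<le> 1"
      "\<And>(v::'a) h. v \<noteq> 0 \<Longrightarrow> 0 < h \<Longrightarrow> h < \<delta> * norm v \<Longrightarrow>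
       real (2 * DIM('a)) * norm v powr (- 2 * p) < (\<Sum>b\<in>Basis. norm (v + h *\<^sub>R b) powr (- 2 * p) + norm (v - h *\<^sub>R b) powr (- 2 * p))"
      using norm_powr_strict_submean[where 'a='a, OF p] by blast
    obtain e :: 'a where e: "norm e = 1" using vector_choose_size[of 1] by auto
    define x where "x = r0 *\<^sub>R e"
    have x: "norm x = r0" using e r01 by (simp add: x_def)
    \<comment> \<open>Every point of the sphere is at distance at least \<open>1 - r0\<close> from
      \<open>x\<close>, so this step size is admissible for all \<open>y\<close> at once; moreover
      the neighbours of \<open>x\<close> stay in the unit ball.\<close>
    define h where "h = \<delta> * (1 - r0) / 2"
    have h: "0 < h" "h < \<delta> * (1 - r0)" "h < 1 - r0"
      using \<delta> r01 mult_right_mono[of \<delta> 1 "1 - r0"] by (auto simp: h_def field_simps)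
    define L where "L y = real (2 * DIM('a)) * norm (x - y) powr (\<alpha> - real DIM('a))" for y
    define Rr where "Rr y = (\<Sum>b\<in>Basis. norm ((x + h *\<^sub>R b) - y) powr (\<alpha> - real DIM('a)) + norm ((x - h *\<^sub>R b) - y) powr (\<alpha> - real DIM('a)))" for y
    interpret \<sigma>: prob_space "sphere_sigma :: 'a measure" by (rule prob_space_sphere_sigma)
    have iL: "integrable sphere_sigma L" unfolding L_def by (intro integrable_mult_right sphere_riesz_integrable)
    have iR: "integrable sphere_sigma Rr" unfolding Rr_def
      by (intro Bochner_Integration.integrable_sum Bochner_Integration.integrable_add sphere_riesz_integrable)
    have less: "AE y in sphere_sigma. L y < Rr y"
      using AE_sphere_sigma[where 'a='a]
    proof eventually_elim
      case (elim y)
      have v: "1 - r0 \<le> norm (x - y)" using norm_triangle_ineq2[of y x] elim x by (simp add: norm_minus_commute)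
      have "h < \<delta> * norm (x - y)" using h(2) mult_left_mono[OF v, of \<delta>] \<delta>(1) by linarith
      moreover have "x - y \<noteq> 0" using v r01 by auto
      ultimately show ?case
        using \<delta>(3)[of "x - y" h] h(1) unfolding L_def Rr_def pe by (simp add: algebra_simps)
    qed
    have "integral\<^sup>L sphere_sigma L < integral\<^sup>L sphere_sigma Rr"
      by (rule \<sigma>.integral_less_AE_space[OF iL iR less]) (simp add: \<sigma>.emeasure_space_1[simplified])
    also have "integral\<^sup>L sphere_sigma Rr = (\<Sum>b\<in>Basis. riesz_profile DIM('a) \<alpha> (norm (x + h *\<^sub>R b)) + riesz_profile DIM('a) \<alpha> (norm (x - h *\<^sub>R b)))"
      unfolding Rr_def by (subst Bochner_Integration.integral_sum)
       (auto simp: sphere_riesz_integrable sphere_riesz_profile[symmetric] sphere_riesz_def)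
    also have "\<dots> \<le> (\<Sum>b\<in>(Basis::'a set). riesz_profile DIM('a) \<alpha> r0 + riesz_profile DIM('a) \<alpha> r0)"
    proof (intro sum_mono add_mono r0(2))
      fix b :: 'a assume b: "b \<in> Basis"
      show "norm (x + h *\<^sub>R b) \<in> {0..1}" "norm (x - h *\<^sub>R b) \<in> {0..1}"
        using norm_triangle_ineq[of x "h *\<^sub>R b"] norm_triangle_ineq4[of x "h *\<^sub>R b"] x h b by auto
    qed
    also have "\<dots> = integral\<^sup>L sphere_sigma L"
      unfolding L_def using sphere_riesz_profile[of x] x by (simp add: sphere_riesz_def)
    finally show False by simp
  qed
  then have le1: "riesz_profile DIM('a) \<alpha> s \<le> riesz_profile DIM('a) \<alpha> 1" if "s \<in> {0..1}" for s using r0(2)[OF that] by simp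
  show ?thesis
  proof (cases "r \<le> 1")
    case True
    then show ?thesis using le1[of r] assms by simp
  next
    case False
    then have "riesz_profile DIM('a) \<alpha> r = r powr (\<alpha> - real DIM('a)) * riesz_profile DIM('a) \<alpha> (1 / r)" by (intro profile_inverse) auto
    also have "\<dots> \<le> 1 * riesz_profile DIM('a) \<alpha> (1 / r)"
      using False dim \<alpha> powr_mono[of "\<alpha> - real DIM('a)" 0 r]
      by (intro mult_right_mono riesz_profile_nonneg[OF dim \<alpha>]) auto
    also have "\<dots> \<le> riesz_profile DIM('a) \<alpha> 1" using False by (simp add: le1)
    finally show ?thesis .
  qed
qed

lemma kappa_pos: "kappa DIM('a) \<alpha> > 0"
  unfolding kappa_def C2_def using dim \<alpha>
  by (intro divide_pos_pos mult_pos_pos Gamma_real_pos) (auto simp: field_simps)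

text \<open>The origin of \<open>C2\<close>: divided by \<open>Gamma (d / 2)\<close> it is the
  reciprocal of the value of the potential on the sphere, so that \<theta> is 1 there.\<close>

lemma kappa_profile_one: "kappa DIM('a) \<alpha> * riesz_profile DIM('a) \<alpha> 1 = 1"
proof -
  have "ennreal (riesz_profile DIM('a) \<alpha> 1) = ennreal (2 powr (\<alpha> - 2) * Beta ((\<alpha> - 1) / 2) ((real DIM('a) - 1) / 2) / Beta (1/2) ((real DIM('a) - 1) / 2))"
    using zonal_riesz_profile[OF dim \<alpha>, of 1] zonal_riesz_one[OF dim \<alpha>(1)] by simp
  then have p: "riesz_profile DIM('a) \<alpha> 1 = 2 powr (\<alpha> - 2) * Beta ((\<alpha> - 1) / 2) ((real DIM('a) - 1) / 2) / Beta (1/2) ((real DIM('a) - 1) / 2)"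
    using Beta_pos[of "(\<alpha> - 1) / 2" "(real DIM('a) - 1) / 2"] Beta_pos[of "1/2" "(real DIM('a) - 1) / 2"] dim \<alpha>
    by (subst (asm) ennreal_inj) (auto simp: riesz_profile_nonneg[OF dim \<alpha>])
  have e: "(\<alpha> - 1) / 2 + (real DIM('a) - 1) / 2 = (\<alpha> + real DIM('a)) / 2 - 1" "1 / 2 + (real DIM('a) - 1) / 2 = real DIM('a) / 2"
    by (auto simp: field_simps)
  define g1 g2 g3 g4 where g: "g1 = Gamma ((\<alpha> - 1) / 2)" "g2 = Gamma ((real DIM('a) - 1) / 2)"
    "g3 = Gamma ((\<alpha> + real DIM('a)) / 2 - 1)" "g4 = Gamma (real DIM('a) / 2)"
  have "g1 > 0" "g2 > 0" "g3 > 0" "g4 > 0"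
    unfolding g using dim \<alpha> by (auto intro!: Gamma_real_pos simp: field_simps)
  moreover have "2 powr (2 - \<alpha>) * 2 powr (\<alpha> - 2) = (1::real)" by (simp add: powr_add[symmetric])
  ultimately show ?thesis
    unfolding p kappa_def C2_def Beta_def e Gamma_one_half_real g[symmetric] by (simp add: field_simps)
qed

text \<open>Inversion pairs the exponent \<open>d - \<alpha>\<close> of the potential with
  \<open>2 * (d - 1) - (d - \<alpha>) = d + \<alpha> - 2\<close>, and the factor it produces is
  \<open>\<bar>1 - r\<^sup>2\<bar> powr (\<alpha> - 1)\<close>: these are the exponents of the
  Poisson kernel.\<close>

lemma PD_kernel_nn:
  assumes x: "norm (x::'a) \<noteq> 1"
  shows "(\<integral>\<^sup>+y. ennreal (PD_kernel \<alpha> x y) \<partial>sphere_sigma) = ennreal (kappa DIM('a) \<alpha> * riesz_profile DIM('a) \<alpha> (norm x))"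
proof -
  obtain e :: 'a where e: "norm e = 1" "x = norm x *\<^sub>R e" using ex_unit_vector by blast
  define r where "r = norm x"
  have inv: "zonal_riesz DIM('a) (real DIM('a) - \<alpha>) r = ennreal (\<bar>1 - r\<^sup>2\<bar> powr (\<alpha> - 1)) * zonal_riesz DIM('a) (real DIM('a) + \<alpha> - 2) r"
    using zonal_riesz_inversion[OF dim, of r "real DIM('a) - \<alpha>"] x by (simp add: r_def algebra_simps)
  have "(\<integral>\<^sup>+y. ennreal (PD_kernel \<alpha> x y) \<partial>sphere_sigma)
    = (\<integral>\<^sup>+y. ennreal (kappa DIM('a) \<alpha> * \<bar>1 - r\<^sup>2\<bar> powr (\<alpha> - 1)) * ennreal (norm (r *\<^sub>R e - y) powr (- (real DIM('a) + \<alpha> - 2))) \<partial>sphere_sigma)"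
  proof (rule nn_integral_cong)
    fix y :: 'a
    have "PD_kernel \<alpha> x y = kappa DIM('a) \<alpha> * \<bar>1 - r\<^sup>2\<bar> powr (\<alpha> - 1) * norm (r *\<^sub>R e - y) powr (- (real DIM('a) + \<alpha> - 2))"
      unfolding PD_kernel_def kappa_def[symmetric] powr_minus r_def e(2)[symmetric]
      by (simp add: divide_inverse abs_minus_commute)
    then show "ennreal (PD_kernel \<alpha> x y) = ennreal (kappa DIM('a) \<alpha> * \<bar>1 - r\<^sup>2\<bar> powr (\<alpha> - 1)) * ennreal (norm (r *\<^sub>R e - y) powr (- (real DIM('a) + \<alpha> - 2)))"
      using kappa_pos by (simp only: ennreal_mult'') (simp add: ennreal_mult''[symmetric])
  qed
  also have "\<dots> = ennreal (kappa DIM('a) \<alpha> * \<bar>1 - r\<^sup>2\<bar> powr (\<alpha> - 1)) * zonal_riesz DIM('a) (real DIM('a) + \<alpha> - 2) r"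
    by (subst nn_integral_cmult, measurable, simp only: nn_integral_sphere_riesz[OF dim e(1)])
  also have "\<dots> = ennreal (kappa DIM('a) \<alpha>) * zonal_riesz DIM('a) (real DIM('a) - \<alpha>) r"
    unfolding inv using kappa_pos by (simp add: ennreal_mult' mult.assoc)
  also have "\<dots> = ennreal (kappa DIM('a) \<alpha> * riesz_profile DIM('a) \<alpha> (norm x))"
    using zonal_riesz_profile[OF dim \<alpha>, of r] kappa_pos by (simp add: r_def ennreal_mult')
  finally show ?thesis .
qed

lemma theta_nonneg: "theta DIM('a) \<alpha> r \<ge> 0"
  unfolding theta_def using kappa_pos riesz_profile_nonneg[OF dim \<alpha>] by simp

lemma theta_le_one: "r \<ge> 0 \<Longrightarrow> theta DIM('a) \<alpha> r \<le> 1"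
  unfolding theta_def using kappa_pos kappa_profile_one
    mult_left_mono[OF profile_le_profile_one, of r "kappa DIM('a) \<alpha>"] by simp

lemma theta_tendsto_one: "(theta DIM('a) \<alpha> \<longlongrightarrow> 1) (at 1)"
proof -
  have "isCont (riesz_profile DIM('a) \<alpha>) 1"
    using riesz_profile_continuous[OF dim \<alpha>] by (rule continuous_on_interior) auto
  then have "((riesz_profile DIM('a) \<alpha>) \<longlongrightarrow> riesz_profile DIM('a) \<alpha> 1) (at 1)" by (simp add: isCont_def)
  then have "((\<lambda>r. kappa DIM('a) \<alpha> * riesz_profile DIM('a) \<alpha> r) \<longlongrightarrow> kappa DIM('a) \<alpha> * riesz_profile DIM('a) \<alpha> 1) (at 1)" by (rule tendsto_mult_left)
  then show ?thesis unfolding kappa_profile_one theta_def[abs_def] .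
qed

end

section \<open>Subordination\<close>

text \<open>Fubini: a random shift multiplies the Fourier density by the characteristic function. As
  the latter is real, no sine terms appear. Gaussian smoothing and the increments of the process are
  both treated by this one computation.\<close>

lemma fourier_average:
  fixes D :: "'w \<Rightarrow> 'a::euclidean_space" and m :: "'a \<Rightarrow> real"
  assumes M: "prob_space M" and D[measurable]: "D \<in> borel_measurable M"
    and char: "\<And>\<xi>. (\<integral>w. cis (\<xi> \<bullet> D w) \<partial>M) = complex_of_real (\<phi> \<xi>)"
    and m: "integrable lborel m"
  shows "(\<integral>w. (\<integral>\<xi>. cos (\<xi> \<bullet> (v + D w)) * m \<xi> \<partial>lborel) \<partial>M) = (\<integral>\<xi>. cos (\<xi> \<bullet> v) * (\<phi> \<xi> * m \<xi>) \<partial>lborel)"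
proof -
  interpret prob_space M by fact
  interpret P: pair_sigma_finite M "lborel :: 'a measure" ..
  have [measurable]: "m \<in> borel_measurable borel" using m by simp
  define f where "f w \<xi> = cos (\<xi> \<bullet> (v + D w)) * m \<xi>" for w \<xi>
  have [measurable]: "case_prod f \<in> borel_measurable (M \<Otimes>\<^sub>M lborel)" unfolding f_def by measurable
  have fb: "norm (f w \<xi>) \<le> norm (m \<xi>)" for w \<xi>
    unfolding f_def by (simp add: abs_mult mult_left_le_one_le)
  have i2: "integrable lborel (f w)" for w
  proof (rule Bochner_Integration.integrable_bound[OF m])
    show "f w \<in> borel_measurable lborel" unfolding f_def by measurable
  qed (use fb in auto)
  have "integrable (M \<Otimes>\<^sub>M lborel) (case_prod f)"
  proof (rule P.Fubini_integrable)
    show "integrable M (\<lambda>w. \<integral>\<xi>. norm (case_prod f (w, \<xi>)) \<partial>lborel)"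
    proof (rule integrable_const_bound[of _ "\<integral>\<xi>. norm (m \<xi>) \<partial>lborel"])
      show "AE w in M. norm (\<integral>\<xi>. norm (case_prod f (w, \<xi>)) \<partial>lborel) \<le> (\<integral>\<xi>. norm (m \<xi>) \<partial>lborel)"
        using m fb i2 by (intro AE_I2) (auto intro!: integral_mono)
    qed measurable
  qed (use i2 in auto)
  then have "(\<integral>w. (\<integral>\<xi>. f w \<xi> \<partial>lborel) \<partial>M) = (\<integral>\<xi>. (\<integral>w. f w \<xi> \<partial>M) \<partial>lborel)"
    by (rule P.Fubini_integral[symmetric])
  also have "\<dots> = (\<integral>\<xi>. cos (\<xi> \<bullet> v) * (\<phi> \<xi> * m \<xi>) \<partial>lborel)"
  proof (rule Bochner_Integration.integral_cong[OF refl])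
    fix \<xi> :: 'a
    have ci: "integrable M (\<lambda>w. cis (\<xi> \<bullet> (v + D w)))"
      by (rule integrable_const_bound[of _ 1]) auto
    have "(\<integral>w. cos (\<xi> \<bullet> (v + D w)) \<partial>M) = Re (\<integral>w. cis (\<xi> \<bullet> (v + D w)) \<partial>M)"
      using integral_Re[OF ci] by simp
    also have "(\<integral>w. cis (\<xi> \<bullet> (v + D w)) \<partial>M) = cis (\<xi> \<bullet> v) * complex_of_real (\<phi> \<xi>)"
      by (simp add: inner_add_right cis_mult[symmetric] char)
    finally show "(\<integral>w. f w \<xi> \<partial>M) = cos (\<xi> \<bullet> v) * (\<phi> \<xi> * m \<xi>)"
      unfolding f_def by simp
  qed
  finally show ?thesis unfolding f_def .
qed

section \<open>Heat kernels, radial integrals and subordination\<close>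

definition heat_kernel :: "real \<Rightarrow> 'a::euclidean_space \<Rightarrow> real" where
  "heat_kernel s v = (2 * pi * s) powr (- real DIM('a) / 2) * exp (- (norm v)\<^sup>2 / (2 * s))"

lemma heat_kernel_nonneg: "heat_kernel s v \<ge> 0" by (simp add: heat_kernel_def)

lemma heat_kernel_measurable [measurable]:
  "(\<lambda>(s, v). heat_kernel s v) \<in> borel_measurable (borel \<Otimes>\<^sub>M borel)"
  unfolding heat_kernel_def by measurable

lemma heat_kernel_fourier:
  fixes v :: "'a::euclidean_space"
  assumes s: "s > 0"
  shows "(\<integral>\<xi>. cos (\<xi> \<bullet> v) * exp (- s * (norm \<xi>)\<^sup>2 / 2) \<partial>lborel) = (2 * pi) ^ DIM('a) * heat_kernel s v"
proof -
  have "(2 * pi / s) powr (real DIM('a) / 2) = (2 * pi) ^ DIM('a) * (2 * pi * s) powr (- real DIM('a) / 2)"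
  proof -
    have e: "(2 * pi) ^ DIM('a) = (2 * pi) powr real DIM('a)" by (simp add: powr_realpow)
    show ?thesis unfolding e powr_def using s
      by (simp add: ln_mult ln_div exp_add[symmetric] algebra_simps add_divide_distrib diff_divide_distrib)
  qed
  then show ?thesis
    unfolding gaussian_fourier[OF s] heat_kernel_def by simp
qed

text \<open>The semigroup property on the Fourier side, where the exponents simply add.\<close>

lemma heat_kernel_convolution:
  fixes v :: "'a::euclidean_space"
  assumes s: "s > 0" and \<rho>: "\<rho> > 0"
  shows "(\<integral>z. heat_kernel \<rho> (v + sqrt s *\<^sub>R z) \<partial>std_gaussian) = heat_kernel (s + \<rho>) v"
proof -
  have m: "integrable lborel (\<lambda>\<xi>::'a. exp (- \<rho> * (norm \<xi>)\<^sup>2 / 2))" by (rule integrable_gaussian[OF \<rho>])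
  have "(\<integral>z. (\<integral>\<xi>. cos (\<xi> \<bullet> (v + sqrt s *\<^sub>R z)) * exp (- \<rho> * (norm \<xi>)\<^sup>2 / 2) \<partial>lborel) \<partial>std_gaussian)
    = (\<integral>\<xi>. cos (\<xi> \<bullet> v) * (exp (- (norm (sqrt s *\<^sub>R \<xi>))\<^sup>2 / 2) * exp (- \<rho> * (norm \<xi>)\<^sup>2 / 2)) \<partial>lborel)"
  proof (rule fourier_average[OF prob_space_std_gaussian _ _ m])
    fix \<xi> :: 'a
    have "(\<integral>w. cis (\<xi> \<bullet> (sqrt s *\<^sub>R w)) \<partial>std_gaussian) = (\<integral>w. cis (w \<bullet> (sqrt s *\<^sub>R \<xi>)) \<partial>std_gaussian)"
      by (simp add: inner_commute)
    then show "(\<integral>w. cis (\<xi> \<bullet> (sqrt s *\<^sub>R w)) \<partial>std_gaussian) = complex_of_real (exp (- (norm (sqrt s *\<^sub>R \<xi>))\<^sup>2 / 2))"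
      by (simp only: std_gaussian_cis)
  qed measurable
  also have "\<dots> = (\<integral>\<xi>. cos (\<xi> \<bullet> v) * exp (- (s + \<rho>) * (norm \<xi>)\<^sup>2 / 2) \<partial>lborel)"
  proof (rule Bochner_Integration.integral_cong[OF refl])
    fix \<xi> :: 'a
    have "- (norm (sqrt s *\<^sub>R \<xi>))\<^sup>2 / 2 + - \<rho> * (norm \<xi>)\<^sup>2 / 2 = - (s + \<rho>) * (norm \<xi>)\<^sup>2 / 2"
      using s by (simp add: power_mult_distrib field_simps)
    then show "cos (\<xi> \<bullet> v) * (exp (- (norm (sqrt s *\<^sub>R \<xi>))\<^sup>2 / 2) * exp (- \<rho> * (norm \<xi>)\<^sup>2 / 2)) = cos (\<xi> \<bullet> v) * exp (- (s + \<rho>) * (norm \<xi>)\<^sup>2 / 2)"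
      by (simp only: exp_add[symmetric])
  qed
  also have "\<dots> = (2 * pi) ^ DIM('a) * heat_kernel (s + \<rho>) v"
    by (rule heat_kernel_fourier) (use s \<rho> in simp)
  finally show ?thesis
    unfolding heat_kernel_fourier[OF \<rho>] by simp
qed

lemma nn_integral_heat_kernel_convolution:
  fixes v :: "'a::euclidean_space"
  assumes s: "s > 0" and \<rho>: "\<rho> > 0"
  shows "(\<integral>\<^sup>+z. ennreal (heat_kernel \<rho> (v + sqrt s *\<^sub>R z)) \<partial>std_gaussian) = ennreal (heat_kernel (s + \<rho>) v)"
proof -
  interpret prob_space "std_gaussian :: 'a measure" by (rule prob_space_std_gaussian)
  have "integrable std_gaussian (\<lambda>z::'a. heat_kernel \<rho> (v + sqrt s *\<^sub>R z))"
    by (rule integrable_const_bound[of _ "(2 * pi * \<rho>) powr (- real DIM('a) / 2)"])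
      (use \<rho> in \<open>auto simp: heat_kernel_def abs_mult intro!: mult_left_le\<close>)
  then show ?thesis
    by (subst nn_integral_eq_integral) (auto simp: heat_kernel_nonneg heat_kernel_convolution[OF s \<rho>])
qed

lemma nn_integral_radial_powr_exp:
  fixes p q b :: real
  assumes "q \<noteq> 0" "(p + real DIM('a)) / q > 0" "b > 0"
  shows "(\<integral>\<^sup>+\<xi>. ennreal (norm \<xi> powr p * exp (- b * norm \<xi> powr q)) \<partial>(lborel :: 'a::euclidean_space measure))
    = ennreal (real DIM('a) * measure lborel (ball 0 1 :: 'a set) * (Gamma ((p + real DIM('a)) / q) / (\<bar>q\<bar> * b powr ((p + real DIM('a)) / q))))"
proof -
  interpret prob_space "sphere_sigma :: 'a measure" by (rule prob_space_sphere_sigma)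
  have "(\<integral>\<^sup>+\<xi>. ennreal (norm \<xi> powr p * exp (- b * norm \<xi> powr q)) \<partial>(lborel :: 'a measure))
    = (\<integral>\<^sup>+\<xi>. ennreal (norm \<xi> powr p * exp (- b * norm \<xi> powr q)) * 1 \<partial>(lborel :: 'a measure))" by simp
  also have "\<dots> = ennreal (real DIM('a) * measure lborel (ball 0 1 :: 'a set)) *
     (\<integral>\<^sup>+r. ennreal (r powr p * exp (- b * r powr q)) * (ennreal (r powr (real DIM('a) - 1)) * indicator {0<..} r) \<partial>lborel)"
    by (subst nn_integral_polar[where f="\<lambda>_::'a. 1" and h="\<lambda>r. ennreal (r powr p * exp (- b * r powr q))"])
      (auto simp: emeasure_space_1[simplified])
  also have "(\<integral>\<^sup>+r. ennreal (r powr p * exp (- b * r powr q)) * (ennreal (r powr (real DIM('a) - 1)) * indicator {0<..} r) \<partial>lborel)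
    = (\<integral>\<^sup>+r. ennreal (r powr ((p + real DIM('a)) - 1) * exp (- b * r powr q)) * indicator {0<..} r \<partial>lborel)"
  proof (rule nn_integral_cong)
    fix r :: real
    have "r powr p * exp (- b * r powr q) * r powr (real DIM('a) - 1) = r powr ((p + real DIM('a)) - 1) * exp (- b * r powr q)"
      using powr_add[of r p "real DIM('a) - 1"] by (simp add: add_diff_eq)
    then show "ennreal (r powr p * exp (- b * r powr q)) * (ennreal (r powr (real DIM('a) - 1)) * indicator {0<..} r) = ennreal (r powr ((p + real DIM('a)) - 1) * exp (- b * r powr q)) * indicator {0<..} r"
      unfolding mult.assoc[symmetric] by (subst ennreal_mult'[symmetric]) (simp, simp only:)
  qed
  also have "\<dots> = ennreal (Gamma ((p + real DIM('a)) / q) / (\<bar>q\<bar> * b powr ((p + real DIM('a)) / q)))"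
    by (rule nn_integral_powr_exp_powr[OF assms])
  finally show ?thesis
    by (subst ennreal_mult') auto
qed

lemma integrable_radial_powr_exp:
  fixes p q b :: real
  assumes "q \<noteq> 0" "(p + real DIM('a)) / q > 0" "b > 0"
  shows "integrable lborel (\<lambda>\<xi>::'a::euclidean_space. norm \<xi> powr p * exp (- b * norm \<xi> powr q))"
proof (rule integrableI_nonneg)
  show "(\<integral>\<^sup>+\<xi>. ennreal (norm \<xi> powr p * exp (- b * norm \<xi> powr q)) \<partial>(lborel :: 'a measure)) < \<infinity>"
    unfolding nn_integral_radial_powr_exp[OF assms] by simp
qed auto

lemma integrable_radial_powr_gaussian:
  fixes p s :: real
  assumes "p + real DIM('a) > 0" "s > 0"
  shows "integrable lborel (\<lambda>\<xi>::'a::euclidean_space. norm \<xi> powr p * exp (- s * (norm \<xi>)\<^sup>2 / 2))"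
  using integrable_radial_powr_exp[where 'a='a, of 2 p "s / 2"] assms by simp

text \<open>The Riesz kernel, up to a constant, convolved with a centred Gaussian of variance
  \<open>s\<close>, written as an inverse Fourier integral. Without the Gaussian factor the integral
  would not converge absolutely at infinity because \<alpha> < d; with it, time evolution and
  generator act by multiplication under the integral.\<close>

definition smoothed_riesz :: "real \<Rightarrow> real \<Rightarrow> 'a::euclidean_space \<Rightarrow> real" where
  "smoothed_riesz \<alpha> s v = (\<integral>\<xi>. cos (\<xi> \<bullet> v) * (norm \<xi> powr (- \<alpha>) * exp (- s * (norm \<xi>)\<^sup>2 / 2)) \<partial>lborel) / (2 * pi) ^ DIM('a)"

definition sphere_pot :: "real \<Rightarrow> real \<Rightarrow> 'a::euclidean_space \<Rightarrow> real" where
  "sphere_pot \<alpha> s x = (\<integral>y. smoothed_riesz \<alpha> s (x - y) \<partial>sphere_sigma)"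

text \<open>The negative generator applied to \<open>sphere_pot\<close>: multiplying the Fourier
  density by \<open>norm \<xi> powr \<alpha>\<close> leaves only the Gaussian. It is the rate at
  which the process loses potential.\<close>

definition sphere_heat :: "real \<Rightarrow> 'a::euclidean_space \<Rightarrow> real" where
  "sphere_heat s x = (\<integral>y. heat_kernel s (x - y) \<partial>sphere_sigma)"

lemma smoothed_riesz_measurable [measurable]: "smoothed_riesz \<alpha> s \<in> borel_measurable borel"
  unfolding smoothed_riesz_def by measurable

lemma sphere_pot_measurable [measurable]: "sphere_pot \<alpha> s \<in> borel_measurable (borel :: 'a::euclidean_space measure)"
proof -
  interpret prob_space "sphere_sigma :: 'a measure" by (rule prob_space_sphere_sigma)
  show ?thesis unfolding sphere_pot_def by measurable
qed

lemma sphere_heat_measurable [measurable]: "sphere_heat s \<in> borel_measurable (borel :: 'a::euclidean_space measure)"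
proof -
  interpret prob_space "sphere_sigma :: 'a measure" by (rule prob_space_sphere_sigma)
  show ?thesis unfolding sphere_heat_def by measurable
qed

text \<open>Constants of the two subordination formulas
  \<open>|\<xi>| powr - \<alpha> = subord1 \<alpha> \<integral> \<rho> powr (\<alpha>/2 - 1) exp (- \<rho> |\<xi>|\<^sup>2 / 2) d\<rho>\<close> and
  \<open>|v| powr (\<alpha> - n) = subord2 n \<alpha> \<integral> \<rho> powr (\<alpha>/2 - 1) heat_kernel \<rho> v d\<rho>\<close>.\<close>
definition subord1 :: "real \<Rightarrow> real" where
  "subord1 \<alpha> = 1 / (Gamma (\<alpha> / 2) * 2 powr (\<alpha> / 2))"

definition subord2 :: "nat \<Rightarrow> real \<Rightarrow> real" where
  "subord2 n \<alpha> = (2 * pi) powr (real n / 2) / (Gamma ((real n - \<alpha>) / 2) * 2 powr ((real n - \<alpha>) / 2))"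

context stable_index
begin

lemma subord1_pos: "subord1 \<alpha> > 0"
  unfolding subord1_def using \<alpha> by (simp add: Gamma_real_pos)

lemma subord2_pos: "subord2 DIM('a) \<alpha> > 0"
  unfolding subord2_def using dim \<alpha> by (simp add: Gamma_real_pos)

lemma subordination1:
  assumes "\<xi> \<noteq> (0::'a)"
  shows "(\<integral>\<^sup>+\<rho>. ennreal (\<rho> powr (\<alpha>/2 - 1) * exp (- \<rho> * (norm \<xi>)\<^sup>2 / 2)) * indicator {0<..} \<rho> \<partial>lborel)
    = ennreal (norm \<xi> powr (- \<alpha>) / subord1 \<alpha>)"
proof -
  have "(\<integral>\<^sup>+\<rho>. ennreal (\<rho> powr (\<alpha>/2 - 1) * exp (- \<rho> * (norm \<xi>)\<^sup>2 / 2)) * indicator {0<..} \<rho> \<partial>lborel)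
    = (\<integral>\<^sup>+\<rho>. ennreal (\<rho> powr (\<alpha>/2 - 1) * exp (- ((norm \<xi>)\<^sup>2 / 2) * \<rho> powr 1)) * indicator {0<..} \<rho> \<partial>lborel)"
    by (intro nn_integral_cong) (auto split: split_indicator simp: mult_ac)
  also have "\<dots> = ennreal (Gamma (\<alpha>/2/1) / (\<bar>1\<bar> * ((norm \<xi>)\<^sup>2 / 2) powr (\<alpha>/2/1)))"
    by (rule nn_integral_powr_exp_powr) (use \<alpha> assms in auto)
  also have "((norm \<xi>)\<^sup>2 / 2) powr (\<alpha>/2/1) = norm \<xi> powr \<alpha> / 2 powr (\<alpha>/2)"
    using powr_powr[of "norm \<xi>" 2 "\<alpha>/2"] assms by (simp add: powr_divide)
  finally show ?thesis by (simp add: subord1_def powr_minus_divide)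
qed

lemma subordination2:
  assumes "v \<noteq> (0::'a)"
  shows "(\<integral>\<^sup>+\<rho>. ennreal (\<rho> powr (\<alpha>/2 - 1) * heat_kernel \<rho> v) * indicator {0<..} \<rho> \<partial>lborel)
    = ennreal (norm v powr (\<alpha> - real DIM('a)) / subord2 DIM('a) \<alpha>)"
proof -
  define p where "p = (\<alpha> - real DIM('a)) / 2"
  have "(\<integral>\<^sup>+\<rho>. ennreal (\<rho> powr (\<alpha>/2 - 1) * heat_kernel \<rho> v) * indicator {0<..} \<rho> \<partial>lborel)
    = (\<integral>\<^sup>+\<rho>. ennreal ((2 * pi) powr (- real DIM('a) / 2)) * (ennreal (\<rho> powr (p - 1) * exp (- ((norm v)\<^sup>2 / 2) * \<rho> powr (-1))) * indicator {0<..} \<rho>) \<partial>lborel)"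
  proof (rule nn_integral_cong)
    fix \<rho> :: real
    have "\<rho> powr (\<alpha>/2 - 1) * heat_kernel \<rho> v = (2 * pi) powr (- real DIM('a) / 2) * (\<rho> powr (p - 1) * exp (- ((norm v)\<^sup>2 / 2) * \<rho> powr (-1)))" if "\<rho> > 0"
    proof -
      have E1: "\<rho> powr (\<alpha>/2 - 1) * \<rho> powr (- real DIM('a) / 2) = \<rho> powr (p - 1)"
        unfolding powr_add[symmetric] by (simp add: p_def diff_divide_distrib algebra_simps)
      have E2: "(2 * pi * \<rho>) powr (- real DIM('a) / 2) = (2 * pi) powr (- real DIM('a) / 2) * \<rho> powr (- real DIM('a) / 2)"
        using that powr_mult[of "2 * pi" \<rho>] by simp
      have E3: "- (norm v)\<^sup>2 / (2 * \<rho>) = - ((norm v)\<^sup>2 / 2) * \<rho> powr (-1)"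
        using that by (simp add: powr_minus_divide)
      show ?thesis unfolding heat_kernel_def E2 E3 E1[symmetric] by (simp only: mult_ac)
    qed
    then show "ennreal (\<rho> powr (\<alpha>/2 - 1) * heat_kernel \<rho> v) * indicator {0<..} \<rho>
      = ennreal ((2 * pi) powr (- real DIM('a) / 2)) * (ennreal (\<rho> powr (p - 1) * exp (- ((norm v)\<^sup>2 / 2) * \<rho> powr (-1))) * indicator {0<..} \<rho>)"
      by (auto split: split_indicator simp: ennreal_mult'[symmetric])
  qed
  also have "\<dots> = ennreal ((2 * pi) powr (- real DIM('a) / 2)) * ennreal (Gamma (p / (-1)) / (\<bar>-1\<bar> * ((norm v)\<^sup>2 / 2) powr (p / (-1))))"
    by (subst nn_integral_cmult, measurable, subst nn_integral_powr_exp_powr) (use dim \<alpha> assms in \<open>auto simp: p_def\<close>)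
  also have "\<dots> = ennreal (norm v powr (\<alpha> - real DIM('a)) / subord2 DIM('a) \<alpha>)"
  proof -
    have mp: "- p = (real DIM('a) - \<alpha>) / 2" by (simp add: p_def field_simps)
    have "((norm v)\<^sup>2 / 2) powr (- p) = norm v powr (real DIM('a) - \<alpha>) / 2 powr (- p)"
      using powr_powr[of "norm v" 2 "- p"] assms by (simp add: powr_divide mp diff_divide_distrib)
    moreover have "norm v powr (\<alpha> - real DIM('a)) = 1 / norm v powr (real DIM('a) - \<alpha>)"
      using powr_minus_divide[of "norm v" "real DIM('a) - \<alpha>"] by simp
    moreover have "(2 * pi) powr (- real DIM('a) / 2) = 1 / (2 * pi) powr (real DIM('a) / 2)"
      using powr_minus_divide[of "2 * pi" "real DIM('a) / 2"] by simp
    moreover have "1 / P * (g / (\<bar>- 1\<bar> * (N / T))) = 1 / N / (P / (g * T))" for P g N T :: real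
      by simp
    moreover have "p / (-1) = - p" by simp
    ultimately show ?thesis
      unfolding subord2_def mp[symmetric] by (subst ennreal_mult'[symmetric]) (simp, simp only:)
  qed
  finally show ?thesis .
qed

end

section \<open>The smoothed Riesz kernel as a mixture of heat kernels\<close>

context stable_index
begin

lemma smoothed_riesz_integrable:
  assumes s: "s > 0"
  shows "integrable lborel (\<lambda>\<xi>::'a. norm \<xi> powr (- \<alpha>) * exp (- s * (norm \<xi>)\<^sup>2 / 2))"
  using integrable_radial_powr_gaussian[where 'a='a, of "- \<alpha>" s] dim \<alpha> s by simp

text \<open>Writing \<open>norm \<xi> powr (- \<alpha>)\<close> as a mixture of Gaussians and
  exchanging integrals exhibits the kernel as a mixture of heat kernels. Positivity and radial
  monotonicity, invisible in the cosine integral, follow.\<close>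

lemma smoothed_riesz_mixture:
  fixes v :: 'a
  assumes s: "s > 0"
  shows "ennreal (smoothed_riesz \<alpha> s v) = ennreal (subord1 \<alpha>) * (\<integral>\<^sup>+\<rho>. ennreal (\<rho> powr (\<alpha>/2 - 1) * heat_kernel (s + \<rho>) v) * indicator {0<..} \<rho> \<partial>lborel)"
    and "smoothed_riesz \<alpha> s v \<ge> 0"
proof -
  define h where "h \<xi> \<rho> = indicator {0<..} \<rho> * (\<rho> powr (\<alpha>/2 - 1) * exp (- \<rho> * (norm \<xi>)\<^sup>2 / 2))" for \<xi> :: 'a and \<rho> :: real
  define e where "e \<xi> = exp (- s * (norm \<xi>)\<^sup>2 / 2)" for \<xi> :: 'a
  define f where "f \<xi> \<rho> = cos (\<xi> \<bullet> v) * e \<xi> * h \<xi> \<rho>" for \<xi> :: 'a and \<rho> :: real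
  have [measurable]: "case_prod h \<in> borel_measurable (borel \<Otimes>\<^sub>M borel)" "e \<in> borel_measurable borel"
    unfolding h_def e_def by measurable
  have [measurable]: "case_prod f \<in> borel_measurable (borel \<Otimes>\<^sub>M borel)" unfolding f_def by measurable
  have h0: "h \<xi> \<rho> \<ge> 0" for \<xi> \<rho> by (simp add: h_def)
  have hn: "(\<integral>\<^sup>+\<rho>. ennreal (h \<xi> \<rho>) \<partial>lborel) = ennreal (norm \<xi> powr (- \<alpha>) / subord1 \<alpha>)" if "\<xi> \<noteq> 0" for \<xi>
  proof -
    have "(\<integral>\<^sup>+\<rho>. ennreal (h \<xi> \<rho>) \<partial>lborel) = (\<integral>\<^sup>+\<rho>. ennreal (\<rho> powr (\<alpha>/2 - 1) * exp (- \<rho> * (norm \<xi>)\<^sup>2 / 2)) * indicator {0<..} \<rho> \<partial>lborel)"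
      unfolding h_def by (intro nn_integral_cong) (auto split: split_indicator)
    then show ?thesis using subordination1[OF that] by simp
  qed
  have hi: "integrable lborel (h \<xi>)" "(\<integral>\<rho>. h \<xi> \<rho> \<partial>lborel) = norm \<xi> powr (- \<alpha>) / subord1 \<alpha>" if "\<xi> \<noteq> 0" for \<xi>
  proof -
    show 1: "integrable lborel (h \<xi>)"
      by (rule integrableI_nonneg) (use h0 hn[OF that] in auto)
    show "(\<integral>\<rho>. h \<xi> \<rho> \<partial>lborel) = norm \<xi> powr (- \<alpha>) / subord1 \<alpha>"
      using hn[OF that] h0 subord1_pos by (subst integral_eq_nn_integral) auto
  qed
  have fi: "integrable (lborel \<Otimes>\<^sub>M lborel) (case_prod f)"
  proof (rule lborel_pair.Fubini_integrable)
    have nf: "(\<integral>\<rho>. norm (case_prod f (\<xi>, \<rho>)) \<partial>lborel) = \<bar>cos (\<xi> \<bullet> v)\<bar> * (norm \<xi> powr (- \<alpha>) * e \<xi> / subord1 \<alpha>)" if "\<xi> \<noteq> 0" for \<xi>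
      using hi[OF that] h0 by (simp add: f_def abs_mult e_def)
    show "integrable lborel (\<lambda>\<xi>. \<integral>\<rho>. norm (case_prod f (\<xi>, \<rho>)) \<partial>lborel)"
    proof (rule Bochner_Integration.integrable_bound)
      show "integrable lborel (\<lambda>\<xi>. norm \<xi> powr (- \<alpha>) * e \<xi> / subord1 \<alpha>)"
        unfolding e_def by (intro integrable_divide smoothed_riesz_integrable s)
      show "AE \<xi> in lborel. norm (\<integral>\<rho>. norm (case_prod f (\<xi>, \<rho>)) \<partial>lborel) \<le> norm (norm \<xi> powr (- \<alpha>) * e \<xi> / subord1 \<alpha>)"
        using AE_lborel_singleton[of "0::'a"]
      proof eventually_elim
        case (elim \<xi>)
        show ?case unfolding nf[OF elim] by (simp add: abs_mult mult_left_le_one_le divide_right_mono)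
      qed
    qed measurable
    show "AE \<xi> in lborel. integrable lborel (\<lambda>\<rho>. case_prod f (\<xi>, \<rho>))"
      using AE_lborel_singleton[of "0::'a"] by eventually_elim (simp add: f_def hi)
  qed measurable
  have inner: "(\<integral>\<xi>. f \<xi> \<rho> \<partial>lborel) = (2 * pi) ^ DIM('a) * (indicator {0<..} \<rho> * (\<rho> powr (\<alpha>/2 - 1) * heat_kernel (s + \<rho>) v))" for \<rho>
  proof (cases "\<rho> > 0")
    case True
    have "f \<xi> \<rho> = \<rho> powr (\<alpha>/2 - 1) * (cos (\<xi> \<bullet> v) * exp (- (s + \<rho>) * (norm \<xi>)\<^sup>2 / 2))" for \<xi>
    proof -
      have "- s * (norm \<xi>)\<^sup>2 / 2 + - \<rho> * (norm \<xi>)\<^sup>2 / 2 = - (s + \<rho>) * (norm \<xi>)\<^sup>2 / 2" by (simp add: field_simps)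
      then have "exp (- (s + \<rho>) * (norm \<xi>)\<^sup>2 / 2) = exp (- s * (norm \<xi>)\<^sup>2 / 2) * exp (- \<rho> * (norm \<xi>)\<^sup>2 / 2)"
        by (simp only: exp_add[symmetric])
      then show ?thesis using True by (simp add: f_def h_def e_def)
    qed
    then have "(\<integral>\<xi>. f \<xi> \<rho> \<partial>lborel) = \<rho> powr (\<alpha>/2 - 1) * (\<integral>\<xi>. cos (\<xi> \<bullet> v) * exp (- (s + \<rho>) * (norm \<xi>)\<^sup>2 / 2) \<partial>lborel)"
      by (simp only: integral_mult_right_zero)
    also have "\<dots> = \<rho> powr (\<alpha>/2 - 1) * ((2 * pi) ^ DIM('a) * heat_kernel (s + \<rho>) v)"
      using True s by (subst heat_kernel_fourier) auto
    finally show ?thesis using True by simp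
  qed (simp add: f_def h_def)
  define c where "c = (2 * pi) ^ DIM('a)"
  have c: "c > 0" by (simp add: c_def)
  define H where "H \<rho> = indicator {0<..} \<rho> * (\<rho> powr (\<alpha>/2 - 1) * heat_kernel (s + \<rho>) v)" for \<rho> :: real
  have "integrable lborel (\<lambda>\<rho>. \<integral>\<xi>. f \<xi> \<rho> \<partial>lborel)"
    using lborel_pair.integrable_fst'[OF lborel_pair.integrable_product_swap[OF fi]] lborel_pair.integrable_snd[OF fi] by simp
  then have Hi: "integrable lborel H"
    unfolding inner H_def using c unfolding c_def by simp
  have "(\<integral>\<xi>. (\<integral>\<rho>. f \<xi> \<rho> \<partial>lborel) \<partial>lborel) = (\<integral>\<rho>. (\<integral>\<xi>. f \<xi> \<rho> \<partial>lborel) \<partial>lborel)"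
    by (rule lborel_pair.Fubini_integral[OF fi, symmetric])
  also have "\<dots> = c * (\<integral>\<rho>. H \<rho> \<partial>lborel)"
    unfolding inner H_def c_def by (rule integral_mult_right_zero)
  also have "(\<integral>\<xi>. (\<integral>\<rho>. f \<xi> \<rho> \<partial>lborel) \<partial>lborel) = (\<integral>\<xi>. (cos (\<xi> \<bullet> v) * (norm \<xi> powr (- \<alpha>) * e \<xi>)) / subord1 \<alpha> \<partial>lborel)"
  proof (rule integral_cong_AE)
    show "AE \<xi> in lborel. (\<integral>\<rho>. f \<xi> \<rho> \<partial>lborel) = cos (\<xi> \<bullet> v) * (norm \<xi> powr (- \<alpha>) * e \<xi>) / subord1 \<alpha>"
      using AE_lborel_singleton[of "0::'a"]
      by eventually_elim (simp add: f_def hi)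
  qed measurable
  also have "\<dots> = c * smoothed_riesz \<alpha> s v / subord1 \<alpha>"
    unfolding smoothed_riesz_def e_def c_def by simp
  finally have k: "smoothed_riesz \<alpha> s v = subord1 \<alpha> * (\<integral>\<rho>. H \<rho> \<partial>lborel)"
    using c subord1_pos by (simp add: field_simps)
  have H0: "H \<rho> \<ge> 0" for \<rho> by (simp add: H_def heat_kernel_nonneg)
  show "smoothed_riesz \<alpha> s v \<ge> 0"
    unfolding k using subord1_pos H0 by (intro mult_nonneg_nonneg Bochner_Integration.integral_nonneg) auto
  have "ennreal (smoothed_riesz \<alpha> s v) = ennreal (subord1 \<alpha>) * (\<integral>\<^sup>+\<rho>. ennreal (H \<rho>) \<partial>lborel)"
    unfolding k using subord1_pos H0 Hi by (subst nn_integral_eq_integral) (auto simp: ennreal_mult')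
  also have "(\<integral>\<^sup>+\<rho>. ennreal (H \<rho>) \<partial>lborel) = (\<integral>\<^sup>+\<rho>. ennreal (\<rho> powr (\<alpha>/2 - 1) * heat_kernel (s + \<rho>) v) * indicator {0<..} \<rho> \<partial>lborel)"
    unfolding H_def by (intro nn_integral_cong) (auto split: split_indicator)
  finally show "ennreal (smoothed_riesz \<alpha> s v) = ennreal (subord1 \<alpha>) * (\<integral>\<^sup>+\<rho>. ennreal (\<rho> powr (\<alpha>/2 - 1) * heat_kernel (s + \<rho>) v) * indicator {0<..} \<rho> \<partial>lborel)" .
qed

lemma smoothed_riesz_mono:
  fixes v v' :: 'a
  assumes s: "s > 0" and "norm v \<le> norm v'"
  shows "smoothed_riesz \<alpha> s v' \<le> smoothed_riesz \<alpha> s v"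
proof -
  have "ennreal (smoothed_riesz \<alpha> s v') \<le> ennreal (smoothed_riesz \<alpha> s v)"
    unfolding smoothed_riesz_mixture(1)[OF s]
    using assms
    by (intro mult_left_mono nn_integral_mono)
      (auto split: split_indicator simp: heat_kernel_def intro!: ennreal_leI mult_left_mono divide_right_mono power_mono)
  then show ?thesis using smoothed_riesz_mixture(2)[OF s] by (simp add: ennreal_le_iff)
qed

text \<open>The second subordination formula reads the same mixture as a Gaussian average of
  \<open>norm v powr (\<alpha> - d)\<close>, since a Gaussian shift turns
  \<open>heat_kernel \<rho>\<close> into \<open>heat_kernel (s + \<rho>)\<close>. This identifies
  the Fourier integral with the Riesz kernel by nonnegative integrands alone, without
  distributions.\<close>

lemma smoothed_riesz_eq:
  fixes v :: 'a
  assumes s: "s > 0"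
  shows "ennreal (smoothed_riesz \<alpha> s v) = ennreal (subord1 \<alpha> / subord2 DIM('a) \<alpha>) *
    (\<integral>\<^sup>+z. ennreal (norm (v + sqrt s *\<^sub>R z) powr (\<alpha> - real DIM('a))) \<partial>std_gaussian)"
proof -
  interpret prob_space "std_gaussian :: 'a measure" by (rule prob_space_std_gaussian)
  interpret P: pair_sigma_finite "std_gaussian :: 'a measure" "lborel :: real measure" ..
  \<comment> \<open>At the origin \<open>powr\<close> returns 0 whereas the mixture diverges; the
    Gaussian law gives this point no mass.\<close>
  have null: "AE z in std_gaussian. v + sqrt s *\<^sub>R z \<noteq> 0"
  proof -
    have "AE z in lborel. z \<noteq> - (v /\<^sub>R sqrt s)" by (rule AE_lborel_singleton)
    then have "AE z in lborel. v + sqrt s *\<^sub>R z \<noteq> 0"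
    proof eventually_elim
      case (elim z)
      have "z = - (v /\<^sub>R sqrt s)" if "v + sqrt s *\<^sub>R z = 0"
      proof -
        have "sqrt s *\<^sub>R z = - v" using that by (simp add: eq_neg_iff_add_eq_0 add.commute)
        then have "(sqrt s *\<^sub>R z) /\<^sub>R sqrt s = - (v /\<^sub>R sqrt s)" by simp
        then show ?thesis using s by simp
      qed
      then show ?case using elim by auto
    qed
    then show ?thesis unfolding std_gaussian_def by (simp add: AE_density)
  qed
  have "ennreal (1 / subord2 DIM('a) \<alpha>) * (\<integral>\<^sup>+z. ennreal (norm (v + sqrt s *\<^sub>R z) powr (\<alpha> - real DIM('a))) \<partial>std_gaussian)
    = (\<integral>\<^sup>+z. ennreal (norm (v + sqrt s *\<^sub>R z) powr (\<alpha> - real DIM('a)) / subord2 DIM('a) \<alpha>) \<partial>std_gaussian)"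
    using subord2_pos by (subst nn_integral_cmult[symmetric]) (auto simp: ennreal_mult'[symmetric])
  also have "\<dots> = (\<integral>\<^sup>+z. (\<integral>\<^sup>+\<rho>. ennreal (\<rho> powr (\<alpha>/2 - 1) * heat_kernel \<rho> (v + sqrt s *\<^sub>R z)) * indicator {0<..} \<rho> \<partial>lborel) \<partial>std_gaussian)"
    using null by (intro nn_integral_cong_AE) (auto elim!: eventually_mono simp: subordination2)
  also have "\<dots> = (\<integral>\<^sup>+\<rho>. (\<integral>\<^sup>+z. ennreal (\<rho> powr (\<alpha>/2 - 1) * heat_kernel \<rho> (v + sqrt s *\<^sub>R z)) * indicator {0<..} \<rho> \<partial>std_gaussian) \<partial>lborel)"
    by (rule P.Fubini'[symmetric]) measurable
  also have "\<dots> = (\<integral>\<^sup>+\<rho>. ennreal (\<rho> powr (\<alpha>/2 - 1) * heat_kernel (s + \<rho>) v) * indicator {0<..} \<rho> \<partial>lborel)"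
  proof (rule nn_integral_cong)
    fix \<rho> :: real
    show "(\<integral>\<^sup>+z. ennreal (\<rho> powr (\<alpha>/2 - 1) * heat_kernel \<rho> (v + sqrt s *\<^sub>R z)) * indicator {0<..} \<rho> \<partial>std_gaussian) = ennreal (\<rho> powr (\<alpha>/2 - 1) * heat_kernel (s + \<rho>) v) * indicator {0<..} \<rho>"
    proof (cases "\<rho> > 0")
      case True
      then have "(\<integral>\<^sup>+z. ennreal (\<rho> powr (\<alpha>/2 - 1) * heat_kernel \<rho> (v + sqrt s *\<^sub>R z)) * indicator {0<..} \<rho> \<partial>std_gaussian) = ennreal (\<rho> powr (\<alpha>/2 - 1)) * (\<integral>\<^sup>+z. ennreal (heat_kernel \<rho> (v + sqrt s *\<^sub>R z)) \<partial>std_gaussian)"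
        by (subst nn_integral_cmult[symmetric]) (auto simp: ennreal_mult' heat_kernel_nonneg)
      then show ?thesis using True by (simp add: nn_integral_heat_kernel_convolution[OF s True] ennreal_mult')
    qed simp
  qed
  finally have "ennreal (subord1 \<alpha>) * (ennreal (1 / subord2 DIM('a) \<alpha>) * (\<integral>\<^sup>+z. ennreal (norm (v + sqrt s *\<^sub>R z) powr (\<alpha> - real DIM('a))) \<partial>std_gaussian)) = ennreal (smoothed_riesz \<alpha> s v)"
    unfolding smoothed_riesz_mixture(1)[OF s] by simp
  moreover have "ennreal (subord1 \<alpha>) * (ennreal (1 / subord2 DIM('a) \<alpha>) * Z) = ennreal (subord1 \<alpha> / subord2 DIM('a) \<alpha>) * Z" for Z
    unfolding mult.assoc[symmetric] using subord1_pos by (subst ennreal_mult'[symmetric]) auto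
  ultimately show ?thesis by simp
qed

end

section \<open>The smoothed potential of the sphere: bounds, limits, and the heat near and far from
  the sphere\<close>

context stable_index
begin

abbreviation (input) "riesz_const \<equiv> \<lambda>n. subord1 \<alpha> / subord2 n \<alpha>"

lemma riesz_const_pos: "riesz_const DIM('a) > 0"
  using subord1_pos subord2_pos by simp

lemma smoothed_riesz_nonneg: "s > 0 \<Longrightarrow> smoothed_riesz \<alpha> s (v::'a) \<ge> 0"
  by (rule smoothed_riesz_mixture(2))

lemma smoothed_riesz_bound: "s > 0 \<Longrightarrow> norm (smoothed_riesz \<alpha> s (v::'a)) \<le> smoothed_riesz \<alpha> s (0::'a)"
  using smoothed_riesz_mono[of s 0 v] smoothed_riesz_nonneg[of s v] by simp

lemma smoothed_riesz_sigma_integrable: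
  "s > 0 \<Longrightarrow> integrable sphere_sigma (\<lambda>y::'a. smoothed_riesz \<alpha> s (x - y))"
  by (rule finite_measure.integrable_const_bound[OF prob_space.finite_measure[OF prob_space_sphere_sigma], of _ "smoothed_riesz \<alpha> s (0::'a)"])
    (auto simp: smoothed_riesz_bound[simplified])

lemma profile_norm_measurable [measurable]: "(\<lambda>x::'a. riesz_profile DIM('a) \<alpha> (norm x)) \<in> borel_measurable borel"
  unfolding sphere_riesz_profile[symmetric] by measurable

lemma profile_gaussian_integrable:
  "integrable std_gaussian (\<lambda>z::'a. riesz_profile DIM('a) \<alpha> (norm (x + sqrt s *\<^sub>R z)))"
proof -
  interpret prob_space "std_gaussian :: 'a measure" by (rule prob_space_std_gaussian)
  show ?thesis
    by (rule integrable_const_bound[of _ "riesz_profile DIM('a) \<alpha> 1"])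
      (auto simp: riesz_profile_nonneg[OF dim \<alpha>] profile_le_profile_one)
qed

text \<open>Tonelli exchanges the sphere with the Gaussian, so the smoothed potential is an average
  of the profile. The upper bound, the limit as \<open>s\<close> tends to 0 and the decay at
  infinity are thereby inherited from the profile.\<close>

lemma sphere_pot_eq:
  assumes s: "s > 0"
  shows "sphere_pot \<alpha> s (x::'a) = riesz_const DIM('a) * (\<integral>z. riesz_profile DIM('a) \<alpha> (norm (x + sqrt s *\<^sub>R z)) \<partial>std_gaussian)"
proof -
  interpret \<sigma>: prob_space "sphere_sigma :: 'a measure" by (rule prob_space_sphere_sigma)
  interpret \<gamma>: prob_space "std_gaussian :: 'a measure" by (rule prob_space_std_gaussian)
  interpret P: pair_sigma_finite "sphere_sigma :: 'a measure" "std_gaussian :: 'a measure" ..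
  let ?c = "riesz_const DIM('a)"
  have c: "?c > 0" by (rule riesz_const_pos)
  have "ennreal (sphere_pot \<alpha> s x) = (\<integral>\<^sup>+y. ennreal (smoothed_riesz \<alpha> s (x - y)) \<partial>sphere_sigma)"
    unfolding sphere_pot_def using smoothed_riesz_nonneg[OF s]
    by (subst nn_integral_eq_integral[OF smoothed_riesz_sigma_integrable[OF s]]) auto
  also have "\<dots> = (\<integral>\<^sup>+y. ennreal ?c * (\<integral>\<^sup>+z. ennreal (norm ((x - y) + sqrt s *\<^sub>R z) powr (\<alpha> - real DIM('a))) \<partial>std_gaussian) \<partial>sphere_sigma)"
    by (simp only: smoothed_riesz_eq[OF s])
  also have "\<dots> = ennreal ?c * (\<integral>\<^sup>+y. (\<integral>\<^sup>+z. ennreal (norm ((x - y) + sqrt s *\<^sub>R z) powr (\<alpha> - real DIM('a))) \<partial>std_gaussian) \<partial>sphere_sigma)"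
    by (rule nn_integral_cmult) measurable
  also have "(\<integral>\<^sup>+y. (\<integral>\<^sup>+z. ennreal (norm ((x - y) + sqrt s *\<^sub>R z) powr (\<alpha> - real DIM('a))) \<partial>std_gaussian) \<partial>sphere_sigma)
    = (\<integral>\<^sup>+z. (\<integral>\<^sup>+y. ennreal (norm ((x - y) + sqrt s *\<^sub>R z) powr (\<alpha> - real DIM('a))) \<partial>sphere_sigma) \<partial>std_gaussian)"
    by (rule P.Fubini'[symmetric]) measurable
  also have "\<dots> = (\<integral>\<^sup>+z. ennreal (riesz_profile DIM('a) \<alpha> (norm (x + sqrt s *\<^sub>R z))) \<partial>std_gaussian)"
  proof (rule nn_integral_cong)
    fix z :: 'a
    have "(x - y) + sqrt s *\<^sub>R z = (x + sqrt s *\<^sub>R z) - y" for y by simp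
    then show "(\<integral>\<^sup>+y. ennreal (norm ((x - y) + sqrt s *\<^sub>R z) powr (\<alpha> - real DIM('a))) \<partial>sphere_sigma) = ennreal (riesz_profile DIM('a) \<alpha> (norm (x + sqrt s *\<^sub>R z)))"
      by (simp only: sphere_riesz_nn)
  qed
  also have "\<dots> = ennreal (\<integral>z. riesz_profile DIM('a) \<alpha> (norm (x + sqrt s *\<^sub>R z)) \<partial>std_gaussian)"
    by (rule nn_integral_eq_integral[OF profile_gaussian_integrable]) (simp add: riesz_profile_nonneg[OF dim \<alpha>])
  finally have "ennreal (sphere_pot \<alpha> s x) = ennreal (?c * (\<integral>z. riesz_profile DIM('a) \<alpha> (norm (x + sqrt s *\<^sub>R z)) \<partial>std_gaussian))"
    using c by (subst ennreal_mult') auto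
  moreover have "sphere_pot \<alpha> s x \<ge> 0"
    unfolding sphere_pot_def by (intro Bochner_Integration.integral_nonneg smoothed_riesz_nonneg s)
  moreover have "?c * (\<integral>z. riesz_profile DIM('a) \<alpha> (norm (x + sqrt s *\<^sub>R z)) \<partial>std_gaussian) \<ge> 0"
    using c by (intro mult_nonneg_nonneg Bochner_Integration.integral_nonneg riesz_profile_nonneg[OF dim \<alpha>]) auto
  ultimately show ?thesis by (simp only: ennreal_inj)
qed

lemma sphere_pot_nonneg: "s > 0 \<Longrightarrow> sphere_pot \<alpha> s (x::'a) \<ge> 0"
  unfolding sphere_pot_def by (intro Bochner_Integration.integral_nonneg smoothed_riesz_nonneg)

lemma sphere_pot_le:
  assumes "s > 0"
  shows "sphere_pot \<alpha> s (x::'a) \<le> riesz_const DIM('a) * riesz_profile DIM('a) \<alpha> 1"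
proof -
  interpret \<gamma>: prob_space "std_gaussian :: 'a measure" by (rule prob_space_std_gaussian)
  have "(\<integral>z. riesz_profile DIM('a) \<alpha> (norm (x + sqrt s *\<^sub>R z)) \<partial>std_gaussian) \<le> (\<integral>z. riesz_profile DIM('a) \<alpha> 1 \<partial>(std_gaussian :: 'a measure))"
    by (intro integral_mono profile_gaussian_integrable profile_le_profile_one) auto
  then show ?thesis
    unfolding sphere_pot_eq[OF assms] using riesz_const_pos \<gamma>.prob_space by (intro mult_left_mono) auto
qed

lemma sphere_pot_tendsto:
  assumes s: "\<And>n. s n > 0" "s \<longlonglongrightarrow> 0"
  shows "(\<lambda>n. sphere_pot \<alpha> (s n) (x::'a)) \<longlonglongrightarrow> riesz_const DIM('a) * riesz_profile DIM('a) \<alpha> (norm x)"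
proof -
  interpret \<gamma>: prob_space "std_gaussian :: 'a measure" by (rule prob_space_std_gaussian)
  have "(\<lambda>n. \<integral>z. riesz_profile DIM('a) \<alpha> (norm (x + sqrt (s n) *\<^sub>R z)) \<partial>std_gaussian) \<longlonglongrightarrow> (\<integral>z. riesz_profile DIM('a) \<alpha> (norm x) \<partial>(std_gaussian :: 'a measure))"
  proof (rule integral_dominated_convergence[where w="\<lambda>_. riesz_profile DIM('a) \<alpha> 1"])
    show "AE z in std_gaussian. (\<lambda>n. riesz_profile DIM('a) \<alpha> (norm (x + sqrt (s n) *\<^sub>R z))) \<longlonglongrightarrow> riesz_profile DIM('a) \<alpha> (norm x)"
    proof (rule AE_I2)
      fix z :: 'a
      have "(\<lambda>n. norm (x + sqrt (s n) *\<^sub>R z)) \<longlonglongrightarrow> norm (x + sqrt 0 *\<^sub>R z)"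
        by (intro tendsto_intros s)
      then have "(\<lambda>n. norm (x + sqrt (s n) *\<^sub>R z)) \<longlonglongrightarrow> norm x" by simp
      moreover have "\<forall>l X. (\<forall>n. X n \<in> {0..}) \<and> l \<in> {0..} \<and> X \<longlonglongrightarrow> l \<longrightarrow> (riesz_profile DIM('a) \<alpha> \<circ> X) \<longlonglongrightarrow> riesz_profile DIM('a) \<alpha> l"
        using riesz_profile_continuous[OF dim \<alpha>] unfolding continuous_on_sequentially by blast
      ultimately show "(\<lambda>n. riesz_profile DIM('a) \<alpha> (norm (x + sqrt (s n) *\<^sub>R z))) \<longlonglongrightarrow> riesz_profile DIM('a) \<alpha> (norm x)"
        by (auto simp: o_def)
    qed
  qed (auto simp: riesz_profile_nonneg[OF dim \<alpha>] profile_le_profile_one)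
  then show ?thesis
    unfolding sphere_pot_eq[OF s(1)] using \<gamma>.prob_space by (intro tendsto_mult_left) auto
qed

lemma profile_tendsto_0: "(riesz_profile DIM('a) \<alpha> \<longlongrightarrow> 0) at_top"
proof (rule tendsto_sandwich[of "\<lambda>_. 0" _ _ "\<lambda>r. r powr (\<alpha> - real DIM('a)) * riesz_profile DIM('a) \<alpha> 1"])
  show "eventually (\<lambda>r. riesz_profile DIM('a) \<alpha> r \<le> r powr (\<alpha> - real DIM('a)) * riesz_profile DIM('a) \<alpha> 1) at_top"
    using eventually_gt_at_top[of 0]
    by eventually_elim (subst profile_inverse, auto intro!: mult_left_mono profile_le_profile_one)
  show "((\<lambda>r. r powr (\<alpha> - real DIM('a)) * riesz_profile DIM('a) \<alpha> 1) \<longlongrightarrow> 0) at_top"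
    using dim \<alpha> by (intro tendsto_mult_left_zero tendsto_neg_powr filterlim_ident) auto
qed (auto simp: riesz_profile_nonneg[OF dim \<alpha>])

lemma sphere_pot_tendsto_0:
  assumes s: "s > 0" and x: "filterlim (\<lambda>n. norm (x n)) at_top sequentially"
  shows "(\<lambda>n. sphere_pot \<alpha> s (x n :: 'a)) \<longlonglongrightarrow> 0"
proof -
  interpret \<gamma>: prob_space "std_gaussian :: 'a measure" by (rule prob_space_std_gaussian)
  have "(\<lambda>n. \<integral>z. riesz_profile DIM('a) \<alpha> (norm (x n + sqrt s *\<^sub>R z)) \<partial>std_gaussian) \<longlonglongrightarrow> (\<integral>z. 0 \<partial>(std_gaussian :: 'a measure))"
  proof (rule integral_dominated_convergence[where w="\<lambda>_. riesz_profile DIM('a) \<alpha> 1"])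
    show "AE z in std_gaussian. (\<lambda>n. riesz_profile DIM('a) \<alpha> (norm (x n + sqrt s *\<^sub>R z))) \<longlonglongrightarrow> 0"
    proof (rule AE_I2)
      fix z :: 'a
      have "filterlim (\<lambda>n. - norm (sqrt s *\<^sub>R z) + norm (x n)) at_top sequentially"
        by (rule filterlim_tendsto_add_at_top[OF tendsto_const x])
      then have "filterlim (\<lambda>n. norm (x n + sqrt s *\<^sub>R z)) at_top sequentially"
      proof (rule filterlim_at_top_mono, intro always_eventually allI)
        fix n show "- norm (sqrt s *\<^sub>R z) + norm (x n) \<le> norm (x n + sqrt s *\<^sub>R z)"
          using norm_diff_ineq[of "x n" "sqrt s *\<^sub>R z"] by linarith
      qed
      then show "(\<lambda>n. riesz_profile DIM('a) \<alpha> (norm (x n + sqrt s *\<^sub>R z))) \<longlonglongrightarrow> 0"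
        by (rule filterlim_compose[OF profile_tendsto_0])
    qed
  qed (auto simp: riesz_profile_nonneg[OF dim \<alpha>] profile_le_profile_one)
  then have "(\<lambda>n. riesz_const DIM('a) * (\<integral>z. riesz_profile DIM('a) \<alpha> (norm (x n + sqrt s *\<^sub>R z)) \<partial>std_gaussian)) \<longlonglongrightarrow> riesz_const DIM('a) * 0"
    by (intro tendsto_mult_left) simp
  then show ?thesis unfolding sphere_pot_eq[OF s] by simp
qed

text \<open>Points of norm at most 2 are within distance 3 of the whole sphere, so by radial
  monotonicity one positive value at distance 3 is a common lower bound. It turns estimates of the
  potential into hitting estimates for \<open>ball 0 2\<close>, which contains the shells of width
  at most 1.\<close>

lemma sphere_pot_lower_bound:
  assumes s: "s > 0"
  obtains c where "c > 0" "\<And>x::'a. norm x \<le> 2 \<Longrightarrow> c \<le> sphere_pot \<alpha> s x"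
proof -
  interpret \<sigma>: prob_space "sphere_sigma :: 'a measure" by (rule prob_space_sphere_sigma)
  interpret \<gamma>: prob_space "std_gaussian :: 'a measure" by (rule prob_space_std_gaussian)
  obtain v :: 'a where v: "norm v = 3" using vector_choose_size[of 3] by auto
  have "smoothed_riesz \<alpha> s v \<noteq> 0"
  proof
    assume "smoothed_riesz \<alpha> s v = 0"
    then have "(\<integral>\<^sup>+z. ennreal (norm (v + sqrt s *\<^sub>R z) powr (\<alpha> - real DIM('a))) \<partial>std_gaussian) = 0"
      using smoothed_riesz_eq[OF s, of v] subord1_pos subord2_pos by auto
    then have "AE z in std_gaussian. v + sqrt s *\<^sub>R z = 0"
      by (subst (asm) nn_integral_0_iff_AE) auto
    then have "AE z in (lborel :: 'a measure). v + sqrt s *\<^sub>R z = 0"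
      unfolding std_gaussian_def by (subst (asm) AE_density) (auto elim!: eventually_mono)
    moreover have "AE z in (lborel :: 'a measure). z \<noteq> - (v /\<^sub>R sqrt s)" by (rule AE_lborel_singleton)
    ultimately have "AE z in (lborel :: 'a measure). False"
    proof eventually_elim
      case (elim z)
      have "sqrt s *\<^sub>R z = - v" using elim(1) by (simp add: eq_neg_iff_add_eq_0 add.commute)
      then have "(sqrt s *\<^sub>R z) /\<^sub>R sqrt s = - (v /\<^sub>R sqrt s)" by simp
      then show False using elim(2) s by simp
    qed
    then have "emeasure lborel (space (lborel :: 'a measure)) = 0"
      unfolding eventually_False ae_filter_eq_bot_iff .
    then show False by simp
  qed
  then have c: "smoothed_riesz \<alpha> s v > 0" using smoothed_riesz_nonneg[OF s, of v] by simp
  show thesis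
  proof
    show "smoothed_riesz \<alpha> s v > 0" by fact
    fix x :: 'a assume x: "norm x \<le> 2"
    have "AE y in sphere_sigma. smoothed_riesz \<alpha> s v \<le> smoothed_riesz \<alpha> s (x - y)"
      using AE_sphere_sigma[where 'a='a]
    proof eventually_elim
      case (elim y)
      then show ?case using x v norm_triangle_ineq4[of x y] by (intro smoothed_riesz_mono s) auto
    qed
    then have "(\<integral>y. smoothed_riesz \<alpha> s v \<partial>(sphere_sigma :: 'a measure)) \<le> sphere_pot \<alpha> s x"
      unfolding sphere_pot_def by (intro integral_mono_AE smoothed_riesz_sigma_integrable s) auto
    then show "smoothed_riesz \<alpha> s v \<le> sphere_pot \<alpha> s x" using \<sigma>.prob_space by simp
  qed
qed

lemma heat_kernel_le: "s > 0 \<Longrightarrow> norm (heat_kernel s (v::'a)) \<le> (2 * pi * s) powr (- real DIM('a) / 2)"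
  by (simp add: heat_kernel_def abs_mult mult_left_le)

lemma heat_kernel_sigma_integrable: "s > 0 \<Longrightarrow> integrable sphere_sigma (\<lambda>y::'a. heat_kernel s (x - y))"
  by (rule finite_measure.integrable_const_bound[OF prob_space.finite_measure[OF prob_space_sphere_sigma], of _ "(2 * pi * s) powr (- real DIM('a) / 2)"])
    (auto simp: heat_kernel_le[simplified])

lemma sphere_heat_nonneg: "sphere_heat s (x::'a) \<ge> 0"
  unfolding sphere_heat_def by (intro Bochner_Integration.integral_nonneg heat_kernel_nonneg)

text \<open>Away from the sphere the process loses hardly any smoothed potential: for fixed \<delta>
  the bound vanishes as \<open>s\<close> tends to 0, by
  \<open>gaussian_far_tendsto_0\<close>.\<close>

lemma sphere_heat_far:
  assumes s: "s > 0" and \<delta>: "\<delta> > 0" "\<delta> \<le> \<bar>norm (x::'a) - 1\<bar>"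
  shows "sphere_heat s x \<le> (2 * pi * s) powr (- real DIM('a) / 2) * exp (- \<delta>\<^sup>2 / (2 * s))"
proof -
  interpret \<sigma>: prob_space "sphere_sigma :: 'a measure" by (rule prob_space_sphere_sigma)
  have "AE y in sphere_sigma. heat_kernel s (x - y) \<le> (2 * pi * s) powr (- real DIM('a) / 2) * exp (- \<delta>\<^sup>2 / (2 * s))"
    using AE_sphere_sigma[where 'a='a]
  proof eventually_elim
    case (elim y)
    have "\<delta> \<le> norm (x - y)" using \<delta>(2) norm_triangle_ineq3[of x y] elim by simp
    then have "\<delta>\<^sup>2 \<le> (norm (x - y))\<^sup>2" using \<delta>(1) by (intro power_mono) auto
    then show ?case unfolding heat_kernel_def using s by (intro mult_left_mono) (auto simp: divide_right_mono)
  qed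
  then have "sphere_heat s x \<le> (\<integral>y. (2 * pi * s) powr (- real DIM('a) / 2) * exp (- \<delta>\<^sup>2 / (2 * s)) \<partial>(sphere_sigma :: 'a measure))"
    unfolding sphere_heat_def by (intro integral_mono_AE heat_kernel_sigma_integrable s) auto
  then show ?thesis using \<sigma>.prob_space by simp
qed

lemma gaussian_far_tendsto_0:
  fixes \<delta> d :: real
  assumes "\<delta> > 0" "d > 0"
  shows "((\<lambda>s. (2 * pi * s) powr (- d / 2) * exp (- \<delta>\<^sup>2 / (2 * s))) \<longlongrightarrow> 0) (at_right 0)"
proof -
  have "\<delta>\<^sup>2 / 2 > 0" "d / 2 > 0" using assms by auto
  then have "((\<lambda>s. s powr (- (d / 2)) * exp (- (\<delta>\<^sup>2 / 2) / s)) \<longlongrightarrow> 0) (at_right 0)"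
    by real_asymp
  then have "((\<lambda>s. (2 * pi) powr (- d / 2) * (s powr (- (d / 2)) * exp (- (\<delta>\<^sup>2 / 2) / s))) \<longlongrightarrow> 0) (at_right 0)"
    by (rule tendsto_mult_right_zero)
  moreover have "eventually (\<lambda>s. (2 * pi) powr (- d / 2) * (s powr (- (d / 2)) * exp (- (\<delta>\<^sup>2 / 2) / s)) = (2 * pi * s) powr (- d / 2) * exp (- \<delta>\<^sup>2 / (2 * s))) (at_right 0)"
    using eventually_at_right_less[of "0::real"] by eventually_elim (simp add: powr_mult)
  ultimately show ?thesis by (rule Lim_transform_eventually)
qed

text \<open>A cap of height \<open>s\<close> has radius of order \<open>sqrt s\<close> in
  \<open>d - 1\<close> dimensions, whence the exponent.\<close>

lemma sphere_cap_lower: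
  obtains K where "K > 0" "\<And>(e::'a) s. norm e = 1 \<Longrightarrow> 0 < s \<Longrightarrow> s < 1 \<Longrightarrow>
    K * s powr ((real DIM('a) - 1) / 2) \<le> measure sphere_sigma {y. 1 - s \<le> y \<bullet> e}"
proof -
  interpret \<sigma>: prob_space "sphere_sigma :: 'a measure" by (rule prob_space_sphere_sigma)
  define B where "B = Beta (1/2) ((real DIM('a) - 1) / 2)"
  have B: "B > 0" unfolding B_def using dim by (intro Beta_pos) auto
  define a where "a = (real DIM('a) - 3) / 2"
  have a: "a \<ge> - 1/2" "a > -1" using dim by (auto simp: a_def field_simps)
  have a1: "a + 1 = (real DIM('a) - 1) / 2" by (simp add: a_def field_simps)
  \<comment> \<open>On the cap \<open>1 + t\<close> lies between 1 and 2 and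
    \<open>a \<ge> - 1/2\<close>, which gives the factor \<open>2 powr (- 1/2)\<close>;
    \<open>1 / B\<close> normalises the zonal density and \<open>1 / (a + 1)\<close> comes from
    integrating \<open>u powr a\<close>.\<close>
  define K where "K = 2 powr (- 1/2) / B / (a + 1)"
  show thesis
  proof
    show "K > 0" using a B by (simp add: K_def)
    fix e :: 'a and s :: real assume e: "norm e = 1" and s: "0 < s" "s < 1"
    have I: "(\<integral>\<^sup>+u. ennreal (u powr a) * indicator {0<..<s} u \<partial>lborel) = ennreal (s powr (a + 1) / (a + 1))"
    proof (rule nn_integral_eq_has_integral_pos)
      show "((\<lambda>u. u powr a) has_integral s powr (a + 1) / (a + 1)) {0<..<s}"
        unfolding has_integral_Icc_iff_Ioo[symmetric] using a s by (intro has_integral_powr_from_0) auto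
    qed auto
    have "ennreal (K * s powr ((real DIM('a) - 1) / 2)) = ennreal (2 powr (- 1/2) / B) * ennreal (s powr (a + 1) / (a + 1))"
      using a B unfolding K_def a1[symmetric] by (subst ennreal_mult'[symmetric]) auto
    also have "\<dots> = (\<integral>\<^sup>+u. ennreal (2 powr (- 1/2) / B) * (ennreal (u powr a) * indicator {0<..<s} u) \<partial>lborel)"
      unfolding I[symmetric] by (rule nn_integral_cmult[symmetric]) measurable
    also have "\<dots> = (\<integral>\<^sup>+t. ennreal (2 powr (- 1/2) / B) * (ennreal ((1 - t) powr a) * indicator {0<..<s} (1 - t)) \<partial>lborel)"
      by (subst nn_integral_real_affine[where c="-1" and t=1]) auto
    also have "\<dots> \<le> (\<integral>\<^sup>+t. indicator {1 - s..} t * ennreal (zonal_density DIM('a) t) \<partial>lborel)"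
    proof (rule nn_integral_mono)
      fix t :: real
      show "ennreal (2 powr (- 1/2) / B) * (ennreal ((1 - t) powr a) * indicator {0<..<s} (1 - t)) \<le> indicator {1 - s..} t * ennreal (zonal_density DIM('a) t)"
      proof (cases "1 - t \<in> {0<..<s}")
        case True
        then have t: "0 < t" "t < 1" "1 - s \<le> t" using s by auto
        have "2 powr (- 1/2) \<le> (1 + t) powr (- 1/2)" using t by (intro powr_mono2') auto
        also have "\<dots> \<le> (1 + t) powr a" using t a by (intro powr_mono) auto
        finally have "2 powr (- 1/2) * (1 - t) powr a \<le> (1 + t) powr a * (1 - t) powr a" by (intro mult_right_mono) auto
        also have "\<dots> = (1 - t\<^sup>2) powr a"
          using t powr_mult[of "1 + t" "1 - t" a] by (simp add: power2_eq_square algebra_simps)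
        finally have "2 powr (- 1/2) / B * (1 - t) powr a \<le> (1 - t\<^sup>2) powr a / B"
          using B by (simp add: divide_right_mono)
        also have "\<dots> = zonal_density DIM('a) t" using t by (simp add: zonal_density_def B_def a_def)
        finally have "ennreal (2 powr (- 1/2) / B * (1 - t) powr a) \<le> ennreal (zonal_density DIM('a) t)" by (rule ennreal_leI)
        moreover have "ennreal (2 powr (- 1/2) / B) * ennreal ((1 - t) powr a) = ennreal (2 powr (- 1/2) / B * (1 - t) powr a)"
          using B by (subst ennreal_mult') auto
        ultimately show ?thesis using True t by simp
      qed simp
    qed
    also have "\<dots> = (\<integral>\<^sup>+y. indicator {1 - s..} (y \<bullet> e) \<partial>sphere_sigma)"
      by (rule nn_integral_zonal[OF dim e, symmetric]) measurable
    also have "\<dots> = (\<integral>\<^sup>+y. indicator {y. 1 - s \<le> y \<bullet> e} y \<partial>sphere_sigma)"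
      by (intro nn_integral_cong) (auto split: split_indicator)
    also have "\<dots> = emeasure sphere_sigma {y. 1 - s \<le> y \<bullet> e}"
      by (rule nn_integral_indicator) measurable
    also have "\<dots> = ennreal (measure sphere_sigma {y. 1 - s \<le> y \<bullet> e})"
      by (rule \<sigma>.emeasure_eq_measure)
    finally show "K * s powr ((real DIM('a) - 1) / 2) \<le> measure sphere_sigma {y. 1 - s \<le> y \<bullet> e}"
      by (simp add: ennreal_le_iff)
  qed
qed

text \<open>The sphere has codimension one: the height \<open>s powr (- d / 2)\<close> of the heat
  kernel times a cap of size \<open>s powr ((d - 1) / 2)\<close> gives
  \<open>s powr (- 1/2)\<close>, which is unbounded as \<open>s\<close> tends to 0. Since the
  expected total heat is bounded, the time spent near the sphere must be short.\<close>

lemma sphere_heat_near: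
  obtains s \<delta> where "s > 0" "\<delta> > 0" "\<And>x::'a. \<bar>norm x - 1\<bar> < \<delta> \<Longrightarrow> R \<le> sphere_heat s x"
proof -
  interpret \<sigma>: prob_space "sphere_sigma :: 'a measure" by (rule prob_space_sphere_sigma)
  obtain K where K: "K > 0" "\<And>(e::'a) s. norm e = 1 \<Longrightarrow> 0 < s \<Longrightarrow> s < 1 \<Longrightarrow>
    K * s powr ((real DIM('a) - 1) / 2) \<le> measure sphere_sigma {y. 1 - s \<le> y \<bullet> e}" using sphere_cap_lower by blast
  \<comment> \<open>In the shell of width \<open>sqrt s\<close> and for \<open>y\<close> in the cap,
    \<open>norm (x - y) \<le> 3 * sqrt s\<close>; hence the Gaussian exponent is at least
    \<open>- 9/2\<close>.\<close>
  define J where "J = (2 * pi) powr (- real DIM('a) / 2) * exp (- 9/2) * K"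
  have J: "J > 0" using K by (simp add: J_def)
  then have "filterlim (\<lambda>s. J * s powr (- 1/2)) at_top (at_right 0)" by real_asymp
  then have "eventually (\<lambda>s. R \<le> J * s powr (- 1/2)) (at_right 0)" by (simp add: filterlim_at_top)
  moreover have "eventually (\<lambda>s. s \<in> {0<..<1}) (at_right (0::real))" by (intro eventually_at_right_field[THEN iffD2] exI[of _ 1]) auto
  ultimately have "eventually (\<lambda>s. R \<le> J * s powr (- 1/2) \<and> s \<in> {0<..<1}) (at_right (0::real))" by (rule eventually_conj)
  then obtain s where s: "R \<le> J * s powr (- 1/2)" "0 < s" "s < 1"
    using eventually_happens'[of "at_right (0::real)"] by auto
  show thesis
  proof
    show "s > 0" "sqrt s > 0" using s by auto
    fix x :: 'a assume x: "\<bar>norm x - 1\<bar> < sqrt s"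
    have "sqrt s < 1" using s by simp
    then have nx: "norm x > 0" using x by (cases "x = 0") auto
    define e where "e = x /\<^sub>R norm x"
    have e: "norm e = 1" using nx by (simp add: e_def)
    have "x - e = (norm x - 1) *\<^sub>R e" using nx by (simp add: e_def algebra_simps)
    then have xe: "norm (x - e) \<le> sqrt s" using x e by simp
    define c where "c = (2 * pi * s) powr (- real DIM('a) / 2) * exp (- 9/2)"
    have "AE y in sphere_sigma. c * indicator {y. 1 - s \<le> y \<bullet> e} y \<le> heat_kernel s (x - y)"
      using AE_sphere_sigma[where 'a='a]
    proof eventually_elim
      case (elim y)
      show ?case
      proof (cases "1 - s \<le> y \<bullet> e")
        case True
        have "(norm (e - y))\<^sup>2 = (norm e)\<^sup>2 + (norm y)\<^sup>2 - 2 * (y \<bullet> e)"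
          unfolding power2_norm_eq_inner by (simp add: inner_diff_left inner_diff_right inner_commute)
        also have "\<dots> \<le> (2 * sqrt s)\<^sup>2" using True s e elim by (simp add: power_mult_distrib)
        finally have "norm (e - y) \<le> 2 * sqrt s" using s by (intro power2_le_imp_le[of "norm (e - y)"]) auto
        then have "norm (x - y) \<le> 3 * sqrt s" using xe norm_triangle_ineq[of "x - e" "e - y"] by simp
        then have "(norm (x - y))\<^sup>2 \<le> (3 * sqrt s)\<^sup>2" by (intro power_mono) auto
        also have "\<dots> = 9 * s" using s by (simp add: power_mult_distrib)
        finally have "(norm (x - y))\<^sup>2 / (2 * s) \<le> 9/2" using s by (simp add: field_simps)
        then show ?thesis using True unfolding c_def heat_kernel_def by (simp add: mult_left_mono)
      qed (simp add: heat_kernel_nonneg)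
    qed
    then have "(\<integral>y. c * indicator {y. 1 - s \<le> y \<bullet> e} y \<partial>sphere_sigma) \<le> sphere_heat s x"
      unfolding sphere_heat_def
      by (intro integral_mono_AE heat_kernel_sigma_integrable s integrable_mult_right)
        (auto intro!: integrable_real_indicator simp: \<sigma>.emeasure_eq_measure)
    then have "c * measure sphere_sigma {y. 1 - s \<le> y \<bullet> e} \<le> sphere_heat s x" by simp
    moreover have "c * (K * s powr ((real DIM('a) - 1) / 2)) \<le> c * measure sphere_sigma {y. 1 - s \<le> y \<bullet> e}"
      using K(2)[OF e s(2,3)] by (intro mult_left_mono) (auto simp: c_def)
    moreover have "c * (K * s powr ((real DIM('a) - 1) / 2)) = J * s powr (- 1/2)"
    proof -
      have E1: "s powr (- real DIM('a) / 2) * s powr ((real DIM('a) - 1) / 2) = s powr (- 1/2)"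
        unfolding powr_add[symmetric] by (simp add: diff_divide_distrib)
      have E2: "(2 * pi * s) powr (- real DIM('a) / 2) = (2 * pi) powr (- real DIM('a) / 2) * s powr (- real DIM('a) / 2)"
        using s powr_mult[of "2 * pi" s] by simp
      show ?thesis unfolding c_def J_def E2 E1[symmetric] by (simp only: mult_ac)
    qed
    ultimately show "R \<le> sphere_heat s x" using s(1) by linarith
  qed
qed

end

section \<open>Short-time expansion, decay in time and tails of increments\<close>

lemma one_minus_exp_ge:
  fixes x :: real assumes "x \<ge> 0" shows "x - x\<^sup>2 \<le> 1 - exp (- x)" "1 - exp (- x) \<le> x"
proof -
  show "1 - exp (- x) \<le> x" using exp_ge_add_one_self[of "- x"] by simp
  have "(1 + x) * exp (- x) \<le> 1"
    using exp_ge_add_one_self[of x] mult_right_mono[of "1 + x" "exp x" "exp (- x)"] by (simp add: exp_minus)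
  moreover have "(1 + x) * (1 - x + x\<^sup>2) \<ge> 1" using assms by (simp add: power2_eq_square algebra_simps)
  ultimately have "(1 + x) * exp (- x) \<le> (1 + x) * (1 - x + x\<^sup>2)" by linarith
  then have "exp (- x) \<le> 1 - x + x\<^sup>2" using assms by simp
  then show "x - x\<^sup>2 \<le> 1 - exp (- x)" by simp
qed

context stable_index
begin

lemma smoothed_riesz_average:
  fixes D :: "'w \<Rightarrow> 'a"
  assumes M: "prob_space M" and D[measurable]: "D \<in> borel_measurable M"
    and char: "\<And>\<xi>. (\<integral>w. cis (\<xi> \<bullet> D w) \<partial>M) = complex_of_real (exp (- \<tau> * norm \<xi> powr \<alpha>))"
    and s: "s > 0"
  shows "(\<integral>w. smoothed_riesz \<alpha> s (v + D w) \<partial>M) = (\<integral>\<xi>. cos (\<xi> \<bullet> v) * (exp (- \<tau> * norm \<xi> powr \<alpha>) * (norm \<xi> powr (- \<alpha>) * exp (- s * (norm \<xi>)\<^sup>2 / 2))) \<partial>lborel) / (2 * pi) ^ DIM('a)"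
  unfolding smoothed_riesz_def
  using fourier_average[OF M D char smoothed_riesz_integrable[OF s], of v] by simp

text \<open>Under the integral this expands \<open>(exp (- \<tau> * a) - 1) / a\<close> with
  \<open>a = norm \<xi> powr \<alpha>\<close>: the leading term \<open>- \<tau>\<close> leaves the
  pure Gaussian, that is the heat kernel, and the remainder is at most
  \<open>\<tau>\<^sup>2 * a\<close>, integrable against the Gaussian. The error is quadratic in
  \<tau> and uniform in \<open>v\<close>, so it disappears when summed over a fine time
  grid.\<close>

lemma smoothed_riesz_generator:
  fixes v :: 'a
  assumes s: "s > 0" and \<tau>: "\<tau> \<ge> 0"
  defines "C \<equiv> (\<integral>\<xi>. norm (\<xi>::'a) powr \<alpha> * exp (- s * (norm \<xi>)\<^sup>2 / 2) \<partial>lborel) / (2 * pi) ^ DIM('a)"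
  shows "\<bar>(\<integral>\<xi>. cos (\<xi> \<bullet> v) * (exp (- \<tau> * norm \<xi> powr \<alpha>) * (norm \<xi> powr (- \<alpha>) * exp (- s * (norm \<xi>)\<^sup>2 / 2))) \<partial>lborel) / (2 * pi) ^ DIM('a)
      - smoothed_riesz \<alpha> s v + \<tau> * heat_kernel s v\<bar> \<le> C * \<tau>\<^sup>2"
proof -
  define e where "e \<xi> = exp (- s * (norm \<xi>)\<^sup>2 / 2)" for \<xi> :: 'a
  define n where "n \<xi> = norm \<xi> powr (- \<alpha>)" for \<xi> :: 'a
  define E where "E \<xi> = exp (- \<tau> * norm \<xi> powr \<alpha>)" for \<xi> :: 'a
  define c where "c = (2 * pi) ^ DIM('a)"
  have c: "c > 0" by (simp add: c_def)
  have [measurable]: "e \<in> borel_measurable borel" "n \<in> borel_measurable borel" "E \<in> borel_measurable borel"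
    unfolding e_def n_def E_def by measurable
  have E1: "0 \<le> E \<xi>" "E \<xi> \<le> 1" for \<xi> using \<tau> by (auto simp: E_def)
  have cosb: "\<bar>cos t * x\<bar> \<le> \<bar>x\<bar>" for t x :: real by (simp add: abs_mult mult_left_le_one_le)
  have i1: "integrable lborel (\<lambda>\<xi>. cos (\<xi> \<bullet> v) * (n \<xi> * e \<xi>))"
    by (rule Bochner_Integration.integrable_bound[OF smoothed_riesz_integrable[OF s]])
      (measurable, rule AE_I2, simp add: n_def e_def abs_mult mult_left_le_one_le)
  have i2: "integrable lborel (\<lambda>\<xi>. cos (\<xi> \<bullet> v) * (E \<xi> * (n \<xi> * e \<xi>)))"
  proof (rule Bochner_Integration.integrable_bound[OF smoothed_riesz_integrable[OF s]])
    show "AE \<xi> in lborel. norm (cos (\<xi> \<bullet> v) * (E \<xi> * (n \<xi> * e \<xi>))) \<le> norm (norm \<xi> powr - \<alpha> * exp (- s * (norm \<xi>)\<^sup>2 / 2))"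
    proof (rule AE_I2)
      fix \<xi> :: 'a
      have "\<bar>cos (\<xi> \<bullet> v) * (E \<xi> * (n \<xi> * e \<xi>))\<bar> \<le> \<bar>E \<xi> * (n \<xi> * e \<xi>)\<bar>" by (rule cosb)
      also have "\<dots> \<le> n \<xi> * e \<xi>" using E1[of \<xi>] by (simp add: abs_mult n_def e_def mult_left_le_one_le)
      finally show "norm (cos (\<xi> \<bullet> v) * (E \<xi> * (n \<xi> * e \<xi>))) \<le> norm (norm \<xi> powr - \<alpha> * exp (- s * (norm \<xi>)\<^sup>2 / 2))"
        by (simp add: n_def e_def)
    qed
  qed measurable
  have i3: "integrable lborel (\<lambda>\<xi>. cos (\<xi> \<bullet> v) * e \<xi>)"
    by (rule Bochner_Integration.integrable_bound[OF integrable_gaussian[OF s]])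
      (measurable, rule AE_I2, simp add: e_def abs_mult mult_left_le_one_le)
  have i4: "integrable lborel (\<lambda>\<xi>::'a. norm \<xi> powr \<alpha> * e \<xi>)"
    unfolding e_def using \<alpha> s by (intro integrable_radial_powr_gaussian) auto
  have "(\<integral>\<xi>. cos (\<xi> \<bullet> v) * (E \<xi> * (n \<xi> * e \<xi>)) \<partial>lborel) / c - smoothed_riesz \<alpha> s v + \<tau> * heat_kernel s v
    = (\<integral>\<xi>. cos (\<xi> \<bullet> v) * (E \<xi> * (n \<xi> * e \<xi>)) - cos (\<xi> \<bullet> v) * (n \<xi> * e \<xi>) + \<tau> * (cos (\<xi> \<bullet> v) * e \<xi>) \<partial>lborel) / c"
  proof -
    have "smoothed_riesz \<alpha> s v = (\<integral>\<xi>. cos (\<xi> \<bullet> v) * (n \<xi> * e \<xi>) \<partial>lborel) / c"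
      by (simp add: smoothed_riesz_def n_def e_def c_def)
    moreover have "heat_kernel s v = (\<integral>\<xi>. cos (\<xi> \<bullet> v) * e \<xi> \<partial>lborel) / c"
      unfolding e_def heat_kernel_fourier[OF s] c_def by simp
    ultimately show ?thesis using i1 i2 i3 by (simp add: add_divide_distrib diff_divide_distrib)
  qed
  also have "\<bar>\<dots>\<bar> \<le> (\<integral>\<xi>. \<tau>\<^sup>2 * (norm (\<xi>::'a) powr \<alpha> * e \<xi>) \<partial>lborel) / c"
  proof -
    let ?F = "\<lambda>\<xi>. cos (\<xi> \<bullet> v) * (E \<xi> * (n \<xi> * e \<xi>)) - cos (\<xi> \<bullet> v) * (n \<xi> * e \<xi>) + \<tau> * (cos (\<xi> \<bullet> v) * e \<xi>)"
    have "\<bar>integral\<^sup>L lborel ?F\<bar> \<le> (\<integral>\<xi>. \<bar>?F \<xi>\<bar> \<partial>lborel)" by (rule integral_abs_bound)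
    also have "\<dots> \<le> (\<integral>\<xi>. \<tau>\<^sup>2 * (norm (\<xi>::'a) powr \<alpha> * e \<xi>) \<partial>lborel)"
    proof (rule integral_mono_AE)
      show "integrable lborel (\<lambda>\<xi>. \<bar>?F \<xi>\<bar>)"
        by (intro integrable_abs Bochner_Integration.integrable_add Bochner_Integration.integrable_diff integrable_mult_right i1 i2 i3)
      show "integrable lborel (\<lambda>\<xi>::'a. \<tau>\<^sup>2 * (norm \<xi> powr \<alpha> * e \<xi>))" by (intro integrable_mult_right i4)
      have main: "\<bar>E \<xi> * n \<xi> - n \<xi> + \<tau>\<bar> \<le> \<tau>\<^sup>2 * norm \<xi> powr \<alpha>" if "\<xi> \<noteq> 0" for \<xi>
      proof -
        define a where "a = norm \<xi> powr \<alpha>"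
        have a: "a > 0" "n \<xi> = 1 / a" using that by (auto simp: a_def n_def powr_minus_divide)
        have "\<tau> * a - (\<tau> * a)\<^sup>2 \<le> 1 - E \<xi>" "1 - E \<xi> \<le> \<tau> * a"
          using one_minus_exp_ge[of "\<tau> * a"] \<tau> a by (auto simp: E_def a_def)
        then have "0 \<le> (E \<xi> - 1 + \<tau> * a) / a" "(E \<xi> - 1 + \<tau> * a) / a \<le> (\<tau> * a)\<^sup>2 / a"
          using a by (auto intro!: divide_right_mono)
        moreover have "E \<xi> * n \<xi> - n \<xi> + \<tau> = (E \<xi> - 1 + \<tau> * a) / a" using a by (simp add: field_simps)
        moreover have "(\<tau> * a)\<^sup>2 / a = \<tau>\<^sup>2 * norm \<xi> powr \<alpha>" using a by (simp add: power2_eq_square a_def[symmetric])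
        ultimately show ?thesis by simp
      qed
      show "AE \<xi> in lborel. \<bar>?F \<xi>\<bar> \<le> \<tau>\<^sup>2 * (norm \<xi> powr \<alpha> * e \<xi>)"
        using AE_lborel_singleton[of "0::'a"]
      proof eventually_elim
        case (elim \<xi>)
        have "?F \<xi> = cos (\<xi> \<bullet> v) * ((E \<xi> * n \<xi> - n \<xi> + \<tau>) * e \<xi>)" by (simp add: algebra_simps)
        then have "\<bar>?F \<xi>\<bar> \<le> \<bar>(E \<xi> * n \<xi> - n \<xi> + \<tau>) * e \<xi>\<bar>" using cosb[of "\<xi> \<bullet> v"] by simp
        also have "\<dots> = \<bar>E \<xi> * n \<xi> - n \<xi> + \<tau>\<bar> * e \<xi>" by (simp add: abs_mult e_def)
        also have "\<dots> \<le> (\<tau>\<^sup>2 * norm \<xi> powr \<alpha>) * e \<xi>"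
          by (intro mult_right_mono main elim) (simp add: e_def)
        finally show ?case by (simp add: mult.assoc)
      qed
    qed
    finally have "\<bar>integral\<^sup>L lborel ?F\<bar> \<le> (\<integral>\<xi>. \<tau>\<^sup>2 * (norm (\<xi>::'a) powr \<alpha> * e \<xi>) \<partial>lborel)" .
    then show ?thesis using c by (simp add: divide_right_mono)
  qed
  also have "\<dots> = C * \<tau>\<^sup>2" unfolding C_def e_def c_def by simp
  finally show ?thesis unfolding E_def n_def e_def c_def .
qed

end

context stable_index
begin

definition generator_error :: "real \<Rightarrow> 'a itself \<Rightarrow> real" where
  "generator_error s T = (\<integral>\<xi>. norm (\<xi>::'a) powr \<alpha> * exp (- s * (norm \<xi>)\<^sup>2 / 2) \<partial>lborel) / (2 * pi) ^ DIM('a)"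

lemma sphere_pot_average:
  fixes D :: "'w \<Rightarrow> 'a"
  assumes M: "prob_space M" and D[measurable]: "D \<in> borel_measurable M" and s: "s > 0"
  shows "(\<integral>w. sphere_pot \<alpha> s (x + D w) \<partial>M) = (\<integral>y. (\<integral>w. smoothed_riesz \<alpha> s ((x - y) + D w) \<partial>M) \<partial>sphere_sigma)"
    and "integrable sphere_sigma (\<lambda>y. \<integral>w. smoothed_riesz \<alpha> s ((x - y) + D w) \<partial>M)"
proof -
  interpret prob_space M by fact
  interpret \<sigma>: prob_space "sphere_sigma :: 'a measure" by (rule prob_space_sphere_sigma)
  interpret P: pair_prob_space M "sphere_sigma :: 'a measure" ..
  have i: "integrable (M \<Otimes>\<^sub>M sphere_sigma) (\<lambda>(w, y). smoothed_riesz \<alpha> s ((x - y) + D w))"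
    by (rule P.integrable_const_bound[of _ "smoothed_riesz \<alpha> s (0::'a)"])
      (rule AE_I2, simp add: case_prod_unfold smoothed_riesz_bound[OF s, simplified], measurable)
  have "(\<integral>w. sphere_pot \<alpha> s (x + D w) \<partial>M) = (\<integral>w. (\<integral>y. smoothed_riesz \<alpha> s ((x - y) + D w) \<partial>sphere_sigma) \<partial>M)"
    unfolding sphere_pot_def by (intro Bochner_Integration.integral_cong refl arg_cong[where f="smoothed_riesz \<alpha> s"]) simp
  also have "\<dots> = (\<integral>y. (\<integral>w. smoothed_riesz \<alpha> s ((x - y) + D w) \<partial>M) \<partial>sphere_sigma)"
    by (rule P.Fubini_integral[OF i, symmetric])
  finally show "(\<integral>w. sphere_pot \<alpha> s (x + D w) \<partial>M) = (\<integral>y. (\<integral>w. smoothed_riesz \<alpha> s ((x - y) + D w) \<partial>M) \<partial>sphere_sigma)" .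
  show "integrable sphere_sigma (\<lambda>y. \<integral>w. smoothed_riesz \<alpha> s ((x - y) + D w) \<partial>M)"
    by (rule P.integrable_snd[OF i])
qed

lemma sphere_pot_generator:
  fixes D :: "'w \<Rightarrow> 'a"
  assumes M: "prob_space M" and D[measurable]: "D \<in> borel_measurable M"
    and char: "\<And>\<xi>. (\<integral>w. cis (\<xi> \<bullet> D w) \<partial>M) = complex_of_real (exp (- \<tau> * norm \<xi> powr \<alpha>))"
    and s: "s > 0" and \<tau>: "\<tau> \<ge> 0"
  shows "\<bar>(\<integral>w. sphere_pot \<alpha> s (x + D w) \<partial>M) - sphere_pot \<alpha> s x + \<tau> * sphere_heat s x\<bar> \<le> generator_error s TYPE('a) * \<tau>\<^sup>2"
proof -
  interpret \<sigma>: prob_space "sphere_sigma :: 'a measure" by (rule prob_space_sphere_sigma)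
  let ?A = "\<lambda>y. \<integral>w. smoothed_riesz \<alpha> s ((x - y) + D w) \<partial>M"
  note iA = sphere_pot_average(2)[OF M D s, of x]
  note ik = smoothed_riesz_sigma_integrable[OF s, of x]
  note ih = heat_kernel_sigma_integrable[OF s, of x]
  let ?F = "\<lambda>y. ?A y - smoothed_riesz \<alpha> s (x - y) + \<tau> * heat_kernel s (x - y)"
  have iF: "integrable sphere_sigma ?F"
    by (intro Bochner_Integration.integrable_add Bochner_Integration.integrable_diff integrable_mult_right iA ik ih)
  have "(\<integral>w. sphere_pot \<alpha> s (x + D w) \<partial>M) - sphere_pot \<alpha> s x + \<tau> * sphere_heat s x = integral\<^sup>L sphere_sigma ?F"
    unfolding sphere_pot_average(1)[OF M D s] unfolding sphere_pot_def sphere_heat_def using iA ik ih by simp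
  also have "\<bar>\<dots>\<bar> \<le> (\<integral>y. \<bar>?F y\<bar> \<partial>sphere_sigma)" by (rule integral_abs_bound)
  also have "\<dots> \<le> (\<integral>y. generator_error s TYPE('a) * \<tau>\<^sup>2 \<partial>(sphere_sigma :: 'a measure))"
  proof (intro integral_mono integrable_abs iF)
    fix y :: 'a
    show "\<bar>?F y\<bar> \<le> generator_error s TYPE('a) * \<tau>\<^sup>2"
      unfolding smoothed_riesz_average[OF M D char s] generator_error_def by (rule smoothed_riesz_generator[OF s \<tau>])
  qed simp
  also have "\<dots> = generator_error s TYPE('a) * \<tau>\<^sup>2" using \<sigma>.prob_space by simp
  finally show ?thesis .
qed

text \<open>Cosine and Gaussian are bounded by 1, which leaves the integral of \<open>norm \<xi>
  powr (- \<alpha>) * exp (- \<tau> * norm \<xi> powr \<alpha>)\<close>; it converges because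
  \<alpha> < d and scales in \<tau> as claimed. The constant is independent of \<open>s\<close>, so
  that \<open>s\<close> may tend to 0 before the time tends to infinity.\<close>

lemma sphere_pot_decay:
  obtains K :: real where "\<And>(M :: 'w measure) (D :: 'w \<Rightarrow> 'a) (\<tau>::real) (s::real) (x::'a). prob_space M \<Longrightarrow> D \<in> borel_measurable M \<Longrightarrow>
    (\<And>\<xi>. (\<integral>w. cis (\<xi> \<bullet> D w) \<partial>M) = complex_of_real (exp (- \<tau> * norm \<xi> powr \<alpha>))) \<Longrightarrow> s > 0 \<Longrightarrow> \<tau> > 0 \<Longrightarrow>
    (\<integral>w. sphere_pot \<alpha> s (x + D w) \<partial>M) \<le> K * \<tau> powr (- ((real DIM('a) - \<alpha>) / \<alpha>))"
proof -
  define q where "q = (real DIM('a) - \<alpha>) / \<alpha>"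
  have q: "q > 0" using dim \<alpha> by (simp add: q_def)
  define K0 where "K0 = real DIM('a) * measure lborel (ball 0 1 :: 'a set) * (Gamma q / \<alpha>)"
  define c where "c = (2 * pi) ^ DIM('a)"
  have c: "c > 0" by (simp add: c_def)
  show thesis
  proof
    fix M :: "'w measure" and D :: "'w \<Rightarrow> 'a" and \<tau> s :: real and x :: 'a
    assume M: "prob_space M" and D: "D \<in> borel_measurable M"
      and char: "\<And>\<xi>. (\<integral>w. cis (\<xi> \<bullet> D w) \<partial>M) = complex_of_real (exp (- \<tau> * norm \<xi> powr \<alpha>))" and s: "s > 0" and \<tau>: "\<tau> > 0"
    interpret \<sigma>: prob_space "sphere_sigma :: 'a measure" by (rule prob_space_sphere_sigma)
    have h: "\<alpha> \<noteq> 0" "(- \<alpha> + real DIM('a)) / \<alpha> > 0" using dim \<alpha> by auto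
    have q': "(- \<alpha> + real DIM('a)) / \<alpha> = q" by (simp add: q_def)
    have i: "integrable lborel (\<lambda>\<xi>::'a. norm \<xi> powr (- \<alpha>) * exp (- \<tau> * norm \<xi> powr \<alpha>))"
      by (rule integrable_radial_powr_exp[OF h \<tau>])
    have val: "(\<integral>\<xi>. norm (\<xi>::'a) powr (- \<alpha>) * exp (- \<tau> * norm \<xi> powr \<alpha>) \<partial>lborel) = K0 * \<tau> powr (- q)"
    proof -
      have "ennreal (\<integral>\<xi>. norm (\<xi>::'a) powr (- \<alpha>) * exp (- \<tau> * norm \<xi> powr \<alpha>) \<partial>lborel) = ennreal (real DIM('a) * measure lborel (ball 0 1 :: 'a set) * (Gamma q / (\<bar>\<alpha>\<bar> * \<tau> powr q)))"
        unfolding nn_integral_radial_powr_exp[where 'a='a, OF h \<tau>, unfolded q', symmetric] by (rule nn_integral_eq_integral[OF i, symmetric]) auto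
      moreover have "real DIM('a) * measure lborel (ball 0 1 :: 'a set) * (Gamma q / (\<bar>\<alpha>\<bar> * \<tau> powr q)) = K0 * \<tau> powr (- q)"
        unfolding K0_def using \<alpha> by (simp add: powr_minus_divide)
      moreover have "K0 \<ge> 0" unfolding K0_def using Gamma_real_pos[OF q] \<alpha> by simp
      ultimately show ?thesis
        by (simp only:) (subst (asm) ennreal_inj; auto intro!: Bochner_Integration.integral_nonneg)
    qed
    have bound: "(\<integral>w. smoothed_riesz \<alpha> s (v + D w) \<partial>M) \<le> K0 / c * \<tau> powr (- q)" for v :: 'a
    proof -
      let ?f = "\<lambda>\<xi>::'a. cos (\<xi> \<bullet> v) * (exp (- \<tau> * norm \<xi> powr \<alpha>) * (norm \<xi> powr (- \<alpha>) * exp (- s * (norm \<xi>)\<^sup>2 / 2)))"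
      have fb: "\<bar>?f \<xi>\<bar> \<le> norm \<xi> powr (- \<alpha>) * exp (- \<tau> * norm \<xi> powr \<alpha>)" for \<xi>
      proof -
        have "\<bar>?f \<xi>\<bar> = (\<bar>cos (\<xi> \<bullet> v)\<bar> * exp (- s * (norm \<xi>)\<^sup>2 / 2)) * (norm \<xi> powr (- \<alpha>) * exp (- \<tau> * norm \<xi> powr \<alpha>))"
          by (simp add: abs_mult)
        also have "\<dots> \<le> 1 * (norm \<xi> powr (- \<alpha>) * exp (- \<tau> * norm \<xi> powr \<alpha>))"
          using s by (intro mult_right_mono mult_le_one) auto
        finally show ?thesis by simp
      qed
      have "integral\<^sup>L lborel ?f \<le> (\<integral>\<xi>. norm (\<xi>::'a) powr (- \<alpha>) * exp (- \<tau> * norm \<xi> powr \<alpha>) \<partial>lborel)"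
      proof (rule integral_mono[OF _ i])
        show "integrable lborel ?f"
          by (rule Bochner_Integration.integrable_bound[OF i]) (measurable, rule AE_I2, use fb in \<open>auto intro: order.trans\<close>)
        show "?f \<xi> \<le> norm \<xi> powr (- \<alpha>) * exp (- \<tau> * norm \<xi> powr \<alpha>)" for \<xi> using fb[of \<xi>] by linarith
      qed
      then show ?thesis
        unfolding smoothed_riesz_average[OF M D char s] val c_def[symmetric] using c by (simp add: divide_right_mono)
    qed
    have "(\<integral>w. sphere_pot \<alpha> s (x + D w) \<partial>M) \<le> (\<integral>y. K0 / c * \<tau> powr (- q) \<partial>(sphere_sigma :: 'a measure))"
      unfolding sphere_pot_average(1)[OF M D s] by (intro integral_mono sphere_pot_average(2)[OF M D s] bound) simp
    then show "(\<integral>w. sphere_pot \<alpha> s (x + D w) \<partial>M) \<le> K0 / c * \<tau> powr (- ((real DIM('a) - \<alpha>) / \<alpha>))"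
      using \<sigma>.prob_space by (simp add: q_def)
  qed
qed

text \<open>The function \<open>1 - exp (- (norm (D w))\<^sup>2 / 2)\<close> is a Gaussian average
  of cosines, so its mean is of order \<tau>, and it is at least \<open>b\<close> where the
  increment is larger than \<epsilon>. A linear rate is just what a union over the steps of a grid
  can absorb.\<close>

lemma increment_tail:
  assumes \<epsilon>: "\<epsilon> > 0"
  obtains K where "\<And>(M :: 'w measure) (D :: 'w \<Rightarrow> 'a) \<tau>. prob_space M \<Longrightarrow> D \<in> borel_measurable M \<Longrightarrow>
    (\<And>\<xi>. (\<integral>w. cis (\<xi> \<bullet> D w) \<partial>M) = complex_of_real (exp (- \<tau> * norm \<xi> powr \<alpha>))) \<Longrightarrow> \<tau> \<ge> 0 \<Longrightarrow>
    measure M {w \<in> space M. \<epsilon> < norm (D w)} \<le> K * \<tau>"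
proof -
  define e where "e \<xi> = exp (- 1 * (norm \<xi>)\<^sup>2 / 2)" for \<xi> :: 'a
  define J where "J = (\<integral>\<xi>. norm (\<xi>::'a) powr \<alpha> * e \<xi> \<partial>lborel)"
  define c where "c = (2 * pi) powr (real DIM('a) / 2)"
  have c: "c > 0" by (simp add: c_def)
  define b where "b = 1 - exp (- \<epsilon>\<^sup>2 / 2)"
  have b: "b > 0" using \<epsilon> by (simp add: b_def)
  have ie: "integrable lborel e" unfolding e_def by (rule integrable_gaussian) simp
  have ia: "integrable lborel (\<lambda>\<xi>. norm \<xi> powr \<alpha> * e \<xi>)"
    unfolding e_def using \<alpha> by (intro integrable_radial_powr_gaussian) auto
  show thesis
  proof
    fix M :: "'w measure" and D :: "'w \<Rightarrow> 'a" and \<tau>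
    assume M: "prob_space M" and D[measurable]: "D \<in> borel_measurable M"
      and char: "\<And>\<xi>. (\<integral>w. cis (\<xi> \<bullet> D w) \<partial>M) = complex_of_real (exp (- \<tau> * norm \<xi> powr \<alpha>))" and \<tau>: "\<tau> \<ge> 0"
    interpret prob_space M by fact
    have "(\<integral>w. c * exp (- (norm (D w))\<^sup>2 / 2) \<partial>M) = (\<integral>w. (\<integral>\<xi>. cos (\<xi> \<bullet> (0 + D w)) * e \<xi> \<partial>lborel) \<partial>M)"
      unfolding e_def gaussian_fourier[OF zero_less_one] c_def by simp
    also have "\<dots> = (\<integral>\<xi>. cos (\<xi> \<bullet> 0) * (exp (- \<tau> * norm \<xi> powr \<alpha>) * e \<xi>) \<partial>lborel)"
      by (rule fourier_average[OF M D char ie])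
    also have "\<dots> \<ge> (\<integral>\<xi>. e \<xi> - \<tau> * (norm \<xi> powr \<alpha> * e \<xi>) \<partial>lborel)"
    proof (rule integral_mono)
      show "integrable lborel (\<lambda>\<xi>. e \<xi> - \<tau> * (norm \<xi> powr \<alpha> * e \<xi>))"
        by (intro Bochner_Integration.integrable_diff integrable_mult_right ie ia)
      show "integrable lborel (\<lambda>\<xi>. cos (\<xi> \<bullet> 0) * (exp (- \<tau> * norm \<xi> powr \<alpha>) * e \<xi>))"
      proof (rule Bochner_Integration.integrable_bound[OF ie])
        show "AE \<xi> in lborel. norm (cos (\<xi> \<bullet> 0) * (exp (- \<tau> * norm \<xi> powr \<alpha>) * e \<xi>)) \<le> norm (e \<xi>)"
          using \<tau> by (intro AE_I2) (simp add: abs_mult e_def)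
      qed (simp add: e_def)
      show "e \<xi> - \<tau> * (norm \<xi> powr \<alpha> * e \<xi>) \<le> cos (\<xi> \<bullet> 0) * (exp (- \<tau> * norm \<xi> powr \<alpha>) * e \<xi>)" for \<xi>
      proof -
        have "1 - \<tau> * norm \<xi> powr \<alpha> \<le> exp (- \<tau> * norm \<xi> powr \<alpha>)" using exp_ge_add_one_self[of "- \<tau> * norm \<xi> powr \<alpha>"] by simp
        then have "(1 - \<tau> * norm \<xi> powr \<alpha>) * e \<xi> \<le> exp (- \<tau> * norm \<xi> powr \<alpha>) * e \<xi>" by (intro mult_right_mono) (auto simp: e_def)
        then show ?thesis by (simp add: algebra_simps)
      qed
    qed
    also have "(\<integral>\<xi>. e \<xi> - \<tau> * (norm \<xi> powr \<alpha> * e \<xi>) \<partial>lborel) = c - \<tau> * J"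
    proof -
      have "integral\<^sup>L lborel e = c"
        using gaussian_fourier[OF zero_less_one, of "0::'a"] by (simp add: c_def e_def[abs_def])
      then show ?thesis using ie ia by (simp add: J_def)
    qed
    finally have 1: "c - \<tau> * J \<le> c * (\<integral>w. exp (- (norm (D w))\<^sup>2 / 2) \<partial>M)" by simp
    have iD: "integrable M (\<lambda>w. exp (- (norm (D w))\<^sup>2 / 2))"
      by (rule integrable_const_bound[of _ 1]) auto
    have "b * prob {w \<in> space M. \<epsilon> < norm (D w)} = (\<integral>w. b * indicator {w \<in> space M. \<epsilon> < norm (D w)} w \<partial>M)" by simp
    also have "\<dots> \<le> (\<integral>w. 1 - exp (- (norm (D w))\<^sup>2 / 2) \<partial>M)"
    proof (rule integral_mono)
      show "integrable M (\<lambda>w. b * indicator {w \<in> space M. \<epsilon> < norm (D w)} w)"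
        by (intro integrable_mult_right integrable_real_indicator) (auto simp: emeasure_eq_measure)
      show "integrable M (\<lambda>w. 1 - exp (- (norm (D w))\<^sup>2 / 2))" by (intro Bochner_Integration.integrable_diff iD) auto
      fix w
      show "b * indicator {w \<in> space M. \<epsilon> < norm (D w)} w \<le> 1 - exp (- (norm (D w))\<^sup>2 / 2)"
        using \<epsilon> by (auto simp: b_def split: split_indicator intro!: power_mono)
    qed
    also have "\<dots> = 1 - (\<integral>w. exp (- (norm (D w))\<^sup>2 / 2) \<partial>M)" using iD prob_space by simp
    also have "\<dots> \<le> \<tau> * J / c" using 1 c by (simp add: field_simps)
    finally show "prob {w \<in> space M. \<epsilon> < norm (D w)} \<le> (J / c / b) * \<tau>" using b c by (simp add: field_simps)
  qed
qed

end

section \<open>The process and its potential\<close>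

text \<open>Freezing: the future part \<open>Q\<close> is integrated with the past \<open>Z\<close>
  held fixed, on an event of the past. It serves as the Markov property at a grid time.\<close>

lemma (in prob_space) indep_var_integral_add:
  fixes f :: "'b::euclidean_space \<Rightarrow> real"
  assumes ind: "indep_var S Z T Q" and A: "A \<in> sets S" and y: "y \<in> borel_measurable S" and r: "r \<in> borel_measurable T"
    and f[measurable]: "f \<in> borel_measurable borel" and bd: "\<And>v. \<bar>f v\<bar> \<le> B"
  shows "(\<integral>w. indicator A (Z w) * f (y (Z w) + r (Q w)) \<partial>M) = (\<integral>w. indicator A (Z w) * (\<integral>w'. f (y (Z w) + r (Q w')) \<partial>M) \<partial>M)"
proof -
  note [measurable] = A y r
  have Z[measurable]: "Z \<in> measurable M S" and Q[measurable]: "Q \<in> measurable M T"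
    and eq: "distr M S Z \<Otimes>\<^sub>M distr M T Q = distr M (S \<Otimes>\<^sub>M T) (\<lambda>w. (Z w, Q w))"
    using ind unfolding indep_var_distribution_eq by auto
  interpret Z: prob_space "distr M S Z" by (rule prob_space_distr) fact
  interpret Q: prob_space "distr M T Q" by (rule prob_space_distr) fact
  interpret P: pair_prob_space "distr M S Z" "distr M T Q" ..
  define F where "F z v = indicator A z * f (y z + r v)" for z v
  have [measurable]: "case_prod F \<in> borel_measurable (S \<Otimes>\<^sub>M T)"
    unfolding F_def by measurable
  have FB: "\<bar>F z v\<bar> \<le> \<bar>B\<bar>" for z v using bd[of "y z + r v"] by (auto simp: F_def split: split_indicator)
  have iF: "integrable (distr M S Z \<Otimes>\<^sub>M distr M T Q) (case_prod F)"
    by (rule P.integrable_const_bound[of _ "\<bar>B\<bar>"]) (auto simp: FB)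
  have "(\<integral>w. F (Z w) (Q w) \<partial>M) = (\<integral>p. case_prod F p \<partial>distr M (S \<Otimes>\<^sub>M T) (\<lambda>w. (Z w, Q w)))"
    by (subst integral_distr) auto
  also have "\<dots> = (\<integral>p. case_prod F p \<partial>(distr M S Z \<Otimes>\<^sub>M distr M T Q))" unfolding eq ..
  also have "\<dots> = (\<integral>z. (\<integral>v. F z v \<partial>distr M T Q) \<partial>distr M S Z)"
    using P.integral_fst'[OF iF] by simp
  also have "\<dots> = (\<integral>w. (\<integral>v. F (Z w) v \<partial>distr M T Q) \<partial>M)"
    by (subst integral_distr) (auto simp: F_def)
  also have "\<dots> = (\<integral>w. (\<integral>w'. F (Z w) (Q w') \<partial>M) \<partial>M)"
  proof (rule Bochner_Integration.integral_cong[OF refl])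
    fix w assume "w \<in> space M"
    then have "Z w \<in> space S" using measurable_space[OF Z] by simp
    then show "(\<integral>v. F (Z w) v \<partial>distr M T Q) = (\<integral>w'. F (Z w) (Q w') \<partial>M)"
      unfolding F_def by (subst integral_distr) auto
  qed
  finally show ?thesis unfolding F_def by simp
qed

definition pot_bound :: "nat \<Rightarrow> real \<Rightarrow> real" where
  "pot_bound n \<alpha> = subord1 \<alpha> / subord2 n \<alpha> * riesz_profile n \<alpha> 1"

context stable_index
begin

lemma pot_bound_nonneg: "pot_bound DIM('a) \<alpha> \<ge> 0"
  unfolding pot_bound_def by (intro mult_nonneg_nonneg riesz_profile_nonneg[OF dim \<alpha>] less_imp_le[OF riesz_const_pos])

lemma sphere_pot_le_bound: "s > 0 \<Longrightarrow> sphere_pot \<alpha> s (x::'a) \<le> pot_bound DIM('a) \<alpha>"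
  unfolding pot_bound_def by (rule sphere_pot_le)

lemma sphere_heat_le: "s > 0 \<Longrightarrow> sphere_heat s (v::'a) \<le> (2 * pi * s) powr (- real DIM('a) / 2)"
proof -
  assume s: "s > 0"
  interpret \<sigma>: prob_space "sphere_sigma :: 'a measure" by (rule prob_space_sphere_sigma)
  have "sphere_heat s v \<le> (\<integral>y. (2 * pi * s) powr (- real DIM('a) / 2) \<partial>(sphere_sigma :: 'a measure))"
    unfolding sphere_heat_def using heat_kernel_le[OF s]
    by (intro integral_mono heat_kernel_sigma_integrable s) (auto intro: order.trans[OF abs_ge_self])
  then show ?thesis using \<sigma>.prob_space by simp
qed

end

section \<open>The process observed on a time grid\<close>

locale stable_process = stable_index \<alpha> "TYPE('a)" for \<alpha> and dim_type :: "'a::euclidean_space itself" +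
  fixes M :: "'w measure" and X :: "real \<Rightarrow> 'w \<Rightarrow> 'a"
  assumes process: "sym_stable_process \<alpha> M X"
begin

sublocale prob_space M
  using process by (simp add: sym_stable_process_def)

lemma X_measurable [measurable]: "t \<ge> 0 \<Longrightarrow> X t \<in> borel_measurable M"
  using process by (simp add: sym_stable_process_def)

lemma X_0: "w \<in> space M \<Longrightarrow> X 0 w = 0"
  using process by (simp add: sym_stable_process_def)

lemma X_right_continuous: "w \<in> space M \<Longrightarrow> t \<ge> 0 \<Longrightarrow> ((\<lambda>s. X s w) \<longlongrightarrow> X t w) (at_right t)"
  using process unfolding sym_stable_process_def continuous_within by blast

lemma X_left_limit: "w \<in> space M \<Longrightarrow> t > 0 \<Longrightarrow> \<exists>l. ((\<lambda>s. X s w) \<longlongrightarrow> l) (at_left t)"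
  using process unfolding sym_stable_process_def by blast

lemma X_increment_char:
  "0 \<le> s \<Longrightarrow> s \<le> t \<Longrightarrow> (\<integral>w. cis (\<xi> \<bullet> (X t w - X s w)) \<partial>M) = complex_of_real (exp (- (t - s) * norm \<xi> powr \<alpha>))"
  using process unfolding sym_stable_process_def by blast

lemma X_char: "0 \<le> t \<Longrightarrow> (\<integral>w. cis (\<xi> \<bullet> X t w) \<partial>M) = complex_of_real (exp (- t * norm \<xi> powr \<alpha>))"
  using X_increment_char[of 0 t \<xi>] by (simp add: X_0 cong: Bochner_Integration.integral_cong)

context
  fixes x :: 'a and a \<eta> :: real
  assumes a: "a \<ge> 0" and \<eta>: "\<eta> > 0"
begin

text \<open>The offset \<open>a\<close> is 0 for hitting from the start, and a large integer when
  returns after that time are studied.\<close>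

definition grid :: "nat \<Rightarrow> 'w \<Rightarrow> 'a" where
  "grid k w = x + X (a + real k * \<eta>) w"

lemma grid_measurable [measurable]: "grid k \<in> borel_measurable M"
  unfolding grid_def using a \<eta> by (intro borel_measurable_add borel_measurable_const X_measurable) auto

lemma grid_indep:
  obtains Z Q :: "'w \<Rightarrow> nat \<Rightarrow> 'a" and Y :: "nat \<Rightarrow> (nat \<Rightarrow> 'a) \<Rightarrow> 'a" where
    "indep_var (PiM {..k} (\<lambda>_. borel)) Z (PiM {Suc k} (\<lambda>_. borel)) Q"
    "\<And>w. grid (Suc k) w - grid k w = Q w (Suc k)"
    "\<And>j. j \<le> k \<Longrightarrow> Y j \<in> borel_measurable (PiM {..k} (\<lambda>_. borel))"
    "\<And>j w. j \<le> k \<Longrightarrow> w \<in> space M \<Longrightarrow> grid j w = Y j (Z w)"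
proof -
  \<comment> \<open>Time 0 is put in front of the grid times, which shifts the index by one:
    increment 0 leads from time 0 to \<open>a\<close>, increment \<open>Suc k\<close> from
    \<open>grid k\<close> to \<open>grid (Suc k)\<close>. Hence the increments up to index
    \<open>j\<close> add up to \<open>grid j\<close> minus \<open>x\<close>.\<close>
  define s where "s i = (case i of 0 \<Rightarrow> 0 | Suc j \<Rightarrow> a + real j * \<eta>)" for i :: nat
  define \<Delta> where "\<Delta> i w = X (s (Suc i)) w - X (s i) w" for i w
  have "mono s"
    unfolding mono_iff_le_Suc using a \<eta> by (auto simp: s_def split: nat.split)
  then have ind: "indep_vars (\<lambda>_. borel) \<Delta> UNIV"
  proof -
    have "0 \<le> s 0" by (simp add: s_def)
    with \<open>mono s\<close> show ?thesis using process unfolding sym_stable_process_def \<Delta>_def[abs_def] by blast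
  qed
  define Z where "Z w = restrict (\<lambda>i. \<Delta> i w) {..k}" for w
  define Y where "Y j z = x + (\<Sum>i\<le>j. z i)" for j and z :: "nat \<Rightarrow> 'a"
  define Q where "Q w = restrict (\<lambda>i. \<Delta> i w) {Suc k}" for w
  have 1: "indep_var (PiM {..k} (\<lambda>_. borel)) Z (PiM {Suc k} (\<lambda>_. borel)) Q"
    unfolding Z_def Q_def by (rule indep_var_restrict[OF ind]) auto
  have 4: "grid (Suc k) w - grid k w = Q w (Suc k)" for w
    by (auto simp: Q_def \<Delta>_def s_def grid_def)
  have 2: "Y j \<in> borel_measurable (PiM {..k} (\<lambda>_. borel))" if "j \<le> k" for j
    unfolding Y_def using that
    by (intro borel_measurable_add borel_measurable_const borel_measurable_sum measurable_component_singleton) auto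
  have 3: "grid j w = Y j (Z w)" if "j \<le> k" "w \<in> space M" for j w
  proof -
    have "(\<Sum>i\<le>j. Z w i) = (\<Sum>i\<le>j. \<Delta> i w)"
      using that by (intro sum.cong) (auto simp: Z_def)
    also have "\<dots> = X (s (Suc j)) w - X (s 0) w"
      unfolding \<Delta>_def by (induction j) auto
    finally show ?thesis using that X_0[of w] by (simp add: Y_def grid_def s_def)
  qed
  from 1 4 2 3 show thesis by (rule that)
qed

lemma grid_increment_indep:
  assumes [measurable]: "V \<in> sets borel"
  shows "prob {w \<in> space M. grid k w \<in> V \<and> \<epsilon> < norm (grid (Suc k) w - grid k w)}
    = prob {w \<in> space M. grid k w \<in> V} * prob {w \<in> space M. \<epsilon> < norm (grid (Suc k) w - grid k w)}"
proof -
  obtain Z Q :: "'w \<Rightarrow> nat \<Rightarrow> 'a" and Y where Z: "indep_var (PiM {..k} (\<lambda>_. borel)) Z (PiM {Suc k} (\<lambda>_. borel)) Q"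
    and Q: "\<And>w. grid (Suc k) w - grid k w = Q w (Suc k)"
    and Ym: "\<And>j. j \<le> k \<Longrightarrow> Y j \<in> borel_measurable (PiM {..k} (\<lambda>_. borel :: 'a measure))"
    and Y: "\<And>j w. j \<le> k \<Longrightarrow> w \<in> space M \<Longrightarrow> grid j w = Y j (Z w)"
    using grid_indep[of k] by blast
  let ?S = "PiM {..k} (\<lambda>_. borel :: 'a measure)" and ?T = "PiM {Suc k} (\<lambda>_. borel :: 'a measure)"
  define A where "A = Y k -` V \<inter> space ?S"
  define B where "B = {q \<in> space ?T. \<epsilon> < norm (q (Suc k))}"
  have A: "A \<in> sets ?S" unfolding A_def using Ym[OF order_refl] assms by (rule measurable_sets)
  have B: "B \<in> sets ?T" unfolding B_def by measurable
  have Zs: "Z w \<in> space ?S" "Q w \<in> space ?T" if "w \<in> space M" for w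
    using indep_var_rv1[OF Z] indep_var_rv2[OF Z] that by (auto dest: measurable_space)
  have "{w \<in> space M. grid k w \<in> V \<and> \<epsilon> < norm (grid (Suc k) w - grid k w)} = (\<lambda>w. (Z w, Q w)) -` (A \<times> B) \<inter> space M"
    using Zs Y[OF order_refl] by (auto simp: A_def B_def Q)
  moreover have "{w \<in> space M. grid k w \<in> V} = Z -` A \<inter> space M" using Zs Y[OF order_refl] by (auto simp: A_def)
  moreover have "{w \<in> space M. \<epsilon> < norm (grid (Suc k) w - grid k w)} = Q -` B \<inter> space M" using Zs by (auto simp: B_def Q)
  ultimately show ?thesis using indep_varD[OF Z A B] by simp
qed

lemma grid_increment_char:
  "(\<integral>w. cis (\<xi> \<bullet> (grid (Suc k) w - grid k w)) \<partial>M) = complex_of_real (exp (- \<eta> * norm \<xi> powr \<alpha>))"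
proof -
  have "grid (Suc k) w - grid k w = X (a + real (Suc k) * \<eta>) w - X (a + real k * \<eta>) w" for w
    by (simp add: grid_def)
  moreover have "(a + real (Suc k) * \<eta>) - (a + real k * \<eta>) = \<eta>" by (simp add: algebra_simps)
  moreover have "a + real k * \<eta> \<le> a + real (Suc k) * \<eta>" "0 \<le> a + real k * \<eta>" using a \<eta> by (auto simp: algebra_simps)
  ultimately show ?thesis using X_increment_char[of "a + real k * \<eta>" "a + real (Suc k) * \<eta>" \<xi>] by (simp only:)
qed

definition avoid :: "'a set \<Rightarrow> nat \<Rightarrow> 'w set" where
  "avoid U k = {w \<in> space M. \<forall>j\<le>k. grid j w \<notin> U}"

lemma avoid_sets [measurable]: "U \<in> sets borel \<Longrightarrow> avoid U k \<in> sets M"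
proof -
  assume U: "U \<in> sets borel"
  have "avoid U k = (\<Inter>j\<in>{..k}. grid j -` (- U) \<inter> space M)" by (auto simp: avoid_def)
  also have "\<dots> \<in> sets M" using U by (intro sets.finite_INT measurable_sets[OF grid_measurable]) auto
  finally show ?thesis .
qed

lemma pot_integrable:
  assumes s: "s > 0" and [measurable]: "B \<in> sets M"
  shows "integrable M (\<lambda>w. indicator B w * sphere_pot \<alpha> s (grid k w))"
proof (rule integrable_const_bound[of _ "pot_bound DIM('a) \<alpha>"])
  show "AE w in M. norm (indicator B w * sphere_pot \<alpha> s (grid k w)) \<le> pot_bound DIM('a) \<alpha>"
    by (rule AE_I2) (simp add: indicator_def pot_bound_nonneg sphere_pot_nonneg[OF s] sphere_pot_le_bound[OF s])
qed measurable

lemma heat_integrable: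
  assumes s: "s > 0" and [measurable]: "B \<in> sets M"
  shows "integrable M (\<lambda>w. indicator B w * sphere_heat s (grid k w))"
proof (rule integrable_const_bound[of _ "(2 * pi * s) powr (- real DIM('a) / 2)"])
  show "AE w in M. norm (indicator B w * sphere_heat s (grid k w)) \<le> (2 * pi * s) powr (- real DIM('a) / 2)"
    using sphere_heat_le[OF s] by (intro AE_I2) (simp add: indicator_def sphere_heat_nonneg)
qed measurable

text \<open>A discrete Dynkin formula on the event that \<open>U\<close> has been avoided up to step
  \<open>k\<close>. This event depends on the increments up to index \<open>k\<close> only, so the
  next increment can be averaged first, and the short-time expansion applies at each
  position.\<close>

lemma grid_step:
  assumes s: "s > 0" and U[measurable]: "U \<in> sets borel"
  shows "\<bar>(\<integral>w. indicator (avoid U k) w * sphere_pot \<alpha> s (grid (Suc k) w) \<partial>M)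
     - (\<integral>w. indicator (avoid U k) w * sphere_pot \<alpha> s (grid k w) \<partial>M)
     + \<eta> * (\<integral>w. indicator (avoid U k) w * sphere_heat s (grid k w) \<partial>M)\<bar> \<le> generator_error s TYPE('a) * \<eta>\<^sup>2"
proof -
  obtain Z Q :: "'w \<Rightarrow> nat \<Rightarrow> 'a" and Y where Z: "indep_var (PiM {..k} (\<lambda>_. borel)) Z (PiM {Suc k} (\<lambda>_. borel)) Q"
    and Q: "\<And>w. grid (Suc k) w - grid k w = Q w (Suc k)"
    and Ym: "\<And>j. j \<le> k \<Longrightarrow> Y j \<in> borel_measurable (PiM {..k} (\<lambda>_. borel :: 'a measure))"
    and Y: "\<And>j w. j \<le> k \<Longrightarrow> w \<in> space M \<Longrightarrow> grid j w = Y j (Z w)"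
    using grid_indep[of k] by blast
  define D where "D w = Q w (Suc k)" for w
  define A where "A = (\<Inter>j\<in>{..k}. Y j -` (- U) \<inter> space (PiM {..k} (\<lambda>_. borel :: 'a measure)))"
  have A: "A \<in> sets (PiM {..k} (\<lambda>_. borel))"
    unfolding A_def using Ym U by (intro sets.finite_INT measurable_sets[where A=borel]) auto
  have ZS: "Z w \<in> space (PiM {..k} (\<lambda>_. borel))" if "w \<in> space M" for w
    using Z that unfolding indep_var_distribution_eq by (auto dest: measurable_space)
  have ind: "indicator (avoid U k) w = (indicator A (Z w) :: real)" if "w \<in> space M" for w
  proof -
    have "Z w \<in> A \<longleftrightarrow> (\<forall>j\<le>k. Y j (Z w) \<notin> U)" using ZS[OF that] by (auto simp: A_def)
    also have "\<dots> \<longleftrightarrow> w \<in> avoid U k" using Y[OF _ that] that by (auto simp: avoid_def)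
    finally show ?thesis by (simp add: indicator_def)
  qed
  have gk: "grid (Suc k) w = Y k (Z w) + D w" if "w \<in> space M" for w
    using Y[OF order_refl that] Q[of w] by (simp add: D_def algebra_simps)
  have Dm[measurable]: "D \<in> borel_measurable M" unfolding D_def Q[symmetric] by measurable
  have char: "(\<integral>w. cis (\<xi> \<bullet> D w) \<partial>M) = complex_of_real (exp (- \<eta> * norm \<xi> powr \<alpha>))" for \<xi>
    unfolding D_def Q[symmetric] by (rule grid_increment_char)
  let ?W = "\<lambda>v. \<integral>w'. sphere_pot \<alpha> s (v + D w') \<partial>M"
  have Wm: "?W \<in> borel_measurable borel" by measurable
  have gen: "\<bar>?W v - sphere_pot \<alpha> s v + \<eta> * sphere_heat s v\<bar> \<le> generator_error s TYPE('a) * \<eta>\<^sup>2" for v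
    using \<eta> by (intro sphere_pot_generator[OF prob_space_axioms Dm char s]) auto
  have "(\<integral>w. indicator (avoid U k) w * sphere_pot \<alpha> s (grid (Suc k) w) \<partial>M) = (\<integral>w. indicator A (Z w) * sphere_pot \<alpha> s (Y k (Z w) + D w) \<partial>M)"
    by (intro Bochner_Integration.integral_cong refl) (simp add: ind gk)
  also have "\<dots> = (\<integral>w. indicator A (Z w) * ?W (Y k (Z w)) \<partial>M)"
    unfolding D_def by (rule indep_var_integral_add[OF Z A Ym, where r="\<lambda>q. q (Suc k)" and B="pot_bound DIM('a) \<alpha>"])
      (auto simp: sphere_pot_nonneg[OF s] sphere_pot_le_bound[OF s])
  also have "\<dots> = (\<integral>w. indicator (avoid U k) w * ?W (grid k w) \<partial>M)"
    by (intro Bochner_Integration.integral_cong refl) (simp add: ind Y)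
  finally have 1: "(\<integral>w. indicator (avoid U k) w * sphere_pot \<alpha> s (grid (Suc k) w) \<partial>M) = (\<integral>w. indicator (avoid U k) w * ?W (grid k w) \<partial>M)" .
  have Av: "avoid U k \<in> sets M" by measurable
  have iW: "integrable M (\<lambda>w. indicator (avoid U k) w * ?W (grid k w))"
  proof (rule integrable_const_bound[of _ "pot_bound DIM('a) \<alpha>"])
    have "\<bar>?W v\<bar> \<le> pot_bound DIM('a) \<alpha>" for v
    proof -
      have "0 \<le> ?W v" by (intro Bochner_Integration.integral_nonneg sphere_pot_nonneg s)
      moreover have "?W v \<le> (\<integral>w'. pot_bound DIM('a) \<alpha> \<partial>M)"
        by (intro integral_mono sphere_pot_le_bound s integrable_const_bound[of _ "pot_bound DIM('a) \<alpha>"])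
          (auto simp: sphere_pot_nonneg[OF s] sphere_pot_le_bound[OF s] pot_bound_nonneg)
      ultimately show ?thesis using prob_space by simp
    qed
    then show "AE w in M. norm (indicator (avoid U k) w * ?W (grid k w)) \<le> pot_bound DIM('a) \<alpha>"
      by (intro AE_I2) (simp add: indicator_def pot_bound_nonneg)
    show "(\<lambda>w. indicator (avoid U k) w * ?W (grid k w)) \<in> borel_measurable M"
      by (intro borel_measurable_times borel_measurable_indicator Av measurable_compose[OF grid_measurable Wm])
  qed
  note ip = pot_integrable[OF s Av, of k] and ih = heat_integrable[OF s Av, of k]
  let ?F = "\<lambda>w. indicator (avoid U k) w * ?W (grid k w) - indicator (avoid U k) w * sphere_pot \<alpha> s (grid k w) + \<eta> * (indicator (avoid U k) w * sphere_heat s (grid k w))"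
  have iF: "integrable M ?F"
    by (rule Bochner_Integration.integrable_add[OF Bochner_Integration.integrable_diff[OF iW ip] integrable_mult_right[OF ih]])
  have eqF: "(\<integral>w. indicator (avoid U k) w * sphere_pot \<alpha> s (grid (Suc k) w) \<partial>M)
     - (\<integral>w. indicator (avoid U k) w * sphere_pot \<alpha> s (grid k w) \<partial>M)
     + \<eta> * (\<integral>w. indicator (avoid U k) w * sphere_heat s (grid k w) \<partial>M) = integral\<^sup>L M ?F"
    unfolding 1 Bochner_Integration.integral_add[OF Bochner_Integration.integrable_diff[OF iW ip] integrable_mult_right[OF ih]]
      Bochner_Integration.integral_diff[OF iW ip] integral_mult_right_zero ..
  have "(\<integral>w. \<bar>?F w\<bar> \<partial>M) \<le> (\<integral>w. generator_error s TYPE('a) * \<eta>\<^sup>2 \<partial>M)"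
  proof (rule integral_mono[OF integrable_abs[OF iF] integrable_const])
    fix w
    have "?F w = indicator (avoid U k) w * (?W (grid k w) - sphere_pot \<alpha> s (grid k w) + \<eta> * sphere_heat s (grid k w))"
      by (simp only: distrib_left right_diff_distrib mult.left_commute)
    then have *: "\<bar>?F w\<bar> = indicator (avoid U k) w * \<bar>?W (grid k w) - sphere_pot \<alpha> s (grid k w) + \<eta> * sphere_heat s (grid k w)\<bar>"
      by (simp only: abs_mult abs_of_nonneg[OF indicator_pos_le])
    also have "\<dots> \<le> 1 * (generator_error s TYPE('a) * \<eta>\<^sup>2)"
      by (rule mult_mono[OF indicator_le_1 gen]) auto
    finally show "\<bar>?F w\<bar> \<le> generator_error s TYPE('a) * \<eta>\<^sup>2" unfolding mult_1 .
  qed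
  then have "\<bar>integral\<^sup>L M ?F\<bar> \<le> (\<integral>w. generator_error s TYPE('a) * \<eta>\<^sup>2 \<partial>M)"
    by (rule order.trans[OF integral_abs_bound])
  then show ?thesis unfolding eqF using prob_space by simp
qed

lemma pot_split:
  assumes s: "s > 0" and U[measurable]: "U \<in> sets borel"
  shows "(\<integral>w. indicator (avoid U k) w * sphere_pot \<alpha> s (grid (Suc k) w) \<partial>M)
    = (\<integral>w. indicator (avoid U (Suc k)) w * sphere_pot \<alpha> s (grid (Suc k) w) \<partial>M)
    + (\<integral>w. indicator (avoid U k - avoid U (Suc k)) w * sphere_pot \<alpha> s (grid (Suc k) w) \<partial>M)"
proof -
  have "avoid U (Suc k) \<subseteq> avoid U k" by (auto simp: avoid_def)
  then have "indicator (avoid U k) w * sphere_pot \<alpha> s (grid (Suc k) w) = indicator (avoid U (Suc k)) w * sphere_pot \<alpha> s (grid (Suc k) w)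
    + indicator (avoid U k - avoid U (Suc k)) w * sphere_pot \<alpha> s (grid (Suc k) w)" for w
    by (auto split: split_indicator)
  then show ?thesis
    by (simp only:) (rule Bochner_Integration.integral_add; rule pot_integrable[OF s]; measurable)
qed

lemma prob_avoid_split:
  assumes [measurable]: "U \<in> sets borel"
  shows "prob (space M - avoid U (Suc k)) = prob (space M - avoid U k) + prob (avoid U k - avoid U (Suc k))"
proof -
  have "avoid U (Suc k) \<subseteq> avoid U k" "avoid U k \<subseteq> space M" by (auto simp: avoid_def)
  then have "space M - avoid U (Suc k) = (space M - avoid U k) \<union> (avoid U k - avoid U (Suc k))" by auto
  then show ?thesis by (simp only:) (rule finite_measure_Union; auto)
qed

lemma pot_const_le:
  assumes s: "s > 0" and [measurable]: "B \<in> sets M" and c: "\<And>w. w \<in> B \<Longrightarrow> c \<le> sphere_pot \<alpha> s (grid k w)"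
  shows "c * prob B \<le> (\<integral>w. indicator B w * sphere_pot \<alpha> s (grid k w) \<partial>M)"
proof -
  have "c * prob B = (\<integral>w. c * indicator B w \<partial>M)" by simp
  also have "\<dots> \<le> (\<integral>w. indicator B w * sphere_pot \<alpha> s (grid k w) \<partial>M)"
    by (intro integral_mono pot_integrable s integrable_mult_right integrable_real_indicator)
      (auto split: split_indicator simp: c emeasure_eq_measure)
  finally show ?thesis .
qed

lemma pot_le_const:
  assumes s: "s > 0" and [measurable]: "B \<in> sets M"
  shows "(\<integral>w. indicator B w * sphere_pot \<alpha> s (grid k w) \<partial>M) \<le> pot_bound DIM('a) \<alpha> * prob B"
proof -
  have "(\<integral>w. indicator B w * sphere_pot \<alpha> s (grid k w) \<partial>M) \<le> (\<integral>w. pot_bound DIM('a) \<alpha> * indicator B w \<partial>M)"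
    by (intro integral_mono pot_integrable s integrable_mult_right integrable_real_indicator)
      (auto split: split_indicator simp: sphere_pot_le_bound[OF s] emeasure_eq_measure)
  then show ?thesis by simp
qed

lemma avoid_space_split:
  assumes s: "s > 0" and U[measurable]: "U \<in> sets borel"
  shows "(\<integral>w. sphere_pot \<alpha> s (grid 0 w) \<partial>M) = (\<integral>w. indicator (avoid U 0) w * sphere_pot \<alpha> s (grid 0 w) \<partial>M)
    + (\<integral>w. indicator (space M - avoid U 0) w * sphere_pot \<alpha> s (grid 0 w) \<partial>M)"
proof -
  have "(\<integral>w. sphere_pot \<alpha> s (grid 0 w) \<partial>M) = (\<integral>w. indicator (avoid U 0) w * sphere_pot \<alpha> s (grid 0 w) + indicator (space M - avoid U 0) w * sphere_pot \<alpha> s (grid 0 w) \<partial>M)"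
    by (intro Bochner_Integration.integral_cong refl) (auto split: split_indicator)
  also have "\<dots> = (\<integral>w. indicator (avoid U 0) w * sphere_pot \<alpha> s (grid 0 w) \<partial>M)
    + (\<integral>w. indicator (space M - avoid U 0) w * sphere_pot \<alpha> s (grid 0 w) \<partial>M)"
    by (rule Bochner_Integration.integral_add; rule pot_integrable[OF s]; measurable)
  finally show ?thesis .
qed

text \<open>Optional stopping by hand: if paths that have hit are counted with the value
  \<open>c\<close>, the left-hand side grows in each step by at most the generator error, since the
  heat term only lowers the potential.\<close>

lemma grid_hit_upper:
  assumes s: "s > 0" and U[measurable]: "U \<in> sets borel" and c: "\<And>v. v \<in> U \<Longrightarrow> c \<le> sphere_pot \<alpha> s v"
  shows "c * prob (space M - avoid U k) + (\<integral>w. indicator (avoid U k) w * sphere_pot \<alpha> s (grid k w) \<partial>M)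
    \<le> (\<integral>w. sphere_pot \<alpha> s (grid 0 w) \<partial>M) + real k * (generator_error s TYPE('a) * \<eta>\<^sup>2)"
proof (induction k)
  case 0
  have "c * prob (space M - avoid U 0) \<le> (\<integral>w. indicator (space M - avoid U 0) w * sphere_pot \<alpha> s (grid 0 w) \<partial>M)"
    by (rule pot_const_le[OF s]) (auto simp: avoid_def intro!: c)
  then show ?case using avoid_space_split[OF s U] by simp
next
  case (Suc k)
  have h: "(\<integral>w. indicator (avoid U k) w * sphere_heat s (grid k w) \<partial>M) \<ge> 0"
    by (intro Bochner_Integration.integral_nonneg mult_nonneg_nonneg sphere_heat_nonneg) auto
  have "c * prob (avoid U k - avoid U (Suc k)) \<le> (\<integral>w. indicator (avoid U k - avoid U (Suc k)) w * sphere_pot \<alpha> s (grid (Suc k) w) \<partial>M)"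
    by (rule pot_const_le[OF s]) (auto simp: avoid_def le_Suc_eq intro!: c)
  moreover have "real (Suc k) * (generator_error s TYPE('a) * \<eta>\<^sup>2) = real k * (generator_error s TYPE('a) * \<eta>\<^sup>2) + generator_error s TYPE('a) * \<eta>\<^sup>2"
    by (simp add: distrib_right)
  moreover have "\<eta> * (\<integral>w. indicator (avoid U k) w * sphere_heat s (grid k w) \<partial>M) \<ge> 0" using h \<eta> by simp
  ultimately show ?case
    using Suc grid_step[OF s U, of k] pot_split[OF s U, of k] prob_avoid_split[OF U, of k]
    unfolding abs_le_iff by (simp only: distrib_left) linarith
qed

text \<open>The reverse estimate: paths that have hit carry at most \<open>pot_bound\<close>, and
  outside \<open>U\<close> at most \<open>\<eta> * g\<close> is lost per step. When \<open>g\<close>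
  is small, the initial potential has to be accounted for by hitting or by the terminal
  term.\<close>

lemma grid_hit_lower:
  assumes s: "s > 0" and U[measurable]: "U \<in> sets borel" and g: "\<And>v. v \<notin> U \<Longrightarrow> sphere_heat s v \<le> g" "g \<ge> 0"
  shows "(\<integral>w. sphere_pot \<alpha> s (grid 0 w) \<partial>M) \<le> pot_bound DIM('a) \<alpha> * prob (space M - avoid U k)
    + (\<integral>w. indicator (avoid U k) w * sphere_pot \<alpha> s (grid k w) \<partial>M) + real k * (\<eta> * g + generator_error s TYPE('a) * \<eta>\<^sup>2)"
proof (induction k)
  case 0
  show ?case using avoid_space_split[OF s U] pot_le_const[OF s, of "space M - avoid U 0" 0] by simp
next
  case (Suc k)
  have "(\<integral>w. indicator (avoid U k) w * sphere_heat s (grid k w) \<partial>M) \<le> (\<integral>w. g \<partial>M)"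
    by (intro integral_mono heat_integrable s) (auto split: split_indicator simp: avoid_def g)
  then have "\<eta> * (\<integral>w. indicator (avoid U k) w * sphere_heat s (grid k w) \<partial>M) \<le> \<eta> * g" using \<eta> prob_space by simp
  moreover have "real (Suc k) * (\<eta> * g + generator_error s TYPE('a) * \<eta>\<^sup>2) = real k * (\<eta> * g + generator_error s TYPE('a) * \<eta>\<^sup>2) + \<eta> * g + generator_error s TYPE('a) * \<eta>\<^sup>2"
    by (simp add: distrib_right)
  ultimately show ?case
    using Suc grid_step[OF s U, of k] pot_split[OF s U, of k] prob_avoid_split[OF U, of k]
      pot_le_const[OF s sets.Diff[OF avoid_sets[OF U, of k] avoid_sets[OF U, of "Suc k"]], of "Suc k"]
    unfolding abs_le_iff by (simp only: distrib_left) linarith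
qed

lemma grid_step_all:
  assumes s: "s > 0"
  shows "(\<integral>w. sphere_pot \<alpha> s (grid (Suc k) w) \<partial>M) + \<eta> * (\<integral>w. sphere_heat s (grid k w) \<partial>M)
    \<le> (\<integral>w. sphere_pot \<alpha> s (grid k w) \<partial>M) + generator_error s TYPE('a) * \<eta>\<^sup>2"
proof -
  have A: "(\<integral>w. indicator (avoid {} j) w * f w \<partial>M) = (\<integral>w. f w \<partial>M)" for j and f :: "'w \<Rightarrow> real"
    by (intro Bochner_Integration.integral_cong refl) (simp add: avoid_def)
  have "p1 + h \<le> p0 + E" if "\<bar>p1 - p0 + h\<bar> \<le> E" for h p0 p1 E :: real
    using that by linarith
  from this[OF grid_step[OF s sets.empty_sets, unfolded A, of k]] show ?thesis .
qed

text \<open>The one-step estimates telescope: the expected heat collected in total cannot exceed the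
  initial potential, up to the generator errors.\<close>

lemma grid_occupation:
  assumes s: "s > 0"
  shows "(\<Sum>j<k. \<eta> * (\<integral>w. sphere_heat s (grid j w) \<partial>M)) \<le> pot_bound DIM('a) \<alpha> + real k * (generator_error s TYPE('a) * \<eta>\<^sup>2)"
proof -
  define p where "p j = (\<integral>w. sphere_pot \<alpha> s (grid j w) \<partial>M)" for j
  define h where "h j = \<eta> * (\<integral>w. sphere_heat s (grid j w) \<partial>M)" for j
  define E where "E = generator_error s TYPE('a) * \<eta>\<^sup>2"
  have step: "p (Suc j) + h j \<le> p j + E" for j
    unfolding p_def h_def E_def by (rule grid_step_all[OF s])
  have ind: "(\<Sum>j<m. h j) + p m \<le> p 0 + real m * E" for m
  proof (induction m)
    case (Suc m)
    have "real (Suc m) * E = real m * E + E" by (simp add: distrib_right)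
    then show ?case using Suc step[of m] unfolding sum.lessThan_Suc by linarith
  qed simp
  have p0: "p k \<ge> 0" unfolding p_def by (intro Bochner_Integration.integral_nonneg sphere_pot_nonneg s)
  have p1: "p 0 \<le> pot_bound DIM('a) \<alpha>"
  proof -
    have "p 0 = (\<integral>w. indicator (space M) w * sphere_pot \<alpha> s (grid 0 w) \<partial>M)"
      unfolding p_def by (intro Bochner_Integration.integral_cong refl) auto
    also have "\<dots> \<le> pot_bound DIM('a) \<alpha> * prob (space M)" by (rule pot_le_const[OF s sets.top])
    finally show ?thesis using prob_space by simp
  qed
  have "(\<Sum>j<k. h j) \<le> pot_bound DIM('a) \<alpha> + real k * E" using ind[of k] p0 p1 by linarith
  then show ?thesis unfolding h_def E_def .
qed

end

section \<open>From grids to continuous time: hitting open sets\<close>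

definition hit_set :: "'a \<Rightarrow> real \<Rightarrow> 'a set \<Rightarrow> 'w set" where
  "hit_set x a U = {w \<in> space M. \<exists>t\<ge>a. x + X t w \<in> U}"

text \<open>Mesh \<open>1 / 2 ^ m\<close> and horizon \<open>m\<close> are refined together, so that
  the events increase and exhaust \<open>hit_set\<close>; the accumulated error,
  \<open>m * 2 ^ m\<close> steps of order \<open>1 / 4 ^ m\<close> each, still vanishes.\<close>

definition grid_hit :: "'a \<Rightarrow> real \<Rightarrow> 'a set \<Rightarrow> nat \<Rightarrow> 'w set" where
  "grid_hit x a U m = space M - avoid x a (1 / 2 ^ m) U (m * 2 ^ m)"

lemma grid_hit_sets: "a \<ge> 0 \<Longrightarrow> U \<in> sets borel \<Longrightarrow> grid_hit x a U m \<in> sets M"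
  unfolding grid_hit_def by (intro sets.Diff sets.top avoid_sets) auto

lemma right_cont_open:
  assumes w: "w \<in> space M" and t: "t \<ge> 0" and U: "open U" "x + X t w \<in> U"
  obtains e where "e > 0" "\<And>s. t \<le> s \<Longrightarrow> s < t + e \<Longrightarrow> x + X s w \<in> U"
proof -
  have "((\<lambda>s. x + X s w) \<longlongrightarrow> x + X t w) (at_right t)"
    by (intro tendsto_intros X_right_continuous w t)
  then have "eventually (\<lambda>s. x + X s w \<in> U) (at_right t)" using U by (rule topological_tendstoD)
  then obtain b where b: "b > t" "\<And>s. s > t \<Longrightarrow> s < b \<Longrightarrow> x + X s w \<in> U" by (auto simp: eventually_at_right_field)
  show thesis
  proof
    show "b - t > 0" using b by simp
    fix s assume "t \<le> s" "s < t + (b - t)"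
    then show "x + X s w \<in> U" using b(2)[of s] U(2) by (cases "s = t") auto
  qed
qed

text \<open>By right continuity a path that enters an open set stays there for a positive time and
  so meets a fine grid. This gives measurability of the continuous-time event by a countable
  union.\<close>

lemma hit_set_eq:
  assumes a: "a \<ge> 0" and U: "open U"
  shows "hit_set x a U = (\<Union>m. grid_hit x a U m)"
proof (intro set_eqI iffI)
  fix w assume "w \<in> hit_set x a U"
  then obtain t where w: "w \<in> space M" and t: "t \<ge> a" "x + X t w \<in> U" by (auto simp: hit_set_def)
  obtain e where e: "e > 0" "\<And>s. t \<le> s \<Longrightarrow> s < t + e \<Longrightarrow> x + X s w \<in> U"
    using right_cont_open[OF w _ U t(2)] t a by auto
  obtain m0 where m0: "(1/2) ^ m0 < e" using real_arch_pow_inv[OF e(1), of "1/2"] by auto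
  \<comment> \<open>The index \<open>m0\<close> makes the mesh finer than \<open>e\<close>; the
    other bound puts the horizon at least at \<open>t - a + 1\<close>, which leaves room for
    rounding up to the grid.\<close>
  define m where "m = max m0 (nat \<lceil>t - a\<rceil> + 1)"
  have "(1/2 :: real) ^ m \<le> (1/2) ^ m0" by (intro power_decreasing) (auto simp: m_def)
  then have me: "1 / 2 ^ m < e" using m0 by (simp add: power_one_over)
  have mt: "t - a + 1 \<le> real m"
  proof -
    have "t - a \<le> real (nat \<lceil>t - a\<rceil>)" using t by linarith
    then show ?thesis by (simp add: m_def)
  qed
  define k where "k = nat \<lceil>(t - a) * 2 ^ m\<rceil>"
  have k: "(t - a) * 2 ^ m \<le> real k" "real k < (t - a) * 2 ^ m + 1"
    unfolding k_def using t by (auto simp: of_nat_nat ceiling_correct) linarith+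
  have s1: "t \<le> a + real k * (1 / 2 ^ m)" using k(1) by (simp add: field_simps)
  have s2: "a + real k * (1 / 2 ^ m) < t + 1 / 2 ^ m"
    using divide_strict_right_mono[OF k(2), of "2 ^ m"] by (simp add: add_divide_distrib)
  have "real k < (t - a + 1) * 2 ^ m"
    using k(2) one_le_power[of "2::real" m] unfolding distrib_right mult_1 by linarith
  also have "\<dots> \<le> real m * 2 ^ m" using mt by (intro mult_right_mono) auto
  finally have "real k < real (m * 2 ^ m)" by simp
  then have "k \<le> m * 2 ^ m" by (simp only: of_nat_less_iff)
  moreover have "x + X (a + real k * (1 / 2 ^ m)) w \<in> U" using s1 s2 me by (intro e(2)) auto
  ultimately have "w \<in> grid_hit x a U m" using w by (auto simp: grid_hit_def avoid_def[OF a] grid_def[OF a])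
  then show "w \<in> (\<Union>m. grid_hit x a U m)" by blast
next
  fix w assume "w \<in> (\<Union>m. grid_hit x a U m)"
  then obtain m j where "w \<in> space M" "x + X (a + real j * (1 / 2 ^ m)) w \<in> U"
    by (auto simp: grid_hit_def avoid_def[OF a] grid_def[OF a])
  then show "w \<in> hit_set x a U" by (auto simp: hit_set_def intro!: exI[of _ "a + real j * (1 / 2 ^ m)"])
qed

lemma hit_set_sets: "a \<ge> 0 \<Longrightarrow> open U \<Longrightarrow> hit_set x a U \<in> sets M"
  unfolding hit_set_eq by (intro sets.countable_UN) (auto intro!: grid_hit_sets)

lemma grid_hit_incseq: "a \<ge> 0 \<Longrightarrow> incseq (grid_hit x a U)"
proof (rule incseq_SucI, rule subsetI)
  fix m w assume a: "a \<ge> 0" and "w \<in> grid_hit x a U m"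
  then obtain j where j: "w \<in> space M" "j \<le> m * 2 ^ m" "x + X (a + real j * (1 / 2 ^ m)) w \<in> U"
    by (auto simp: grid_hit_def avoid_def[OF a] grid_def[OF a])
  have "real j * (1 / 2 ^ m) = real (2 * j) * (1 / 2 ^ Suc m)" by simp
  moreover have "2 * j \<le> Suc m * 2 ^ Suc m" using j(2) by simp
  moreover have "(1::real) / 2 ^ Suc m > 0" by simp
  ultimately show "w \<in> grid_hit x a U (Suc m)"
    using j(1,3) by (auto simp: grid_hit_def avoid_def[OF a] grid_def[OF a] simp del: power_Suc of_nat_mult intro!: exI[of _ "2 * j"])
qed

lemma prob_grid_hit_tendsto: "a \<ge> 0 \<Longrightarrow> open U \<Longrightarrow> (\<lambda>m. prob (grid_hit x a U m)) \<longlonglongrightarrow> prob (hit_set x a U)"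
  unfolding hit_set_eq by (intro finite_Lim_measure_incseq grid_hit_incseq) (auto intro!: grid_hit_sets)

lemma prob_hit_upper:
  assumes a: "a \<ge> 0" and s: "s > 0" and U: "open U" and c: "\<And>v. v \<in> U \<Longrightarrow> c \<le> sphere_pot \<alpha> s v"
  shows "c * prob (hit_set x a U) \<le> (\<integral>w. sphere_pot \<alpha> s (x + X a w) \<partial>M)"
proof (rule LIMSEQ_le)
  let ?C = "generator_error s TYPE('a)"
  show "(\<lambda>m. c * prob (grid_hit x a U m)) \<longlonglongrightarrow> c * prob (hit_set x a U)"
    by (intro tendsto_mult_left prob_grid_hit_tendsto a U)
  have "(\<lambda>m. real m / 2 ^ m) \<longlonglongrightarrow> 0" by real_asymp
  then have "(\<lambda>m. (\<integral>w. sphere_pot \<alpha> s (x + X a w) \<partial>M) + ?C * (real m / 2 ^ m)) \<longlonglongrightarrow> (\<integral>w. sphere_pot \<alpha> s (x + X a w) \<partial>M) + ?C * 0"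
    by (intro tendsto_intros)
  then show "(\<lambda>m. (\<integral>w. sphere_pot \<alpha> s (x + X a w) \<partial>M) + ?C * (real m / 2 ^ m)) \<longlonglongrightarrow> (\<integral>w. sphere_pot \<alpha> s (x + X a w) \<partial>M)" by simp
  show "\<exists>N. \<forall>m\<ge>N. c * prob (grid_hit x a U m) \<le> (\<integral>w. sphere_pot \<alpha> s (x + X a w) \<partial>M) + ?C * (real m / 2 ^ m)"
  proof (intro exI allI impI)
    fix m :: nat
    have \<eta>: "(1::real) / 2 ^ m > 0" by simp
    have Ub: "U \<in> sets borel" using U by simp
    have "(\<integral>w. indicator (avoid x a (1 / 2 ^ m) U (m * 2 ^ m)) w * sphere_pot \<alpha> s (grid x a (1 / 2 ^ m) (m * 2 ^ m) w) \<partial>M) \<ge> 0"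
      by (intro Bochner_Integration.integral_nonneg mult_nonneg_nonneg sphere_pot_nonneg s) auto
    then have "c * prob (grid_hit x a U m) \<le> (\<integral>w. sphere_pot \<alpha> s (grid x a (1 / 2 ^ m) 0 w) \<partial>M) + real (m * 2 ^ m) * (?C * (1 / 2 ^ m)\<^sup>2)"
      using grid_hit_upper[OF a \<eta> s Ub c, of x "m * 2 ^ m"] unfolding grid_hit_def by linarith
    moreover have "real (m * 2 ^ m) * (?C * (1 / 2 ^ m)\<^sup>2) = ?C * (real m / 2 ^ m)" by (simp add: power2_eq_square)
    ultimately show "c * prob (grid_hit x a U m) \<le> (\<integral>w. sphere_pot \<alpha> s (x + X a w) \<partial>M) + ?C * (real m / 2 ^ m)"
      by (simp add: grid_def[OF a \<eta>])
  qed
qed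

definition shell :: "real \<Rightarrow> 'a set" where
  "shell \<delta> = {z. \<bar>norm z - 1\<bar> < \<delta>}"

lemma open_shell [simp]: "open (shell \<delta>)"
  unfolding shell_def by (intro open_Collect_less continuous_intros)

text \<open>Three limits are applied to \<open>grid_hit_lower\<close>, in this order: the mesh
  tending to 0 removes the generator error, \<open>s\<close> tending to 0 removes the heat outside
  the shell and restores the true potential, and the horizon \<open>T\<close> tending to infinity
  removes the terminal term. What remains compares the potential at \<open>x\<close> with its value
  on the sphere, and \<open>kappa_profile_one\<close> turns the quotient into \<theta>.\<close>

lemma theta_le_prob_hit:
  assumes \<delta>: "\<delta> > 0"
  shows "theta DIM('a) \<alpha> (norm x) \<le> prob (hit_set x 0 (shell \<delta>))"
proof -
  let ?P = "prob (hit_set x 0 (shell \<delta>))" and ?pb = "pot_bound DIM('a) \<alpha>"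
  define q where "q = (real DIM('a) - \<alpha>) / \<alpha>"
  have q: "q > 0" using dim \<alpha> by (simp add: q_def)
  obtain K :: real where K: "\<And>(M :: 'w measure) (D :: 'w \<Rightarrow> 'a) (\<tau>::real) (s::real) (x::'a). prob_space M \<Longrightarrow> D \<in> borel_measurable M \<Longrightarrow>
    (\<And>\<xi>. (\<integral>w. cis (\<xi> \<bullet> D w) \<partial>M) = complex_of_real (exp (- \<tau> * norm \<xi> powr \<alpha>))) \<Longrightarrow> s > 0 \<Longrightarrow> \<tau> > 0 \<Longrightarrow>
    (\<integral>w. sphere_pot \<alpha> s (x + D w) \<partial>M) \<le> K * \<tau> powr (- q)"
    using sphere_pot_decay[where 'w='w] unfolding q_def by blast
  define g where "g s = (2 * pi * s) powr (- real DIM('a) / 2) * exp (- \<delta>\<^sup>2 / (2 * s))" for s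
  have step: "sphere_pot \<alpha> s x \<le> ?pb * ?P + K * real T powr (- q) + real T * g s" if s: "s > 0" and T: "T > 0" for s and T :: nat
  proof (rule LIMSEQ_le)
    let ?C = "generator_error s TYPE('a)"
    show "(\<lambda>m::nat. sphere_pot \<alpha> s x) \<longlonglongrightarrow> sphere_pot \<alpha> s x" by simp
    have "(\<lambda>m. real T / 2 ^ m) \<longlonglongrightarrow> 0" by real_asymp
    then have "(\<lambda>m. ?pb * ?P + K * real T powr (- q) + real T * g s + ?C * (real T / 2 ^ m)) \<longlonglongrightarrow> ?pb * ?P + K * real T powr (- q) + real T * g s + ?C * 0"
      by (intro tendsto_intros)
    then show "(\<lambda>m. ?pb * ?P + K * real T powr (- q) + real T * g s + ?C * (real T / 2 ^ m)) \<longlonglongrightarrow> ?pb * ?P + K * real T powr (- q) + real T * g s" by simp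
    show "\<exists>N. \<forall>m\<ge>N. sphere_pot \<alpha> s x \<le> ?pb * ?P + K * real T powr (- q) + real T * g s + ?C * (real T / 2 ^ m)"
    proof (intro exI allI impI)
      fix m :: nat
      have \<eta>: "(1::real) / 2 ^ m > 0" by simp
      let ?k = "T * 2 ^ m" and ?av = "avoid x 0 (1 / 2 ^ m) (shell \<delta>) (T * 2 ^ m)"
      have Ub: "shell \<delta> \<in> sets borel" by simp
      have av: "?av \<in> sets M" by (rule avoid_sets[OF order_refl \<eta> Ub])
      have "(\<integral>w. sphere_pot \<alpha> s (grid x 0 (1 / 2 ^ m) 0 w) \<partial>M) = (\<integral>w. sphere_pot \<alpha> s x \<partial>M)"
        by (intro Bochner_Integration.integral_cong refl) (simp add: grid_def[OF order_refl \<eta>] X_0)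
      then have 1: "(\<integral>w. sphere_pot \<alpha> s (grid x 0 (1 / 2 ^ m) 0 w) \<partial>M) = sphere_pot \<alpha> s x" using prob_space by simp
      have 2: "prob (space M - ?av) \<le> ?P"
      proof (intro finite_measure_mono hit_set_sets)
        show "space M - ?av \<subseteq> hit_set x 0 (shell \<delta>)"
        proof
          fix w assume "w \<in> space M - ?av"
          then obtain j where "w \<in> space M" "x + X (0 + real j * (1 / 2 ^ m)) w \<in> shell \<delta>"
            by (auto simp: avoid_def[OF order_refl \<eta>] grid_def[OF order_refl \<eta>])
          then show "w \<in> hit_set x 0 (shell \<delta>)" by (auto simp: hit_set_def intro!: exI[of _ "0 + real j * (1 / 2 ^ m)"])
        qed
      qed auto
      have T2: "0 + real ?k * (1 / 2 ^ m) = real T" by simp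
      have 3: "(\<integral>w. indicator ?av w * sphere_pot \<alpha> s (grid x 0 (1 / 2 ^ m) ?k w) \<partial>M) \<le> K * real T powr (- q)"
      proof -
        have "(\<integral>w. indicator ?av w * sphere_pot \<alpha> s (grid x 0 (1 / 2 ^ m) ?k w) \<partial>M) \<le> (\<integral>w. sphere_pot \<alpha> s (grid x 0 (1 / 2 ^ m) ?k w) \<partial>M)"
        proof (rule integral_mono)
          show "integrable M (\<lambda>w. indicator ?av w * sphere_pot \<alpha> s (grid x 0 (1 / 2 ^ m) ?k w))"
            by (rule pot_integrable[OF order_refl \<eta> s av])
          show "integrable M (\<lambda>w. sphere_pot \<alpha> s (grid x 0 (1 / 2 ^ m) ?k w))"
            using pot_integrable[OF order_refl \<eta> s sets.top, of x ?k]
            by (rule Bochner_Integration.integrable_cong[THEN iffD1, rotated -1]) auto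
        qed (auto split: split_indicator simp: sphere_pot_nonneg s)
        also have "\<dots> = (\<integral>w. sphere_pot \<alpha> s (x + X (real T) w) \<partial>M)" unfolding grid_def[OF order_refl \<eta>] T2 ..
        also have "\<dots> \<le> K * real T powr (- q)"
          using T by (intro K[OF prob_space_axioms X_measurable X_char s]) auto
        finally show ?thesis .
      qed
      have 4: "sphere_heat s v \<le> g s" if "v \<notin> shell \<delta>" for v
        unfolding g_def using that \<delta> by (intro sphere_heat_far s) (auto simp: shell_def)
      have 5: "g s \<ge> 0" by (simp add: g_def)
      have 6: "real ?k * (1 / 2 ^ m * g s + ?C * (1 / 2 ^ m)\<^sup>2) = real T * g s + ?C * (real T / 2 ^ m)"
        by (simp add: power2_eq_square distrib_left)
      have "?pb * prob (space M - ?av) \<le> ?pb * ?P" by (intro mult_left_mono 2 pot_bound_nonneg)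
      then show "sphere_pot \<alpha> s x \<le> ?pb * ?P + K * real T powr (- q) + real T * g s + ?C * (real T / 2 ^ m)"
        using grid_hit_lower[OF order_refl \<eta> s Ub 4 5, of x ?k] 3 unfolding 1 6 by linarith
    qed
  qed
  have step2: "riesz_const DIM('a) * riesz_profile DIM('a) \<alpha> (norm x) \<le> ?pb * ?P + K * real T powr (- q)" if T: "T > 0" for T :: nat
  proof (rule LIMSEQ_le)
    define s where "s n = 1 / real (Suc n)" for n
    have s: "s n > 0" for n by (simp add: s_def)
    have s0: "s \<longlonglongrightarrow> 0" unfolding s_def by (rule LIMSEQ_inverse_real_of_nat[unfolded inverse_eq_divide])
    show "(\<lambda>n. sphere_pot \<alpha> (s n) x) \<longlonglongrightarrow> riesz_const DIM('a) * riesz_profile DIM('a) \<alpha> (norm x)"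
      by (rule sphere_pot_tendsto[OF s s0])
    have "filterlim s (at_right 0) sequentially"
      using s0 s by (auto simp: filterlim_at intro!: always_eventually less_imp_neq[symmetric])
    then have "(\<lambda>n. g (s n)) \<longlonglongrightarrow> 0"
      unfolding g_def by (rule filterlim_compose[OF gaussian_far_tendsto_0[OF \<delta>, of "real DIM('a)"], rotated]) simp
    then have "(\<lambda>n. ?pb * ?P + K * real T powr (- q) + real T * g (s n)) \<longlonglongrightarrow> ?pb * ?P + K * real T powr (- q) + real T * 0"
      by (intro tendsto_intros)
    then show "(\<lambda>n. ?pb * ?P + K * real T powr (- q) + real T * g (s n)) \<longlonglongrightarrow> ?pb * ?P + K * real T powr (- q)" by simp
    show "\<exists>N. \<forall>n\<ge>N. sphere_pot \<alpha> (s n) x \<le> ?pb * ?P + K * real T powr (- q) + real T * g (s n)"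
      using step[OF s T] by blast
  qed
  have "riesz_const DIM('a) * riesz_profile DIM('a) \<alpha> (norm x) \<le> ?pb * ?P"
  proof (rule LIMSEQ_le_const)
    have "(\<lambda>T. real T powr (- q)) \<longlonglongrightarrow> 0"
      using q by (intro tendsto_neg_powr filterlim_real_sequentially) auto
    then have "(\<lambda>T. ?pb * ?P + K * real T powr (- q)) \<longlonglongrightarrow> ?pb * ?P + K * 0" by (intro tendsto_intros)
    then show "(\<lambda>T. ?pb * ?P + K * real T powr (- q)) \<longlonglongrightarrow> ?pb * ?P" by simp
    show "\<exists>N. \<forall>T\<ge>N. riesz_const DIM('a) * riesz_profile DIM('a) \<alpha> (norm x) \<le> ?pb * ?P + K * real T powr (- q)"
      using step2 by (intro exI[of _ 1]) auto
  qed
  then have "riesz_const DIM('a) * riesz_profile DIM('a) \<alpha> (norm x) \<le> riesz_const DIM('a) * (riesz_profile DIM('a) \<alpha> 1 * ?P)"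
    unfolding pot_bound_def by (simp only: mult.assoc)
  then have "riesz_profile DIM('a) \<alpha> (norm x) \<le> riesz_profile DIM('a) \<alpha> 1 * ?P"
    using riesz_const_pos by (simp only: mult_le_cancel_left_pos)
  then have "kappa DIM('a) \<alpha> * riesz_profile DIM('a) \<alpha> (norm x) \<le> kappa DIM('a) \<alpha> * (riesz_profile DIM('a) \<alpha> 1 * ?P)"
    using kappa_pos by (intro mult_left_mono) auto
  then show ?thesis unfolding theta_def mult.assoc[symmetric] kappa_profile_one by simp
qed

section \<open>Jumps that start at the sphere\<close>

definition jump_event :: "'a \<Rightarrow> nat \<Rightarrow> real \<Rightarrow> real \<Rightarrow> nat \<Rightarrow> 'w set" where
  "jump_event x T \<delta> \<epsilon> m = (\<Union>k<T * 2 ^ m. {w \<in> space M. grid x 0 (1 / 2 ^ m) k w \<in> shell \<delta> \<and>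
     \<epsilon> < norm (grid x 0 (1 / 2 ^ m) (Suc k) w - grid x 0 (1 / 2 ^ m) k w)})"

text \<open>A jump from the sphere is seen by every sufficiently fine grid. Taking the lower limit
  of the grid events, rather than their union, keeps its probability below any bound that holds for
  all fine grids.\<close>

definition jump_liminf :: "'a \<Rightarrow> nat \<Rightarrow> real \<Rightarrow> real \<Rightarrow> 'w set" where
  "jump_liminf x T \<delta> \<epsilon> = (\<Union>n. \<Inter>m\<in>{n..}. jump_event x T \<delta> \<epsilon> m)"

lemma jump_event_sets [measurable]: "jump_event x T \<delta> \<epsilon> m \<in> sets M"
proof -
  have \<eta>: "(1::real) / 2 ^ m > 0" by simp
  have [measurable]: "shell \<delta> \<in> sets borel" by simp
  note [measurable] = grid_measurable[OF order_refl \<eta>]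
  show ?thesis unfolding jump_event_def by measurable
qed

lemma jump_liminf_sets [measurable]: "jump_liminf x T \<delta> \<epsilon> \<in> sets M"
  unfolding jump_liminf_def by (intro sets.countable_UN image_subsetI sets.countable_INT') auto

text \<open>A jump of size \<open>> \<epsilon>\<close> occurs at rate \<open>O(1)\<close> independently of the current position, and the expected time
  spent near the sphere is small; hence jumps starting at the sphere do not occur.\<close>
lemma prob_jump_liminf:
  assumes \<epsilon>: "\<epsilon> > 0" and e: "e > 0"
  obtains \<delta> where "\<delta> > 0" "prob (jump_liminf x T \<delta> \<epsilon>) \<le> e"
proof -
  obtain K where K: "\<And>(M :: 'w measure) (D :: 'w \<Rightarrow> 'a) \<tau>. prob_space M \<Longrightarrow> D \<in> borel_measurable M \<Longrightarrow>
    (\<And>\<xi>. (\<integral>w. cis (\<xi> \<bullet> D w) \<partial>M) = complex_of_real (exp (- \<tau> * norm \<xi> powr \<alpha>))) \<Longrightarrow> \<tau> \<ge> 0 \<Longrightarrow>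
    measure M {w \<in> space M. \<epsilon> < norm (D w)} \<le> K * \<tau>"
    using increment_tail[OF \<epsilon>, where 'w='w] by blast
  define K' where "K' = max K 0"
  let ?pb = "pot_bound DIM('a) \<alpha>"
  \<comment> \<open>Up to errors that vanish with the mesh, the expected time near the sphere is at
    most \<open>pot_bound / R\<close> and jumps occur at rate at most \<open>K'\<close>. This
    \<open>R\<close> makes the product at most \<open>e\<close>; the summand 1 keeps it
    positive.\<close>
  define R where "R = K' * ?pb / e + 1"
  have R: "R > 0" using e pot_bound_nonneg by (auto simp: R_def K'_def intro!: add_nonneg_pos divide_nonneg_pos mult_nonneg_nonneg)
  obtain s \<delta> where s: "s > 0" and \<delta>: "\<delta> > 0" and near: "\<And>v::'a. \<bar>norm v - 1\<bar> < \<delta> \<Longrightarrow> R \<le> sphere_heat s v"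
    using sphere_heat_near[of R] by blast
  let ?C = "generator_error s TYPE('a)"
  have pj: "prob (jump_event x T \<delta> \<epsilon> m) \<le> K' / R * (?pb + ?C * (real T / 2 ^ m))" for m
  proof -
    define \<eta> where "\<eta> = (1::real) / 2 ^ m"
    have \<eta>: "\<eta> > 0" by (simp add: \<eta>_def)
    let ?g = "grid x 0 \<eta>"
    note [measurable] = grid_measurable[OF order_refl \<eta>]
    have [measurable]: "shell \<delta> \<in> sets borel" by simp
    have one: "prob {w \<in> space M. ?g k w \<in> shell \<delta> \<and> \<epsilon> < norm (?g (Suc k) w - ?g k w)} \<le> K' / R * (\<eta> * (\<integral>w. sphere_heat s (?g k w) \<partial>M))" for k
    proof -
      have t: "prob {w \<in> space M. \<epsilon> < norm (?g (Suc k) w - ?g k w)} \<le> K' * \<eta>"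
      proof -
        have "prob {w \<in> space M. \<epsilon> < norm (?g (Suc k) w - ?g k w)} \<le> K * \<eta>"
          using \<eta> by (intro K[OF prob_space_axioms _ grid_increment_char[OF order_refl \<eta>]]) auto
        also have "\<dots> \<le> K' * \<eta>" using \<eta> by (intro mult_right_mono) (auto simp: K'_def)
        finally show ?thesis .
      qed
      have h: "R * prob {w \<in> space M. ?g k w \<in> shell \<delta>} \<le> (\<integral>w. sphere_heat s (?g k w) \<partial>M)"
      proof -
        have "R * prob {w \<in> space M. ?g k w \<in> shell \<delta>} = (\<integral>w. R * indicator {w \<in> space M. ?g k w \<in> shell \<delta>} w \<partial>M)" by simp
        also have "\<dots> \<le> (\<integral>w. sphere_heat s (?g k w) \<partial>M)"
        proof (rule integral_mono)
          show "integrable M (\<lambda>w. R * indicator {w \<in> space M. ?g k w \<in> shell \<delta>} w)"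
            by (intro integrable_mult_right integrable_real_indicator) (auto simp: emeasure_eq_measure)
          show "integrable M (\<lambda>w. sphere_heat s (?g k w))"
            using heat_integrable[OF order_refl \<eta> s sets.top, of x k]
            by (rule Bochner_Integration.integrable_cong[THEN iffD1, rotated -1]) auto
          show "R * indicator {w \<in> space M. ?g k w \<in> shell \<delta>} w \<le> sphere_heat s (?g k w)" for w
            using near[of "?g k w"] by (auto split: split_indicator simp: shell_def sphere_heat_nonneg)
        qed
        finally show ?thesis .
      qed
      have "prob {w \<in> space M. ?g k w \<in> shell \<delta> \<and> \<epsilon> < norm (?g (Suc k) w - ?g k w)}
        = prob {w \<in> space M. ?g k w \<in> shell \<delta>} * prob {w \<in> space M. \<epsilon> < norm (?g (Suc k) w - ?g k w)}"
        by (rule grid_increment_indep[OF order_refl \<eta>]) simp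
      also have "\<dots> \<le> ((\<integral>w. sphere_heat s (?g k w) \<partial>M) / R) * (K' * \<eta>)"
        using h R by (intro mult_mono t) (auto simp: field_simps intro!: divide_nonneg_pos Bochner_Integration.integral_nonneg sphere_heat_nonneg)
      finally show ?thesis by (simp add: mult_ac)
    qed
    have "prob (jump_event x T \<delta> \<epsilon> m) \<le> (\<Sum>k<T * 2 ^ m. prob {w \<in> space M. ?g k w \<in> shell \<delta> \<and> \<epsilon> < norm (?g (Suc k) w - ?g k w)})"
      unfolding jump_event_def \<eta>_def[symmetric] by (rule finite_measure_subadditive_finite) auto
    also have "\<dots> \<le> (\<Sum>k<T * 2 ^ m. K' / R * (\<eta> * (\<integral>w. sphere_heat s (?g k w) \<partial>M)))" by (intro sum_mono one)
    also have "\<dots> = K' / R * (\<Sum>k<T * 2 ^ m. \<eta> * (\<integral>w. sphere_heat s (?g k w) \<partial>M))" by (simp only: sum_distrib_left)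
    also have "\<dots> \<le> K' / R * (?pb + real (T * 2 ^ m) * (?C * \<eta>\<^sup>2))"
      using R by (intro mult_left_mono grid_occupation[OF order_refl \<eta> s]) (auto simp: K'_def)
    also have "real (T * 2 ^ m) * (?C * \<eta>\<^sup>2) = ?C * (real T / 2 ^ m)" by (simp add: \<eta>_def power2_eq_square)
    finally show ?thesis .
  qed
  have "prob (\<Inter>m\<in>{n..}. jump_event x T \<delta> \<epsilon> m) \<le> K' / R * ?pb" for n
  proof (rule LIMSEQ_le_const)
    have "(\<lambda>m. real T / 2 ^ m) \<longlonglongrightarrow> 0" by real_asymp
    then have "(\<lambda>m. K' / R * (?pb + ?C * (real T / 2 ^ m))) \<longlonglongrightarrow> K' / R * (?pb + ?C * 0)" by (intro tendsto_intros)
    then show "(\<lambda>m. K' / R * (?pb + ?C * (real T / 2 ^ m))) \<longlonglongrightarrow> K' / R * ?pb" by simp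
    show "\<exists>N. \<forall>m\<ge>N. prob (\<Inter>m\<in>{n..}. jump_event x T \<delta> \<epsilon> m) \<le> K' / R * (?pb + ?C * (real T / 2 ^ m))"
      by (intro exI[of _ n] allI impI order.trans[OF finite_measure_mono pj]) auto
  qed
  moreover have "(\<lambda>n. prob (\<Inter>m\<in>{n..}. jump_event x T \<delta> \<epsilon> m)) \<longlonglongrightarrow> prob (jump_liminf x T \<delta> \<epsilon>)"
    unfolding jump_liminf_def
    by (rule finite_Lim_measure_incseq) (auto intro!: sets.countable_INT' incseq_SucI)
  ultimately have "prob (jump_liminf x T \<delta> \<epsilon>) \<le> K' / R * ?pb"
    by (intro LIMSEQ_le_const2) auto
  also have "\<dots> \<le> e"
  proof -
    have "K' * ?pb \<le> e * R" using e by (simp add: R_def distrib_left)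
    then show ?thesis using R by (simp add: field_simps)
  qed
  finally show thesis using that[OF \<delta>] by blast
qed

text \<open>Two neighbouring grid times straddle \<open>t\<close>: before it the path is close to
  the left limit \<open>l\<close>, hence in the shell, and after it close to \<open>X t w\<close> by
  right continuity.\<close>

lemma jump_in_liminf:
  assumes w: "w \<in> space M" and t: "0 < t" "t \<le> real T" and l: "((\<lambda>s. X s w) \<longlongrightarrow> l) (at_left t)"
    and x: "norm (x + l) = 1" and \<epsilon>: "\<epsilon> < norm (X t w - l)" and \<delta>: "\<delta> > 0"
  shows "w \<in> jump_liminf x T \<delta> \<epsilon>"
proof -
  \<comment> \<open>Half of the excess of the jump over \<epsilon>: the approximation errors at both
    ends together still leave a step larger than \<epsilon>.\<close>
  define \<rho> where "\<rho> = (norm (X t w - l) - \<epsilon>) / 2"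
  have \<rho>: "\<rho> > 0" using \<epsilon> by (simp add: \<rho>_def)
  have "((\<lambda>s. \<bar>norm (x + X s w) - 1\<bar>) \<longlongrightarrow> \<bar>norm (x + l) - 1\<bar>) (at_left t)" by (intro tendsto_intros l)
  then have "eventually (\<lambda>s. \<bar>norm (x + X s w) - 1\<bar> < \<delta>) (at_left t)" using x \<delta> by (auto dest: order_tendstoD(2))
  moreover have "eventually (\<lambda>s. dist (X s w) l < \<rho>) (at_left t)" using l \<rho> by (rule tendstoD)
  ultimately have "eventually (\<lambda>s. \<bar>norm (x + X s w) - 1\<bar> < \<delta> \<and> dist (X s w) l < \<rho>) (at_left t)" by (rule eventually_conj)
  then obtain b where b: "b < t" "\<And>s. b < s \<Longrightarrow> s < t \<Longrightarrow> \<bar>norm (x + X s w) - 1\<bar> < \<delta> \<and> dist (X s w) l < \<rho>"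
    by (auto simp: eventually_at_left_field)
  obtain e where e: "e > 0" "\<And>s. t \<le> s \<Longrightarrow> s < t + e \<Longrightarrow> 0 + X s w \<in> ball (X t w) \<rho>"
    using right_cont_open[OF w less_imp_le[OF t(1)], of "ball (X t w) \<rho>" 0] \<rho> by auto
  obtain n where n: "(1/2) ^ n < min e (t - b)" using real_arch_pow_inv[of "min e (t - b)" "1/2"] e b by auto
  have "w \<in> jump_event x T \<delta> \<epsilon> m" if m: "m \<ge> n" for m
  proof -
    have "(1/2 :: real) ^ m \<le> (1/2) ^ n" using m by (intro power_decreasing) auto
    then have me: "1 / 2 ^ m < e" "1 / 2 ^ m < t - b" using n by (auto simp: power_one_over)
    have \<eta>: "(1::real) / 2 ^ m > 0" by simp
    \<comment> \<open>The last grid index strictly before \<open>t\<close>. If \<open>t\<close> is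
      itself a grid time, it has to be the right end of the step.\<close>
    define k where "k = nat (\<lceil>t * 2 ^ m\<rceil> - 1)"
    have "t * 2 ^ m > 0" using t by simp
    then have k: "real k < t * 2 ^ m" "t * 2 ^ m \<le> real k + 1" unfolding k_def by linarith+
    have k1: "real k * (1 / 2 ^ m) < t" "t \<le> real (Suc k) * (1 / 2 ^ m)" using k by (auto simp: field_simps)
    have k2: "real (Suc k) * (1 / 2 ^ m) = real k * (1 / 2 ^ m) + 1 / 2 ^ m" by (simp add: add_divide_distrib)
    have "t * 2 ^ m \<le> real T * 2 ^ m" using t(2) by (intro mult_right_mono) auto
    then have "real k < real T * 2 ^ m" using k(1) by linarith
    then have "real k < real (T * 2 ^ m)" by simp
    then have kT: "k < T * 2 ^ m" by (simp only: of_nat_less_iff)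
    have L: "\<bar>norm (x + X (real k * (1 / 2 ^ m)) w) - 1\<bar> < \<delta>" "dist (X (real k * (1 / 2 ^ m)) w) l < \<rho>"
      using b(2)[of "real k * (1 / 2 ^ m)"] k1 k2 me by auto
    have "X (real (Suc k) * (1 / 2 ^ m)) w \<in> ball (X t w) \<rho>"
      using e(2)[of "real (Suc k) * (1 / 2 ^ m)"] k1 k2 me by auto
    then have "dist (X (real (Suc k) * (1 / 2 ^ m)) w) (X t w) < \<rho>" by (simp add: dist_commute)
    moreover have "norm (X t w - l) \<le> dist (X (real (Suc k) * (1 / 2 ^ m)) w) (X t w) + norm (X (real (Suc k) * (1 / 2 ^ m)) w - X (real k * (1 / 2 ^ m)) w) + dist (X (real k * (1 / 2 ^ m)) w) l"
      unfolding dist_norm by norm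
    ultimately have "\<epsilon> < norm (X (real (Suc k) * (1 / 2 ^ m)) w - X (real k * (1 / 2 ^ m)) w)"
      using L(2) unfolding \<rho>_def by (simp add: field_simps)
    then show ?thesis
      using kT L(1) w unfolding jump_event_def grid_def[OF order_refl \<eta>] shell_def
      by (intro UN_I[of k]) auto
  qed
  then show ?thesis unfolding jump_liminf_def by auto
qed

end

section \<open>The hitting probability of the sphere\<close>

context stable_process
begin

lemma hit_time_finite_iff:
  "hit_time B (path_from X x w) < \<infinity> \<longleftrightarrow> (\<exists>t>0. x + X t w \<in> B)"
proof -
  let ?S = "{ereal t |t. 0 < t \<and> path_from X x w t \<notin> - B}"
  have "Inf ?S < \<infinity> \<longleftrightarrow> ?S \<noteq> {}"
  proof
    assume *: "Inf ?S < \<infinity>"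
    show "?S \<noteq> {}"
    proof
      assume "?S = {}"
      then have "Inf ?S = \<infinity>" by (simp only: Inf_empty top_ereal_def)
      then show False using * by simp
    qed
  next
    assume "?S \<noteq> {}"
    then obtain t where t: "ereal t \<in> ?S" by auto
    then have "Inf ?S \<le> ereal t" by (rule Inf_lower)
    then show "Inf ?S < \<infinity>" by (rule le_less_trans) simp
  qed
  then show ?thesis by (auto simp: hit_time_def exit_time_def path_from_def)
qed

text \<open>Returning to the ball after time \<open>n\<close> requires potential at time
  \<open>n\<close>, whose mean is of order \<open>n powr (- ((d - \<alpha>) / \<alpha>))\<close> and
  tends to 0. This excludes paths that come close to the sphere only as time tends to
  infinity.\<close>

lemma transient_null:
  "prob (\<Inter>n. hit_set x (real n) (ball 0 2)) = 0"
proof -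
  obtain K :: real where K: "\<And>(M :: 'w measure) (D :: 'w \<Rightarrow> 'a) (\<tau>::real) (s::real) (x::'a). prob_space M \<Longrightarrow> D \<in> borel_measurable M \<Longrightarrow>
    (\<And>\<xi>. (\<integral>w. cis (\<xi> \<bullet> D w) \<partial>M) = complex_of_real (exp (- \<tau> * norm \<xi> powr \<alpha>))) \<Longrightarrow> s > 0 \<Longrightarrow> \<tau> > 0 \<Longrightarrow>
    (\<integral>w. sphere_pot \<alpha> s (x + D w) \<partial>M) \<le> K * \<tau> powr (- ((real DIM('a) - \<alpha>) / \<alpha>))"
    using sphere_pot_decay[where 'w='w] by blast
  obtain c where c: "c > 0" "\<And>x::'a. norm x \<le> 2 \<Longrightarrow> c \<le> sphere_pot \<alpha> 1 x"
    using sphere_pot_lower_bound[of 1] by auto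
  let ?A = "\<Inter>n. hit_set x (real n) (ball 0 2)"
  have m: "hit_set x (real n) (ball 0 2) \<in> sets M" for n by (rule hit_set_sets) auto
  have "c * prob ?A \<le> K * real n powr (- ((real DIM('a) - \<alpha>) / \<alpha>))" if "n \<ge> 1" for n :: nat
  proof -
    have "c * prob ?A \<le> c * prob (hit_set x (real n) (ball 0 2))"
      using c(1) m by (intro mult_left_mono finite_measure_mono) auto
    also have "\<dots> \<le> (\<integral>w. sphere_pot \<alpha> 1 (x + X (real n) w) \<partial>M)"
      by (rule prob_hit_upper) (use c in auto)
    also have "\<dots> \<le> K * real n powr (- ((real DIM('a) - \<alpha>) / \<alpha>))"
      using that by (intro K[OF prob_space_axioms X_measurable X_char]) auto
    finally show ?thesis .
  qed
  moreover have "(\<lambda>n. K * real n powr (- ((real DIM('a) - \<alpha>) / \<alpha>))) \<longlonglongrightarrow> 0"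
    using dim \<alpha> by (intro tendsto_mult_right_zero tendsto_neg_powr filterlim_real_sequentially) auto
  ultimately have "c * prob ?A \<le> 0" by (intro LIMSEQ_le_const) auto
  then show ?thesis using c(1) measure_nonneg[of M ?A] by (simp add: mult_le_0_iff)
qed

text \<open>For each horizon \<open>T\<close> and jump size \<open>1 / real (Suc j)\<close> the
  exceptional events are intersected over shells belonging to the error bounds
  \<open>1 / real (Suc n)\<close>, and a countable union covers all jumps. Producing a measurable
  superset \<open>N\<close> avoids the question whether the jump event itself is measurable.\<close>

lemma jump_null_set:
  obtains N where "N \<in> sets M" "prob N = 0"
    "\<And>w t l. w \<in> space M \<Longrightarrow> 0 < t \<Longrightarrow> ((\<lambda>s. X s w) \<longlongrightarrow> l) (at_left t) \<Longrightarrow> norm (x + l) = 1 \<Longrightarrow> X t w \<noteq> l \<Longrightarrow> w \<in> N"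
proof -
  have "\<exists>\<delta>>0. prob (jump_liminf x T \<delta> (1 / real (Suc j))) \<le> 1 / real (Suc n)" for T j n
    using prob_jump_liminf[of "1 / real (Suc j)" "1 / real (Suc n)" x T] by auto
  then obtain \<delta> where \<delta>: "\<And>T j n. \<delta> T j n > 0" "\<And>T j n. prob (jump_liminf x T (\<delta> T j n) (1 / real (Suc j))) \<le> 1 / real (Suc n)"
    by metis
  define J where "J T j = (\<Inter>n. jump_liminf x T (\<delta> T j n) (1 / real (Suc j)))" for T j
  have Jm: "J T j \<in> sets M" for T j unfolding J_def by (intro sets.countable_INT) auto
  have J0: "prob (J T j) = 0" for T j
  proof -
    have "prob (J T j) \<le> 1 / real (Suc n)" for n
      by (rule order.trans[OF finite_measure_mono \<delta>(2)[of T j n]]) (auto simp: J_def)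
    moreover have "(\<lambda>n. 1 / real (Suc n)) \<longlonglongrightarrow> 0" by (rule LIMSEQ_inverse_real_of_nat[unfolded inverse_eq_divide])
    ultimately have "prob (J T j) \<le> 0" by (intro LIMSEQ_le_const) auto
    then show ?thesis using measure_nonneg[of M "J T j"] by linarith
  qed
  show thesis
  proof
    show "(\<Union>T. \<Union>j. J T j) \<in> sets M" using Jm by (intro sets.countable_UN) auto
    have "(\<Union>T. \<Union>j. J T j) \<in> null_sets M"
      by (intro null_sets_UN null_setsI Jm) (simp add: emeasure_eq_measure J0)
    then show "prob (\<Union>T. \<Union>j. J T j) = 0" by (simp add: null_sets_def measure_def)
    fix w t l assume a: "w \<in> space M" "0 < t" "((\<lambda>s. X s w) \<longlongrightarrow> l) (at_left t)" "norm (x + l) = 1" "X t w \<noteq> l"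
    obtain T :: nat where T: "t \<le> real T" using real_arch_simple by blast
    obtain j :: nat where j: "1 / real (Suc j) < norm (X t w - l)"
      using reals_Archimedean[of "norm (X t w - l)"] a(5) by (auto simp: inverse_eq_divide)
    have "w \<in> J T j" unfolding J_def using jump_in_liminf[OF a(1,2) T a(3,4) j \<delta>(1)] by auto
    then show "w \<in> (\<Union>T. \<Union>j. J T j)" by auto
  qed
qed

text \<open>The times of approach to thinner and thinner shells are bounded because of
  \<open>tr\<close> and accumulate at some \<tau>. If infinitely many of them lie at or after
  \<tau>, right continuity puts the position at \<tau> on the sphere. Otherwise \<tau> is approached
  from the left, the left limit lies on the sphere, and \<open>jump\<close> identifies it with the
  position at \<tau>.\<close>

lemma path_hits_sphere:
  assumes w: "w \<in> space M" and x: "norm x \<noteq> 1"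
    and hits: "\<And>n. w \<in> hit_set x 0 (shell (1 / real (Suc n)))"
    and tr: "w \<notin> (\<Inter>n. hit_set x (real n) (ball 0 2))"
    and jump: "\<And>t l. 0 < t \<Longrightarrow> ((\<lambda>s. X s w) \<longlongrightarrow> l) (at_left t) \<Longrightarrow> norm (x + l) = 1 \<Longrightarrow> X t w = l"
  shows "\<exists>t>0. norm (x + X t w) = 1"
proof -
  have "\<exists>t\<ge>0. \<bar>norm (x + X t w) - 1\<bar> < 1 / real (Suc n)" for n
    using hits[of n] by (auto simp: hit_set_def shell_def)
  then obtain t where t: "\<And>n. t n \<ge> 0" "\<And>n. \<bar>norm (x + X (t n) w) - 1\<bar> < 1 / real (Suc n)" by metis
  obtain N :: nat where N: "\<And>s. s \<ge> real N \<Longrightarrow> x + X s w \<notin> ball 0 2" using tr w by (auto simp: hit_set_def)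
  have tN: "t n \<in> {0..real N}" for n
  proof -
    have "1 / real (Suc n) \<le> 1" by simp
    then have "norm (x + X (t n) w) < 2" using t(2)[of n] unfolding abs_less_iff by linarith
    then have "x + X (t n) w \<in> ball 0 2" by simp
    then show ?thesis using N[of "t n"] t(1)[of n] by (cases "real N \<le> t n") auto
  qed
  obtain \<tau> r where r: "\<tau> \<in> {0..real N}" "strict_mono (r :: nat \<Rightarrow> nat)" "(t \<circ> r) \<longlonglongrightarrow> \<tau>"
    using compact_Icc[of 0 "real N", unfolded compact_def] tN by blast
  have lim1: "(\<lambda>n. norm (x + X (t (r n)) w)) \<longlonglongrightarrow> 1"
  proof (rule LIM_zero_cancel, rule tendsto_rabs_zero_cancel, rule tendsto_sandwich[of "\<lambda>_. 0" _ _ "\<lambda>n. 1 / real (Suc n)"])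
    show "\<forall>\<^sub>F n in sequentially. \<bar>norm (x + X (t (r n)) w) - 1\<bar> \<le> 1 / real (Suc n)"
    proof (intro always_eventually allI)
      fix n
      have "\<bar>norm (x + X (t (r n)) w) - 1\<bar> \<le> 1 / real (Suc (r n))" using t(2)[of "r n"] by simp
      also have "\<dots> \<le> 1 / real (Suc n)" using seq_suble[OF r(2), of n] by (intro divide_left_mono) auto
      finally show "\<bar>norm (x + X (t (r n)) w) - 1\<bar> \<le> 1 / real (Suc n)" .
    qed
    show "(\<lambda>n. 1 / real (Suc n)) \<longlonglongrightarrow> 0" by (rule LIMSEQ_inverse_real_of_nat[unfolded inverse_eq_divide])
  qed auto
  have \<tau>0: "\<tau> \<ge> 0" using r by simp
  show ?thesis
  proof (cases "\<exists>\<^sub>F n in sequentially. t (r n) \<ge> \<tau>")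
    case True
    have "norm (x + X \<tau> w) = 1"
    proof (rule ccontr)
      assume ne: "norm (x + X \<tau> w) \<noteq> 1"
      define \<epsilon> where "\<epsilon> = \<bar>norm (x + X \<tau> w) - 1\<bar> / 2"
      have \<epsilon>: "\<epsilon> > 0" using ne by (simp add: \<epsilon>_def)
      obtain e where e: "e > 0" "\<And>s. \<tau> \<le> s \<Longrightarrow> s < \<tau> + e \<Longrightarrow> x + X s w \<in> ball (x + X \<tau> w) \<epsilon>"
        using right_cont_open[OF w \<tau>0, of "ball (x + X \<tau> w) \<epsilon>" x] \<epsilon> by auto
      have "eventually (\<lambda>n. t (r n) < \<tau> + e) sequentially"
        using r(3) e(1) by (intro order_tendstoD(2)[of _ \<tau>]) (auto simp: o_def)
      moreover have "eventually (\<lambda>n. \<bar>norm (x + X (t (r n)) w) - 1\<bar> < \<epsilon>) sequentially"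
        using tendstoD[OF lim1 \<epsilon>] by (simp add: dist_real_def)
      ultimately have "eventually (\<lambda>n. t (r n) < \<tau> + e \<and> \<bar>norm (x + X (t (r n)) w) - 1\<bar> < \<epsilon>) sequentially" by (rule eventually_conj)
      with True have "\<exists>\<^sub>F n in sequentially. t (r n) \<ge> \<tau> \<and> (t (r n) < \<tau> + e \<and> \<bar>norm (x + X (t (r n)) w) - 1\<bar> < \<epsilon>)"
        by (rule frequently_eventually_frequently)
      then obtain n where n: "t (r n) \<ge> \<tau>" "t (r n) < \<tau> + e" "\<bar>norm (x + X (t (r n)) w) - 1\<bar> < \<epsilon>"
        by (auto dest: frequently_ex)
      have "dist (x + X \<tau> w) (x + X (t (r n)) w) < \<epsilon>" using e(2)[OF n(1,2)] by simp
      then have "\<bar>norm (x + X \<tau> w) - norm (x + X (t (r n)) w)\<bar> < \<epsilon>"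
        using norm_triangle_ineq3[of "x + X \<tau> w" "x + X (t (r n)) w"] by (simp add: dist_norm)
      moreover have False if "\<bar>a - b\<bar> < e" "\<bar>b - 1\<bar> < e" "e = \<bar>a - 1\<bar> / 2" for a b e :: real
        using that by (auto simp: abs_if split: if_splits)
      ultimately show False using n(3) \<epsilon>_def by blast
    qed
    \<comment> \<open>Hitting counts at strictly positive times only; \<tau> is positive since the
      starting point is not on the sphere.\<close>
    moreover from this have "\<tau> \<noteq> 0" using x X_0[OF w] by auto
    ultimately show ?thesis using \<tau>0 by (intro exI[of _ \<tau>]) auto
  next
    case False
    then have ev: "eventually (\<lambda>n. t (r n) < \<tau>) sequentially" by (simp add: not_frequently not_le)
    then obtain n where "t (r n) < \<tau>" by (auto simp: eventually_sequentially)
    then have \<tau>: "\<tau> > 0" using t(1)[of "r n"] by linarith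
    obtain l where l: "((\<lambda>s. X s w) \<longlongrightarrow> l) (at_left \<tau>)" using X_left_limit[OF w \<tau>] by blast
    have "filterlim (\<lambda>n. t (r n)) (at_left \<tau>) sequentially"
      using r(3) ev by (auto simp: filterlim_at o_def elim!: eventually_mono)
    then have "(\<lambda>n. X (t (r n)) w) \<longlonglongrightarrow> l" by (rule filterlim_compose[OF l])
    then have "(\<lambda>n. norm (x + X (t (r n)) w)) \<longlonglongrightarrow> norm (x + l)" by (intro tendsto_intros)
    then have nl: "norm (x + l) = 1" using lim1 by (rule LIMSEQ_unique)
    then have "X \<tau> w = l" by (rule jump[OF \<tau> l])
    then show ?thesis using nl \<tau> by (intro exI[of _ \<tau>]) auto
  qed
qed

text \<open>The hitting event differs from the measurable event of meeting all shells by a subset of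
  a null set, so it is measurable in the completion and has the same measure.\<close>

lemma Phi_eq:
  assumes x: "norm x \<noteq> 1"
  shows "Phi M X x = prob (\<Inter>n. hit_set x 0 (shell (1 / real (Suc n))))"
proof -
  define E where "E = (\<Inter>n. hit_set x 0 (shell (1 / real (Suc n))))"
  define T where "T = (\<Inter>n. hit_set x (real n) (ball 0 2))"
  define H where "H = {w \<in> space M. \<exists>t>0. norm (x + X t w) = 1}"
  obtain N where N: "N \<in> sets M" "prob N = 0"
    "\<And>w t l. w \<in> space M \<Longrightarrow> 0 < t \<Longrightarrow> ((\<lambda>s. X s w) \<longlongrightarrow> l) (at_left t) \<Longrightarrow> norm (x + l) = 1 \<Longrightarrow> X t w \<noteq> l \<Longrightarrow> w \<in> N"
    using jump_null_set[of x] by blast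
  have Tm: "T \<in> sets M" unfolding T_def by (intro sets.countable_INT image_subsetI hit_set_sets) auto
  have Em: "E \<in> sets M" unfolding E_def by (intro sets.countable_INT image_subsetI hit_set_sets) auto
  have null: "T \<union> N \<in> null_sets M"
    using transient_null[of x] N(1,2) Tm unfolding T_def[symmetric] by (intro null_sets.Un null_setsI) (auto simp: emeasure_eq_measure)
  have HE: "H \<subseteq> E" by (auto simp: H_def E_def hit_set_def shell_def intro: less_imp_le)
  have EH: "w \<in> H" if "w \<in> E" "w \<notin> T \<union> N" for w
  proof -
    have w: "w \<in> space M" using that(1) by (auto simp: E_def hit_set_def)
    have "\<exists>t>0. norm (x + X t w) = 1"
      using that N(3)[OF w] by (intro path_hits_sphere[OF w x]) (auto simp: E_def T_def)
    then show ?thesis using w by (simp add: H_def)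
  qed
  have Hm: "H \<in> sets (completion M)"
  proof (rule sets_completionI)
    show "H = (E - (T \<union> N)) \<union> (H \<inter> (T \<union> N))" using HE EH by auto
    show "H \<inter> (T \<union> N) \<subseteq> T \<union> N" by auto
    show "T \<union> N \<in> null_sets M" by (rule null)
    show "E - (T \<union> N) \<in> sets M" using Em null by (intro sets.Diff) auto
  qed
  have "Phi M X x = measure (completion M) H"
    unfolding Phi_def hit_time_finite_iff H_def by simp
  also have "\<dots> = measure (completion M) E"
  proof (rule measure_eq_AE)
    have "AE w in M. w \<notin> T \<union> N" by (rule AE_not_in[OF null])
    then have "AE w in completion M. w \<notin> T \<union> N" by (rule AE_completion)
    then show "AE w in completion M. (w \<in> H) = (w \<in> E)"
      by eventually_elim (use HE EH in blast)
  qed (use Hm Em in auto)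
  also have "\<dots> = prob E" using Em by simp
  finally show ?thesis unfolding E_def .
qed

lemma theta_le_Phi:
  assumes x: "norm x \<noteq> 1"
  shows "theta DIM('a) \<alpha> (norm x) \<le> Phi M X x"
proof (rule LIMSEQ_le_const)
  have "decseq (\<lambda>n. hit_set x 0 (shell (1 / real (Suc n))))"
  proof (rule decseq_SucI)
    fix n
    have "1 / real (Suc (Suc n)) \<le> 1 / real (Suc n)" by (intro divide_left_mono) auto
    then have "shell (1 / real (Suc (Suc n))) \<subseteq> shell (1 / real (Suc n))"
      unfolding shell_def using order.strict_trans2 by blast
    then show "hit_set x 0 (shell (1 / real (Suc (Suc n)))) \<subseteq> hit_set x 0 (shell (1 / real (Suc n)))"
      unfolding hit_set_def by blast
  qed
  then show "(\<lambda>n. prob (hit_set x 0 (shell (1 / real (Suc n))))) \<longlonglongrightarrow> Phi M X x"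
    unfolding Phi_eq[OF x] by (intro finite_Lim_measure_decseq image_subsetI hit_set_sets) auto
  show "\<exists>N. \<forall>n\<ge>N. theta DIM('a) \<alpha> (norm x) \<le> prob (hit_set x 0 (shell (1 / real (Suc n))))"
    by (intro exI allI impI theta_le_prob_hit) simp
qed

lemma Phi_le_one: "norm x \<noteq> 1 \<Longrightarrow> Phi M X x \<le> 1" and Phi_nonneg: "Phi M X x \<ge> 0"
  by (simp add: Phi_eq) (simp add: Phi_def)

text \<open>Hitting the sphere entails meeting the shell of width 1, which lies in the ball of
  radius 2, where the potential smoothed with \<open>s = 1\<close> is at least \<open>c\<close>. Its
  value at the starting point tends to 0.\<close>

lemma Phi_tendsto_0:
  assumes x: "\<And>n. norm (x n) \<noteq> 1" "filterlim (\<lambda>n. norm (x n)) at_top sequentially"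
  shows "(\<lambda>n. Phi M X (x n)) \<longlonglongrightarrow> 0"
proof -
  obtain c where c: "c > 0" "\<And>x::'a. norm x \<le> 2 \<Longrightarrow> c \<le> sphere_pot \<alpha> 1 x"
    using sphere_pot_lower_bound[of 1] by auto
  have le: "Phi M X (x n) \<le> sphere_pot \<alpha> 1 (x n) / c" for n
  proof -
    have 1: "Phi M X (x n) \<le> prob (hit_set (x n) 0 (shell (1 / real (Suc 0))))"
      unfolding Phi_eq[OF x(1)] by (intro finite_measure_mono hit_set_sets INT_lower) auto
    have 2: "c * prob (hit_set (x n) 0 (shell (1 / real (Suc 0)))) \<le> (\<integral>w. sphere_pot \<alpha> 1 (x n + X 0 w) \<partial>M)"
      by (rule prob_hit_upper[OF order_refl zero_less_one open_shell]) (auto simp: shell_def intro!: c(2))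
    have "(\<integral>w. sphere_pot \<alpha> 1 (x n + X 0 w) \<partial>M) = (\<integral>w. sphere_pot \<alpha> 1 (x n) \<partial>M)"
      by (intro Bochner_Integration.integral_cong refl) (simp add: X_0)
    then have "(\<integral>w. sphere_pot \<alpha> 1 (x n + X 0 w) \<partial>M) = sphere_pot \<alpha> 1 (x n)" using prob_space by simp
    then have "c * Phi M X (x n) \<le> sphere_pot \<alpha> 1 (x n)"
      using mult_left_mono[OF 1 less_imp_le[OF c(1)]] 2 by linarith
    then show ?thesis using c(1) by (simp add: field_simps)
  qed
  have "(\<lambda>n. sphere_pot \<alpha> 1 (x n) / c) \<longlonglongrightarrow> 0 / c"
    using c(1) by (intro tendsto_divide sphere_pot_tendsto_0 x(2) tendsto_const) auto
  then have lim: "(\<lambda>n. sphere_pot \<alpha> 1 (x n) / c) \<longlonglongrightarrow> 0" by simp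
  show ?thesis
  proof (rule tendsto_sandwich[OF _ _ tendsto_const lim])
    show "eventually (\<lambda>n. 0 \<le> Phi M X (x n)) sequentially" by (rule always_eventually) (simp add: Phi_nonneg)
    show "eventually (\<lambda>n. Phi M X (x n) \<le> sphere_pot \<alpha> 1 (x n) / c) sequentially" by (rule always_eventually) (simp add: le)
  qed
qed

end

section \<open>Norms and approximation\<close>

lemma Lp_norm_le_iff:
  fixes f :: "'b \<Rightarrow> real"
  assumes p: "1 \<le> p" "p \<noteq> \<infinity>" and B: "B \<ge> 0"
  shows "Lp_norm N p f \<le> ereal B \<longleftrightarrow> (\<integral>\<^sup>+x. ennreal (\<bar>f x\<bar> powr real_of_ereal p) \<partial>N) \<le> ennreal (B powr real_of_ereal p)"
proof -
  define q where "q = real_of_ereal p"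
  have q: "q \<ge> 1" using p by (cases p) (auto simp: q_def)
  define I where "I = (\<integral>\<^sup>+x. ennreal (\<bar>f x\<bar> powr q) \<partial>N)"
  show ?thesis
  proof (cases "I = \<top>")
    case True
    then show ?thesis using p unfolding Lp_norm_def q_def[symmetric] I_def[symmetric] Let_def by (simp add: top_unique)
  next
    case False
    then obtain i where i: "I = ennreal i" "i \<ge> 0" by (cases I) auto
    have "i powr (1 / q) \<le> B \<longleftrightarrow> i \<le> B powr q"
    proof
      assume "i powr (1 / q) \<le> B"
      then have "(i powr (1 / q)) powr q \<le> B powr q" using q by (intro powr_mono2) auto
      then show "i \<le> B powr q" using q i by (simp add: powr_powr)
    next
      assume "i \<le> B powr q"
      then have "i powr (1 / q) \<le> (B powr q) powr (1 / q)" using q i by (intro powr_mono2) auto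
      then show "i powr (1 / q) \<le> B" using q B by (simp add: powr_powr)
    qed
    then show ?thesis using False p i unfolding Lp_norm_def q_def[symmetric] I_def[symmetric] Let_def
      by (simp add: ennreal_le_iff)
  qed
qed

lemma Lp_norm_inf_le_iff:
  fixes f :: "'b \<Rightarrow> real"
  assumes [measurable]: "f \<in> borel_measurable N"
  shows "Lp_norm N \<infinity> f \<le> ereal B \<longleftrightarrow> (AE x in N. \<bar>f x\<bar> \<le> B)"
proof
  assume *: "Lp_norm N \<infinity> f \<le> ereal B"
  have "AE x in N. ereal \<bar>f x\<bar> \<le> esssup N (\<lambda>x. ereal \<bar>f x\<bar>)" by (rule esssup_AE)
  then show "AE x in N. \<bar>f x\<bar> \<le> B"
  proof eventually_elim
    case (elim x)
    then have "ereal \<bar>f x\<bar> \<le> ereal B" using order.trans[of "ereal \<bar>f x\<bar>" "Lp_norm N \<infinity> f" "ereal B"] * by (simp add: Lp_norm_def)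
    then show ?case by simp
  qed
next
  assume "AE x in N. \<bar>f x\<bar> \<le> B"
  then show "Lp_norm N \<infinity> f \<le> ereal B" unfolding Lp_norm_def by (auto intro!: esssup_I elim!: eventually_mono)
qed

lemma Lp_norm_nonneg:
  assumes "prob_space N" "1 \<le> p"
  shows "0 \<le> Lp_norm N p f"
proof -
  interpret prob_space N by fact
  have "0 \<le> esssup N (\<lambda>x. ereal \<bar>f x\<bar>)"
  proof (cases "(\<lambda>x. ereal \<bar>f x\<bar>) \<in> borel_measurable N")
    case True
    have "esssup N (\<lambda>x. 0::ereal) \<le> esssup N (\<lambda>x. ereal \<bar>f x\<bar>)" by (rule esssup_mono) auto
    then show ?thesis by (simp add: esssup_const emeasure_space_1)
  qed (simp add: esssup_non_measurable top_ereal_def)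
  then show ?thesis by (auto simp: Lp_norm_def Let_def)
qed

text \<open>Lower semicontinuity under almost everywhere convergence, for finite exponents and
  \<infinity> alike. It transfers the bounds on spheres of radius \<open>r\<close> to the limits as
  \<open>r\<close> tends to infinity or to 1.\<close>

lemma Lp_norm_Fatou:
  fixes f :: "'b \<Rightarrow> real"
  assumes p: "1 \<le> p" and B: "B \<ge> 0" and u[measurable]: "\<And>n. u n \<in> borel_measurable N" and f[measurable]: "f \<in> borel_measurable N"
    and lim: "AE x in N. (\<lambda>n. u n x) \<longlonglongrightarrow> f x" and le: "\<And>n. Lp_norm N p (u n) \<le> ereal B"
  shows "Lp_norm N p f \<le> ereal B"
proof (cases "p = \<infinity>")
  case True
  have "AE x in N. \<forall>n. \<bar>u n x\<bar> \<le> B"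
    unfolding AE_all_countable using le Lp_norm_inf_le_iff[OF u] unfolding True by blast
  then have "AE x in N. \<bar>f x\<bar> \<le> B"
    using lim
  proof eventually_elim
    case (elim x)
    then show ?case by (intro LIMSEQ_le_const2[OF tendsto_rabs[OF elim(2)]]) auto
  qed
  then show ?thesis unfolding True by (simp add: Lp_norm_inf_le_iff)
next
  case False
  define q where "q = real_of_ereal p"
  have q: "q \<ge> 1" using p False by (cases p) (auto simp: q_def)
  have "(\<integral>\<^sup>+x. ennreal (\<bar>f x\<bar> powr q) \<partial>N) = (\<integral>\<^sup>+x. liminf (\<lambda>n. ennreal (\<bar>u n x\<bar> powr q)) \<partial>N)"
  proof (rule nn_integral_cong_AE)
    show "AE x in N. ennreal (\<bar>f x\<bar> powr q) = liminf (\<lambda>n. ennreal (\<bar>u n x\<bar> powr q))"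
      using lim
    proof eventually_elim
      case (elim x)
      have "(\<lambda>n. ennreal (\<bar>u n x\<bar> powr q)) \<longlonglongrightarrow> ennreal (\<bar>f x\<bar> powr q)"
        using q by (intro tendsto_ennrealI tendsto_powr' tendsto_rabs elim tendsto_const) auto
      from lim_imp_Liminf[OF _ this] show ?case by simp
    qed
  qed
  also have "\<dots> \<le> liminf (\<lambda>n. \<integral>\<^sup>+x. ennreal (\<bar>u n x\<bar> powr q) \<partial>N)" by (rule nn_integral_liminf) measurable
  also have "\<dots> \<le> ennreal (B powr q)"
    using le unfolding Lp_norm_le_iff[OF p False B] q_def[symmetric]
    by (intro Liminf_le) (auto intro!: always_eventually)
  finally show ?thesis unfolding Lp_norm_le_iff[OF p False B] q_def[symmetric] .
qed

lemma Lp_norm_const: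
  assumes "prob_space N" "1 \<le> p"
  shows "Lp_norm N p (\<lambda>_. c) = ereal \<bar>c\<bar>"
proof -
  interpret prob_space N by fact
  show ?thesis
  proof (cases "p = \<infinity>")
    case True
    then show ?thesis by (simp add: Lp_norm_def esssup_const emeasure_space_1)
  next
    case False
    then have "real_of_ereal p \<ge> 1" using assms by (cases p) auto
    then show ?thesis using False by (simp add: Lp_norm_def emeasure_space_1 powr_powr)
  qed
qed

section \<open>Approximation by compact sets and by continuous functions\<close>

lemma inner_regular_compact:
  fixes N :: "'a::euclidean_space measure"
  assumes sets: "sets N = sets borel" and fin: "finite_measure N" and A: "A \<in> sets borel" and e: "e > 0"
  obtains K where "K \<subseteq> A" "compact K" "measure N A - e \<le> measure N K"
proof (cases "measure N A \<le> e")
  case True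
  then show thesis using that[of "{}"] by auto
next
  case False
  interpret finite_measure N by fact
  have "ennreal (measure N A - e) < emeasure N A" using e False by (simp add: emeasure_eq_measure ennreal_less_iff)
  also have "emeasure N A = (SUP K\<in>{K. K \<subseteq> A \<and> compact K}. emeasure N K)"
    by (rule inner_regular[OF sets _ A]) (simp add: emeasure_eq_measure)
  finally obtain K where "K \<subseteq> A" "compact K" "ennreal (measure N A - e) < emeasure N K" by (auto simp: less_SUP_iff)
  then show thesis using that[of K] False by (auto simp: emeasure_eq_measure ennreal_less_iff)
qed

text \<open>Truncated distance functions decrease to the indicator of a closed set; together with inner regularity this gives
  density of the bounded continuous functions.\<close>
lemma L1_dense_continuous:
  fixes N :: "'a::euclidean_space measure"
  assumes sets: "sets N = sets borel" and fin: "finite_measure N" and f: "integrable N f" and e: "e > 0"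
  obtains g :: "'a \<Rightarrow> real" and B where "continuous_on UNIV g" "\<And>x. \<bar>g x\<bar> \<le> B" "(\<integral>x. \<bar>f x - g x\<bar> \<partial>N) < e"
proof -
  interpret finite_measure N by fact
  have space: "space N = UNIV" using sets_eq_imp_space_eq[OF sets] by simp
  have meas: "g \<in> borel_measurable N" if "continuous_on UNIV g" for g :: "'a \<Rightarrow> real"
    using borel_measurable_continuous_onI[OF that] measurable_cong_sets[OF sets refl] by blast
  have intg: "integrable N g" if "continuous_on UNIV g" "\<And>x. \<bar>g x\<bar> \<le> B" for g :: "'a \<Rightarrow> real" and B
    using that by (intro integrable_const_bound[of _ B] meas) auto
  have "\<forall>e>0. \<exists>g B. continuous_on UNIV g \<and> (\<forall>x. \<bar>g x\<bar> \<le> B) \<and> (\<integral>x. \<bar>f x - g x\<bar> \<partial>N) < e"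
    using f
  proof (induction rule: integrable_induct)
    case (base A c)
    show ?case
    proof (intro allI impI)
      fix e :: real assume e: "e > 0"
      have A: "A \<in> sets borel" using base sets by simp
      \<comment> \<open>Two errors of size \<open>e'\<close>, one from replacing \<open>A\<close> by
        \<open>K\<close> and one from \<open>g n\<close>, are multiplied by
        \<open>\<bar>c\<bar>\<close>; the summand 1 covers \<open>c = 0\<close>.\<close>
      define e' where "e' = e / (2 * (\<bar>c\<bar> + 1))"
      have e': "e' > 0" using e by (simp add: e'_def)
      obtain K where K: "K \<subseteq> A" "compact K" "measure N A - e' \<le> measure N K"
        using inner_regular_compact[OF sets fin A e'] .
      have Kc: "closed K" using K(2) by (rule compact_imp_closed)
      have Km[measurable]: "K \<in> sets N" using Kc sets by simp
      have Am[measurable]: "A \<in> sets N" using base by simp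
      define g where "g n x = (if K = {} then 0 else max 0 (1 - real n * infdist x K))" for n and x :: 'a
      have gc: "continuous_on UNIV (g n)" for n unfolding g_def by (cases "K = {}") (auto intro!: continuous_intros)
      have gb: "\<bar>g n x\<bar> \<le> 1" for n x by (auto simp: g_def infdist_nonneg)
      have glim: "(\<lambda>n. g n x) \<longlonglongrightarrow> indicator K x" for x
      proof (cases "x \<in> K")
        case True
        then have "g n x = 1" for n by (auto simp: g_def infdist_zero)
        then show ?thesis using True by simp
      next
        case False
        show ?thesis
        proof (cases "K = {}")
          case False
          then have pos: "infdist x K > 0" using \<open>x \<notin> K\<close> Kc infdist_pos_not_in_closed by blast
          obtain n0 :: nat where n0: "1 < real n0 * infdist x K" using reals_Archimedean3[OF pos] by blast
          have "g n x = 0" if "n \<ge> n0" for n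
          proof -
            have "real n0 * infdist x K \<le> real n * infdist x K" using that pos by (intro mult_right_mono) auto
            then show ?thesis using n0 by (simp add: g_def)
          qed
          then have "eventually (\<lambda>n. g n x = 0) sequentially" by (auto simp: eventually_sequentially)
          then show ?thesis using \<open>x \<notin> K\<close> by (simp add: tendsto_eventually)
        qed (simp add: g_def)
      qed
      have "(\<lambda>n. \<integral>x. \<bar>indicator K x - g n x\<bar> \<partial>N) \<longlonglongrightarrow> (\<integral>x. 0 \<partial>N)"
      proof (rule integral_dominated_convergence[where w="\<lambda>_. 2"])
        show "AE x in N. (\<lambda>n. \<bar>indicator K x - g n x\<bar>) \<longlonglongrightarrow> 0"
        proof (rule AE_I2)
          fix x
          have "(\<lambda>n. \<bar>indicator K x - g n x\<bar>) \<longlonglongrightarrow> \<bar>indicator K x - indicator K x\<bar>" by (intro tendsto_intros glim)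
          then show "(\<lambda>n. \<bar>indicator K x - g n x\<bar>) \<longlonglongrightarrow> 0" by simp
        qed
        show "AE x in N. norm \<bar>indicator K x - g n x\<bar> \<le> 2" for n
          using gb[of n] by (intro AE_I2) (auto split: split_indicator simp: abs_le_iff, (smt (verit) gb)+)
      qed (use gc meas in auto)
      then have "eventually (\<lambda>n. (\<integral>x. \<bar>indicator K x - g n x\<bar> \<partial>N) < e') sequentially" using e' by (auto dest: order_tendstoD(2))
      then obtain n where n: "(\<integral>x. \<bar>indicator K x - g n x\<bar> \<partial>N) < e'" by (auto simp: eventually_sequentially)
      have ig: "integrable N (g n)" using intg[OF gc gb] .
      have iK: "integrable N (indicator K :: 'a \<Rightarrow> real)" "integrable N (indicator A :: 'a \<Rightarrow> real)" by (auto simp: emeasure_eq_measure)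
      have "(\<integral>x. \<bar>indicator A x *\<^sub>R c - c * g n x\<bar> \<partial>N) \<le> (\<integral>x. \<bar>c\<bar> * ((indicator A x - indicator K x) + \<bar>indicator K x - g n x\<bar>) \<partial>N)"
      proof (rule integral_mono)
        show "integrable N (\<lambda>x. \<bar>indicator A x *\<^sub>R c - c * g n x\<bar>)" using iK ig by auto
        show "integrable N (\<lambda>x. \<bar>c\<bar> * ((indicator A x - indicator K x) + \<bar>indicator K x - g n x\<bar>))" using iK ig by auto
        fix x
        have "indicator A x *\<^sub>R c - c * g n x = c * ((indicator A x - indicator K x) + (indicator K x - g n x))" by (simp add: algebra_simps)
        also have "\<bar>\<dots>\<bar> \<le> \<bar>c\<bar> * (\<bar>indicator A x - indicator K x\<bar> + \<bar>indicator K x - g n x\<bar>)"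
          unfolding abs_mult by (intro mult_left_mono abs_triangle_ineq) auto
        also have "\<bar>indicator A x - indicator K x\<bar> = (indicator A x - indicator K x :: real)" using K(1) by (auto split: split_indicator)
        finally show "\<bar>indicator A x *\<^sub>R c - c * g n x\<bar> \<le> \<bar>c\<bar> * ((indicator A x - indicator K x) + \<bar>indicator K x - g n x\<bar>)" .
      qed
      also have "\<dots> = \<bar>c\<bar> * ((measure N A - measure N K) + (\<integral>x. \<bar>indicator K x - g n x\<bar> \<partial>N))"
        using iK ig by simp
      also have "\<dots> \<le> \<bar>c\<bar> * (e' + e')" using K(3) n by (intro mult_left_mono) auto
      also have "\<bar>c\<bar> * (e' + e') = 2 * e' * (\<bar>c\<bar> + 1) - 2 * e'" by (simp add: algebra_simps)
      also have "2 * e' * (\<bar>c\<bar> + 1) = e" using abs_ge_zero[of c] by (simp add: e'_def field_simps)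
      also have "e - 2 * e' < e" using e' by simp
      finally show "\<exists>g B. continuous_on UNIV g \<and> (\<forall>x. \<bar>g x\<bar> \<le> B) \<and> (\<integral>x. \<bar>indicator A x *\<^sub>R c - g x\<bar> \<partial>N) < e"
        using gb[of n] by (intro exI[of _ "\<lambda>x. c * g n x"] exI[of _ "\<bar>c\<bar>"] conjI continuous_intros gc)
          (auto simp: abs_mult mult_left_le)
    qed
  next
    case (add f g)
    show ?case
    proof (intro allI impI)
      fix e :: real assume e: "e > 0"
      obtain a A where a: "continuous_on UNIV a" "\<And>x. \<bar>a x\<bar> \<le> A" "(\<integral>x. \<bar>f x - a x\<bar> \<partial>N) < e / 2"
        using add.IH(1) e by (meson half_gt_zero)
      obtain b B where b: "continuous_on UNIV b" "\<And>x. \<bar>b x\<bar> \<le> B" "(\<integral>x. \<bar>g x - b x\<bar> \<partial>N) < e / 2"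
        using add.IH(2) e by (meson half_gt_zero)
      have i: "integrable N a" "integrable N b" using intg a b by blast+
      have "(\<integral>x. \<bar>f x + g x - (a x + b x)\<bar> \<partial>N) \<le> (\<integral>x. \<bar>f x - a x\<bar> + \<bar>g x - b x\<bar> \<partial>N)"
        using add i by (intro integral_mono) auto
      also have "\<dots> < e" using add i a(3) b(3) by simp
      finally show "\<exists>h B. continuous_on UNIV h \<and> (\<forall>x. \<bar>h x\<bar> \<le> B) \<and> (\<integral>x. \<bar>f x + g x - h x\<bar> \<partial>N) < e"
        using a b by (intro exI[of _ "\<lambda>x. a x + b x"] exI[of _ "A + B"]) (auto intro!: continuous_intros order.trans[OF abs_triangle_ineq add_mono])
    qed
  next
    case (lim f s)
    show ?case
    proof (intro allI impI)
      fix e :: real assume e: "e > 0"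
      have "(\<lambda>n. \<integral>x. \<bar>f x - s n x\<bar> \<partial>N) \<longlonglongrightarrow> (\<integral>x. 0 \<partial>N)"
      proof (rule integral_dominated_convergence[where w="\<lambda>x. 3 * \<bar>f x\<bar>"])
        show "AE x in N. (\<lambda>n. \<bar>f x - s n x\<bar>) \<longlonglongrightarrow> 0"
        proof (rule AE_I2)
          fix x assume "x \<in> space N"
          then have "(\<lambda>n. \<bar>f x - s n x\<bar>) \<longlonglongrightarrow> \<bar>f x - f x\<bar>" by (intro tendsto_intros lim)
          then show "(\<lambda>n. \<bar>f x - s n x\<bar>) \<longlonglongrightarrow> 0" by simp
        qed
        show "AE x in N. norm \<bar>f x - s n x\<bar> \<le> 3 * \<bar>f x\<bar>" for n
        proof (rule AE_I2)
          fix x assume "x \<in> space N"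
          then have "\<bar>s n x\<bar> \<le> 2 * \<bar>f x\<bar>" using lim(3)[of x n] by simp
          then show "norm \<bar>f x - s n x\<bar> \<le> 3 * \<bar>f x\<bar>" using abs_triangle_ineq4[of "f x" "s n x"] by simp
        qed
      qed (use lim in auto)
      then have "eventually (\<lambda>n. (\<integral>x. \<bar>f x - s n x\<bar> \<partial>N) < e / 2) sequentially" using order_tendstoD(2)[of _ 0 sequentially "e / 2"] e by simp
      then obtain n where n: "(\<integral>x. \<bar>f x - s n x\<bar> \<partial>N) < e / 2" by (auto simp: eventually_sequentially)
      obtain a A where a: "continuous_on UNIV a" "\<And>x. \<bar>a x\<bar> \<le> A" "(\<integral>x. \<bar>s n x - a x\<bar> \<partial>N) < e / 2"
        using lim(5)[of n] e by (meson half_gt_zero)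
      have i: "integrable N a" using intg a by blast
      have "(\<integral>x. \<bar>f x - a x\<bar> \<partial>N) \<le> (\<integral>x. \<bar>f x - s n x\<bar> + \<bar>s n x - a x\<bar> \<partial>N)"
        using lim i by (intro integral_mono) auto
      also have "\<dots> < e" using lim i a(3) n by simp
      finally show "\<exists>h B. continuous_on UNIV h \<and> (\<forall>x. \<bar>h x\<bar> \<le> B) \<and> (\<integral>x. \<bar>f x - h x\<bar> \<partial>N) < e" using a by blast
    qed
  qed
  then show thesis using that e by blast
qed

text \<open>The supporting line at \<open>a\<close>, reduced by homogeneity to \<open>a = 1\<close>.
  Integrated, it yields Jensen's inequality in a form that suits weights split between the kernel
  and a single point. At \<open>a = 0\<close> all powers on the left are 0 by convention, also for
  \<open>q = 1\<close>.\<close>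

lemma powr_tangent:
  fixes a z q :: real
  assumes "a \<ge> 0" "z \<ge> 0" "q \<ge> 1"
  shows "a powr q + q * a powr (q - 1) * (z - a) \<le> z powr q"
proof (cases "a = 0")
  case True
  then show ?thesis by simp
next
  case False
  then have a: "a > 0" using assms by simp
  have bern: "1 + q * (t - 1) \<le> t powr q" if "t \<ge> 0" for t :: real
  proof (cases "t = 0")
    case False
    then have t: "t > 0" using that by simp
    have "((\<lambda>x. x powr q) has_real_derivative q * 1 powr (q - 1)) (at 1 within {0<..})"
      by (auto intro!: derivative_eq_intros)
    then have "t powr q - 1 powr q \<ge> (q * 1 powr (q - 1)) * (t - 1)"
      using t assms by (intro convex_on_imp_above_tangent[OF powr_convex[OF assms(3)]]) (auto simp: interior_open)
    then show ?thesis by simp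
  qed (use assms in simp)
  have "a powr q * (1 + q * (z / a - 1)) \<le> a powr q * (z / a) powr q"
    using assms a by (intro mult_left_mono bern) auto
  also have "a powr q * (z / a) powr q = z powr q" using a assms by (simp add: powr_divide)
  also have "a powr q * (1 + q * (z / a - 1)) = a powr q + q * a powr (q - 1) * (z - a)"
    using a by (simp add: powr_diff field_simps)
  finally show ?thesis .
qed

section \<open>The Poisson kernel\<close>

context stable_index
begin

lemma PD_kernel_nonneg: "PD_kernel \<alpha> (x::'a) y \<ge> 0"
  unfolding PD_kernel_def kappa_def[symmetric] using kappa_pos by (auto intro!: mult_nonneg_nonneg divide_nonneg_nonneg)

lemma PD_kernel_measurable [measurable]:
  assumes [measurable]: "f \<in> borel_measurable N" "g \<in> borel_measurable N"
  shows "(\<lambda>w. PD_kernel \<alpha> (f w :: 'a) (g w)) \<in> borel_measurable N"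
  unfolding PD_kernel_def by measurable

lemma PD_kernel_le:
  assumes "m > 0" "m \<le> norm (x - y)"
  shows "PD_kernel \<alpha> (x::'a) y \<le> kappa DIM('a) \<alpha> * \<bar>(norm x)\<^sup>2 - 1\<bar> powr (\<alpha> - 1) / m powr (real DIM('a) + \<alpha> - 2)"
  unfolding PD_kernel_def kappa_def[symmetric] using assms kappa_pos dim \<alpha>
  by (intro divide_left_mono powr_mono2 mult_nonneg_nonneg mult_pos_pos) auto

lemma PD_kernel_le_radial:
  assumes "norm x \<noteq> 1" "norm y = 1"
  shows "PD_kernel \<alpha> (x::'a) y \<le> kappa DIM('a) \<alpha> * \<bar>(norm x)\<^sup>2 - 1\<bar> powr (\<alpha> - 1) / \<bar>norm x - 1\<bar> powr (real DIM('a) + \<alpha> - 2)"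
  using assms norm_triangle_ineq3[of x y] by (intro PD_kernel_le) auto

text \<open>For unit vectors the distance depends only on \<open>r\<close> and the inner product.
  The symmetry makes the Poisson operator at radius \<open>r\<close> self-adjoint, so integrating
  out \<open>x\<close> against \<open>sphere_sigma\<close> is the same task as integrating out
  \<open>y\<close>.\<close>

lemma PD_kernel_swap:
  assumes "norm x = 1" "norm y = 1"
  shows "PD_kernel \<alpha> (r *\<^sub>R x :: 'a) y = PD_kernel \<alpha> (r *\<^sub>R y) x"
proof -
  have "(norm (r *\<^sub>R x - y))\<^sup>2 = (norm (r *\<^sub>R y - x))\<^sup>2"
    using assms by (simp add: power2_norm_eq_inner inner_diff norm_eq_1 inner_commute algebra_simps)
  then have "norm (r *\<^sub>R x - y) = norm (r *\<^sub>R y - x)" by (simp add: power2_eq_iff_nonneg)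
  then show ?thesis using assms unfolding PD_kernel_def by simp
qed

lemma PD_kernel_integrable:
  assumes x: "norm x \<noteq> 1" and N: "sets N = sets borel" "AE y in N. norm y = 1" and f: "integrable N f"
  shows "integrable N (\<lambda>y. PD_kernel \<alpha> (x::'a) y * f y)"
proof -
  define C where "C = kappa DIM('a) \<alpha> * \<bar>(norm x)\<^sup>2 - 1\<bar> powr (\<alpha> - 1) / \<bar>norm x - 1\<bar> powr (real DIM('a) + \<alpha> - 2)"
  note [measurable_cong] = N(1)
  have [measurable]: "f \<in> borel_measurable N" using f by auto
  show ?thesis
  proof (rule Bochner_Integration.integrable_bound)
    show "integrable N (\<lambda>y. C * f y)" using f by simp
    show "AE y in N. norm (PD_kernel \<alpha> x y * f y) \<le> norm (C * f y)"
      using N(2)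
    proof eventually_elim
      case (elim y)
      have "PD_kernel \<alpha> x y \<le> \<bar>C\<bar>" using PD_kernel_le_radial[OF x elim] unfolding C_def by linarith
      then show ?case using PD_kernel_nonneg[of x y] by (auto simp: abs_mult intro!: mult_right_mono)
    qed
  qed measurable
qed

lemma PD_kernel_integral:
  assumes x: "norm x \<noteq> 1"
  shows "integrable sphere_sigma (PD_kernel \<alpha> (x::'a))" "(\<integral>y. PD_kernel \<alpha> x y \<partial>sphere_sigma) = theta DIM('a) \<alpha> (norm x)"
proof -
  interpret S: prob_space "sphere_sigma :: 'a measure" by (rule prob_space_sphere_sigma)
  show i: "integrable sphere_sigma (PD_kernel \<alpha> x)"
    using PD_kernel_integrable[OF x sets_sphere_sigma AE_sphere_sigma, of "\<lambda>_. 1"] by simp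
  have "ennreal (\<integral>y. PD_kernel \<alpha> x y \<partial>sphere_sigma) = ennreal (theta DIM('a) \<alpha> (norm x))"
    using PD_kernel_nn[OF x] nn_integral_eq_integral[OF i] by (simp add: PD_kernel_nonneg theta_def)
  then show "(\<integral>y. PD_kernel \<alpha> x y \<partial>sphere_sigma) = theta DIM('a) \<alpha> (norm x)"
    using theta_nonneg by (simp add: integral_nonneg_AE PD_kernel_nonneg)
qed

text \<open>After the exchange of integrals and \<open>PD_kernel_swap\<close> the inner integral is
  the mass of the kernel, the same for every \<open>y\<close> on the sphere.\<close>

lemma PD_kernel_Tonelli:
  fixes N :: "'a measure" and h :: "'a \<Rightarrow> ennreal"
  assumes N: "sets N = sets borel" "finite_measure N" "AE y in N. norm y = 1" and h: "h \<in> borel_measurable borel"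
    and r: "r > 0" "r \<noteq> 1"
  shows "(\<integral>\<^sup>+x. (\<integral>\<^sup>+y. ennreal (PD_kernel \<alpha> (r *\<^sub>R x) y) * h y \<partial>N) \<partial>sphere_sigma) = ennreal (theta DIM('a) \<alpha> r) * (\<integral>\<^sup>+y. h y \<partial>N)"
proof -
  interpret S: prob_space "sphere_sigma :: 'a measure" by (rule prob_space_sphere_sigma)
  interpret N: finite_measure N by fact
  interpret P: pair_sigma_finite "sphere_sigma :: 'a measure" N by unfold_locales
  note [measurable_cong] = N(1)
  note [measurable] = h
  have "(\<integral>\<^sup>+x. (\<integral>\<^sup>+y. ennreal (PD_kernel \<alpha> (r *\<^sub>R x) y) * h y \<partial>N) \<partial>sphere_sigma)
    = (\<integral>\<^sup>+y. (\<integral>\<^sup>+x. ennreal (PD_kernel \<alpha> (r *\<^sub>R x) y) * h y \<partial>sphere_sigma) \<partial>N)"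
    by (rule P.Fubini'[symmetric]) measurable
  also have "\<dots> = (\<integral>\<^sup>+y. ennreal (theta DIM('a) \<alpha> r) * h y \<partial>N)"
  proof (rule nn_integral_cong_AE)
    show "AE y in N. (\<integral>\<^sup>+x. ennreal (PD_kernel \<alpha> (r *\<^sub>R x) y) * h y \<partial>sphere_sigma) = ennreal (theta DIM('a) \<alpha> r) * h y"
      using N(3)
    proof eventually_elim
      case (elim y)
      have "(\<integral>\<^sup>+x. ennreal (PD_kernel \<alpha> (r *\<^sub>R x) y) * h y \<partial>sphere_sigma) = (\<integral>\<^sup>+x. ennreal (PD_kernel \<alpha> (r *\<^sub>R x) y) \<partial>sphere_sigma) * h y"
        by (rule nn_integral_multc) measurable
      also have "(\<integral>\<^sup>+x. ennreal (PD_kernel \<alpha> (r *\<^sub>R x) y) \<partial>sphere_sigma) = (\<integral>\<^sup>+x. ennreal (PD_kernel \<alpha> (r *\<^sub>R y) x) \<partial>sphere_sigma)"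
      proof (rule nn_integral_cong_AE)
        show "AE x in sphere_sigma. ennreal (PD_kernel \<alpha> (r *\<^sub>R x) y) = ennreal (PD_kernel \<alpha> (r *\<^sub>R y) x)"
          using AE_sphere_sigma by eventually_elim (simp add: PD_kernel_swap[OF _ elim])
      qed
      also have "\<dots> = ennreal (theta DIM('a) \<alpha> r)" using PD_kernel_nn[of "r *\<^sub>R y"] elim r by (simp add: theta_def)
      finally show ?case .
    qed
  qed
  also have "\<dots> = ennreal (theta DIM('a) \<alpha> r) * (\<integral>\<^sup>+y. h y \<partial>N)" by (rule nn_integral_cmult) (use N in measurable)
  finally show ?thesis .
qed

text \<open>Jensen's inequality for the probability made of the kernel, of mass \<theta>, and one
  further point of mass 1 - \<theta> that carries the value \<open>\<bar>c\<bar>\<close>.\<close>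

lemma PD_fun_jensen:
  fixes f :: "'a \<Rightarrow> real"
  assumes x: "norm x \<noteq> 1" and q: "q \<ge> 1" and f: "integrable sphere_sigma f" "integrable sphere_sigma (\<lambda>y. \<bar>f y\<bar> powr q)"
  shows "(\<bar>PD_fun \<alpha> f x\<bar> + \<bar>c\<bar> * (1 - theta DIM('a) \<alpha> (norm x))) powr q
    \<le> (\<integral>y. PD_kernel \<alpha> x y * \<bar>f y\<bar> powr q \<partial>sphere_sigma) + (1 - theta DIM('a) \<alpha> (norm x)) * \<bar>c\<bar> powr q"
proof -
  interpret S: prob_space "sphere_sigma :: 'a measure" by (rule prob_space_sphere_sigma)
  note I = PD_kernel_integrable[OF x sets_sphere_sigma AE_sphere_sigma]
  define t where "t = theta DIM('a) \<alpha> (norm x)"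
  have t: "t \<ge> 0" "t \<le> 1" using theta_nonneg theta_le_one[of "norm x"] by (auto simp: t_def)
  define m where "m = (\<integral>y. PD_kernel \<alpha> x y * \<bar>f y\<bar> \<partial>sphere_sigma)"
  \<comment> \<open>The mean of the values under this probability. In the tangent at
    \<open>A\<close> the linear terms cancel exactly, because the masses add up to 1.\<close>
  define A where "A = m + \<bar>c\<bar> * (1 - t)"
  have m: "\<bar>PD_fun \<alpha> f x\<bar> \<le> m"
    using integral_abs_bound[of sphere_sigma "\<lambda>y. PD_kernel \<alpha> x y * f y"] PD_kernel_nonneg[of x]
    unfolding PD_fun_def m_def by (simp add: abs_mult)
  then have A: "A \<ge> 0" using t unfolding A_def by (intro add_nonneg_nonneg) auto
  define s where "s = q * A powr (q - 1)"
  have "(\<integral>y. PD_kernel \<alpha> x y * (A powr q + s * (\<bar>f y\<bar> - A)) \<partial>sphere_sigma) \<le> (\<integral>y. PD_kernel \<alpha> x y * \<bar>f y\<bar> powr q \<partial>sphere_sigma)"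
    using f powr_tangent[OF A abs_ge_zero q]
    by (intro integral_mono I mult_left_mono PD_kernel_nonneg)
      (auto simp: s_def intro!: Bochner_Integration.integrable_add Bochner_Integration.integrable_diff)
  moreover have "(\<integral>y. PD_kernel \<alpha> x y * (A powr q + s * (\<bar>f y\<bar> - A)) \<partial>sphere_sigma)
    = (\<integral>y. (A powr q - s * A) * PD_kernel \<alpha> x y + s * (PD_kernel \<alpha> x y * \<bar>f y\<bar>) \<partial>sphere_sigma)"
    by (intro Bochner_Integration.integral_cong refl) (simp add: algebra_simps)
  moreover have "\<dots> = (A powr q - s * A) * t + s * m"
    using PD_kernel_integral[OF x] I[of "\<lambda>y. \<bar>f y\<bar>"] f by (simp add: t_def m_def)
  moreover have "(1 - t) * (A powr q + s * (\<bar>c\<bar> - A)) \<le> (1 - t) * \<bar>c\<bar> powr q"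
    using powr_tangent[OF A abs_ge_zero q] t unfolding s_def by (intro mult_left_mono) auto
  moreover have "(A powr q - s * A) * t + s * m + (1 - t) * (A powr q + s * (\<bar>c\<bar> - A)) = A powr q"
    unfolding A_def by (simp add: algebra_simps)
  ultimately have "A powr q \<le> (\<integral>y. PD_kernel \<alpha> x y * \<bar>f y\<bar> powr q \<partial>sphere_sigma) + (1 - t) * \<bar>c\<bar> powr q" by linarith
  moreover have "(\<bar>PD_fun \<alpha> f x\<bar> + \<bar>c\<bar> * (1 - t)) powr q \<le> A powr q"
    using m t q unfolding A_def by (intro powr_mono2) auto
  ultimately show ?thesis unfolding t_def by linarith
qed

text \<open>The mass tends to 1, and at a fixed distance from \<open>x\<close> the kernel is bounded
  by a multiple of \<open>\<bar>r\<^sup>2 - 1\<bar> powr (\<alpha> - 1)\<close>, which vanishes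
  since \<alpha> > 1. Compactness of the sphere makes this uniform in \<open>x\<close>, as is
  required for integrating against an arbitrary measure.\<close>

lemma PD_approx_identity:
  fixes \<phi> :: "'a \<Rightarrow> real"
  assumes cont: "continuous_on UNIV \<phi>" and e: "e > 0"
  shows "eventually (\<lambda>r. \<forall>x. norm x = 1 \<longrightarrow> \<bar>PD_fun \<alpha> \<phi> (r *\<^sub>R x) - \<phi> x\<bar> \<le> e) (at 1)"
proof -
  have "continuous_on (sphere 0 1) \<phi>" using cont continuous_on_subset by blast
  then have "bounded (\<phi> ` sphere 0 1)" "uniformly_continuous_on (sphere 0 1) \<phi>"
    by (auto intro!: compact_imp_bounded compact_continuous_image compact_uniformly_continuous)
  then obtain B \<eta> where B: "B > 0" "\<And>x. norm x = 1 \<Longrightarrow> \<bar>\<phi> x\<bar> \<le> B"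
    and \<eta>: "\<eta> > 0" "\<And>x y. norm x = 1 \<Longrightarrow> norm y = 1 \<Longrightarrow> norm (y - x) < \<eta> \<Longrightarrow> \<bar>\<phi> y - \<phi> x\<bar> < e / 3"
    using e unfolding bounded_pos uniformly_continuous_on_def
    by (auto simp: dist_norm dest!: spec[of _ "e / 3"])
  \<comment> \<open>If \<open>norm (y - x) \<ge> \<eta>\<close> and
    \<open>\<bar>r - 1\<bar> < \<eta> / 2\<close>, then \<open>y\<close> is at distance at least
    \<open>\<eta> / 2\<close> from \<open>r *\<^sub>R x\<close>, which explains the
    denominator.\<close>
  define C where "C r = kappa DIM('a) \<alpha> * \<bar>r\<^sup>2 - 1\<bar> powr (\<alpha> - 1) / (\<eta> / 2) powr (real DIM('a) + \<alpha> - 2)" for r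
  have "((\<lambda>r. 2 * B * C r) \<longlongrightarrow> 2 * B * (kappa DIM('a) \<alpha> * 0 powr (\<alpha> - 1) / (\<eta> / 2) powr (real DIM('a) + \<alpha> - 2))) (at 1)"
    unfolding C_def using \<alpha> \<eta>(1) by (intro tendsto_intros tendsto_powr' tendsto_divide) (auto intro!: tendsto_eq_intros)
  then have "((\<lambda>r. 2 * B * C r) \<longlongrightarrow> 0) (at 1)" by simp
  then have 1: "eventually (\<lambda>r. 2 * B * C r < e / 3) (at 1)" by (rule order_tendstoD(2)) (use e in simp)
  have "((\<lambda>r. B * (1 - theta DIM('a) \<alpha> r)) \<longlongrightarrow> B * (1 - 1)) (at 1)" by (intro tendsto_intros theta_tendsto_one)
  then have 2: "eventually (\<lambda>r. B * (1 - theta DIM('a) \<alpha> r) < e / 3) (at 1)" using order_tendstoD(2)[of _ 0 "at 1" "e / 3"] e by simp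
  have 3: "eventually (\<lambda>r. \<bar>r - 1\<bar> < min (\<eta> / 2) 1) (at (1::real))"
    using \<eta>(1) unfolding eventually_at by (intro exI[of _ "min (\<eta> / 2) 1"]) (auto simp: dist_real_def)
  have 4: "eventually (\<lambda>r. r \<noteq> 1) (at (1::real))" by (simp add: eventually_at_filter)
  show ?thesis
    using 1 2 3 4
  proof eventually_elim
    case (elim r)
    show ?case
    proof (intro allI impI)
      fix x :: 'a assume x: "norm x = 1"
      have r: "r > 0" using elim(3) by linarith
      have rx: "norm (r *\<^sub>R x) \<noteq> 1" "norm (r *\<^sub>R x) = r" using elim(4) r x by auto
      note I = PD_kernel_integrable[OF rx(1) sets_sphere_sigma AE_sphere_sigma]
      interpret S: prob_space "sphere_sigma :: 'a measure" by (rule prob_space_sphere_sigma)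
      have [measurable]: "\<phi> \<in> borel_measurable borel" using cont by (rule borel_measurable_continuous_onI)
      have i\<phi>: "integrable sphere_sigma \<phi>"
        using AE_sphere_sigma B(2) by (intro S.integrable_const_bound[of _ B]) (auto elim!: eventually_mono)
      have C0: "C r \<ge> 0" using kappa_pos by (simp add: C_def)
      have t: "theta DIM('a) \<alpha> r \<le> 1" "theta DIM('a) \<alpha> r \<ge> 0" using theta_le_one[of r] theta_nonneg r by auto
      have "\<bar>\<integral>y. PD_kernel \<alpha> (r *\<^sub>R x) y * (\<phi> y - \<phi> x) \<partial>sphere_sigma\<bar> \<le> (\<integral>y. \<bar>PD_kernel \<alpha> (r *\<^sub>R x) y * (\<phi> y - \<phi> x)\<bar> \<partial>sphere_sigma)"
        by (rule integral_abs_bound)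
      also have "\<dots> \<le> (\<integral>y. e / 3 * PD_kernel \<alpha> (r *\<^sub>R x) y + 2 * B * C r \<partial>sphere_sigma)"
      proof (rule integral_mono_AE)
        show "integrable sphere_sigma (\<lambda>y. \<bar>PD_kernel \<alpha> (r *\<^sub>R x) y * (\<phi> y - \<phi> x)\<bar>)" using i\<phi> by (intro integrable_abs I) auto
        show "integrable sphere_sigma (\<lambda>y. e / 3 * PD_kernel \<alpha> (r *\<^sub>R x) y + 2 * B * C r)" using PD_kernel_integral(1)[OF rx(1)] by auto
        show "AE y in sphere_sigma. \<bar>PD_kernel \<alpha> (r *\<^sub>R x) y * (\<phi> y - \<phi> x)\<bar> \<le> e / 3 * PD_kernel \<alpha> (r *\<^sub>R x) y + 2 * B * C r"
          using AE_sphere_sigma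
        proof eventually_elim
          case (elim y)
          define k where "k = PD_kernel \<alpha> (r *\<^sub>R x) y"
          have k: "k \<ge> 0" by (simp add: k_def PD_kernel_nonneg)
          have "k * \<bar>\<phi> y - \<phi> x\<bar> \<le> e / 3 * k + 2 * B * C r"
          proof (cases "norm (y - x) < \<eta>")
            case True
            then have "k * \<bar>\<phi> y - \<phi> x\<bar> \<le> k * (e / 3)" using \<eta>(2)[OF x elim] k by (intro mult_left_mono) auto
            moreover have "0 \<le> 2 * B * C r" using B C0 by simp
            moreover have "k * (e / 3) = e / 3 * k" by simp
            ultimately show ?thesis by linarith
          next
            case False
            have "norm (x - y) \<le> norm (r *\<^sub>R x - y) + norm ((1 - r) *\<^sub>R x)"
              using norm_triangle_ineq[of "r *\<^sub>R x - y" "(1 - r) *\<^sub>R x"] by (simp add: algebra_simps)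
            then have "\<eta> / 2 \<le> norm (r *\<^sub>R x - y)" using False x \<open>\<bar>r - 1\<bar> < min (\<eta> / 2) 1\<close> by (simp add: norm_minus_commute abs_minus_commute)
            then have "k \<le> C r" using PD_kernel_le[of "\<eta> / 2" "r *\<^sub>R x" y] \<eta>(1) rx(2) by (simp add: C_def k_def)
            moreover have "\<bar>\<phi> y - \<phi> x\<bar> \<le> 2 * B" using B(2)[OF x] B(2)[OF elim] by linarith
            ultimately have "k * \<bar>\<phi> y - \<phi> x\<bar> \<le> C r * (2 * B)" using C0 by (intro mult_mono) auto
            moreover have "0 \<le> e / 3 * k" using e k by simp
            ultimately show ?thesis by (simp add: mult.commute)
          qed
          then show ?case using k by (simp add: k_def abs_mult)
        qed
      qed
      also have "\<dots> = e / 3 * theta DIM('a) \<alpha> r + 2 * B * C r"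
        using PD_kernel_integral[OF rx(1)] rx(2) S.prob_space by simp
      also have "\<dots> \<le> e / 3 + e / 3" using e elim(1) mult_left_mono[OF t(1), of "e / 3"] by linarith
      finally have a: "\<bar>\<integral>y. PD_kernel \<alpha> (r *\<^sub>R x) y * (\<phi> y - \<phi> x) \<partial>sphere_sigma\<bar> \<le> e / 3 + e / 3" .
      have "(\<integral>y. PD_kernel \<alpha> (r *\<^sub>R x) y * (\<phi> y - \<phi> x) \<partial>sphere_sigma) = PD_fun \<alpha> \<phi> (r *\<^sub>R x) - theta DIM('a) \<alpha> r * \<phi> x"
        using I[OF i\<phi>] PD_kernel_integral[OF rx(1)] rx(2) by (simp add: PD_fun_def right_diff_distrib)
      then have "PD_fun \<alpha> \<phi> (r *\<^sub>R x) - \<phi> x = (\<integral>y. PD_kernel \<alpha> (r *\<^sub>R x) y * (\<phi> y - \<phi> x) \<partial>sphere_sigma) - (1 - theta DIM('a) \<alpha> r) * \<phi> x"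
        by (simp add: algebra_simps)
      moreover have "\<bar>(1 - theta DIM('a) \<alpha> r) * \<phi> x\<bar> \<le> (1 - theta DIM('a) \<alpha> r) * B"
        unfolding abs_mult using t B(2)[OF x] by (intro mult_mono) auto
      ultimately show "\<bar>PD_fun \<alpha> \<phi> (r *\<^sub>R x) - \<phi> x\<bar> \<le> e" using a elim(2) by (simp add: mult.commute)
    qed
  qed
qed

end

section \<open>Hahn sets and the total variation norm\<close>

lemma integral_indicator_le_of_le:
  fixes f :: "'b \<Rightarrow> real"
  assumes sets: "sets N = sets M" and Y: "Y \<in> sets M" and le: "\<And>X. X \<in> sets M \<Longrightarrow> X \<subseteq> Y \<Longrightarrow> emeasure N X \<le> emeasure M X"
    and f: "integrable M f" "integrable N f" "\<And>x. f x \<ge> 0"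
  shows "(\<integral>x. f x * indicator Y x \<partial>N) \<le> (\<integral>x. f x * indicator Y x \<partial>M)"
proof -
  have [simp]: "space N = space M" using sets_eq_imp_space_eq[OF sets] .
  have s: "Y \<inter> space M \<in> sets M" "Y \<inter> space N \<in> sets N" using Y sets by auto
  have "(\<integral>\<^sup>+x. ennreal (f x) * indicator Y x \<partial>N) = nn_integral (restrict_space N Y) (\<lambda>x. ennreal (f x))"
    using s by (simp add: nn_integral_restrict_space)
  also have "\<dots> \<le> nn_integral (restrict_space M Y) (\<lambda>x. ennreal (f x))"
  proof (rule nn_integral_mono_measure)
    show eq: "sets (restrict_space N Y) = sets (restrict_space M Y)" using sets by (simp add: sets_restrict_space)
    show "restrict_space N Y \<le> restrict_space M Y"
    proof (subst le_measure[OF eq], intro ballI)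
      fix X assume "X \<in> sets (restrict_space N Y)"
      then have X: "X \<in> sets M" "X \<subseteq> Y" using s Y sets by (auto simp: sets_restrict_space)
      then show "emeasure (restrict_space N Y) X \<le> emeasure (restrict_space M Y) X"
        using le[OF X] s by (simp add: emeasure_restrict_space)
    qed
  qed
  also have "\<dots> = (\<integral>\<^sup>+x. ennreal (f x) * indicator Y x \<partial>M)" using s by (simp add: nn_integral_restrict_space)
  finally have "(\<integral>\<^sup>+x. ennreal (f x * indicator Y x) \<partial>N) \<le> (\<integral>\<^sup>+x. ennreal (f x * indicator Y x) \<partial>M)"
    by (simp add: ennreal_mult' ennreal_indicator f(3))
  moreover have "integrable M (\<lambda>x. f x * indicator Y x)" "integrable N (\<lambda>x. f x * indicator Y x)"
    using f Y sets by (auto intro!: integrable_real_mult_indicator)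
  ultimately show ?thesis using f(3) by (simp add: nn_integral_eq_integral integral_nonneg_AE)
qed

text \<open>\<open>N1\<close> and \<open>N2\<close> may overlap, so the sign of their difference is
  taken from a Hahn set \<open>Y\<close>. Splitting each member of a disjoint family along
  \<open>Y\<close> bounds every sum, and the pair \<open>Y\<close>, \<open>- Y\<close> attains the
  bound.\<close>

lemma tv_norm_Hahn:
  fixes N1 N2 :: "'a::euclidean_space measure"
  assumes sets: "sets N1 = sets borel" "sets N2 = sets borel" and fin: "finite_measure N1" "finite_measure N2"
  obtains Y where "Y \<in> sets borel"
    "\<forall>X\<in>sets borel. X \<subseteq> Y \<longrightarrow> emeasure N2 X \<le> emeasure N1 X"
    "\<forall>X\<in>sets borel. X \<inter> Y = {} \<longrightarrow> emeasure N1 X \<le> emeasure N2 X"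
    "tv_norm N1 N2 = (measure N1 Y - measure N2 Y) + (measure N2 (- Y) - measure N1 (- Y))"
proof -
  interpret N1: finite_measure N1 by fact
  interpret N2: finite_measure N2 by fact
  have sp: "space N1 = UNIV" "space N2 = UNIV" using sets[THEN sets_eq_imp_space_eq] by simp_all
  obtain Y where Y: "Y \<in> sets borel"
    "\<forall>X\<in>sets borel. X \<subseteq> Y \<longrightarrow> emeasure N2 X \<le> emeasure N1 X"
    "\<forall>X\<in>sets borel. X \<inter> Y = {} \<longrightarrow> emeasure N1 X \<le> emeasure N2 X"
    using finite_unsigned_Hahn_decomposition[OF fin] sets by auto
  define d where "d X = measure N1 X - measure N2 X" for X
  have dU: "d (A \<union> B) = d A + d B" if "A \<in> sets borel" "B \<in> sets borel" "A \<inter> B = {}" for A B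
    using that N1.finite_measure_Union[of A B] N2.finite_measure_Union[of A B] by (simp add: d_def sets)
  have dp: "0 \<le> d X" if "X \<in> sets borel" "X \<subseteq> Y" for X using Y(2) that by (simp add: d_def N1.emeasure_eq_measure N2.emeasure_eq_measure)
  have dn: "d X \<le> 0" if "X \<in> sets borel" "X \<inter> Y = {}" for X using Y(3) that by (simp add: d_def N1.emeasure_eq_measure N2.emeasure_eq_measure)
  have dsum: "(\<Sum>i<n. d (A i)) = d (\<Union>i<n. A i)" if "\<And>i. i < n \<Longrightarrow> A i \<in> sets borel" "disjoint_family_on A {..<n}" for n :: nat and A
    using that N1.finite_measure_finite_Union[of "{..<n}" A] N2.finite_measure_finite_Union[of "{..<n}" A]
    by (auto simp: d_def sum_subtractf sets image_subset_iff)
  let ?F = "\<lambda>(n, A). \<Sum>i<n. \<bar>measure N1 (A i) - measure N2 (A i)\<bar>"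
  let ?S = "{(n::nat, A). (\<forall>i<n. A i \<in> sets N1 \<inter> sets N2) \<and> disjoint_family_on A {..<n}}"
  have ub: "?F z \<le> d Y - d (- Y)" if zS: "z \<in> ?S" for z
  proof -
    obtain n A where z: "z = (n, A)" by (cases z)
    have A: "\<And>i. i < n \<Longrightarrow> A i \<in> sets borel" "disjoint_family_on A {..<n}" using zS by (auto simp: z sets)
    have "(\<Sum>i<n. \<bar>d (A i)\<bar>) \<le> (\<Sum>i<n. d (A i \<inter> Y) - d (A i - Y))"
    proof (rule sum_mono)
      fix i assume "i \<in> {..<n}"
      then have i: "A i \<in> sets borel" using A by auto
      have "d (A i) = d (A i \<inter> Y \<union> (A i - Y))" by (rule arg_cong[of _ _ d]) auto
      also have "\<dots> = d (A i \<inter> Y) + d (A i - Y)" using i Y(1) by (intro dU) auto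
      finally show "\<bar>d (A i)\<bar> \<le> d (A i \<inter> Y) - d (A i - Y)"
        using dp[of "A i \<inter> Y"] dn[of "A i - Y"] i Y(1) by (simp add: Diff_Int_distrib2 sets.Diff)
    qed
    also have "\<dots> = (\<Sum>i<n. d (A i \<inter> Y)) - (\<Sum>i<n. d (A i - Y))" by (simp add: sum_subtractf)
    also have "(\<Sum>i<n. d (A i \<inter> Y)) = d (\<Union>i<n. A i \<inter> Y)"
      using A Y(1) by (intro dsum) (auto simp: disjoint_family_on_def)
    also have "(\<Sum>i<n. d (A i - Y)) = d (\<Union>i<n. A i - Y)"
      using A Y(1) by (intro dsum) (auto simp: disjoint_family_on_def)
    finally have 1: "(\<Sum>i<n. \<bar>d (A i)\<bar>) \<le> d (\<Union>i<n. A i \<inter> Y) - d (\<Union>i<n. A i - Y)" .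
    have 2: "d (\<Union>i<n. A i \<inter> Y) \<le> d Y"
    proof -
      have "d Y = d ((\<Union>i<n. A i \<inter> Y) \<union> (Y - (\<Union>i<n. A i \<inter> Y)))" by (rule arg_cong[of _ _ d]) auto
      also have "\<dots> = d (\<Union>i<n. A i \<inter> Y) + d (Y - (\<Union>i<n. A i \<inter> Y))" using A Y(1) by (intro dU) auto
      finally show ?thesis using dp[of "Y - (\<Union>i<n. A i \<inter> Y)"] A Y(1) by auto
    qed
    have 3: "d (- Y) \<le> d (\<Union>i<n. A i - Y)"
    proof -
      have "d (- Y) = d ((\<Union>i<n. A i - Y) \<union> (- Y - (\<Union>i<n. A i - Y)))" by (rule arg_cong[of _ _ d]) auto
      also have "\<dots> = d (\<Union>i<n. A i - Y) + d (- Y - (\<Union>i<n. A i - Y))" using A Y(1) by (intro dU) auto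
      finally show ?thesis using dn[of "- Y - (\<Union>i<n. A i - Y)"] A Y(1) by auto
    qed
    from 1 2 3 have "(\<Sum>i<n. \<bar>d (A i)\<bar>) \<le> d Y - d (- Y)" by linarith
    then show ?thesis by (simp add: z d_def)
  qed
  have "tv_norm N1 N2 = d Y - d (- Y)"
    unfolding tv_norm_def
  proof (rule cSup_eq_maximum)
    have *: "(Suc (Suc 0), \<lambda>i. if i = 0 then Y else - Y) \<in> ?S" using Y(1) by (auto simp: sets disjoint_family_on_def)
    have "d Y - d (- Y) = ?F (Suc (Suc 0), \<lambda>i. if i = 0 then Y else - Y)"
      using dp[of Y] dn[of "- Y"] Y(1) by (simp add: d_def)
    then show "d Y - d (- Y) \<in> ?F ` ?S" using * by (rule image_eqI)
  qed (use ub in blast)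
  then show thesis using Y that[of Y] by (simp add: d_def)
qed

section \<open>Duality of the Poisson operator and boundary values in the mean\<close>

context stable_index
begin

text \<open>Duality by \<open>PD_kernel_swap\<close>: pairing a Poisson integral with \<phi> is
  integrating the extension of \<phi>. With \<open>\<phi> = 1\<close> and \<open>g\<close> the sign
  of a Hahn set it computes masses; with \<open>g = 1\<close> it reduces boundary limits of measures
  to those of continuous functions.\<close>

lemma PD_Fubini:
  fixes N :: "'a measure" and \<phi> g :: "'a \<Rightarrow> real"
  assumes N: "sets N = sets borel" "finite_measure N" "AE y in N. norm y = 1" and r: "r > 0" "r \<noteq> 1"
    and \<phi>: "\<phi> \<in> borel_measurable borel" "\<And>x. \<bar>\<phi> x\<bar> \<le> A" and g: "g \<in> borel_measurable borel" "\<And>x. \<bar>g x\<bar> \<le> B"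
  shows "integrable sphere_sigma (\<lambda>x. \<phi> x * (\<integral>y. PD_kernel \<alpha> (r *\<^sub>R x) y * g y \<partial>N))" (is ?I)
    and "(\<integral>x. \<phi> x * (\<integral>y. PD_kernel \<alpha> (r *\<^sub>R x) y * g y \<partial>N) \<partial>sphere_sigma) = (\<integral>y. g y * PD_fun \<alpha> \<phi> (r *\<^sub>R y) \<partial>N)" (is ?E)
proof -
  interpret S: prob_space "sphere_sigma :: 'a measure" by (rule prob_space_sphere_sigma)
  interpret N: finite_measure N by fact
  interpret P: pair_sigma_finite "sphere_sigma :: 'a measure" N by unfold_locales
  interpret F: finite_measure "(sphere_sigma :: 'a measure) \<Otimes>\<^sub>M N"
    by (rule finite_measure_pair_measure[OF N.finite_measure_axioms S.finite_measure_axioms])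
  note [measurable_cong] = N(1)
  note [measurable] = \<phi>(1) g(1)
  define C where "C = kappa DIM('a) \<alpha> * \<bar>r\<^sup>2 - 1\<bar> powr (\<alpha> - 1) / \<bar>r - 1\<bar> powr (real DIM('a) + \<alpha> - 2)"
  define F where "F x y = \<phi> x * (PD_kernel \<alpha> (r *\<^sub>R x) y * g y)" for x y
  have [measurable]: "case_prod F \<in> borel_measurable ((sphere_sigma :: 'a measure) \<Otimes>\<^sub>M N)" unfolding F_def split_beta' by measurable
  have "AE z in (sphere_sigma :: 'a measure) \<Otimes>\<^sub>M N. norm (fst z) = 1 \<and> norm (snd z) = 1"
  proof (rule P.AE_pair_measure)
    show "AE x in sphere_sigma. AE y in N. norm (fst (x, y)) = 1 \<and> norm (snd (x, y)) = 1"
      using AE_sphere_sigma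
    proof eventually_elim
      case (elim x)
      show ?case using N(3) by eventually_elim (simp add: elim)
    qed
  qed measurable
  then have "AE z in sphere_sigma \<Otimes>\<^sub>M N. norm (case_prod F z) \<le> A * (C * B)"
  proof eventually_elim
    case (elim z)
    obtain x y where z: "z = (x, y)" by (cases z)
    have "PD_kernel \<alpha> (r *\<^sub>R x) y \<le> C" using PD_kernel_le_radial[of "r *\<^sub>R x" y] elim r unfolding C_def z by simp
    then have "\<bar>\<phi> x\<bar> * (PD_kernel \<alpha> (r *\<^sub>R x) y * \<bar>g y\<bar>) \<le> A * (C * B)"
      using \<phi>(2)[of x] g(2)[of y] PD_kernel_nonneg[of "r *\<^sub>R x" y] by (intro mult_mono) auto
    then show ?case unfolding z F_def by (simp add: abs_mult PD_kernel_nonneg)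
  qed
  then have i: "integrable (sphere_sigma \<Otimes>\<^sub>M N) (case_prod F)" by (rule F.integrable_const_bound) measurable
  show ?I using P.integrable_fst'[OF i] by (simp add: F_def)
  have "(\<integral>x. \<phi> x * (\<integral>y. PD_kernel \<alpha> (r *\<^sub>R x) y * g y \<partial>N) \<partial>sphere_sigma) = (\<integral>x. (\<integral>y. F x y \<partial>N) \<partial>sphere_sigma)" by (simp add: F_def)
  also have "\<dots> = (\<integral>y. (\<integral>x. F x y \<partial>sphere_sigma) \<partial>N)" by (rule P.Fubini_integral[OF i, symmetric])
  also have "\<dots> = (\<integral>y. g y * PD_fun \<alpha> \<phi> (r *\<^sub>R y) \<partial>N)"
  proof (rule integral_cong_AE)
    show "AE y in N. (\<integral>x. F x y \<partial>sphere_sigma) = g y * PD_fun \<alpha> \<phi> (r *\<^sub>R y)"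
      using N(3)
    proof eventually_elim
      case (elim y)
      have "(\<integral>x. F x y \<partial>sphere_sigma) = (\<integral>x. g y * (PD_kernel \<alpha> (r *\<^sub>R y) x * \<phi> x) \<partial>sphere_sigma)"
      proof (rule integral_cong_AE)
        show "AE x in sphere_sigma. F x y = g y * (PD_kernel \<alpha> (r *\<^sub>R y) x * \<phi> x)"
          using AE_sphere_sigma by eventually_elim (simp add: F_def PD_kernel_swap[OF _ elim])
      qed (unfold F_def, measurable)
      then show ?case by (simp add: PD_fun_def)
    qed
  qed (unfold F_def PD_fun_def, measurable)
  finally show ?E .
qed

lemma PD_fun_const: "norm y \<noteq> 1 \<Longrightarrow> PD_fun \<alpha> (\<lambda>_. 1) (y::'a) = theta DIM('a) \<alpha> (norm y)"
  by (simp add: PD_fun_def PD_kernel_integral)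

text \<open>The contraction constant is the mass \<theta> \<le> 1, seen by integrating out the outer
  variable first.\<close>

lemma PD_fun_L1:
  fixes f :: "'a \<Rightarrow> real"
  assumes r: "r > 0" "r \<noteq> 1" and f: "f \<in> borel_measurable borel" "integrable sphere_sigma f"
  shows "integrable sphere_sigma (\<lambda>x. PD_fun \<alpha> f (r *\<^sub>R x))" "(\<integral>x. \<bar>PD_fun \<alpha> f (r *\<^sub>R x)\<bar> \<partial>sphere_sigma) \<le> (\<integral>x. \<bar>f x\<bar> \<partial>sphere_sigma)"
proof -
  interpret S: prob_space "sphere_sigma :: 'a measure" by (rule prob_space_sphere_sigma)
  note [measurable] = f(1)
  have [measurable]: "(\<lambda>x. PD_fun \<alpha> f (r *\<^sub>R x)) \<in> borel_measurable sphere_sigma" unfolding PD_fun_def by measurable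
  have "(\<integral>\<^sup>+x. ennreal \<bar>PD_fun \<alpha> f (r *\<^sub>R x)\<bar> \<partial>sphere_sigma) \<le> (\<integral>\<^sup>+x. (\<integral>\<^sup>+y. ennreal (PD_kernel \<alpha> (r *\<^sub>R x) y) * ennreal \<bar>f y\<bar> \<partial>sphere_sigma) \<partial>sphere_sigma)"
  proof (rule nn_integral_mono_AE)
    show "AE x in sphere_sigma. ennreal \<bar>PD_fun \<alpha> f (r *\<^sub>R x)\<bar> \<le> (\<integral>\<^sup>+y. ennreal (PD_kernel \<alpha> (r *\<^sub>R x) y) * ennreal \<bar>f y\<bar> \<partial>sphere_sigma)"
      using AE_sphere_sigma
    proof eventually_elim
      case (elim x)
      have i: "integrable sphere_sigma (\<lambda>y. PD_kernel \<alpha> (r *\<^sub>R x) y * f y)"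
        using elim r f by (intro PD_kernel_integrable AE_sphere_sigma) auto
      show ?case using integral_norm_bound_ennreal[OF i]
        by (simp add: PD_fun_def abs_mult PD_kernel_nonneg ennreal_mult)
    qed
  qed
  also have "\<dots> = ennreal (theta DIM('a) \<alpha> r) * (\<integral>\<^sup>+y. ennreal \<bar>f y\<bar> \<partial>sphere_sigma)"
    using r by (intro PD_kernel_Tonelli AE_sphere_sigma) (auto simp: S.finite_measure_axioms)
  also have "\<dots> \<le> ennreal 1 * (\<integral>\<^sup>+y. ennreal \<bar>f y\<bar> \<partial>sphere_sigma)"
    using theta_le_one[of r] r by (intro mult_right_mono ennreal_leI) auto
  also have "\<dots> = ennreal (\<integral>y. \<bar>f y\<bar> \<partial>sphere_sigma)" using f by (simp add: nn_integral_eq_integral)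
  finally have le: "(\<integral>\<^sup>+x. ennreal \<bar>PD_fun \<alpha> f (r *\<^sub>R x)\<bar> \<partial>sphere_sigma) \<le> ennreal (\<integral>y. \<bar>f y\<bar> \<partial>sphere_sigma)" .
  show i: "integrable sphere_sigma (\<lambda>x. PD_fun \<alpha> f (r *\<^sub>R x))"
    using le_less_trans[OF le ennreal_less_top] by (intro integrableI_bounded) auto
  have "ennreal (\<integral>x. \<bar>PD_fun \<alpha> f (r *\<^sub>R x)\<bar> \<partial>sphere_sigma) \<le> ennreal (\<integral>y. \<bar>f y\<bar> \<partial>sphere_sigma)"
    using le i by (simp add: nn_integral_eq_integral)
  then show "(\<integral>x. \<bar>PD_fun \<alpha> f (r *\<^sub>R x)\<bar> \<partial>sphere_sigma) \<le> (\<integral>x. \<bar>f x\<bar> \<partial>sphere_sigma)" by (simp add: integral_nonneg_AE)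
qed

text \<open>Continuous functions converge uniformly on the sphere and are dense in mean, and the
  contraction property makes the error of the approximation uniform in \<open>r\<close>. Convergence
  in mean serves all exponents, because a subsequence converging almost everywhere can be extracted
  from it.\<close>

lemma PD_fun_tendsto_L1:
  fixes f :: "'a \<Rightarrow> real"
  assumes f: "f \<in> borel_measurable borel" "integrable sphere_sigma f"
  shows "((\<lambda>r. \<integral>x. \<bar>PD_fun \<alpha> f (r *\<^sub>R x) - f x\<bar> \<partial>sphere_sigma) \<longlongrightarrow> 0) (at 1)"
proof (rule tendstoI)
  fix e :: real assume e: "e > 0"
  interpret S: prob_space "sphere_sigma :: 'a measure" by (rule prob_space_sphere_sigma)
  obtain g :: "'a \<Rightarrow> real" and B where g: "continuous_on UNIV g" "\<And>x. \<bar>g x\<bar> \<le> B" "(\<integral>x. \<bar>f x - g x\<bar> \<partial>sphere_sigma) < e / 4"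
    using L1_dense_continuous[OF sets_sphere_sigma S.finite_measure_axioms f(2), of "e / 4"] e by auto
  have gm[measurable]: "g \<in> borel_measurable borel" using g(1) by (rule borel_measurable_continuous_onI)
  note [measurable] = f(1)
  have gi: "integrable sphere_sigma g" using g(2) by (intro S.integrable_const_bound[of _ B]) auto
  have "eventually (\<lambda>r. \<forall>x. norm x = 1 \<longrightarrow> \<bar>PD_fun \<alpha> g (r *\<^sub>R x) - g x\<bar> \<le> e / 4) (at 1)"
    using PD_approx_identity[OF g(1), of "e / 4"] e by simp
  moreover have "eventually (\<lambda>r. r > 0) (at (1::real))" using order_tendstoD(1)[OF tendsto_ident_at, of 0 "1::real"] by simp
  moreover have "eventually (\<lambda>r. r \<noteq> 1) (at (1::real))" by (simp add: eventually_at_filter)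
  ultimately show "eventually (\<lambda>r. dist (\<integral>x. \<bar>PD_fun \<alpha> f (r *\<^sub>R x) - f x\<bar> \<partial>sphere_sigma) 0 < e) (at 1)"
  proof eventually_elim
    case (elim r)
    have fg: "integrable sphere_sigma (\<lambda>x. f x - g x)" using f gi by simp
    note P = PD_fun_L1[OF elim(2,3)] and close = elim(1)
    have Pfg: "integrable sphere_sigma (\<lambda>x. PD_fun \<alpha> (\<lambda>x. f x - g x) (r *\<^sub>R x))"
      "(\<integral>x. \<bar>PD_fun \<alpha> (\<lambda>x. f x - g x) (r *\<^sub>R x)\<bar> \<partial>sphere_sigma) \<le> (\<integral>x. \<bar>f x - g x\<bar> \<partial>sphere_sigma)"
      using P[OF _ fg] by auto
    have "(\<integral>x. \<bar>PD_fun \<alpha> f (r *\<^sub>R x) - f x\<bar> \<partial>sphere_sigma)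
      \<le> (\<integral>x. \<bar>PD_fun \<alpha> (\<lambda>x. f x - g x) (r *\<^sub>R x)\<bar> + e / 4 + \<bar>f x - g x\<bar> \<partial>sphere_sigma)"
    proof (rule integral_mono_AE)
      show "integrable sphere_sigma (\<lambda>x. \<bar>PD_fun \<alpha> f (r *\<^sub>R x) - f x\<bar>)" using P(1)[OF f] f by simp
      show "integrable sphere_sigma (\<lambda>x. \<bar>PD_fun \<alpha> (\<lambda>x. f x - g x) (r *\<^sub>R x)\<bar> + e / 4 + \<bar>f x - g x\<bar>)" using Pfg fg by simp
      show "AE x in sphere_sigma. \<bar>PD_fun \<alpha> f (r *\<^sub>R x) - f x\<bar> \<le> \<bar>PD_fun \<alpha> (\<lambda>x. f x - g x) (r *\<^sub>R x)\<bar> + e / 4 + \<bar>f x - g x\<bar>"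
        using AE_sphere_sigma
      proof eventually_elim
        case (elim x)
        have rx: "norm (r *\<^sub>R x) \<noteq> 1" using elim \<open>r > 0\<close> \<open>r \<noteq> 1\<close> by simp
        note I = PD_kernel_integrable[OF rx sets_sphere_sigma AE_sphere_sigma]
        have "PD_fun \<alpha> (\<lambda>x. f x - g x) (r *\<^sub>R x) = PD_fun \<alpha> f (r *\<^sub>R x) - PD_fun \<alpha> g (r *\<^sub>R x)"
          using I[OF f(2)] I[OF gi] by (simp add: PD_fun_def right_diff_distrib)
        moreover have "\<bar>PD_fun \<alpha> g (r *\<^sub>R x) - g x\<bar> \<le> e / 4" using close elim by blast
        ultimately show ?case by linarith
      qed
    qed
    also have "\<dots> = (\<integral>x. \<bar>PD_fun \<alpha> (\<lambda>x. f x - g x) (r *\<^sub>R x)\<bar> \<partial>sphere_sigma) + e / 4 + (\<integral>x. \<bar>f x - g x\<bar> \<partial>sphere_sigma)"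
      using Pfg(1) fg S.prob_space by simp
    also have "\<dots> < e" using Pfg(2) g(3) e by linarith
    finally show ?case by (simp add: integral_nonneg_AE)
  qed
qed

text \<open>The exponents combine to
  \<open>2 * (\<alpha> - 1) - (d + \<alpha> - 2) = \<alpha> - d\<close>, which is negative. The
  factor with base 3 comes from \<open>t + 1 \<le> 3 * (t - 1)\<close> for
  \<open>t \<ge> 2\<close>.\<close>

lemma radial_bound_tendsto_0:
  "((\<lambda>t. \<bar>t\<^sup>2 - 1\<bar> powr (\<alpha> - 1) / \<bar>t - 1\<bar> powr (real DIM('a) + \<alpha> - 2)) \<longlongrightarrow> 0) at_top"
proof (rule tendsto_sandwich[OF _ _ tendsto_const])
  define m where "m = real DIM('a) - \<alpha>"
  have m: "m > 0" using dim \<alpha> by (simp add: m_def)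
  have "((\<lambda>t. (t - 1) powr (- m)) \<longlongrightarrow> 0) at_top"
    using m filterlim_tendsto_add_at_top[OF tendsto_const[of "-1"] filterlim_ident] by (intro tendsto_neg_powr) auto
  then have "((\<lambda>t. 3 powr (\<alpha> - 1) * (t - 1) powr (- m)) \<longlongrightarrow> 3 powr (\<alpha> - 1) * 0) at_top" by (intro tendsto_intros)
  then show "((\<lambda>t. 3 powr (\<alpha> - 1) * (t - 1) powr (- m)) \<longlongrightarrow> 0) at_top" by simp
  show "eventually (\<lambda>t. \<bar>t\<^sup>2 - 1\<bar> powr (\<alpha> - 1) / \<bar>t - 1\<bar> powr (real DIM('a) + \<alpha> - 2) \<le> 3 powr (\<alpha> - 1) * (t - 1) powr (- m)) at_top"
    using eventually_ge_at_top[of 2]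
  proof eventually_elim
    case (elim t)
    have eq: "t\<^sup>2 - 1 = (t - 1) * (t + 1)" by (simp add: power2_eq_square algebra_simps)
    have "0 \<le> (t - 1) * (t + 1)" using elim by simp
    then have "\<bar>t\<^sup>2 - 1\<bar> powr (\<alpha> - 1) = (t - 1) powr (\<alpha> - 1) * (t + 1) powr (\<alpha> - 1)"
      using elim by (simp add: eq powr_mult)
    also have "\<dots> \<le> (t - 1) powr (\<alpha> - 1) * (3 * (t - 1)) powr (\<alpha> - 1)"
      using elim \<alpha> by (intro mult_left_mono powr_mono2) auto
    also have "\<dots> = 3 powr (\<alpha> - 1) * (t - 1) powr (2 * (\<alpha> - 1))"
      unfolding powr_mult mult_2 powr_add by (simp add: ac_simps)
    finally have "\<bar>t\<^sup>2 - 1\<bar> powr (\<alpha> - 1) / \<bar>t - 1\<bar> powr (real DIM('a) + \<alpha> - 2) \<le> 3 powr (\<alpha> - 1) * (t - 1) powr (2 * (\<alpha> - 1)) / (t - 1) powr (real DIM('a) + \<alpha> - 2)"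
      using elim divide_right_mono[of _ _ "(t - 1) powr (real DIM('a) + \<alpha> - 2)"] by simp
    also have "\<dots> = 3 powr (\<alpha> - 1) * (t - 1) powr (2 * (\<alpha> - 1) - (real DIM('a) + \<alpha> - 2))" by (simp only: powr_diff times_divide_eq_right)
    also have "2 * (\<alpha> - 1) - (real DIM('a) + \<alpha> - 2) = - m" by (simp add: m_def)
    finally show ?case .
  qed
qed simp

end

section \<open>Upper bounds for the norm\<close>

text \<open>The lower bound is phrased through an arbitrary real bound \<open>B\<close> of all
  radial norms, the form in which Fatou and duality apply. The norm at \<open>r = 2\<close> shows
  that the supremum is nonnegative, hence a real number.\<close>

lemma hp_norm_eqI:
  assumes p: "1 \<le> p"
    and upper: "\<And>r. r > 0 \<Longrightarrow> r \<noteq> 1 \<Longrightarrow> Lp_norm sphere_sigma p (\<lambda>x. u (r *\<^sub>R x)) \<le> ereal a"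
    and lower: "\<And>B. B \<ge> 0 \<Longrightarrow> (\<And>r. r > 0 \<Longrightarrow> r \<noteq> 1 \<Longrightarrow> Lp_norm sphere_sigma p (\<lambda>x. u (r *\<^sub>R x)) \<le> ereal B) \<Longrightarrow> a \<le> B"
  shows "hp_norm p u = ereal a"
proof (rule antisym)
  show le: "hp_norm p u \<le> ereal a" unfolding hp_norm_def using upper by (intro SUP_least) auto
  have up: "Lp_norm sphere_sigma p (\<lambda>x. u (r *\<^sub>R x)) \<le> hp_norm p u" if "r > 0" "r \<noteq> 1" for r
    unfolding hp_norm_def using that by (intro SUP_upper) auto
  have "0 \<le> Lp_norm sphere_sigma p (\<lambda>x. u (2 *\<^sub>R x))" by (rule Lp_norm_nonneg[OF prob_space_sphere_sigma p])
  also have "\<dots> \<le> hp_norm p u" by (rule up) auto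
  finally have "0 \<le> hp_norm p u" .
  then obtain H where H: "hp_norm p u = ereal H" "H \<ge> 0" using le by (cases "hp_norm p u") auto
  then have "a \<le> H" using up by (intro lower) auto
  then show "ereal a \<le> hp_norm p u" using H by simp
qed

lemma sphere_fin_measD:
  assumes "sphere_fin_meas (N :: 'a::euclidean_space measure)"
  shows "sets N = sets borel" "finite_measure N" "AE y in N. norm y = 1"
proof -
  show s: "sets N = sets borel" and "finite_measure N" using assms by (auto simp: sphere_fin_meas_def)
  show "AE y in N. norm y = 1"
    using assms s by (intro AE_I[of _ _ "- sphere 0 1"]) (auto simp: sphere_fin_meas_def)
qed

context stable_index
begin

text \<open>With \<open>B\<close> above both the norm of \<open>f\<close> and
  \<open>\<bar>c\<bar>\<close>, the masses \<theta> and 1 - \<theta> give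
  \<open>t * B powr q + (1 - t) * B powr q = B powr q\<close>. For finite exponents this comes after
  Jensen and Tonelli, for \<infinity> it is pointwise.\<close>

lemma Lp_norm_PD_fun_le:
  fixes u f :: "'a \<Rightarrow> real"
  assumes p: "1 \<le> p" and u: "u \<in> borel_measurable borel" and f: "f \<in> borel_measurable borel" "integrable sphere_sigma f"
    and r: "r > 0" "r \<noteq> 1" and fB: "Lp_norm sphere_sigma p f \<le> ereal B" and cB: "\<bar>c\<bar> \<le> B"
    and le: "\<And>x. norm x = 1 \<Longrightarrow> \<bar>u (r *\<^sub>R x)\<bar> \<le> \<bar>PD_fun \<alpha> f (r *\<^sub>R x)\<bar> + \<bar>c\<bar> * (1 - theta DIM('a) \<alpha> r)"
  shows "Lp_norm sphere_sigma p (\<lambda>x. u (r *\<^sub>R x)) \<le> ereal B"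
proof -
  interpret S: prob_space "sphere_sigma :: 'a measure" by (rule prob_space_sphere_sigma)
  note [measurable] = u f(1)
  define t where "t = theta DIM('a) \<alpha> r"
  have t: "t \<ge> 0" "t \<le> 1" using theta_nonneg theta_le_one[of r] r by (auto simp: t_def)
  have B: "B \<ge> 0" using cB by linarith
  show ?thesis
  proof (cases "p = \<infinity>")
    case True
    have fB': "AE y in sphere_sigma. \<bar>f y\<bar> \<le> B" using fB unfolding True by (subst (asm) Lp_norm_inf_le_iff) auto
    have "AE x in sphere_sigma. \<bar>u (r *\<^sub>R x)\<bar> \<le> B"
      using AE_sphere_sigma
    proof eventually_elim
      case (elim x)
      have rx: "norm (r *\<^sub>R x) \<noteq> 1" "norm (r *\<^sub>R x) = r" using elim r by auto
      note I = PD_kernel_integrable[OF rx(1) sets_sphere_sigma AE_sphere_sigma]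
      have "\<bar>PD_fun \<alpha> f (r *\<^sub>R x)\<bar> \<le> (\<integral>y. \<bar>PD_kernel \<alpha> (r *\<^sub>R x) y * f y\<bar> \<partial>sphere_sigma)"
        unfolding PD_fun_def by (rule integral_abs_bound)
      also have "\<dots> \<le> (\<integral>y. PD_kernel \<alpha> (r *\<^sub>R x) y * B \<partial>sphere_sigma)"
      proof (rule integral_mono_AE)
        show "AE y in sphere_sigma. \<bar>PD_kernel \<alpha> (r *\<^sub>R x) y * f y\<bar> \<le> PD_kernel \<alpha> (r *\<^sub>R x) y * B"
          using fB' by eventually_elim (simp add: abs_mult PD_kernel_nonneg mult_left_mono)
        show "integrable sphere_sigma (\<lambda>y. \<bar>PD_kernel \<alpha> (r *\<^sub>R x) y * f y\<bar>)" using I[OF f(2)] by (rule integrable_abs)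
        show "integrable sphere_sigma (\<lambda>y. PD_kernel \<alpha> (r *\<^sub>R x) y * B)" by (rule I) simp
      qed
      also have "\<dots> = t * B" using PD_kernel_integral[OF rx(1)] rx(2) by (simp add: t_def)
      finally have "\<bar>u (r *\<^sub>R x)\<bar> \<le> t * B + \<bar>c\<bar> * (1 - t)" using le[OF elim] by (simp add: t_def)
      also have "\<dots> \<le> t * B + B * (1 - t)" using cB t by (intro add_left_mono mult_right_mono) auto
      finally show ?case by (simp add: algebra_simps)
    qed
    then show ?thesis unfolding True by (subst Lp_norm_inf_le_iff) auto
  next
    case False
    define q where "q = real_of_ereal p"
    have q: "q \<ge> 1" using p False by (cases p) (auto simp: q_def)
    note iff = Lp_norm_le_iff[OF p False B, folded q_def]
    have fq: "(\<integral>\<^sup>+y. ennreal (\<bar>f y\<bar> powr q) \<partial>sphere_sigma) \<le> ennreal (B powr q)" using fB iff by blast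
    have fqi: "integrable sphere_sigma (\<lambda>y. \<bar>f y\<bar> powr q)"
      using le_less_trans[OF fq ennreal_less_top] by (intro integrableI_bounded) auto
    have Bq: "\<bar>c\<bar> powr q \<le> B powr q" using cB q by (intro powr_mono2) auto
    have "(\<integral>\<^sup>+x. ennreal (\<bar>u (r *\<^sub>R x)\<bar> powr q) \<partial>sphere_sigma)
      \<le> (\<integral>\<^sup>+x. (\<integral>\<^sup>+y. ennreal (PD_kernel \<alpha> (r *\<^sub>R x) y) * ennreal (\<bar>f y\<bar> powr q) \<partial>sphere_sigma) + ennreal ((1 - t) * \<bar>c\<bar> powr q) \<partial>sphere_sigma)"
    proof (rule nn_integral_mono_AE)
      show "AE x in sphere_sigma. ennreal (\<bar>u (r *\<^sub>R x)\<bar> powr q)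
        \<le> (\<integral>\<^sup>+y. ennreal (PD_kernel \<alpha> (r *\<^sub>R x) y) * ennreal (\<bar>f y\<bar> powr q) \<partial>sphere_sigma) + ennreal ((1 - t) * \<bar>c\<bar> powr q)"
        using AE_sphere_sigma
      proof eventually_elim
        case (elim x)
        have rx: "norm (r *\<^sub>R x) \<noteq> 1" "norm (r *\<^sub>R x) = r" using elim r by auto
        note I = PD_kernel_integrable[OF rx(1) sets_sphere_sigma AE_sphere_sigma]
        have "\<bar>u (r *\<^sub>R x)\<bar> powr q \<le> (\<bar>PD_fun \<alpha> f (r *\<^sub>R x)\<bar> + \<bar>c\<bar> * (1 - t)) powr q"
          using le[OF elim] q by (intro powr_mono2) (auto simp: t_def)
        also have "\<dots> \<le> (\<integral>y. PD_kernel \<alpha> (r *\<^sub>R x) y * \<bar>f y\<bar> powr q \<partial>sphere_sigma) + (1 - t) * \<bar>c\<bar> powr q"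
          using PD_fun_jensen[OF rx(1) q f(2) fqi, of c] rx(2) by (simp add: t_def)
        finally have "ennreal (\<bar>u (r *\<^sub>R x)\<bar> powr q) \<le> ennreal ((\<integral>y. PD_kernel \<alpha> (r *\<^sub>R x) y * \<bar>f y\<bar> powr q \<partial>sphere_sigma) + (1 - t) * \<bar>c\<bar> powr q)"
          by (rule ennreal_leI)
        also have "\<dots> = ennreal (\<integral>y. PD_kernel \<alpha> (r *\<^sub>R x) y * \<bar>f y\<bar> powr q \<partial>sphere_sigma) + ennreal ((1 - t) * \<bar>c\<bar> powr q)"
          using t by (intro ennreal_plus integral_nonneg_AE AE_I2 mult_nonneg_nonneg PD_kernel_nonneg) auto
        also have "ennreal (\<integral>y. PD_kernel \<alpha> (r *\<^sub>R x) y * \<bar>f y\<bar> powr q \<partial>sphere_sigma) = (\<integral>\<^sup>+y. ennreal (PD_kernel \<alpha> (r *\<^sub>R x) y * \<bar>f y\<bar> powr q) \<partial>sphere_sigma)"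
          using PD_kernel_nonneg by (intro nn_integral_eq_integral[symmetric] I fqi) auto
        also have "\<dots> = (\<integral>\<^sup>+y. ennreal (PD_kernel \<alpha> (r *\<^sub>R x) y) * ennreal (\<bar>f y\<bar> powr q) \<partial>sphere_sigma)"
          by (intro nn_integral_cong) (simp add: ennreal_mult PD_kernel_nonneg)
        finally show ?case .
      qed
    qed
    also have "\<dots> = (\<integral>\<^sup>+x. (\<integral>\<^sup>+y. ennreal (PD_kernel \<alpha> (r *\<^sub>R x) y) * ennreal (\<bar>f y\<bar> powr q) \<partial>sphere_sigma) \<partial>sphere_sigma) + ennreal ((1 - t) * \<bar>c\<bar> powr q)"
      by (subst nn_integral_add) (auto simp: S.emeasure_space_1[simplified])
    also have "(\<integral>\<^sup>+x. (\<integral>\<^sup>+y. ennreal (PD_kernel \<alpha> (r *\<^sub>R x) y) * ennreal (\<bar>f y\<bar> powr q) \<partial>sphere_sigma) \<partial>sphere_sigma) = ennreal t * (\<integral>\<^sup>+y. ennreal (\<bar>f y\<bar> powr q) \<partial>sphere_sigma)"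
      unfolding t_def using r by (intro PD_kernel_Tonelli AE_sphere_sigma) (auto simp: S.finite_measure_axioms)
    also have "ennreal t * (\<integral>\<^sup>+y. ennreal (\<bar>f y\<bar> powr q) \<partial>sphere_sigma) + ennreal ((1 - t) * \<bar>c\<bar> powr q) \<le> ennreal t * ennreal (B powr q) + ennreal ((1 - t) * B powr q)"
      using fq t Bq by (intro add_mono mult_left_mono ennreal_leI) auto
    also have "\<dots> = ennreal (t * B powr q + (1 - t) * B powr q)" using t by (simp add: ennreal_mult ennreal_plus)
    also have "t * B powr q + (1 - t) * B powr q = B powr q" by (simp add: algebra_simps)
    finally show ?thesis using iff by blast
  qed
qed

text \<open>Multiplication by the sign of the Hahn set turns the signed measure into its total
  variation, so the right-hand side is the Poisson integral of the latter.\<close>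

lemma PD_meas_le_Hahn:
  assumes N1: "sets N1 = sets borel" "finite_measure N1" "AE y in N1. norm y = 1"
    and N2: "sets N2 = sets borel" "finite_measure N2" "AE y in N2. norm y = 1" and x: "norm x \<noteq> 1"
    and Y: "Y \<in> sets borel" "\<forall>X\<in>sets borel. X \<subseteq> Y \<longrightarrow> emeasure N2 X \<le> emeasure N1 X"
      "\<forall>X\<in>sets borel. X \<inter> Y = {} \<longrightarrow> emeasure N1 X \<le> emeasure N2 X"
  shows "\<bar>PD_meas \<alpha> N1 N2 (x::'a)\<bar> \<le> (\<integral>y. PD_kernel \<alpha> x y * (indicator Y y - indicator (- Y) y) \<partial>N1)
    - (\<integral>y. PD_kernel \<alpha> x y * (indicator Y y - indicator (- Y) y) \<partial>N2)"
proof -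
  have i: "integrable N (PD_kernel \<alpha> x)" if "sets N = sets borel" "finite_measure N" "AE y in N. norm y = 1" for N
    using PD_kernel_integrable[OF x that(1,3), of "\<lambda>_. 1"] that(2) by (simp add: finite_measure.integrable_const)
  have j: "integrable N (\<lambda>y. PD_kernel \<alpha> x y * indicator A y)" if "integrable N (PD_kernel \<alpha> x)" "A \<in> sets N" for N A
    using that by (intro integrable_real_mult_indicator)
  have split: "(\<integral>y. PD_kernel \<alpha> x y \<partial>N) = (\<integral>y. PD_kernel \<alpha> x y * indicator Y y \<partial>N) + (\<integral>y. PD_kernel \<alpha> x y * indicator (- Y) y \<partial>N)"
    "(\<integral>y. PD_kernel \<alpha> x y * (indicator Y y - indicator (- Y) y) \<partial>N) = (\<integral>y. PD_kernel \<alpha> x y * indicator Y y \<partial>N) - (\<integral>y. PD_kernel \<alpha> x y * indicator (- Y) y \<partial>N)"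
    if N: "sets N = sets borel" "integrable N (PD_kernel \<alpha> x)" for N
  proof -
    have J: "integrable N (\<lambda>y. PD_kernel \<alpha> x y * indicator Y y)" "integrable N (\<lambda>y. PD_kernel \<alpha> x y * indicator (- Y) y)"
      using j[OF N(2), of Y] j[OF N(2), of "- Y"] Y(1) N(1) by simp_all
    have "(\<integral>y. PD_kernel \<alpha> x y \<partial>N) = (\<integral>y. PD_kernel \<alpha> x y * indicator Y y + PD_kernel \<alpha> x y * indicator (- Y) y \<partial>N)"
      by (intro Bochner_Integration.integral_cong refl) (auto split: split_indicator)
    then show "(\<integral>y. PD_kernel \<alpha> x y \<partial>N) = (\<integral>y. PD_kernel \<alpha> x y * indicator Y y \<partial>N) + (\<integral>y. PD_kernel \<alpha> x y * indicator (- Y) y \<partial>N)"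
      using J by simp
    show "(\<integral>y. PD_kernel \<alpha> x y * (indicator Y y - indicator (- Y) y) \<partial>N) = (\<integral>y. PD_kernel \<alpha> x y * indicator Y y \<partial>N) - (\<integral>y. PD_kernel \<alpha> x y * indicator (- Y) y \<partial>N)"
      unfolding right_diff_distrib by (rule Bochner_Integration.integral_diff[OF J])
  qed
  have "(\<integral>y. PD_kernel \<alpha> x y * indicator Y y \<partial>N2) \<le> (\<integral>y. PD_kernel \<alpha> x y * indicator Y y \<partial>N1)"
    using N1(1) N2(1) Y by (intro integral_indicator_le_of_le i N1 N2 PD_kernel_nonneg) auto
  moreover have "(\<integral>y. PD_kernel \<alpha> x y * indicator (- Y) y \<partial>N1) \<le> (\<integral>y. PD_kernel \<alpha> x y * indicator (- Y) y \<partial>N2)"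
  proof (intro integral_indicator_le_of_le i N1 N2 PD_kernel_nonneg)
    show "emeasure N1 X \<le> emeasure N2 X" if "X \<in> sets N2" "X \<subseteq> - Y" for X using that N2(1) by (intro Y(3)[rule_format]) auto
  qed (use N1(1) N2(1) Y(1) in auto)
  ultimately show ?thesis
    unfolding PD_meas_def split[OF N1(1) i[OF N1]] split[OF N2(1) i[OF N2]] by linarith
qed

text \<open>By duality with the constant 1, the mean over the sphere of the Poisson integral of the
  total variation is \<theta> times \<open>tv_norm\<close>. The total variation measure itself is
  never formed: its integral is the difference \<open>G N1 - G N2\<close> with the sign function
  inside.\<close>

lemma Lp_norm_PD_meas_le:
  fixes u :: "'a \<Rightarrow> real"
  assumes N1: "sets N1 = sets borel" "finite_measure N1" "AE y in N1. norm y = 1"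
    and N2: "sets N2 = sets borel" "finite_measure N2" "AE y in N2. norm y = 1" and u: "u \<in> borel_measurable borel"
    and r: "r > 0" "r \<noteq> 1" and NB: "tv_norm N1 N2 \<le> B" and cB: "\<bar>c\<bar> \<le> B"
    and le: "\<And>x. norm x = 1 \<Longrightarrow> \<bar>u (r *\<^sub>R x)\<bar> \<le> \<bar>PD_meas \<alpha> N1 N2 (r *\<^sub>R x)\<bar> + \<bar>c\<bar> * (1 - theta DIM('a) \<alpha> r)"
  shows "Lp_norm sphere_sigma 1 (\<lambda>x. u (r *\<^sub>R x)) \<le> ereal B"
proof -
  interpret S: prob_space "sphere_sigma :: 'a measure" by (rule prob_space_sphere_sigma)
  define t where "t = theta DIM('a) \<alpha> r"
  have t: "t \<ge> 0" "t \<le> 1" using theta_nonneg theta_le_one[of r] r by (auto simp: t_def)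
  have B: "B \<ge> 0" using cB by linarith
  obtain Y where Y: "Y \<in> sets borel"
    "\<forall>X\<in>sets borel. X \<subseteq> Y \<longrightarrow> emeasure N2 X \<le> emeasure N1 X"
    "\<forall>X\<in>sets borel. X \<inter> Y = {} \<longrightarrow> emeasure N1 X \<le> emeasure N2 X"
    and tv: "tv_norm N1 N2 = (measure N1 Y - measure N2 Y) + (measure N2 (- Y) - measure N1 (- Y))"
    using tv_norm_Hahn[OF N1(1) N2(1) N1(2) N2(2)] .
  define s where "s y = (indicator Y y - indicator (- Y) y :: real)" for y
  have s: "s \<in> borel_measurable borel" "\<And>y. \<bar>s y\<bar> \<le> 1" using Y(1) by (auto simp: s_def[abs_def] split: split_indicator)
  define G where "G N x = (\<integral>y. PD_kernel \<alpha> (r *\<^sub>R x) y * s y \<partial>N)" for N x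
  have Gi: "integrable sphere_sigma (G N)" "(\<integral>x. G N x \<partial>sphere_sigma) = t * (measure N Y - measure N (- Y))"
    if N: "sets N = sets borel" "finite_measure N" "AE y in N. norm y = 1" for N
  proof -
    interpret N: finite_measure N by fact
    have 1: "(\<lambda>_::'a. 1::real) \<in> borel_measurable borel" "\<And>x::'a. \<bar>1::real\<bar> \<le> 1" by auto
    note F = PD_Fubini[OF N r 1 s]
    note [measurable_cong] = N(1) and [measurable] = s(1)
    show "integrable sphere_sigma (G N)" using F(1) by (simp add: G_def[abs_def])
    have Ys: "Y \<in> sets N" "- Y \<in> sets N" "Y \<inter> space N = Y" "- Y \<inter> space N = - Y"
      using Y(1) N(1) sets_eq_imp_space_eq[OF N(1)] by auto
    have "(\<integral>x. G N x \<partial>sphere_sigma) = (\<integral>y. s y * PD_fun \<alpha> (\<lambda>_. 1) (r *\<^sub>R y) \<partial>N)" using F(2) by (simp add: G_def)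
    also have "\<dots> = (\<integral>y. t * s y \<partial>N)"
    proof (rule integral_cong_AE)
      show "AE y in N. s y * PD_fun \<alpha> (\<lambda>_. 1) (r *\<^sub>R y) = t * s y"
        using N(3) by eventually_elim (use r in \<open>simp add: PD_fun_const t_def\<close>)
    qed (unfold PD_fun_def, measurable)
    also have "\<dots> = t * (measure N Y - measure N (- Y))" using Ys unfolding s_def by (simp add: N.emeasure_eq_measure)
    finally show "(\<integral>x. G N x \<partial>sphere_sigma) = t * (measure N Y - measure N (- Y))" .
  qed
  have "(\<integral>\<^sup>+x. ennreal (\<bar>u (r *\<^sub>R x)\<bar> powr 1) \<partial>sphere_sigma) \<le> (\<integral>\<^sup>+x. ennreal (G N1 x - G N2 x + \<bar>c\<bar> * (1 - t)) \<partial>sphere_sigma)"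
  proof (rule nn_integral_mono_AE)
    show "AE x in sphere_sigma. ennreal (\<bar>u (r *\<^sub>R x)\<bar> powr 1) \<le> ennreal (G N1 x - G N2 x + \<bar>c\<bar> * (1 - t))"
      using AE_sphere_sigma
    proof eventually_elim
      case (elim x)
      have "\<bar>PD_meas \<alpha> N1 N2 (r *\<^sub>R x)\<bar> \<le> G N1 x - G N2 x"
        unfolding G_def s_def using elim r by (intro PD_meas_le_Hahn N1 N2 Y) auto
      then show ?case using le[OF elim] by (auto simp: t_def intro!: ennreal_leI)
    qed
  qed
  also have "\<dots> = ennreal (\<integral>x. G N1 x - G N2 x + \<bar>c\<bar> * (1 - t) \<partial>sphere_sigma)"
  proof (rule nn_integral_eq_integral)
    show "integrable sphere_sigma (\<lambda>x. G N1 x - G N2 x + \<bar>c\<bar> * (1 - t))" using Gi(1)[OF N1] Gi(1)[OF N2] by simp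
    show "AE x in sphere_sigma. 0 \<le> G N1 x - G N2 x + \<bar>c\<bar> * (1 - t)"
      using AE_sphere_sigma
    proof eventually_elim
      case (elim x)
      have "\<bar>PD_meas \<alpha> N1 N2 (r *\<^sub>R x)\<bar> \<le> G N1 x - G N2 x"
        unfolding G_def s_def using elim r by (intro PD_meas_le_Hahn N1 N2 Y) auto
      moreover have "0 \<le> \<bar>c\<bar> * (1 - t)" using t by simp
      ultimately show ?case by linarith
    qed
  qed
  also have "(\<integral>x. G N1 x - G N2 x + \<bar>c\<bar> * (1 - t) \<partial>sphere_sigma) = t * tv_norm N1 N2 + \<bar>c\<bar> * (1 - t)"
    using Gi[OF N1] Gi[OF N2] S.prob_space by (simp add: tv algebra_simps)
  also have "ennreal \<dots> \<le> ennreal (t * B + B * (1 - t))" using NB cB t by (intro ennreal_leI add_mono mult_left_mono mult_right_mono) auto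
  also have "t * B + B * (1 - t) = B powr 1" using B by (simp add: algebra_simps)
  finally show ?thesis using Lp_norm_le_iff[of 1 B sphere_sigma "\<lambda>x. u (r *\<^sub>R x)"] B by (simp add: one_ereal_def)
qed

end

section \<open>Lower bounds for the norm\<close>

context stable_index
begin

lemma PD_integral_bound:
  assumes x: "norm x \<noteq> 1" and N: "sets N = sets borel" "AE y in N. norm y = 1" and f: "integrable N f"
  shows "\<bar>\<integral>y. PD_kernel \<alpha> (x::'a) y * f y \<partial>N\<bar> \<le> kappa DIM('a) \<alpha> * (\<integral>y. \<bar>f y\<bar> \<partial>N) *
    (\<bar>(norm x)\<^sup>2 - 1\<bar> powr (\<alpha> - 1) / \<bar>norm x - 1\<bar> powr (real DIM('a) + \<alpha> - 2))"
proof -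
  define C where "C = kappa DIM('a) \<alpha> * \<bar>(norm x)\<^sup>2 - 1\<bar> powr (\<alpha> - 1) / \<bar>norm x - 1\<bar> powr (real DIM('a) + \<alpha> - 2)"
  have "\<bar>\<integral>y. PD_kernel \<alpha> x y * f y \<partial>N\<bar> \<le> (\<integral>y. \<bar>PD_kernel \<alpha> x y * f y\<bar> \<partial>N)" by (rule integral_abs_bound)
  also have "\<dots> \<le> (\<integral>y. C * \<bar>f y\<bar> \<partial>N)"
  proof (rule integral_mono_AE)
    show "integrable N (\<lambda>y. \<bar>PD_kernel \<alpha> x y * f y\<bar>)" by (intro integrable_abs PD_kernel_integrable x N f)
    show "integrable N (\<lambda>y. C * \<bar>f y\<bar>)" using f by simp
    show "AE y in N. \<bar>PD_kernel \<alpha> x y * f y\<bar> \<le> C * \<bar>f y\<bar>"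
      using N(2)
    proof eventually_elim
      case (elim y)
      show ?case using PD_kernel_le_radial[OF x elim] PD_kernel_nonneg[of x y] unfolding C_def abs_mult
        by (intro mult_right_mono) auto
    qed
  qed
  also have "\<dots> = C * (\<integral>y. \<bar>f y\<bar> \<partial>N)" by simp
  finally show ?thesis by (simp add: C_def ac_simps)
qed

lemma eventually_radius: "eventually (\<lambda>r::real. r > 0 \<and> r \<noteq> 1) (at 1)"
proof -
  have "eventually (\<lambda>r. r > 0) (at (1::real))" using order_tendstoD(1)[OF tendsto_ident_at, of 0 "1::real"] by simp
  moreover have "eventually (\<lambda>r. r \<noteq> 1) (at (1::real))" by (simp add: eventually_at_filter)
  ultimately show ?thesis by eventually_elim simp
qed

end

context stable_process
begin

text \<open>As the radius tends to infinity, \<open>v\<close> decays and \<open>Phi\<close> tends to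
  0, so \<open>u\<close> tends to the constant \<open>c\<close> in every direction, and Fatou
  applies. Keeping \<open>v\<close> abstract covers measures and functions at once.\<close>

lemma Lp_norm_const_le:
  fixes u :: "'a \<Rightarrow> real"
  assumes p: "1 \<le> p" and u: "u \<in> borel_measurable borel" and B: "B \<ge> 0"
    and le: "\<And>r. r > 0 \<Longrightarrow> r \<noteq> 1 \<Longrightarrow> Lp_norm sphere_sigma p (\<lambda>x. u (r *\<^sub>R x)) \<le> ereal B"
    and rep: "\<And>x. norm x \<noteq> 1 \<Longrightarrow> u x = v x + c * (1 - Phi M X x)"
    and v: "\<And>x. norm x \<noteq> 1 \<Longrightarrow> \<bar>v x\<bar> \<le> C * (\<bar>(norm x)\<^sup>2 - 1\<bar> powr (\<alpha> - 1) / \<bar>norm x - 1\<bar> powr (real DIM('a) + \<alpha> - 2))"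
  shows "\<bar>c\<bar> \<le> B"
proof -
  define \<rho> where "\<rho> n = 2 + real n" for n
  have \<rho>: "filterlim \<rho> at_top sequentially"
    unfolding \<rho>_def by (rule filterlim_tendsto_add_at_top[OF tendsto_const filterlim_real_sequentially])
  have lim: "(\<lambda>n. u (\<rho> n *\<^sub>R x)) \<longlonglongrightarrow> c" if x: "norm x = 1" for x
  proof -
    have n: "norm (\<rho> n *\<^sub>R x) = \<rho> n" "norm (\<rho> n *\<^sub>R x) \<noteq> 1" for n using x by (auto simp: \<rho>_def)
    have "(\<lambda>n. C * (\<bar>(\<rho> n)\<^sup>2 - 1\<bar> powr (\<alpha> - 1) / \<bar>\<rho> n - 1\<bar> powr (real DIM('a) + \<alpha> - 2))) \<longlonglongrightarrow> C * 0"
      by (intro tendsto_mult tendsto_const filterlim_compose[OF radial_bound_tendsto_0 \<rho>])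
    then have lim: "(\<lambda>n. C * (\<bar>(\<rho> n)\<^sup>2 - 1\<bar> powr (\<alpha> - 1) / \<bar>\<rho> n - 1\<bar> powr (real DIM('a) + \<alpha> - 2))) \<longlonglongrightarrow> 0" by simp
    have bound: "norm (v (\<rho> n *\<^sub>R x)) \<le> C * (\<bar>(\<rho> n)\<^sup>2 - 1\<bar> powr (\<alpha> - 1) / \<bar>\<rho> n - 1\<bar> powr (real DIM('a) + \<alpha> - 2))" for n
      using v[OF n(2)] unfolding n(1) real_norm_def .
    have "(\<lambda>n. v (\<rho> n *\<^sub>R x)) \<longlonglongrightarrow> 0"
      by (rule Lim_null_comparison[OF always_eventually[OF allI[OF bound]] lim])
    moreover have "(\<lambda>n. Phi M X (\<rho> n *\<^sub>R x)) \<longlonglongrightarrow> 0" by (rule Phi_tendsto_0) (use n \<rho> in auto)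
    ultimately have "(\<lambda>n. v (\<rho> n *\<^sub>R x) + c * (1 - Phi M X (\<rho> n *\<^sub>R x))) \<longlonglongrightarrow> 0 + c * (1 - 0)" by (intro tendsto_intros)
    then show ?thesis using rep[OF n(2)] by simp
  qed
  note [measurable] = u
  have "Lp_norm sphere_sigma p (\<lambda>_::'a. c) \<le> ereal B"
  proof (rule Lp_norm_Fatou[OF p B, where u="\<lambda>n x. u (\<rho> n *\<^sub>R x)"])
    show "AE x in sphere_sigma. (\<lambda>n. u (\<rho> n *\<^sub>R x)) \<longlonglongrightarrow> c" using AE_sphere_sigma by eventually_elim (rule lim)
    show "Lp_norm sphere_sigma p (\<lambda>x. u (\<rho> n *\<^sub>R x)) \<le> ereal B" for n by (rule le) (auto simp: \<rho>_def)
  qed measurable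
  then show ?thesis by (simp add: Lp_norm_const[OF prob_space_sphere_sigma p])
qed

text \<open>Replaces 1 - \<open>Phi\<close>, which is accessible only through paths, by 1 -
  \<theta>, which complements the mass of the kernel exactly and tends to 0 at the sphere.\<close>

lemma Phi_remainder:
  assumes "norm x = 1" "r > 0" "r \<noteq> 1"
  shows "\<bar>c * (1 - Phi M X (r *\<^sub>R x))\<bar> \<le> \<bar>c\<bar> * (1 - theta DIM('a) \<alpha> r)"
  using theta_le_Phi[of "r *\<^sub>R x"] Phi_le_one[of "r *\<^sub>R x"] assms unfolding abs_mult by (intro mult_left_mono) auto

text \<open>Convergence in mean at radii tending to 1 yields a subsequence converging almost
  everywhere, along which the remainder vanishes; so one application of Fatou covers all
  exponents.\<close>

lemma Lp_norm_boundary_le: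
  fixes u f :: "'a \<Rightarrow> real"
  assumes p: "1 \<le> p" and u: "u \<in> borel_measurable borel" and f: "f \<in> borel_measurable borel" "integrable sphere_sigma f" and B: "B \<ge> 0"
    and le: "\<And>r. r > 0 \<Longrightarrow> r \<noteq> 1 \<Longrightarrow> Lp_norm sphere_sigma p (\<lambda>x. u (r *\<^sub>R x)) \<le> ereal B"
    and rep: "\<And>x. norm x \<noteq> 1 \<Longrightarrow> u x = PD_fun \<alpha> f x + c * (1 - Phi M X x)"
  shows "Lp_norm sphere_sigma p f \<le> ereal B"
proof -
  note [measurable] = u f(1)
  define r where "r n = 1 + inverse (real (Suc n))" for n
  have r: "r n > 0" "r n \<noteq> 1" for n by (auto simp: r_def add_pos_pos)
  have rlim: "filterlim r (at 1) sequentially"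
    using LIMSEQ_inverse_real_of_nat_add[of 1] r(2) unfolding r_def[symmetric] by (intro filterlim_atI) auto
  have "integrable sphere_sigma (\<lambda>x. PD_fun \<alpha> f (r n *\<^sub>R x) - f x)" for n
    using PD_fun_L1(1)[OF r f] f(2) by (rule Bochner_Integration.integrable_diff)
  moreover have "(\<lambda>n. \<integral>x. norm (PD_fun \<alpha> f (r n *\<^sub>R x) - f x) \<partial>sphere_sigma) \<longlonglongrightarrow> 0"
    using filterlim_compose[OF PD_fun_tendsto_L1[OF f] rlim] by simp
  ultimately obtain k where k: "strict_mono k" "AE x in sphere_sigma. (\<lambda>n. PD_fun \<alpha> f (r (k n) *\<^sub>R x) - f x) \<longlonglongrightarrow> 0"
    using tendsto_L1_AE_subseq[of sphere_sigma "\<lambda>n x. PD_fun \<alpha> f (r n *\<^sub>R x) - f x"] by blast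
  have rk: "filterlim (\<lambda>n. r (k n)) (at 1) sequentially"
    by (rule filterlim_compose[OF rlim filterlim_subseq[OF k(1)]])
  show ?thesis
  proof (rule Lp_norm_Fatou[OF p B, where u="\<lambda>n x. u (r (k n) *\<^sub>R x)"])
    show "Lp_norm sphere_sigma p (\<lambda>x. u (r (k n) *\<^sub>R x)) \<le> ereal B" for n by (rule le[OF r])
    show "AE x in sphere_sigma. (\<lambda>n. u (r (k n) *\<^sub>R x)) \<longlonglongrightarrow> f x"
      using k(2) AE_sphere_sigma
    proof eventually_elim
      case (elim x)
      have "(\<lambda>n. \<bar>c\<bar> * (1 - theta DIM('a) \<alpha> (r (k n)))) \<longlonglongrightarrow> \<bar>c\<bar> * (1 - 1)"
        by (intro tendsto_intros filterlim_compose[OF theta_tendsto_one rk])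
      then have "(\<lambda>n. \<bar>c\<bar> * (1 - theta DIM('a) \<alpha> (r (k n)))) \<longlonglongrightarrow> 0" by simp
      then have "(\<lambda>n. c * (1 - Phi M X (r (k n) *\<^sub>R x))) \<longlonglongrightarrow> 0"
        by (rule Lim_null_comparison[OF always_eventually, rotated])
          (simp only: real_norm_def, intro allI Phi_remainder elim(2) r)
      from tendsto_add[OF tendsto_add[OF elim(1) tendsto_const[of "f x"]] this]
      have "(\<lambda>n. PD_fun \<alpha> f (r (k n) *\<^sub>R x) + c * (1 - Phi M X (r (k n) *\<^sub>R x))) \<longlonglongrightarrow> f x" by simp
      moreover have "norm (r (k n) *\<^sub>R x) \<noteq> 1" for n using elim(2) r[of "k n"] by simp
      ultimately show ?case using rep by simp
    qed
  qed measurable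
qed

text \<open>Almost everywhere limits would lose a singular part of the measure, so the bound is
  obtained by duality: pairings with continuous \<phi> bounded by 1 survive the limit, and such
  \<phi> approximate the sign of the Hahn set.\<close>

lemma tv_norm_boundary_le:
  fixes u :: "'a \<Rightarrow> real"
  assumes N1: "sets N1 = sets borel" "finite_measure N1" "AE y in N1. norm y = 1"
    and N2: "sets N2 = sets borel" "finite_measure N2" "AE y in N2. norm y = 1" and u: "u \<in> borel_measurable borel" and B: "B \<ge> 0"
    and le: "\<And>r. r > 0 \<Longrightarrow> r \<noteq> 1 \<Longrightarrow> Lp_norm sphere_sigma 1 (\<lambda>x. u (r *\<^sub>R x)) \<le> ereal B"
    and rep: "\<And>x. norm x \<noteq> 1 \<Longrightarrow> u x = PD_meas \<alpha> N1 N2 x + c * (1 - Phi M X x)"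
  shows "tv_norm N1 N2 \<le> B"
proof -
  interpret S: prob_space "sphere_sigma :: 'a measure" by (rule prob_space_sphere_sigma)
  interpret N1: finite_measure N1 by fact
  interpret N2: finite_measure N2 by fact
  note [measurable] = u
  \<comment> \<open>By \<open>PD_Fubini\<close> the pairing of \<phi> with \<open>u\<close> at
    radius \<open>r\<close> equals \<open>J r\<close> up to the remainder, and \<open>J r\<close>
    tends to the pairing of \<phi> with the signed measure as \<open>r\<close> tends to 1.\<close>
  have weak: "\<bar>(\<integral>y. \<phi> y \<partial>N1) - (\<integral>y. \<phi> y \<partial>N2)\<bar> \<le> B" if \<phi>: "continuous_on UNIV \<phi>" "\<And>x. \<bar>\<phi> x\<bar> \<le> 1" for \<phi> :: "'a \<Rightarrow> real"
  proof -
    have [measurable]: "\<phi> \<in> borel_measurable borel" using \<phi>(1) by (rule borel_measurable_continuous_onI)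
    define J where "J r = (\<integral>y. PD_fun \<alpha> \<phi> (r *\<^sub>R y) \<partial>N1) - (\<integral>y. PD_fun \<alpha> \<phi> (r *\<^sub>R y) \<partial>N2)" for r
    have J: "\<bar>J r\<bar> \<le> B + \<bar>c\<bar> * (1 - theta DIM('a) \<alpha> r)" if r: "r > 0" "r \<noteq> 1" for r
    proof -
      have one: "(\<lambda>_::'a. 1::real) \<in> borel_measurable borel" "\<And>x::'a. \<bar>1::real\<bar> \<le> 1" by auto
      note F1 = PD_Fubini[OF N1 r _ \<phi>(2) one, simplified] and F2 = PD_Fubini[OF N2 r _ \<phi>(2) one, simplified]
      have Ji: "integrable sphere_sigma (\<lambda>x. \<phi> x * PD_meas \<alpha> N1 N2 (r *\<^sub>R x))"
        "(\<integral>x. \<phi> x * PD_meas \<alpha> N1 N2 (r *\<^sub>R x) \<partial>sphere_sigma) = J r"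
        using F1 F2 by (simp_all add: PD_meas_def right_diff_distrib J_def)
      have uB: "(\<integral>\<^sup>+x. ennreal \<bar>u (r *\<^sub>R x)\<bar> \<partial>sphere_sigma) \<le> ennreal B"
        using le[OF r] Lp_norm_le_iff[of 1 B sphere_sigma "\<lambda>x. u (r *\<^sub>R x)"] B by (simp add: one_ereal_def)
      have ui: "integrable sphere_sigma (\<lambda>x. u (r *\<^sub>R x))"
        using le_less_trans[OF uB ennreal_less_top] by (intro integrableI_bounded) auto
      have "ennreal (\<integral>x. \<bar>u (r *\<^sub>R x)\<bar> \<partial>sphere_sigma) \<le> ennreal B" using uB ui by (simp add: nn_integral_eq_integral)
      then have uB': "(\<integral>x. \<bar>u (r *\<^sub>R x)\<bar> \<partial>sphere_sigma) \<le> B" using B by simp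
      have "\<bar>J r\<bar> \<le> (\<integral>x. \<bar>\<phi> x * PD_meas \<alpha> N1 N2 (r *\<^sub>R x)\<bar> \<partial>sphere_sigma)"
        unfolding Ji(2)[symmetric] by (rule integral_abs_bound)
      also have "\<dots> \<le> (\<integral>x. \<bar>u (r *\<^sub>R x)\<bar> + \<bar>c\<bar> * (1 - theta DIM('a) \<alpha> r) \<partial>sphere_sigma)"
      proof (rule integral_mono_AE)
        show "integrable sphere_sigma (\<lambda>x. \<bar>\<phi> x * PD_meas \<alpha> N1 N2 (r *\<^sub>R x)\<bar>)" using Ji(1) by (rule integrable_abs)
        show "integrable sphere_sigma (\<lambda>x. \<bar>u (r *\<^sub>R x)\<bar> + \<bar>c\<bar> * (1 - theta DIM('a) \<alpha> r))" using ui by simp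
        show "AE x in sphere_sigma. \<bar>\<phi> x * PD_meas \<alpha> N1 N2 (r *\<^sub>R x)\<bar> \<le> \<bar>u (r *\<^sub>R x)\<bar> + \<bar>c\<bar> * (1 - theta DIM('a) \<alpha> r)"
          using AE_sphere_sigma
        proof eventually_elim
          case (elim x)
          have "u (r *\<^sub>R x) = PD_meas \<alpha> N1 N2 (r *\<^sub>R x) + c * (1 - Phi M X (r *\<^sub>R x))" using elim r by (intro rep) simp
          then have "\<bar>PD_meas \<alpha> N1 N2 (r *\<^sub>R x)\<bar> \<le> \<bar>u (r *\<^sub>R x)\<bar> + \<bar>c\<bar> * (1 - theta DIM('a) \<alpha> r)"
            using Phi_remainder[OF elim r, of c] by linarith
          moreover have "\<bar>\<phi> x * PD_meas \<alpha> N1 N2 (r *\<^sub>R x)\<bar> \<le> 1 * \<bar>PD_meas \<alpha> N1 N2 (r *\<^sub>R x)\<bar>"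
            unfolding abs_mult by (rule mult_right_mono[OF \<phi>(2)]) simp
          ultimately show ?case by linarith
        qed
      qed
      also have "\<dots> = (\<integral>x. \<bar>u (r *\<^sub>R x)\<bar> \<partial>sphere_sigma) + \<bar>c\<bar> * (1 - theta DIM('a) \<alpha> r)" using ui S.prob_space by simp
      finally show ?thesis using uB' by linarith
    qed
    have conv: "((\<lambda>r. \<integral>y. PD_fun \<alpha> \<phi> (r *\<^sub>R y) \<partial>N) \<longlongrightarrow> (\<integral>y. \<phi> y \<partial>N)) (at 1)"
      if N: "sets N = sets borel" "finite_measure N" "AE y in N. norm y = 1" for N
    proof (rule tendstoI)
      fix e :: real assume e: "e > 0"
      interpret N: finite_measure N by fact
      note [measurable_cong] = N(1)
      define m where "m = measure N (space N)"
      have m: "m \<ge> 0" unfolding m_def by (rule measure_nonneg)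
      define e' where "e' = e / (2 * (m + 1))"
      have e': "e' > 0" using e m by (simp add: e'_def)
      show "eventually (\<lambda>r. dist (\<integral>y. PD_fun \<alpha> \<phi> (r *\<^sub>R y) \<partial>N) (\<integral>y. \<phi> y \<partial>N) < e) (at 1)"
        using PD_approx_identity[OF \<phi>(1) e'] eventually_radius
      proof eventually_elim
        case (elim r)
        have [measurable]: "(\<lambda>y. PD_fun \<alpha> \<phi> (r *\<^sub>R y)) \<in> borel_measurable N" unfolding PD_fun_def by measurable
        have close: "AE y in N. \<bar>PD_fun \<alpha> \<phi> (r *\<^sub>R y) - \<phi> y\<bar> \<le> e'" using N(3) by eventually_elim (use elim in blast)
        have i\<phi>: "integrable N \<phi>" using \<phi>(2) by (intro N.integrable_const_bound[of _ 1]) auto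
        have id: "integrable N (\<lambda>y. PD_fun \<alpha> \<phi> (r *\<^sub>R y) - \<phi> y)" using close by (intro N.integrable_const_bound[of _ e']) auto
        have iP: "integrable N (\<lambda>y. PD_fun \<alpha> \<phi> (r *\<^sub>R y))" using Bochner_Integration.integrable_add[OF id i\<phi>] by simp
        have "\<bar>(\<integral>y. PD_fun \<alpha> \<phi> (r *\<^sub>R y) \<partial>N) - (\<integral>y. \<phi> y \<partial>N)\<bar> = \<bar>\<integral>y. PD_fun \<alpha> \<phi> (r *\<^sub>R y) - \<phi> y \<partial>N\<bar>" using iP i\<phi> by simp
        also have "\<dots> \<le> (\<integral>y. \<bar>PD_fun \<alpha> \<phi> (r *\<^sub>R y) - \<phi> y\<bar> \<partial>N)" by (rule integral_abs_bound)
        also have "\<dots> \<le> (\<integral>y. e' \<partial>N)" using close id by (intro integral_mono_AE integrable_abs) auto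
        also have "\<dots> = e' * m" by (simp add: m_def)
        also have "\<dots> < e' * (2 * (m + 1))"
          using e' m by (intro mult_strict_left_mono) auto
        also have "\<dots> = e"
          unfolding e'_def using m by (intro nonzero_eq_divide_eq[THEN iffD1, OF _ refl]) auto
        finally show ?case by (simp add: dist_real_def)
      qed
    qed
    have "(J \<longlongrightarrow> (\<integral>y. \<phi> y \<partial>N1) - (\<integral>y. \<phi> y \<partial>N2)) (at 1)"
      unfolding J_def by (intro tendsto_diff conv N1 N2)
    then have J_lim: "((\<lambda>r. \<bar>J r\<bar>) \<longlongrightarrow> \<bar>(\<integral>y. \<phi> y \<partial>N1) - (\<integral>y. \<phi> y \<partial>N2)\<bar>) (at 1)" by (rule tendsto_rabs)
    have "((\<lambda>r. B + \<bar>c\<bar> * (1 - theta DIM('a) \<alpha> r)) \<longlongrightarrow> B + \<bar>c\<bar> * (1 - 1)) (at 1)" by (intro tendsto_intros theta_tendsto_one)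
    from tendsto_le[OF _ this J_lim] have "\<bar>(\<integral>y. \<phi> y \<partial>N1) - (\<integral>y. \<phi> y \<partial>N2)\<bar> \<le> B + \<bar>c\<bar> * (1 - 1)"
      using eventually_mono[OF eventually_radius] J by simp
    then show ?thesis by simp
  qed
  obtain Y where Y: "Y \<in> sets borel"
    "\<forall>X\<in>sets borel. X \<subseteq> Y \<longrightarrow> emeasure N2 X \<le> emeasure N1 X"
    "\<forall>X\<in>sets borel. X \<inter> Y = {} \<longrightarrow> emeasure N1 X \<le> emeasure N2 X"
    and tv: "tv_norm N1 N2 = (measure N1 Y - measure N2 Y) + (measure N2 (- Y) - measure N1 (- Y))"
    using tv_norm_Hahn[OF N1(1) N2(1) N1(2) N2(2)] .
  show ?thesis
  proof (rule field_le_epsilon)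
    fix e :: real assume e: "e > 0"
    \<comment> \<open>Two sets are cut off, each measured by \<open>N1\<close> and by
      \<open>N2\<close>; each of the four measures is at most \<open>d\<close> and enters with
      factor 2.\<close>
    define d where "d = e / 8"
    have d: "d > 0" using e by (simp add: d_def)
    obtain K where K: "K \<subseteq> Y" "compact K" "measure N1 Y - d \<le> measure N1 K"
      using inner_regular_compact[OF N1(1,2) Y(1) d] .
    have Yc: "- Y \<in> sets borel" using Y(1) by simp
    obtain L where L: "L \<subseteq> - Y" "compact L" "measure N2 (- Y) - d \<le> measure N2 L"
      using inner_regular_compact[OF N2(1,2) Yc d] .
    have cl: "closed K" "closed L" "K \<inter> L = {}" using K L compact_imp_closed by auto
    obtain \<phi> :: "'a \<Rightarrow> real" where \<phi>: "continuous_on UNIV \<phi>" "\<And>x. \<phi> x \<in> closed_segment 1 (-1)"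
      "\<And>x. x \<in> K \<Longrightarrow> \<phi> x = 1" "\<And>x. x \<in> L \<Longrightarrow> \<phi> x = -1"
      using Urysohn[OF cl] by metis
    have \<phi>1: "\<bar>\<phi> x\<bar> \<le> 1" for x using \<phi>(2)[of x] by (auto simp: closed_segment_eq_real_ivl)
    have [measurable]: "\<phi> \<in> borel_measurable borel" using \<phi>(1) by (rule borel_measurable_continuous_onI)
    have KL: "K \<in> sets borel" "L \<in> sets borel" using cl by auto
    have m1: "measure N1 (Y - K) \<le> d" "measure N2 (- Y - L) \<le> d"
      using K L N1.finite_measure_Diff[of Y K] N2.finite_measure_Diff[of "- Y" L] Y(1) KL N1(1) N2(1) by auto
    have disj: "(- Y - L) \<inter> Y = {}" by auto
    \<comment> \<open>On subsets of \<open>Y\<close> the measure \<open>N1\<close> dominates, off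
      \<open>Y\<close> the measure \<open>N2\<close> does; so compact approximation for the larger
      measure controls the smaller one too.\<close>
    have m2: "measure N2 (Y - K) \<le> d" "measure N1 (- Y - L) \<le> d"
      using m1 disj Y(2)[rule_format, of "Y - K"] Y(3)[rule_format, of "- Y - L"] Y(1) KL
      by (auto simp: N1.emeasure_eq_measure N2.emeasure_eq_measure)
    have app: "\<bar>(measure N Y - measure N (- Y)) - (\<integral>y. \<phi> y \<partial>N)\<bar> \<le> 2 * measure N (Y - K) + 2 * measure N (- Y - L)"
      if N: "sets N = sets borel" "finite_measure N" for N
    proof -
      interpret N: finite_measure N by fact
      note [measurable_cong] = N(1)
      have sp: "space N = UNIV" using sets_eq_imp_space_eq[OF N(1)] by simp
      have ind: "integrable N (indicator A :: 'a \<Rightarrow> real)" if "A \<in> sets borel" for A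
        using that N(1) by (simp add: N.emeasure_eq_measure)
      have i\<phi>: "integrable N \<phi>" using \<phi>1 by (intro N.integrable_const_bound[of _ 1]) auto
      have sts: "Y \<in> sets borel" "- Y \<in> sets borel" "Y - K \<in> sets borel" "- Y - L \<in> sets borel" using Y(1) KL by auto
      have "(measure N Y - measure N (- Y)) - (\<integral>y. \<phi> y \<partial>N) = (\<integral>y. indicator Y y - indicator (- Y) y - \<phi> y \<partial>N)"
        using ind[OF sts(1)] ind[OF sts(2)] i\<phi> by (simp add: sp)
      also have "\<bar>\<dots>\<bar> \<le> (\<integral>y. \<bar>indicator Y y - indicator (- Y) y - \<phi> y\<bar> \<partial>N)" by (rule integral_abs_bound)
      also have "\<dots> \<le> (\<integral>y. 2 * indicator (Y - K) y + 2 * indicator (- Y - L) y \<partial>N)"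
      proof (rule integral_mono)
        show "integrable N (\<lambda>y. \<bar>indicator Y y - indicator (- Y) y - \<phi> y\<bar>)"
          by (intro integrable_abs Bochner_Integration.integrable_diff ind sts i\<phi>)
        show "integrable N (\<lambda>y. 2 * indicator (Y - K) y + 2 * indicator (- Y - L) y :: real)"
          by (intro Bochner_Integration.integrable_add integrable_mult_right ind sts)
        fix y
        show "\<bar>indicator Y y - indicator (- Y) y - \<phi> y\<bar> \<le> 2 * indicator (Y - K) y + 2 * indicator (- Y - L) y"
          using \<phi>1[of y] \<phi>(3)[of y] \<phi>(4)[of y] K(1) L(1) by (auto simp: indicator_def)
      qed
      also have "\<dots> = 2 * measure N (Y - K) + 2 * measure N (- Y - L)"
        using ind[OF sts(3)] ind[OF sts(4)] by (simp add: sp)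
      finally show ?thesis .
    qed
    show "tv_norm N1 N2 \<le> B + e"
      using app[OF N1(1,2)] app[OF N2(1,2)] m1 m2 weak[OF \<phi>(1) \<phi>1] unfolding tv d_def abs_le_iff by linarith
  qed
qed

end

theorem theorem3p6:
  fixes \<alpha> :: real and M :: "'w measure" and X :: "real \<Rightarrow> 'w \<Rightarrow> 'a::euclidean_space"
    and u :: "'a \<Rightarrow> real"
  assumes "DIM('a) \<ge> 2" and "1 < \<alpha>" and "\<alpha> < 2"
    and "sym_stable_process \<alpha> M X"
    and "alpha_harmonic M X (- sphere 0 1) u"
  shows "(\<forall>N1 N2 (c::real). sphere_fin_meas N1 \<and> sphere_fin_meas N2 \<and>
            (\<forall>x\<in>- sphere 0 1. u x = PD_meas \<alpha> N1 N2 x + c * (1 - Phi M X x)) \<longrightarrow>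
            u \<in> hp_space M X 1 \<and> hp_norm 1 u = max (ereal (tv_norm N1 N2)) (ereal \<bar>c\<bar>))
       \<and> (\<forall>(p::ereal) (f::'a \<Rightarrow> real) (c::real). 1 < p \<and> f \<in> borel_measurable borel \<and>
            Lp_norm sphere_sigma p f < \<infinity> \<and>
            (\<forall>x\<in>- sphere 0 1. u x = PD_fun \<alpha> f x + c * (1 - Phi M X x)) \<longrightarrow>
            u \<in> hp_space M X p \<and> hp_norm p u = max (Lp_norm sphere_sigma p f) (ereal \<bar>c\<bar>))"
proof -
  interpret stable_process \<alpha> "TYPE('a)" M X using assms by unfold_locales auto
  interpret S: prob_space "sphere_sigma :: 'a measure" by (rule prob_space_sphere_sigma)
  have u: "u \<in> borel_measurable borel" using assms(5) by (simp add: alpha_harmonic_def)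
  \<comment> \<open>Harmonicity is assumed, so membership amounts to finiteness of the norm.\<close>
  have space: "u \<in> hp_space M X p" if "hp_norm p u = ereal a" for p a
    using assms(5) that by (simp add: hp_space_def)
  have meas: "hp_norm 1 u = ereal (max (tv_norm N1 N2) \<bar>c\<bar>)"
    if N: "sphere_fin_meas N1" "sphere_fin_meas N2" and rep: "\<forall>x\<in>- sphere 0 1. u x = PD_meas \<alpha> N1 N2 x + c * (1 - Phi M X x)"
    for N1 N2 :: "'a measure" and c
  proof (rule hp_norm_eqI)
    note N1 = sphere_fin_measD[OF N(1)] and N2 = sphere_fin_measD[OF N(2)]
    have rep': "u x = PD_meas \<alpha> N1 N2 x + c * (1 - Phi M X x)" if "norm x \<noteq> 1" for x using rep that by simp
    show "Lp_norm sphere_sigma 1 (\<lambda>x. u (r *\<^sub>R x)) \<le> ereal (max (tv_norm N1 N2) \<bar>c\<bar>)" if r: "r > 0" "r \<noteq> 1" for r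
    proof (rule Lp_norm_PD_meas_le[OF N1 N2 u r])
      fix x :: 'a assume x: "norm x = 1"
      then have "u (r *\<^sub>R x) = PD_meas \<alpha> N1 N2 (r *\<^sub>R x) + c * (1 - Phi M X (r *\<^sub>R x))" using r by (intro rep') simp
      then show "\<bar>u (r *\<^sub>R x)\<bar> \<le> \<bar>PD_meas \<alpha> N1 N2 (r *\<^sub>R x)\<bar> + \<bar>c\<bar> * (1 - theta DIM('a) \<alpha> r)"
        using Phi_remainder[OF x r, of c] by linarith
    qed auto
    fix B :: real assume B: "B \<ge> 0" and le: "\<And>r. r > 0 \<Longrightarrow> r \<noteq> 1 \<Longrightarrow> Lp_norm sphere_sigma 1 (\<lambda>x. u (r *\<^sub>R x)) \<le> ereal B"
    have "tv_norm N1 N2 \<le> B" by (rule tv_norm_boundary_le[OF N1 N2 u B le rep'])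
    moreover have "\<bar>c\<bar> \<le> B"
    proof (rule Lp_norm_const_le[OF order_refl u B le rep'])
      fix x :: 'a assume x: "norm x \<noteq> 1"
      define b where "b = \<bar>(norm x)\<^sup>2 - 1\<bar> powr (\<alpha> - 1) / \<bar>norm x - 1\<bar> powr (real DIM('a) + \<alpha> - 2)"
      have "\<bar>\<integral>y. PD_kernel \<alpha> x y \<partial>N\<bar> \<le> kappa DIM('a) \<alpha> * measure N (space N) * b"
        if N: "sets N = sets borel" "finite_measure N" "AE y in N. norm y = 1" for N
        using PD_integral_bound[OF x N(1,3), of "\<lambda>_. 1"] N(2) by (simp add: finite_measure.integrable_const b_def)
      from this[OF N1] this[OF N2]
      have "\<bar>PD_meas \<alpha> N1 N2 x\<bar> \<le> (kappa DIM('a) \<alpha> * measure N1 (space N1) + kappa DIM('a) \<alpha> * measure N2 (space N2)) * b"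
        unfolding PD_meas_def distrib_right by linarith
      then show "\<bar>PD_meas \<alpha> N1 N2 x\<bar> \<le> (kappa DIM('a) \<alpha> * measure N1 (space N1) + kappa DIM('a) \<alpha> * measure N2 (space N2)) *
        (\<bar>(norm x)\<^sup>2 - 1\<bar> powr (\<alpha> - 1) / \<bar>norm x - 1\<bar> powr (real DIM('a) + \<alpha> - 2))" by (simp only: b_def)
    qed
    ultimately show "max (tv_norm N1 N2) \<bar>c\<bar> \<le> B" by simp
  qed simp
  have func: "\<exists>F. Lp_norm sphere_sigma p f = ereal F \<and> hp_norm p u = ereal (max F \<bar>c\<bar>)"
    if p: "1 < p" and f: "f \<in> borel_measurable borel" and fin: "Lp_norm sphere_sigma p f < \<infinity>"
      and rep: "\<forall>x\<in>- sphere 0 1. u x = PD_fun \<alpha> f x + c * (1 - Phi M X x)" for p f c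
  proof -
    have p1: "1 \<le> p" using p by simp
    note [measurable] = f
    obtain F where F: "Lp_norm sphere_sigma p f = ereal F" "F \<ge> 0"
      using fin Lp_norm_nonneg[OF prob_space_sphere_sigma p1, of f] by (cases "Lp_norm sphere_sigma p f") auto
    have rep': "u x = PD_fun \<alpha> f x + c * (1 - Phi M X x)" if "norm x \<noteq> 1" for x using rep that by simp
    \<comment> \<open>On a probability space a finite norm of any exponent gives integrability: for
      \<infinity> by boundedness, otherwise by
      \<open>\<bar>f y\<bar> \<le> 1 + \<bar>f y\<bar> powr q\<close>. This is what admits
      convergence in mean at the boundary.\<close>
    have fi: "integrable sphere_sigma f"
    proof (cases "p = \<infinity>")
      case True
      then have "AE x in sphere_sigma. \<bar>f x\<bar> \<le> F" using F(1) Lp_norm_inf_le_iff[of f sphere_sigma F] by simp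
      then show ?thesis by (intro S.integrable_const_bound[of _ F]) auto
    next
      case False
      define q where "q = real_of_ereal p"
      have q: "q \<ge> 1" using p1 False by (cases p) (auto simp: q_def)
      have le: "(\<integral>\<^sup>+y. ennreal (\<bar>f y\<bar> powr q) \<partial>sphere_sigma) \<le> ennreal (F powr q)"
        using Lp_norm_le_iff[OF p1 False F(2), of sphere_sigma f] F(1) by (simp add: q_def)
      have qi: "integrable sphere_sigma (\<lambda>y. \<bar>f y\<bar> powr q)"
        using le_less_trans[OF le ennreal_less_top] by (intro integrableI_bounded) auto
      show ?thesis
      proof (rule Bochner_Integration.integrable_bound)
        show "integrable sphere_sigma (\<lambda>y. 1 + \<bar>f y\<bar> powr q)" using qi by simp
        have "\<bar>f y\<bar> \<le> 1 + \<bar>f y\<bar> powr q" for y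
        proof (cases "\<bar>f y\<bar> \<le> 1")
          case False
          then have "\<bar>f y\<bar> powr 1 \<le> \<bar>f y\<bar> powr q" using q by (intro powr_mono) auto
          then show ?thesis using False by simp
        qed (simp add: add_increasing2)
        then show "AE y in sphere_sigma. norm (f y) \<le> norm (1 + \<bar>f y\<bar> powr q)" by simp
      qed measurable
    qed
    have "hp_norm p u = ereal (max F \<bar>c\<bar>)"
    proof (rule hp_norm_eqI[OF p1])
      show "Lp_norm sphere_sigma p (\<lambda>x. u (r *\<^sub>R x)) \<le> ereal (max F \<bar>c\<bar>)" if r: "r > 0" "r \<noteq> 1" for r
      proof (rule Lp_norm_PD_fun_le[OF p1 u f fi r])
        fix x :: 'a assume x: "norm x = 1"
        then have "u (r *\<^sub>R x) = PD_fun \<alpha> f (r *\<^sub>R x) + c * (1 - Phi M X (r *\<^sub>R x))" using r by (intro rep') simp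
        then show "\<bar>u (r *\<^sub>R x)\<bar> \<le> \<bar>PD_fun \<alpha> f (r *\<^sub>R x)\<bar> + \<bar>c\<bar> * (1 - theta DIM('a) \<alpha> r)"
          using Phi_remainder[OF x r, of c] by linarith
      qed (auto simp: F)
      fix B :: real assume B: "B \<ge> 0" and le: "\<And>r. r > 0 \<Longrightarrow> r \<noteq> 1 \<Longrightarrow> Lp_norm sphere_sigma p (\<lambda>x. u (r *\<^sub>R x)) \<le> ereal B"
      have "F \<le> B" using Lp_norm_boundary_le[OF p1 u f fi B le rep'] by (simp add: F)
      moreover have "\<bar>c\<bar> \<le> B"
      proof (rule Lp_norm_const_le[OF p1 u B le rep'])
        fix x :: 'a assume "norm x \<noteq> 1"
        from PD_integral_bound[OF this sets_sphere_sigma AE_sphere_sigma fi]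
        show "\<bar>PD_fun \<alpha> f x\<bar> \<le> (kappa DIM('a) \<alpha> * (\<integral>y. \<bar>f y\<bar> \<partial>sphere_sigma)) *
          (\<bar>(norm x)\<^sup>2 - 1\<bar> powr (\<alpha> - 1) / \<bar>norm x - 1\<bar> powr (real DIM('a) + \<alpha> - 2))" unfolding PD_fun_def .
      qed
      ultimately show "max F \<bar>c\<bar> \<le> B" by simp
    qed
    with F(1) show ?thesis by blast
  qed
  have max_ereal: "max (ereal a) (ereal b) = ereal (max a b)" for a b by (simp add: max_def)
  have 1: "u \<in> hp_space M X 1 \<and> hp_norm 1 u = max (ereal (tv_norm N1 N2)) (ereal \<bar>c\<bar>)"
    if h: "sphere_fin_meas N1" "sphere_fin_meas N2" "\<forall>x\<in>- sphere 0 1. u x = PD_meas \<alpha> N1 N2 x + c * (1 - Phi M X x)" for N1 N2 c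
    unfolding max_ereal by (rule conjI[OF space[OF meas[OF h]] meas[OF h]])
  have 2: "u \<in> hp_space M X p \<and> hp_norm p u = max (Lp_norm sphere_sigma p f) (ereal \<bar>c\<bar>)"
    if h: "1 < p" "f \<in> borel_measurable borel" "Lp_norm sphere_sigma p f < \<infinity>"
      "\<forall>x\<in>- sphere 0 1. u x = PD_fun \<alpha> f x + c * (1 - Phi M X x)" for p f c
  proof -
    from func[OF h] obtain F where F: "Lp_norm sphere_sigma p f = ereal F" "hp_norm p u = ereal (max F \<bar>c\<bar>)" by (elim exE conjE)
    show ?thesis unfolding F(1) max_ereal by (rule conjI[OF space[OF F(2)] F(2)])
  qed
  show ?thesis by (rule conjI; (rule allI)+; rule impI; elim conjE; (rule 1 | rule 2); assumption)
qed

end
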